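(* Let $W:\mathbb{R}^2\to\mathbb{R}_+$ be continuous and $a\in\mathbb{R}$ such that $W$ vanishes at two points $u^\pm=(a,u_2^\pm)$. Assume that $W\ge\frac12w^2$ on $\mathbb{R}^2$, and that $W=\frac12w^2$ and $w>0$ on the open segment $(u^-,u^+)$, where $w\in\mathcal{C}^2(\mathbb{R}^2,\mathbb{R})$ solves the wave equation $\partial_{11}w-\partial_{22}w=0$ in $\mathbb{R}^2$. If $u$ is a global minimizer of problem $(\mathcal P)$ such that either $u\in L^\infty$ or there exist $C,\beta>0$ with $|w(z)|\le Ce^{\beta|z|^2}$ for all $z$, then $u(x)=g(x_1)$ a.e., where $g:\mathbb{R}\to\mathbb{R}^2_a$ is, up to translation, the unique minimizer of $\inf\{\int_\mathbb{R}\frac12|\dot\gamma|^2+W(\gamma)\,dt:\gamma\in\dot H^1(\mathbb{R},\mathbb{R}^2_a),\ \gamma(\pm\infty)=u^\pm\}$.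
   Context: $\mathbb{T}=\mathbb{R}/\mathbb{Z}$, $\Omega=\mathbb{R}\times\mathbb{T}$, $x=(x_1,x_2)$. $\dot H^1_{div}(\Omega,\mathbb{R}^2)=\{u\in H^1_{loc}:\nabla u\in L^2,\ \nabla\cdot u=0\}$, $E(u)=\int_\Omega\frac12|\nabla u|^2+W(u)dx$, $\overline{u}(x_1)=\int_\mathbb{T}u(x_1,x_2)dx_2$. Problem $(\mathcal P)$: minimize $E$ over $u\in\dot H^1_{div}(\Omega,\mathbb{R}^2)$ with $\lim_{x_1\to\pm\infty}\overline{u}(x_1)=u^\pm$; a global minimizer attains this infimum. $\mathbb{R}^2_a=\{z:z_1=a\}$. *)

theory Defs
  imports "HOL-Analysis.Analysis"
begin

type_synonym R2 = "real \<times> real"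

text \<open>Points of R^2 are pairs z = (z1, z2); the norm on real \<times> real is Euclidean.
  Maps u : Omega -> R^2 with Omega = R \<times> T are represented as functions on R^2
  that are 1-periodic in the second variable.\<close>

definition periodic2 :: "(R2 \<Rightarrow> 'b) \<Rightarrow> bool" where
  "periodic2 u \<longleftrightarrow> (\<forall>x1 x2. u (x1, x2 + 1) = u (x1, x2))"

definition test2 :: "(R2 \<Rightarrow> real) \<Rightarrow> (R2 \<Rightarrow> real) \<Rightarrow> (R2 \<Rightarrow> real) \<Rightarrow> bool" where
  "test2 \<phi> \<phi>1 \<phi>2 \<longleftrightarrow> continuous_on UNIV \<phi>1 \<and> continuous_on UNIV \<phi>2 \<and>
     (\<forall>z. (\<phi> has_derivative (\<lambda>h. \<phi>1 z * fst h + \<phi>2 z * snd h)) (at z)) \<and>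
     (\<exists>R. \<forall>z. norm z > R \<longrightarrow> \<phi> z = 0)"

definition weak_grad2 :: "(R2 \<Rightarrow> R2) \<Rightarrow> (R2 \<Rightarrow> R2) \<Rightarrow> (R2 \<Rightarrow> R2) \<Rightarrow> bool" where
  "weak_grad2 u Du1 Du2 \<longleftrightarrow>
     (\<forall>\<phi> \<phi>1 \<phi>2. test2 \<phi> \<phi>1 \<phi>2 \<longrightarrow>
        integrable lborel (\<lambda>z. \<phi>1 z *\<^sub>R u z) \<and> integrable lborel (\<lambda>z. \<phi>2 z *\<^sub>R u z) \<and>
        integrable lborel (\<lambda>z. \<phi> z *\<^sub>R Du1 z) \<and> integrable lborel (\<lambda>z. \<phi> z *\<^sub>R Du2 z) \<and>
        (\<integral>z. \<phi>1 z *\<^sub>R u z \<partial>lborel) = - (\<integral>z. \<phi> z *\<^sub>R Du1 z \<partial>lborel) \<and>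
        (\<integral>z. \<phi>2 z *\<^sub>R u z \<partial>lborel) = - (\<integral>z. \<phi> z *\<^sub>R Du2 z \<partial>lborel))"

definition cell :: "R2 set" where "cell = UNIV \<times> {0..1}"

definition ubar :: "(R2 \<Rightarrow> R2) \<Rightarrow> real \<Rightarrow> R2" where
  "ubar u x1 = (\<integral>x2. u (x1, x2) \<partial>(restrict_space lborel {0..1}))"

text \<open>Essential limits at +/- infinity (functions are only defined a.e.).\<close>
definition ess_lim_top :: "(real \<Rightarrow> R2) \<Rightarrow> R2 \<Rightarrow> bool" where
  "ess_lim_top f l \<longleftrightarrow> (\<forall>\<epsilon>>0. \<exists>R. AE t in lborel. t > R \<longrightarrow> norm (f t - l) < \<epsilon>)"
definition ess_lim_bot :: "(real \<Rightarrow> R2) \<Rightarrow> R2 \<Rightarrow> bool" where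
  "ess_lim_bot f l \<longleftrightarrow> (\<forall>\<epsilon>>0. \<exists>R. AE t in lborel. t < R \<longrightarrow> norm (f t - l) < \<epsilon>)"

definition admP :: "R2 \<Rightarrow> R2 \<Rightarrow> (R2 \<Rightarrow> R2) \<Rightarrow> (R2 \<Rightarrow> R2) \<Rightarrow> (R2 \<Rightarrow> R2) \<Rightarrow> bool" where
  "admP um up u Du1 Du2 \<longleftrightarrow>
     periodic2 u \<and> u \<in> borel_measurable lborel \<and>
     (\<forall>K. compact K \<longrightarrow> (\<integral>\<^sup>+z\<in>K. ennreal ((norm (u z))\<^sup>2) \<partial>lborel) < \<infinity>) \<and>
     Du1 \<in> borel_measurable lborel \<and> Du2 \<in> borel_measurable lborel \<and>
     weak_grad2 u Du1 Du2 \<and>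
     (\<integral>\<^sup>+z\<in>cell. ennreal ((norm (Du1 z))\<^sup>2 + (norm (Du2 z))\<^sup>2) \<partial>lborel) < \<infinity> \<and>
     (AE z in lborel. fst (Du1 z) + snd (Du2 z) = 0) \<and>
     ess_lim_bot (ubar u) um \<and> ess_lim_top (ubar u) up"

definition energyP :: "(R2 \<Rightarrow> real) \<Rightarrow> (R2 \<Rightarrow> R2) \<Rightarrow> (R2 \<Rightarrow> R2) \<Rightarrow> (R2 \<Rightarrow> R2) \<Rightarrow> ennreal" where
  "energyP W u Du1 Du2 =
     (\<integral>\<^sup>+z\<in>cell. ennreal ((1/2) * ((norm (Du1 z))\<^sup>2 + (norm (Du2 z))\<^sup>2) + W (u z)) \<partial>lborel)"

definition global_minP :: "(R2 \<Rightarrow> real) \<Rightarrow> R2 \<Rightarrow> R2 \<Rightarrow> (R2 \<Rightarrow> R2) \<Rightarrow> bool" where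
  "global_minP W um up u \<longleftrightarrow>
     (\<exists>Du1 Du2. admP um up u Du1 Du2 \<and>
        (\<forall>v Dv1 Dv2. admP um up v Dv1 Dv2 \<longrightarrow> energyP W u Du1 Du2 \<le> energyP W v Dv1 Dv2))"

definition test1 :: "(real \<Rightarrow> real) \<Rightarrow> (real \<Rightarrow> real) \<Rightarrow> bool" where
  "test1 \<phi> \<phi>' \<longleftrightarrow> continuous_on UNIV \<phi>' \<and> (\<forall>t. (\<phi> has_real_derivative \<phi>' t) (at t)) \<and>
     (\<exists>R. \<forall>t. \<bar>t\<bar> > R \<longrightarrow> \<phi> t = 0)"

definition weak_deriv1 :: "(real \<Rightarrow> R2) \<Rightarrow> (real \<Rightarrow> R2) \<Rightarrow> bool" where
  "weak_deriv1 \<gamma> \<gamma>' \<longleftrightarrow>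
     (\<forall>\<phi> \<phi>'. test1 \<phi> \<phi>' \<longrightarrow>
        integrable lborel (\<lambda>t. \<phi>' t *\<^sub>R \<gamma> t) \<and> integrable lborel (\<lambda>t. \<phi> t *\<^sub>R \<gamma>' t) \<and>
        (\<integral>t. \<phi>' t *\<^sub>R \<gamma> t \<partial>lborel) = - (\<integral>t. \<phi> t *\<^sub>R \<gamma>' t \<partial>lborel))"

definition adm1 :: "real \<Rightarrow> R2 \<Rightarrow> R2 \<Rightarrow> (real \<Rightarrow> R2) \<Rightarrow> (real \<Rightarrow> R2) \<Rightarrow> bool" where
  "adm1 a um up \<gamma> \<gamma>' \<longleftrightarrow>
     \<gamma> \<in> borel_measurable lborel \<and> \<gamma>' \<in> borel_measurable lborel \<and>
     (\<forall>s t. (\<integral>\<^sup>+r\<in>{s..t}. ennreal (norm (\<gamma> r)) \<partial>lborel) < \<infinity>) \<and>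
     weak_deriv1 \<gamma> \<gamma>' \<and>
     (\<integral>\<^sup>+t. ennreal ((norm (\<gamma>' t))\<^sup>2) \<partial>lborel) < \<infinity> \<and>
     (AE t in lborel. fst (\<gamma> t) = a) \<and>
     ess_lim_bot \<gamma> um \<and> ess_lim_top \<gamma> up"

definition energy1 :: "(R2 \<Rightarrow> real) \<Rightarrow> (real \<Rightarrow> R2) \<Rightarrow> (real \<Rightarrow> R2) \<Rightarrow> ennreal" where
  "energy1 W \<gamma> \<gamma>' = (\<integral>\<^sup>+t. ennreal ((1/2) * (norm (\<gamma>' t))\<^sup>2 + W (\<gamma> t)) \<partial>lborel)"

definition min1 :: "(R2 \<Rightarrow> real) \<Rightarrow> real \<Rightarrow> R2 \<Rightarrow> R2 \<Rightarrow> (real \<Rightarrow> R2) \<Rightarrow> bool" where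
  "min1 W a um up \<gamma> \<longleftrightarrow>
     (\<exists>\<gamma>'. adm1 a um up \<gamma> \<gamma>' \<and>
        (\<forall>\<eta> \<eta>'. adm1 a um up \<eta> \<eta>' \<longrightarrow> energy1 W \<gamma> \<gamma>' \<le> energy1 W \<eta> \<eta>'))"

definition C2_partials :: "(R2 \<Rightarrow> real) \<Rightarrow> (R2 \<Rightarrow> real) \<Rightarrow> (R2 \<Rightarrow> real) \<Rightarrow>
    (R2 \<Rightarrow> real) \<Rightarrow> (R2 \<Rightarrow> real) \<Rightarrow> (R2 \<Rightarrow> real) \<Rightarrow> (R2 \<Rightarrow> real) \<Rightarrow> bool" where
  "C2_partials w w1 w2 w11 w12 w21 w22 \<longleftrightarrow>
     (\<forall>z. (w has_derivative (\<lambda>h. w1 z * fst h + w2 z * snd h)) (at z)) \<and>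
     (\<forall>z. (w1 has_derivative (\<lambda>h. w11 z * fst h + w12 z * snd h)) (at z)) \<and>
     (\<forall>z. (w2 has_derivative (\<lambda>h. w21 z * fst h + w22 z * snd h)) (at z)) \<and>
     continuous_on UNIV w11 \<and> continuous_on UNIV w12 \<and>
     continuous_on UNIV w21 \<and> continuous_on UNIV w22"

end

theory Submission
  imports Defs
begin

text \<open>
  A solution of the wave equation splits as \<open>w z = f (z1 + z2) + h (z1 - z2)\<close>. With antiderivatives
  \<open>F\<close>, \<open>H\<close> of \<open>f\<close>, \<open>h\<close> the vector field \<open>(F (z1 + z2) - H (z1 - z2), F (z1 + z2) + H (z1 - z2))\<close>
  calibrates: along a divergence free \<open>u\<close> its divergence is \<open>w(u) s\<close>, where \<open>s\<close> is the sum of the two off-diagonal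
  derivatives of \<open>u\<close>, and its flux through the cylinder is the optimal one-dimensional energy \<open>\<kappa>\<close>. Hence
  \<open>\<kappa> \<le> \<integral> s\<^sup>2/2 + W(u)\<close>. Since the determinant of the gradient integrates to zero, the energy of \<open>u\<close> exceeds
  the right hand side by twice the integral of \<open>(\<partial>1 u1)\<^sup>2\<close>. The one-dimensional optimal profile is a competitor
  of energy \<open>\<kappa>\<close>, so a minimiser has \<open>\<partial>1 u1 = \<partial>2 u2 = 0\<close>, which forces \<open>u1 = a\<close> and \<open>u2\<close> to depend on \<open>x1\<close> only.

  Replacing \<open>f\<close> and \<open>h\<close> by their truncations at a common large level preserves all properties used, because
  the truncation is odd and 1-Lipschitz; the calibration is then globally Lipschitz, so that its composition
  with \<open>u\<close> is weakly differentiable with square integrable gradient.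
\<close>

section \<open>Weak directional derivatives\<close>

text \<open>A weakly differentiable \<open>u\<close> gives no pointwise divergence of a composed
  field, so the argument runs on increments along straight lines. The calibration permits this
  because \<open>F\<close> depends only on z1 + z2 and \<open>H\<close> only on z1 - z2: just F(u1 +
  u2) along (1, 1) and H(u1 - u2) along (1, -1) have to be differentiated, and since the divergence
  of \<open>u\<close> vanishes, the inner derivatives are s and -s. An absolutely continuous chain
  rule on almost every line then suffices. The slope of the lines costs nothing, because
  \<open>u\<close> is periodic in x2, and fluxes are averaged over strips of unit width so that no
  traces on vertical lines occur.

  The factor two in the excess: with A = d1 u2, B = d2 u1 and C = d1 u1 = - d2 u2 the energy density
  is A^2/2 + B^2/2 + C^2 + W, while s^2/2 = A^2/2 + B^2/2 + A B, and the integral of A B is minus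
  that of C^2. This last identity is obtained from finite differences, without smoothing. It uses u1
  - a in L^2, which follows from the Poincare inequality once the mean of u1 over a period is known
  to be \<open>a\<close>.\<close>

definition C1test :: "('a::euclidean_space \<Rightarrow> real) \<Rightarrow> ('a \<Rightarrow> 'a \<Rightarrow> real) \<Rightarrow> bool" where
  "C1test \<phi> \<phi>' \<longleftrightarrow> (\<forall>x. (\<phi> has_derivative \<phi>' x) (at x)) \<and>
     (\<forall>h. continuous_on UNIV (\<lambda>x. \<phi>' x h)) \<and> (\<exists>R. \<forall>x. norm x > R \<longrightarrow> \<phi> x = 0)"

section \<open>Test functions and the fundamental lemma of the calculus of variations\<close>

lemma has_real_derivative_max0_square:
  "((\<lambda>t. (max 0 t)\<^sup>2) has_real_derivative 2 * max 0 t) (at (t::real))"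
proof (cases "t = 0")
  case True
  have "((\<lambda>h. ((max 0 h)\<^sup>2 - 0) / h) \<longlongrightarrow> 0) (at (0::real))"
  proof (rule Lim_null_comparison)
    show "\<forall>\<^sub>F h in at (0::real). norm (((max 0 h)\<^sup>2 - 0) / h) \<le> \<bar>h\<bar>"
      by (auto simp: max_def power2_eq_square)
    show "((\<lambda>h. \<bar>h\<bar>) \<longlongrightarrow> 0) (at (0::real))"
      using tendsto_rabs[OF tendsto_ident_at[of "0::real" UNIV]] by simp
  qed
  then show ?thesis using True by (simp add: has_field_derivative_iff)
next
  case False
  consider "t > 0" | "t < 0" using False by linarith
  then show ?thesis
  proof cases
    case 1
    have d: "((\<lambda>t. t\<^sup>2) has_real_derivative 2 * t) (at t)"
      by (auto intro!: derivative_eq_intros)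
    have "((\<lambda>t. (max 0 t)\<^sup>2) has_real_derivative 2 * t) (at t)"
      by (rule has_field_derivative_transform_within_open[OF d, of "{0<..}"]) (use 1 in auto)
    then show ?thesis using 1 by simp
  next
    case 2
    have d: "((\<lambda>t. 0) has_real_derivative 0) (at t)" by simp
    have "((\<lambda>t. (max 0 t)\<^sup>2) has_real_derivative 0) (at t)"
      by (rule has_field_derivative_transform_within_open[OF d, of "{..<0}"]) (use 2 in auto)
    then show ?thesis using 2 by simp
  qed
qed

lemma C1test_compose:
  assumes "C1test \<phi> \<phi>'" "\<And>t. (G has_real_derivative G' t) (at t)" "continuous_on UNIV G'" "G 0 = 0"
  shows "C1test (\<lambda>x. G (\<phi> x)) (\<lambda>x h. G' (\<phi> x) * \<phi>' x h)"
proof -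
  have d: "(\<phi> has_derivative \<phi>' x) (at x)" for x using assms(1) by (simp add: C1test_def)
  have c: "continuous_on UNIV \<phi>"
    by (meson continuous_at_imp_continuous_on d has_derivative_continuous)
  have "((\<lambda>x. G (\<phi> x)) has_derivative (\<lambda>h. G' (\<phi> x) * \<phi>' x h)) (at x)" for x
    using has_derivative_compose[OF d[of x], of G "\<lambda>h. G' (\<phi> x) * h"] assms(2)[of "\<phi> x"]
    by (simp add: has_field_derivative_def)
  moreover have "continuous_on UNIV (\<lambda>x. G' (\<phi> x) * \<phi>' x h)" for h
    using assms(1) by (intro continuous_on_mult continuous_on_compose2[OF assms(3) c]) (auto simp: C1test_def)
  ultimately show ?thesis using assms(1,4) unfolding C1test_def by metis
qed

lemma C1test_ball:
  obtains \<phi> \<phi>' where "C1test \<phi> \<phi>'" "\<And>x::'a::euclidean_space. 0 \<le> \<phi> x" "\<And>x. norm x \<le> R \<Longrightarrow> 1 \<le> \<phi> x"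
proof
  define \<phi> where "\<phi> = (\<lambda>x::'a. (max 0 (R\<^sup>2 + 1 - x \<bullet> x))\<^sup>2)"
  define \<phi>' where "\<phi>' = (\<lambda>(x::'a) h. 2 * max 0 (R\<^sup>2 + 1 - x \<bullet> x) * (- 2 * (x \<bullet> h)))"
  have "(\<phi> has_derivative \<phi>' x) (at x)" for x
  proof -
    have "((\<lambda>x. R\<^sup>2 + 1 - x \<bullet> x) has_derivative (\<lambda>h. - 2 * (x \<bullet> h))) (at x)"
      by (auto intro!: derivative_eq_intros simp: inner_commute)
    from has_derivative_compose[OF this, of "\<lambda>t. (max 0 t)\<^sup>2" "\<lambda>h. 2 * max 0 (R\<^sup>2 + 1 - x \<bullet> x) * h"]
      has_real_derivative_max0_square[of "R\<^sup>2 + 1 - x \<bullet> x"]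
    show ?thesis by (simp add: \<phi>_def \<phi>'_def has_field_derivative_def)
  qed
  moreover have "continuous_on UNIV (\<lambda>x. \<phi>' x h)" for h
    unfolding \<phi>'_def by (intro continuous_intros)
  moreover have "\<phi> x = 0" if "norm x > \<bar>R\<bar> + 1" for x
  proof -
    have "(norm x)\<^sup>2 \<ge> (\<bar>R\<bar> + 1)\<^sup>2" using that by (intro power_mono) auto
    then have "x \<bullet> x \<ge> (\<bar>R\<bar> + 1)\<^sup>2" by (simp add: power2_norm_eq_inner)
    then have "R\<^sup>2 + 1 - x \<bullet> x \<le> 0" by (simp add: power2_eq_square algebra_simps)
    then show ?thesis by (simp add: \<phi>_def)
  qed
  ultimately show "C1test \<phi> \<phi>'" unfolding C1test_def by blast
  show "0 \<le> \<phi> x" for x by (simp add: \<phi>_def)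
  show "1 \<le> \<phi> x" if "norm x \<le> R" for x
  proof -
    have "(norm x)\<^sup>2 \<le> R\<^sup>2" using that by (intro power_mono) auto
    then have "1 \<le> max 0 (R\<^sup>2 + 1 - x \<bullet> x)" by (simp add: power2_norm_eq_inner)
    then show ?thesis unfolding \<phi>_def by (simp add: one_le_power)
  qed
qed

text \<open>Some nonnegative test function is at least 1 on the given bounded set and so dominates
  its indicator.\<close>

lemma set_integrable_of_tests:
  fixes k :: "'a::euclidean_space \<Rightarrow> real"
  assumes [measurable]: "k \<in> borel_measurable borel"
    and "\<And>\<phi> \<phi>'. C1test \<phi> \<phi>' \<Longrightarrow> integrable lborel (\<lambda>x. \<phi> x * k x)"
    and "bounded S" and [measurable]: "S \<in> sets borel"
  shows "set_integrable lborel S k"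
proof -
  obtain R where R: "\<And>x. x \<in> S \<Longrightarrow> norm x \<le> R" using \<open>bounded S\<close> by (auto simp: bounded_iff)
  obtain \<phi> \<phi>' where p: "C1test \<phi> \<phi>'" "\<And>x::'a. 0 \<le> \<phi> x" "\<And>x. norm x \<le> R \<Longrightarrow> 1 \<le> \<phi> x"
    using C1test_ball[of R] by metis
  show ?thesis unfolding set_integrable_def
  proof (rule Bochner_Integration.integrable_bound[OF assms(2)[OF p(1)]])
    show "AE x in lborel. norm (indicator S x *\<^sub>R k x) \<le> norm (\<phi> x * k x)"
    proof (rule AE_I2)
      fix x show "norm (indicator S x *\<^sub>R k x) \<le> norm (\<phi> x * k x)"
        using p(2)[of x] p(3)[of x] R[of x]
        by (auto simp: indicator_def abs_mult intro!: mult_right_mono[of 1 "\<phi> x" "\<bar>k x\<bar>", simplified])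
    qed
  qed simp
qed

text \<open>Squared positive parts are of class C^1, and so is the product over the coordinates of
  those of (x_i - a_i)(b_i - x_i). Its positivity set is the box itself, which lets the indicator of
  a box be reached from inside by test functions.\<close>

lemma C1test_box:
  assumes "box a b \<noteq> {}"
  obtains \<phi> \<phi>' where "C1test \<phi> \<phi>'" "\<And>x::'a::euclidean_space. 0 \<le> \<phi> x"
    "\<And>x. x \<in> box a b \<longleftrightarrow> 0 < \<phi> x"
proof
  define r where "r = (\<lambda>i (x::'a). (x \<bullet> i - a \<bullet> i) * (b \<bullet> i - x \<bullet> i))"
  define r' where "r' = (\<lambda>i (x::'a) h. (x \<bullet> i - a \<bullet> i) * (- (h \<bullet> i)) + (h \<bullet> i) * (b \<bullet> i - x \<bullet> i))"
  define s where "s = (\<lambda>(x::'a) i. (max 0 (r i x))\<^sup>2)"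
  define s' where "s' = (\<lambda>i (x::'a) h. 2 * max 0 (r i x) * r' i x h)"
  define \<phi> where "\<phi> = (\<lambda>x::'a. (\<Prod>i\<in>Basis. s x i))"
  define \<phi>' where "\<phi>' = (\<lambda>(x::'a) h. \<Sum>i\<in>Basis. s' i x h * (\<Prod>j\<in>Basis - {i}. s x j))"
  have r: "(r i has_derivative r' i x) (at x)" for i x
    unfolding r_def r'_def by (auto intro!: derivative_eq_intros)
  have s: "((\<lambda>x. s x i) has_derivative s' i x) (at x)" for i x
    using has_derivative_compose[OF r[of i x], of "\<lambda>t. (max 0 t)\<^sup>2" "\<lambda>h. 2 * max 0 (r i x) * h"]
      has_real_derivative_max0_square[of "r i x"]
    by (simp add: s_def s'_def has_field_derivative_def)
  have "(\<phi> has_derivative \<phi>' x) (at x)" for x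
    unfolding \<phi>_def \<phi>'_def by (rule has_derivative_prod) (use s in auto)
  moreover have "continuous_on UNIV (\<lambda>x. \<phi>' x h)" for h
    unfolding \<phi>'_def s'_def s_def r'_def r_def by (intro continuous_intros)
  moreover have pos: "x \<in> box a b \<longleftrightarrow> 0 < \<phi> x" for x
  proof
    assume "x \<in> box a b"
    then show "0 < \<phi> x" unfolding \<phi>_def s_def r_def
      by (intro prod_pos) (auto simp: mem_box zero_less_power2 max_def not_le mult_less_0_iff less_imp_neq dest: less_asym)
  next
    assume *: "0 < \<phi> x"
    have "(x \<bullet> i - a \<bullet> i) * (b \<bullet> i - x \<bullet> i) > 0" if "i \<in> Basis" for i
    proof (rule ccontr)
      assume "\<not> ?thesis"
      then have "s x i = 0" by (simp add: s_def r_def)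
      then show False using * that unfolding \<phi>_def by (metis finite_Basis less_irrefl prod_zero)
    qed
    then have h: "(a \<bullet> i < x \<bullet> i \<and> x \<bullet> i < b \<bullet> i) \<or> (b \<bullet> i < x \<bullet> i \<and> x \<bullet> i < a \<bullet> i)" if "i \<in> Basis" for i
      using that by (fastforce simp: zero_less_mult_iff)
    \<comment> \<open>A positive product also arises from two negative factors; nonemptiness of the
      box excludes that case.\<close>
    have "a \<bullet> i < b \<bullet> i" if "i \<in> Basis" for i using assms that by (simp add: box_ne_empty)
    then have "a \<bullet> i < x \<bullet> i \<and> x \<bullet> i < b \<bullet> i" if "i \<in> Basis" for i using h[OF that] that by fastforce
    then show "x \<in> box a b" by (simp add: mem_box)
  qed
  moreover have nn: "0 \<le> \<phi> x" for x unfolding \<phi>_def s_def by (intro prod_nonneg) auto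
  moreover have "\<exists>R. \<forall>x. norm x > R \<longrightarrow> \<phi> x = 0"
  proof -
    obtain R where "\<forall>x\<in>box a b. norm x \<le> R" using bounded_box[of a b] by (auto simp: bounded_iff)
    then have "\<phi> x = 0" if "norm x > R" for x
      using pos[of x] nn[of x] that by (metis less_eq_real_def not_le)
    then show ?thesis by blast
  qed
  ultimately show "C1test \<phi> \<phi>'" unfolding C1test_def by blast
  show "0 \<le> \<phi> x" for x by (rule nn)
  show "x \<in> box a b \<longleftrightarrow> 0 < \<phi> x" for x by (rule pos)
qed
text \<open>Composing the box function with functions that saturate at 1 gives test functions
  increasing to the indicator of the box; dominated convergence does the rest.\<close>

lemma integral_box_eq_0_of_tests:
  fixes k :: "'a::euclidean_space \<Rightarrow> real"
  assumes [measurable]: "k \<in> borel_measurable borel"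
    and int: "\<And>\<phi> \<phi>'. C1test \<phi> \<phi>' \<Longrightarrow> integrable lborel (\<lambda>x. \<phi> x * k x)"
    and zero: "\<And>\<phi> \<phi>'. C1test \<phi> \<phi>' \<Longrightarrow> (\<integral>x. \<phi> x * k x \<partial>lborel) = 0"
  shows "(\<integral>x. indicator (box a b) x * k x \<partial>lborel) = 0"
proof (cases "box a b = {}")
  case False
  obtain \<phi> \<phi>' where p: "C1test \<phi> \<phi>'" "\<And>x::'a. 0 \<le> \<phi> x" "\<And>x. x \<in> box a b \<longleftrightarrow> 0 < \<phi> x"
    using C1test_box[OF False] by metis
  \<comment> \<open>n t^2 / (1 + n t^2) on t > 0: it vanishes at 0, tends to 1 for every positive
    argument, and its derivative is continuous, so composition with \<phi> stays a test
    function.\<close>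
  define G where "G = (\<lambda>(n::nat) (t::real). real n * (max 0 t)\<^sup>2 / (1 + real n * (max 0 t)\<^sup>2))"
  have dn: "1 + real n * (max 0 t)\<^sup>2 > 0" for n t
    by (smt (verit) mult_nonneg_nonneg of_nat_0_le_iff zero_le_power2)
  have "C1test (\<lambda>x. G n (\<phi> x)) (\<lambda>x h. (real n * (2 * max 0 (\<phi> x)) / (1 + real n * (max 0 (\<phi> x))\<^sup>2)\<^sup>2) * \<phi>' x h)" for n
  proof (rule C1test_compose[OF p(1)])
    show "(G n has_real_derivative real n * (2 * max 0 t) / (1 + real n * (max 0 t)\<^sup>2)\<^sup>2) (at t)" for t
    proof -
      have nz: "1 + real n * (max 0 t)\<^sup>2 \<noteq> 0" using dn[of n t] by simp
      have "((\<lambda>s. real n * s / (1 + real n * s)) has_real_derivative real n / (1 + real n * s)\<^sup>2) (at s)"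
        if "1 + real n * s \<noteq> 0" for s
        using that by (auto intro!: derivative_eq_intros simp: power2_eq_square algebra_simps)
      from DERIV_chain2[OF this[OF nz] has_real_derivative_max0_square]
      show ?thesis by (simp add: G_def[abs_def])
    qed
    show "continuous_on UNIV (\<lambda>t. real n * (2 * max 0 t) / (1 + real n * (max 0 t)\<^sup>2)\<^sup>2)"
      using dn by (intro continuous_intros) (metis less_irrefl power_eq_0_iff)
  qed (simp add: G_def)
  then have ze: "(\<integral>x. G n (\<phi> x) * k x \<partial>lborel) = 0" for n using zero by blast
  have \<phi>m[measurable]: "\<phi> \<in> borel_measurable borel"
    using p(1) unfolding C1test_def
    by (meson borel_measurable_continuous_onI continuous_at_imp_continuous_on has_derivative_continuous)
  have "(\<lambda>n. \<integral>x. G n (\<phi> x) * k x \<partial>lborel) \<longlonglongrightarrow> (\<integral>x. indicator (box a b) x * k x \<partial>lborel)"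
  proof (rule integral_dominated_convergence[where w="\<lambda>x. norm (indicator (box a b) x *\<^sub>R k x)"])
    show "integrable lborel (\<lambda>x. norm (indicator (box a b) x *\<^sub>R k x))"
      using set_integrable_of_tests[of k "box a b", OF assms(1) int bounded_box]
      by (intro integrable_norm) (auto simp: set_integrable_def)
    show "AE x in lborel. (\<lambda>n. G n (\<phi> x) * k x) \<longlonglongrightarrow> indicator (box a b) x * k x"
    proof (rule AE_I2)
      fix x
      have "(\<lambda>n. G n (\<phi> x)) \<longlonglongrightarrow> indicator (box a b) x"
      proof (cases "x \<in> box a b")
        case True
        define c where "c = (max 0 (\<phi> x))\<^sup>2"
        have c: "c > 0" using p(3)[of x] True by (simp add: c_def)
        have "(\<lambda>n. 1 - 1 / (1 + real n * c)) \<longlonglongrightarrow> 1 - 0"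
        proof (intro tendsto_diff tendsto_const)
          have "filterlim (\<lambda>n. 1 + c * real n) at_top sequentially"
            using c by (intro filterlim_tendsto_add_at_top[OF tendsto_const] filterlim_tendsto_pos_mult_at_top[OF tendsto_const] filterlim_real_sequentially)
          then show "(\<lambda>n. 1 / (1 + real n * c)) \<longlonglongrightarrow> 0"
            by (intro real_tendsto_divide_at_top[OF tendsto_const]) (simp add: mult.commute)
        qed
        moreover have "1 - 1 / (1 + real n * c) = G n (\<phi> x)" for n
          using dn[of n "\<phi> x"] unfolding G_def c_def by (simp add: field_simps)
        ultimately show ?thesis using True by simp
      next
        case False
        then have "\<phi> x = 0" using p(2)[of x] p(3)[of x] by (metis less_eq_real_def)
        then show ?thesis using False by (simp add: G_def)
      qed
      then show "(\<lambda>n. G n (\<phi> x) * k x) \<longlonglongrightarrow> indicator (box a b) x * k x" by (intro tendsto_intros)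
    qed
    show "AE x in lborel. norm (G n (\<phi> x) * k x) \<le> norm (indicator (box a b) x *\<^sub>R k x)" for n
    proof (rule AE_I2)
      fix x
      have "0 \<le> G n (\<phi> x)" "G n (\<phi> x) \<le> 1" unfolding G_def using dn[of n "\<phi> x"] by (auto simp: field_simps)
      moreover have "G n (\<phi> x) = 0" if "x \<notin> box a b"
        using that p(2)[of x] p(3)[of x] by (simp add: G_def)
      ultimately show "norm (G n (\<phi> x) * k x) \<le> norm (indicator (box a b) x *\<^sub>R k x)"
        by (auto simp: indicator_def abs_mult intro!: mult_left_le_one_le)
    qed
  qed (simp_all add: G_def)
  then show ?thesis using ze by (simp add: LIMSEQ_const_iff)
qed simp

text \<open>The integral of \<open>k\<close> vanishes over every box, hence over every Borel set,
  since boxes generate and are stable under intersection. Complements and countable unions call for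
  an integrable function, so \<open>k\<close> is first restricted to a large box.\<close>

lemma AE_eq_0_of_tests:
  fixes k :: "'a::euclidean_space \<Rightarrow> real"
  assumes [measurable]: "k \<in> borel_measurable borel"
    and int: "\<And>\<phi> \<phi>'. C1test \<phi> \<phi>' \<Longrightarrow> integrable lborel (\<lambda>x. \<phi> x * k x)"
    and zero: "\<And>\<phi> \<phi>'. C1test \<phi> \<phi>' \<Longrightarrow> (\<integral>x. \<phi> x * k x \<partial>lborel) = 0"
  shows "AE x in lborel. k x = 0"
proof -
  have "AE x in lborel. indicator (box (- real n *\<^sub>R One) (real n *\<^sub>R One)) x * k x = 0" for n
  proof -
    define B where "B = box (- real n *\<^sub>R One) (real n *\<^sub>R (One::'a))"
    have [measurable]: "B \<in> sets borel" by (simp add: B_def)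
    define f where "f = (\<lambda>x. indicator B x * k x)"
    have f: "integrable lborel f"
      using set_integrable_of_tests[of k B, OF assms(1) int] by (simp add: f_def B_def set_integrable_def)
    have "(LINT x:A|lborel. f x) = 0" if "A \<in> sigma_sets UNIV (range (\<lambda>(a, b). box a (b::'a)))" for A
    proof -
      have "Int_stable (range (\<lambda>(a, b). box a (b::'a)))"
        by (auto simp: Int_stable_def box_Int_box)
      moreover have "range (\<lambda>(a, b). box a (b::'a)) \<subseteq> Pow UNIV" by simp
      ultimately show ?thesis using that
    proof (induction rule: sigma_sets_induct_disjoint)
      case (basic A)
      then obtain a b where A: "A = box a b" by auto
      obtain c d where cd: "A \<inter> B = box c d" unfolding A B_def using box_Int_box by blast
      have "(LINT x:A|lborel. f x) = (\<integral>x. indicator (box c d) x * k x \<partial>lborel)"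
        unfolding set_lebesgue_integral_def f_def cd[symmetric]
        by (intro Bochner_Integration.integral_cong refl) (simp add: indicator_inter_arith)
      then show ?case using integral_box_eq_0_of_tests[OF assms] by simp
    next
      case empty then show ?case by (simp add: set_lebesgue_integral_def)
    next
      case (compl A)
      have [measurable]: "A \<in> sets borel" using compl(1) by (simp add: borel_eq_box)
      have "(\<integral>x. f x \<partial>lborel) = 0" using integral_box_eq_0_of_tests[OF assms] by (simp add: f_def B_def)
      moreover have "(LINT x:UNIV - A|lborel. f x) = (\<integral>x. f x - indicator A x *\<^sub>R f x \<partial>lborel)"
        unfolding set_lebesgue_integral_def by (intro Bochner_Integration.integral_cong refl) (auto simp: indicator_def)
      moreover have "\<dots> = (\<integral>x. f x \<partial>lborel) - (LINT x:A|lborel. f x)"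
        unfolding set_lebesgue_integral_def
        using f by (intro Bochner_Integration.integral_diff) (auto intro: integrable_mult_indicator simp del: real_scaleR_def)
      ultimately show ?case using compl by simp
    next
      case (union A)
      have [measurable]: "A i \<in> sets borel" for i using union(2) by (auto simp: borel_eq_box)
      have "(LINT x:(\<Union>i. A i)|lborel. f x) = (\<Sum>i. (LINT x:A i|lborel. f x))"
        using union(1) f
        by (intro lebesgue_integral_countable_add)
          (auto simp: disjoint_family_on_def set_integrable_def intro!: integrable_mult_indicator sets.countable_UN simp del: real_scaleR_def)
      then show ?case using union by simp
    qed
    qed
    then have "(LINT x:A|lborel. f x) = (LINT x:A|lborel. 0)" if "A \<in> sets lborel" for A
      using that by (simp add: borel_eq_box set_lebesgue_integral_def)
    then have "AE x in lborel. f x = 0"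
      by (intro density_unique_real[OF f]) auto
    then show ?thesis by (simp add: f_def B_def)
  qed
  then have "AE x in lborel. \<forall>n. indicator (box (- real n *\<^sub>R One) (real n *\<^sub>R One)) x * k x = 0"
    by (subst AE_all_countable) blast
  then show ?thesis
  proof eventually_elim
    case (elim x)
    have "x \<in> (\<Union>i::nat. box (- (real i *\<^sub>R One)) (real i *\<^sub>R One))" by (simp only: UN_box_eq_UNIV UNIV_I)
    then obtain n :: nat where "x \<in> box (- real n *\<^sub>R One) (real n *\<^sub>R One)" by auto
    with elim[rule_format, of n] show ?case by simp
  qed
qed

section \<open>Translations of Lebesgue measure\<close>

lemma lborel_shift:
  fixes c :: "'a::euclidean_space"
  shows "distr lborel borel (\<lambda>x. x + c) = lborel"
  using lborel_distr_plus[of c] by (simp add: add.commute[of _ c])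

lemma nn_integral_shift:
  fixes c :: "'a::euclidean_space"
  assumes [measurable]: "f \<in> borel_measurable borel"
  shows "(\<integral>\<^sup>+x. f (x + c) \<partial>lborel) = (\<integral>\<^sup>+x. f x \<partial>lborel)"
  by (subst (2) lborel_shift[of c, symmetric]) (simp add: nn_integral_distr)

lemma integral_shift_lborel:
  fixes c :: "'a::euclidean_space" and f :: "'a \<Rightarrow> 'b::{banach, second_countable_topology}"
  assumes [measurable]: "f \<in> borel_measurable borel"
  shows "(\<integral>x. f (x + c) \<partial>lborel) = (\<integral>x. f x \<partial>lborel)"
  by (subst (2) lborel_shift[of c, symmetric]) (simp add: integral_distr)

lemma integrable_shift:
  fixes c :: "'a::euclidean_space" and f :: "'a \<Rightarrow> 'b::{banach, second_countable_topology}"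
  assumes [measurable]: "f \<in> borel_measurable borel"
  shows "integrable lborel (\<lambda>x. f (x + c)) \<longleftrightarrow> integrable lborel f"
  by (subst (2) lborel_shift[of c, symmetric]) (simp add: integrable_distr_eq)

lemma AE_shift:
  fixes c :: "'a::euclidean_space"
  assumes "AE x in lborel. P x"
  shows "AE x in lborel. P (x + c)"
proof -
  have "AE x in distr lborel borel (\<lambda>x. x + c). P x" using assms by (simp only: lborel_shift)
  then show ?thesis by (rule AE_distrD[rotated]) simp
qed

text \<open>The fundamental theorem of calculus along lines parallel to \<open>e\<close>. The null
  set may depend on \<open>t\<close>, so that no particular representative of \<open>p\<close> has
  to be chosen. Backward increments are expressed by the direction \<open>- e\<close>.\<close>

definition dir_deriv :: "'a::euclidean_space \<Rightarrow> ('a \<Rightarrow> real) \<Rightarrow> ('a \<Rightarrow> real) \<Rightarrow> bool" where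
  "dir_deriv e p g \<longleftrightarrow> (\<forall>t\<ge>0. AE x in lborel. set_integrable lborel {0..t} (\<lambda>s. g (x + s *\<^sub>R e)) \<and>
      p (x + t *\<^sub>R e) - p x = (LINT s:{0..t}|lborel. g (x + s *\<^sub>R e)))"

definition weak_dir :: "'a::euclidean_space \<Rightarrow> ('a \<Rightarrow> real) \<Rightarrow> ('a \<Rightarrow> real) \<Rightarrow> bool" where
  "weak_dir e p g \<longleftrightarrow> (\<forall>\<phi> \<phi>'. C1test \<phi> \<phi>' \<longrightarrow>
     integrable lborel (\<lambda>x. \<phi> x * g x) \<and> 
     (\<integral>x. \<phi>' x e * p x \<partial>lborel) = - (\<integral>x. \<phi> x * g x \<partial>lborel))"

text \<open>This average is the test function that turns a weak derivative into a finite increment: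
  its derivative along \<open>e\<close> is the difference of \<phi> and a translate.\<close>

lemma C1test_shift_average:
  fixes e :: "'a::euclidean_space"
  assumes "C1test \<phi> \<phi>'" "t \<ge> 0"
  shows "C1test (\<lambda>x. integral {0..t} (\<lambda>s. \<phi> (x - s *\<^sub>R e))) (\<lambda>x h. integral {0..t} (\<lambda>s. \<phi>' (x - s *\<^sub>R e) h))"
    and "integral {0..t} (\<lambda>s. \<phi>' (x - s *\<^sub>R e) e) = \<phi> x - \<phi> (x - t *\<^sub>R e)"
proof -
  have d: "(\<phi> has_derivative \<phi>' x) (at x)" for x using assms(1) by (simp add: C1test_def)
  have c: "continuous_on UNIV \<phi>"
    by (meson continuous_at_imp_continuous_on d has_derivative_continuous)
  have c': "continuous_on UNIV (\<lambda>x. \<phi>' x h)" for h using assms(1) by (simp add: C1test_def)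
  have bl: "bounded_linear (\<phi>' x)" for x using d has_derivative_bounded_linear by blast
  \<comment> \<open>The Leibniz rule for parameter integrals wants a derivative that is continuous
    as a bounded linear map, whereas \<open>C1test\<close> records continuity for each direction
    separately.\<close>
  let ?B = "\<lambda>x. Blinfun (\<phi>' x)"
  have B: "blinfun_apply (?B x) = \<phi>' x" for x by (rule bounded_linear_Blinfun_apply[OF bl])
  have cB: "continuous_on UNIV ?B"
    by (rule continuous_on_blinfun_componentwise) (simp add: B c')
  show "integral {0..t} (\<lambda>s. \<phi>' (x - s *\<^sub>R e) e) = \<phi> x - \<phi> (x - t *\<^sub>R e)" for x
  proof -
    have "((\<lambda>s. \<phi>' (x - s *\<^sub>R e) e) has_integral (- \<phi> (x - t *\<^sub>R e)) - (- \<phi> (x - 0 *\<^sub>R e))) {0..t}"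
    proof (rule fundamental_theorem_of_calculus[OF assms(2)])
      fix s assume "s \<in> {0..t}"
      have "((\<lambda>s. x - s *\<^sub>R e) has_derivative (\<lambda>h. - (h *\<^sub>R e))) (at s within {0..t})"
        by (auto intro!: derivative_eq_intros)
      from has_derivative_minus[OF has_derivative_compose[OF this d]]
      show "((\<lambda>s. - \<phi> (x - s *\<^sub>R e)) has_vector_derivative \<phi>' (x - s *\<^sub>R e) e) (at s within {0..t})"
        unfolding has_vector_derivative_def
        using bl[of "x - s *\<^sub>R e"] by (simp add: linear_simps bounded_linear.linear linear_neg linear_scale)
    qed
    then show ?thesis by (simp add: integral_unique)
  qed
  have "((\<lambda>x. integral (cbox 0 t) (\<lambda>s. \<phi> (x - s *\<^sub>R e))) has_derivative
      integral (cbox 0 t) (\<lambda>s. ?B (x - s *\<^sub>R e))) (at x within UNIV)" for x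
  proof (rule leibniz_rule)
    show "((\<lambda>x. \<phi> (x - s *\<^sub>R e)) has_derivative blinfun_apply (?B (x - s *\<^sub>R e))) (at x within UNIV)" for x s
      unfolding B by (rule has_derivative_eq_rhs[OF has_derivative_compose[OF _ d]]) (auto intro!: derivative_eq_intros)
    show "(\<lambda>s. \<phi> (x - s *\<^sub>R e)) integrable_on cbox 0 t" for x
      by (intro integrable_continuous continuous_on_compose2[OF c] continuous_intros) auto
    show "continuous_on (UNIV \<times> cbox 0 t) (\<lambda>(x, s). ?B (x - s *\<^sub>R e))"
      unfolding case_prod_unfold by (intro continuous_on_compose2[OF cB] continuous_intros) auto
  qed auto
  moreover have "blinfun_apply (integral (cbox 0 t) (\<lambda>s. ?B (x - s *\<^sub>R e))) h = integral {0..t} (\<lambda>s. \<phi>' (x - s *\<^sub>R e) h)" for x h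
  proof -
    have "(\<lambda>s. ?B (x - s *\<^sub>R e)) integrable_on cbox 0 t"
      by (intro integrable_continuous continuous_on_compose2[OF cB] continuous_intros) auto
    from blinfun_apply_integral[OF this, of h] show ?thesis by (simp add: B)
  qed
  ultimately have 1: "((\<lambda>x. integral {0..t} (\<lambda>s. \<phi> (x - s *\<^sub>R e))) has_derivative
      (\<lambda>h. integral {0..t} (\<lambda>s. \<phi>' (x - s *\<^sub>R e) h))) (at x)" for x
    by (metis (no_types, lifting) cbox_interval has_derivative_eq_rhs ext)
  have 2: "continuous_on UNIV (\<lambda>x. integral {0..t} (\<lambda>s. \<phi>' (x - s *\<^sub>R e) h))" for h
  proof -
    have "continuous_on (UNIV \<times> cbox 0 t) (\<lambda>(x, s). \<phi>' (x - s *\<^sub>R e) h)"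
      unfolding case_prod_unfold by (intro continuous_on_compose2[OF c'] continuous_intros) auto
    then show ?thesis using integral_continuous_on_param by fastforce
  qed
  obtain R where R: "\<And>x. norm x > R \<Longrightarrow> \<phi> x = 0" using assms(1) by (auto simp: C1test_def)
  have 3: "integral {0..t} (\<lambda>s. \<phi> (x - s *\<^sub>R e)) = 0" if "norm x > R + t * norm e" for x
  proof -
    have "\<phi> (x - s *\<^sub>R e) = 0" if s: "s \<in> {0..t}" for s
    proof (rule R)
      have "norm (s *\<^sub>R e) \<le> t * norm e" using s by (auto intro: mult_right_mono)
      moreover have "norm x - norm (s *\<^sub>R e) \<le> norm (x - s *\<^sub>R e)" by (rule norm_triangle_ineq2)
      ultimately show "R < norm (x - s *\<^sub>R e)" using \<open>norm x > R + t * norm e\<close> by linarith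
    qed
    then show ?thesis by (metis (no_types, lifting) integral_cong integral_0)
  qed
  show "C1test (\<lambda>x. integral {0..t} (\<lambda>s. \<phi> (x - s *\<^sub>R e))) (\<lambda>x h. integral {0..t} (\<lambda>s. \<phi>' (x - s *\<^sub>R e) h))"
    unfolding C1test_def using 1 2 3 by blast
qed

definition loc_int :: "('a::euclidean_space \<Rightarrow> real) \<Rightarrow> bool" where
  "loc_int g \<longleftrightarrow> g \<in> borel_measurable borel \<and> (\<forall>S\<in>sets borel. bounded S \<longrightarrow> set_integrable lborel S g)"

lemma loc_int_bounded_mult:
  fixes g :: "'a::euclidean_space \<Rightarrow> real"
  assumes g: "loc_int g" and [measurable]: "b \<in> borel_measurable borel"
    and C: "\<And>x. \<bar>b x\<bar> \<le> C" and R: "\<And>x. norm x > R \<Longrightarrow> b x = 0"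
  shows "integrable lborel (\<lambda>x. b x * g x)"
proof -
  have [measurable]: "g \<in> borel_measurable borel" using g by (simp add: loc_int_def)
  have "set_integrable lborel (cball 0 R) g" using g by (simp add: loc_int_def)
  then have "integrable lborel (\<lambda>x. C * norm (indicator (cball 0 R) x *\<^sub>R g x))"
    unfolding set_integrable_def by (intro integrable_mult_right integrable_norm)
  then show ?thesis
  proof (rule Bochner_Integration.integrable_bound)
    show "AE x in lborel. norm (b x * g x) \<le> norm (C * norm (indicator (cball 0 R) x *\<^sub>R g x))"
    proof (rule AE_I2)
      fix x :: 'a
      have "\<bar>b x\<bar> * \<bar>g x\<bar> \<le> C * \<bar>g x\<bar>" using C[of x] by (intro mult_right_mono) auto
      moreover have "0 \<le> C" using C[of x] by linarith
      ultimately show "norm (b x * g x) \<le> norm (C * norm (indicator (cball 0 R) x *\<^sub>R g x))"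
        using R[of x] by (cases "norm x \<le> R") (auto simp: abs_mult indicator_def)
    qed
  qed simp
qed

text \<open>Fubini for b(x) g(x + s e) with \<open>s\<close> in [0, t]. The aim is the third claim:
  the averaging along \<open>e\<close> passes from \<open>g\<close>, which is only locally
  integrable, to the bounded and compactly supported \<open>b\<close>, with the direction
  reversed.\<close>

lemma shift_kernel_integrable:
  fixes g :: "'a::euclidean_space \<Rightarrow> real" and e :: 'a
  assumes g: "loc_int g" and [measurable]: "b \<in> borel_measurable borel"
    and C: "\<And>x. \<bar>b x\<bar> \<le> C" and R: "\<And>x. norm x > R \<Longrightarrow> b x = 0"
  shows "integrable (lborel \<Otimes>\<^sub>M lborel) (\<lambda>(s, x). indicator {0..t::real} s * (b (x - s *\<^sub>R e) * g x))"
    and "integrable (lborel \<Otimes>\<^sub>M lborel) (\<lambda>(s, x). indicator {0..t::real} s * (b x * g (x + s *\<^sub>R e)))"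
    and "(\<integral>x. b x * (LINT s:{0..t}|lborel. g (x + s *\<^sub>R e)) \<partial>lborel)
       = (\<integral>x. (LINT s:{0..t}|lborel. b (x - s *\<^sub>R e)) * g x \<partial>lborel)"
    and "integrable lborel (\<lambda>x. b x * (LINT s:{0..t}|lborel. g (x + s *\<^sub>R e)))"
proof -
  have gm[measurable]: "g \<in> borel_measurable borel" using g by (simp add: loc_int_def)
  define R' where "R' = R + \<bar>t\<bar> * norm e"
  have [measurable]: "cball (0::'a) R' \<in> sets borel" by simp
  have gR: "set_integrable lborel (cball 0 R') g" using g by (simp add: loc_int_def)
  let ?K = "\<lambda>(s, x). indicator {0..t::real} s * (b (x - s *\<^sub>R e) * g x)"
  let ?J = "\<lambda>(s, x). indicator {0..t::real} s * (b x * g (x + s *\<^sub>R e))"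
  have 1: "integrable (lborel \<Otimes>\<^sub>M lborel) (\<lambda>(s, x). (indicator {0..t} s :: real) * (C * norm (indicator (cball 0 R') x *\<^sub>R g x)))"
  proof (rule lborel_pair.Fubini_integrable)
    show "AE s in lborel. integrable lborel (\<lambda>x. case (s, x) of (s, x) \<Rightarrow> (indicator {0..t} s::real) * (C * norm (indicator (cball 0 R') x *\<^sub>R g x)))"
      using gR unfolding set_integrable_def by (auto intro!: integrable_mult_right integrable_norm simp del: norm_scaleR)
    have "integrable lborel (indicat_real {0..t})" by (simp add: emeasure_lborel_Icc_eq)
    then show "integrable lborel (\<lambda>s. \<integral>x. norm (case (s, x) of (s, x) \<Rightarrow> (indicator {0..t} s::real) * (C * norm (indicator (cball 0 R') x *\<^sub>R g x))) \<partial>lborel)"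
      by (simp add: abs_mult)
  qed measurable
  show K: "integrable (lborel \<Otimes>\<^sub>M lborel) ?K"
  proof (rule Bochner_Integration.integrable_bound[OF 1])
    show "AE z in lborel \<Otimes>\<^sub>M lborel. norm (?K z) \<le> norm (case z of (s, x) \<Rightarrow> (indicator {0..t} s :: real) * (C * norm (indicator (cball 0 R') x *\<^sub>R g x)))"
    proof (rule AE_I2, clarify)
      fix s and x :: 'a
      have "0 \<le> C" using C[of x] by linarith
      have "\<bar>b (x - s *\<^sub>R e)\<bar> * \<bar>g x\<bar> \<le> C * \<bar>g x\<bar>" using C by (intro mult_right_mono) auto
      moreover have "b (x - s *\<^sub>R e) = 0" if "s \<in> {0..t}" "norm x > R'"
      proof (rule R)
        have "norm (s *\<^sub>R e) \<le> \<bar>t\<bar> * norm e" using that by (auto intro: mult_right_mono)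
        moreover have "norm x - norm (s *\<^sub>R e) \<le> norm (x - s *\<^sub>R e)" by (rule norm_triangle_ineq2)
        ultimately show "R < norm (x - s *\<^sub>R e)" using that by (simp add: R'_def)
      qed
      ultimately show "norm (indicator {0..t} s * (b (x - s *\<^sub>R e) * g x)) \<le> norm ((indicator {0..t} s :: real) * (C * norm (indicator (cball 0 R') x *\<^sub>R g x)))"
        using \<open>0 \<le> C\<close> by (cases "s \<in> {0..t}"; cases "norm x \<le> R'") (auto simp: abs_mult indicator_def)
    qed
  qed measurable
  \<comment> \<open>For fixed \<open>s\<close>, translation by s e carries \<open>?K\<close> into
    \<open>?J\<close>. This is used with the norm for integrability and with the identity for the
    value.\<close>
  have eq: "(\<integral>x. (f::real\<Rightarrow>real) (?J (s, x)) \<partial>lborel) = (\<integral>x. f (?K (s, x)) \<partial>lborel)" if [measurable]: "f \<in> borel_measurable borel" for s f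
    using integral_shift_lborel[of "\<lambda>x. f (indicator {0..t::real} s * (b (x - s *\<^sub>R e) * g x))" "s *\<^sub>R e"] by simp
  show J: "integrable (lborel \<Otimes>\<^sub>M lborel) ?J"
  proof (rule lborel_pair.Fubini_integrable)
    show "integrable lborel (\<lambda>s. \<integral>x. norm (?J (s, x)) \<partial>lborel)"
      using lborel_pair.integrable_fst'[OF integrable_norm[OF K]] eq[of norm] by simp
    show "AE s in lborel. integrable lborel (\<lambda>x. ?J (s, x))"
    proof (rule AE_I2)
      fix s
      have "integrable lborel (\<lambda>x. b x * g (x + s *\<^sub>R e))"
      proof -
        have "integrable lborel (\<lambda>x. b (x - s *\<^sub>R e) * g x)"
        proof (rule loc_int_bounded_mult[OF g _ C])
          fix x :: 'a assume "R + norm (s *\<^sub>R e) < norm x"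
          moreover have "norm x - norm (s *\<^sub>R e) \<le> norm (x - s *\<^sub>R e)" by (rule norm_triangle_ineq2)
          ultimately show "b (x - s *\<^sub>R e) = 0" by (intro R) linarith
        qed measurable
        then have "integrable lborel (\<lambda>x. b ((x + s *\<^sub>R e) - s *\<^sub>R e) * g (x + s *\<^sub>R e))"
          by (subst integrable_shift[of "\<lambda>x. b (x - s *\<^sub>R e) * g x"]) auto
        then show ?thesis by simp
      qed
      then show "integrable lborel (\<lambda>x. ?J (s, x))" by simp
    qed
  qed measurable
  have i1: "b x * (LINT s:{0..t}|lborel. g (x + s *\<^sub>R e)) = (\<integral>s. ?J (s, x) \<partial>lborel)" for x
    unfolding set_lebesgue_integral_def
    by (subst integral_mult_right_zero[symmetric]) (intro Bochner_Integration.integral_cong refl, simp)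
  show "integrable lborel (\<lambda>x. b x * (LINT s:{0..t}|lborel. g (x + s *\<^sub>R e)))"
    unfolding i1 using lborel_pair.integrable_snd[of "\<lambda>s x. ?J (s, x)"] J by simp
  have "(\<integral>x. b x * (LINT s:{0..t}|lborel. g (x + s *\<^sub>R e)) \<partial>lborel) = (\<integral>s. (\<integral>x. ?J (s, x) \<partial>lborel) \<partial>lborel)"
    unfolding i1 using lborel_pair.Fubini_integral[of "\<lambda>s x. ?J (s, x)"] J by simp
  also have "\<dots> = (\<integral>s. (\<integral>x. ?K (s, x) \<partial>lborel) \<partial>lborel)" by (rule Bochner_Integration.integral_cong[OF refl]) (rule eq[of "\<lambda>x. x"], measurable)
  also have "\<dots> = (\<integral>x. (\<integral>s. ?K (s, x) \<partial>lborel) \<partial>lborel)"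
    using lborel_pair.Fubini_integral[of "\<lambda>s x. ?K (s, x)"] K by simp
  also have "\<dots> = (\<integral>x. (LINT s:{0..t}|lborel. b (x - s *\<^sub>R e)) * g x \<partial>lborel)"
    unfolding set_lebesgue_integral_def
    by (subst integral_mult_left_zero[symmetric]) (intro Bochner_Integration.integral_cong refl, simp)
  finally show "(\<integral>x. b x * (LINT s:{0..t}|lborel. g (x + s *\<^sub>R e)) \<partial>lborel)
       = (\<integral>x. (LINT s:{0..t}|lborel. b (x - s *\<^sub>R e)) * g x \<partial>lborel)" .
qed

lemma C1test_bounded:
  assumes "C1test \<phi> \<phi>'"
  obtains C R where "\<And>x. \<bar>\<phi> x\<bar> \<le> C" "\<And>x::'a::euclidean_space. norm x > R \<Longrightarrow> \<phi> x = 0"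
    "continuous_on UNIV \<phi>" "\<phi> \<in> borel_measurable borel"
proof -
  obtain R where R: "\<And>x. norm x > R \<Longrightarrow> \<phi> x = 0" using assms by (auto simp: C1test_def)
  have c: "continuous_on UNIV \<phi>"
    using assms unfolding C1test_def by (meson continuous_at_imp_continuous_on has_derivative_continuous)
  have "compact (\<phi> ` cball 0 R)" by (intro compact_continuous_image continuous_on_subset[OF c]) auto
  then obtain C where C: "\<And>x. norm x \<le> R \<Longrightarrow> \<bar>\<phi> x\<bar> \<le> C"
    using compact_imp_bounded by (fastforce simp: bounded_iff)
  have "\<bar>\<phi> x\<bar> \<le> max 0 C" for x using C[of x] R[of x] by (cases "norm x \<le> R") auto
  then show thesis using that R c borel_measurable_continuous_onI by blast
qed

text \<open>Test the claimed identity with \<phi>. The average over [0, t] moves onto \<phi> and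
  becomes a test function whose derivative along \<open>e\<close> is the difference of \<phi> and
  its translate; the weak identity converts this into the increment of \<open>p\<close>.\<close>

lemma weak_dir_imp_dir_deriv:
  fixes p g :: "'a::euclidean_space \<Rightarrow> real"
  assumes p: "loc_int p" and gm[measurable]: "g \<in> borel_measurable borel" and w: "weak_dir e p g"
  shows "loc_int g" "dir_deriv e p g"
proof -
  show g: "loc_int g" unfolding loc_int_def
    using set_integrable_of_tests[OF gm] w by (auto simp: weak_dir_def)
  have pm[measurable]: "p \<in> borel_measurable borel" using p by (simp add: loc_int_def)
  show "dir_deriv e p g" unfolding dir_deriv_def
  proof (intro allI impI)
    fix t :: real assume t: "t \<ge> 0"
    define I where "I = (\<lambda>x. LINT s:{0..t}|lborel. g (x + s *\<^sub>R e))"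
    have Im[measurable]: "I \<in> borel_measurable borel"
      unfolding I_def set_lebesgue_integral_def by measurable
    have "AE x in lborel. p (x + t *\<^sub>R e) - p x - I x = 0"
    proof (rule AE_eq_0_of_tests)
      fix \<phi> \<phi>' assume T: "C1test \<phi> (\<phi>' :: 'a \<Rightarrow> 'a \<Rightarrow> real)"
      obtain C R where C: "\<And>x. \<bar>\<phi> x\<bar> \<le> C" and R: "\<And>x. norm x > R \<Longrightarrow> \<phi> x = 0"
        and c: "continuous_on UNIV \<phi>" and [measurable]: "\<phi> \<in> borel_measurable borel"
        using C1test_bounded[OF T] by blast
      note sk = shift_kernel_integrable[where b=\<phi> and C=C and R=R and e=e and t=t, OF g _ C R, folded I_def]
      have ip: "integrable lborel (\<lambda>x. \<phi> x * p x)" by (rule loc_int_bounded_mult[OF p _ C R]) auto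
      have ip2: "integrable lborel (\<lambda>x. \<phi> (x - t *\<^sub>R e) * p x)"
      proof (rule loc_int_bounded_mult[OF p _ C])
        fix x :: 'a assume "R + norm (t *\<^sub>R e) < norm x"
        moreover have "norm x - norm (t *\<^sub>R e) \<le> norm (x - t *\<^sub>R e)" by (rule norm_triangle_ineq2)
        ultimately show "\<phi> (x - t *\<^sub>R e) = 0" by (intro R) linarith
      qed measurable
      have ip3: "integrable lborel (\<lambda>x. \<phi> x * p (x + t *\<^sub>R e))"
        using ip2 integrable_shift[of "\<lambda>x. \<phi> (x - t *\<^sub>R e) * p x" "t *\<^sub>R e"] by simp
      have ii: "integrable lborel (\<lambda>x. \<phi> x * I x)" using sk(4) by (simp add: I_def)
      show "integrable lborel (\<lambda>x. \<phi> x * (p (x + t *\<^sub>R e) - p x - I x))"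
        unfolding right_diff_distrib using ip ip3 ii by (intro Bochner_Integration.integrable_diff)
      have ps: "(LINT s:{0..t}|lborel. \<phi> (x - s *\<^sub>R e)) = integral {0..t} (\<lambda>s. \<phi> (x - s *\<^sub>R e))" for x
        by (intro set_borel_integral_eq_integral(2) borel_integrable_atLeastAtMost' continuous_on_compose2[OF c] continuous_intros) auto
      have "(\<integral>x. \<phi> x * I x \<partial>lborel) = (\<integral>x. integral {0..t} (\<lambda>s. \<phi> (x - s *\<^sub>R e)) * g x \<partial>lborel)"
        using sk(3) by (simp add: ps I_def)
      also have "\<dots> = - (\<integral>x. integral {0..t} (\<lambda>s. \<phi>' (x - s *\<^sub>R e) e) * p x \<partial>lborel)"
        using w C1test_shift_average(1)[OF T t, of e] unfolding weak_dir_def by fastforce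
      also have "\<dots> = - (\<integral>x. \<phi> x * p x - \<phi> (x - t *\<^sub>R e) * p x \<partial>lborel)"
        by (simp add: C1test_shift_average(2)[OF T t] left_diff_distrib)
      also have "\<dots> = (\<integral>x. \<phi> (x - t *\<^sub>R e) * p x \<partial>lborel) - (\<integral>x. \<phi> x * p x \<partial>lborel)"
        using ip ip2 by (simp add: Bochner_Integration.integral_diff)
      also have "(\<integral>x. \<phi> (x - t *\<^sub>R e) * p x \<partial>lborel) = (\<integral>x. \<phi> x * p (x + t *\<^sub>R e) \<partial>lborel)"
        using integral_shift_lborel[of "\<lambda>x. \<phi> (x - t *\<^sub>R e) * p x" "t *\<^sub>R e"] by simp
      finally show "(\<integral>x. \<phi> x * (p (x + t *\<^sub>R e) - p x - I x) \<partial>lborel) = 0"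
        unfolding right_diff_distrib using ip ip3 ii by (simp add: Bochner_Integration.integral_diff)
    qed measurable
    \<comment> \<open>Integrability on almost every line is obtained ball by ball, because the
      Fubini argument needs a cutoff of bounded support in \<open>x\<close>.\<close>
    moreover have "AE x in lborel. \<forall>n::nat. norm x \<le> real n \<longrightarrow> set_integrable lborel {0..t} (\<lambda>s. g (x + s *\<^sub>R e))"
    proof (subst AE_all_countable, intro allI)
      fix n :: nat
      have "integrable (lborel \<Otimes>\<^sub>M lborel) (\<lambda>(s, x). indicator {0..t::real} s * (indicator (cball 0 (real n)) x * g (x + s *\<^sub>R e)))"
        by (rule shift_kernel_integrable(2)[OF g, where C=1 and R="real n"]) (auto simp: indicator_def)
      from lborel_pair.AE_integrable_snd[OF this]
      show "AE x in lborel. norm x \<le> real n \<longrightarrow> set_integrable lborel {0..t} (\<lambda>s. g (x + s *\<^sub>R e))"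
        by eventually_elim (auto simp: set_integrable_def)
    qed
    ultimately show "AE x in lborel. set_integrable lborel {0..t} (\<lambda>s. g (x + s *\<^sub>R e)) \<and>
        p (x + t *\<^sub>R e) - p x = (LINT s:{0..t}|lborel. g (x + s *\<^sub>R e))"
    proof eventually_elim
      case (elim x)
      obtain n :: nat where "norm x \<le> real n" using real_arch_simple by blast
      then show ?case using elim by (auto simp: I_def)
    qed
  qed
qed

text \<open>\<open>P\<close> is only absolutely continuous. The error of the chain rule over an
  interval is compared with \<epsilon> times the integral of |g|: this bound holds on short
  intervals around each point because F' is continuous, and it is preserved when intervals are
  joined, so bisection (\<open>Bolzano\<close>) yields it on [0, t].\<close>

lemma chain_rule_indefinite_integral:
  fixes g P F F' :: "real \<Rightarrow> real"
  assumes t: "0 \<le> t" and g: "set_integrable lborel {0..t} g"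
    and P: "\<And>s. s \<in> {0..t} \<Longrightarrow> P s = c + (LINT r:{0..s}|lborel. g r)"
    and F: "\<And>y. (F has_real_derivative F' y) (at y)" and F': "continuous_on UNIV F'"
  shows "set_integrable lborel {0..t} (\<lambda>s. F' (P s) * g s)"
    and "F (P t) - F (P 0) = (LINT s:{0..t}|lborel. F' (P s) * g s)"
proof -
  have gs: "set_integrable lborel {a..b} g" if "0 \<le> a" "b \<le> t" for a b
    using that by (intro set_integrable_subset[OF g]) auto
  have gi: "g integrable_on {0..t}" using set_borel_integral_eq_integral(1)[OF g] .
  have Pi: "P s = c + integral {0..s} g" if "s \<in> {0..t}" for s
    using P[OF that] set_borel_integral_eq_integral(2)[OF gs[of 0 s]] that by simp
  have Pc: "continuous_on {0..t} P"
    by (rule continuous_on_eq[where f="\<lambda>s. c + integral {0..s} g"])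
      (auto intro!: continuous_intros indefinite_integral_continuous_1 gi simp: Pi)
  have FPc: "continuous_on {0..t} (\<lambda>s. F' (P s))" by (rule continuous_on_compose2[OF F' Pc]) auto
  have "compact ((\<lambda>s. F' (P s)) ` {0..t})" by (intro compact_continuous_image FPc) auto
  then obtain B where B: "\<And>s. s \<in> {0..t} \<Longrightarrow> \<bar>F' (P s)\<bar> \<le> B"
    using compact_imp_bounded by (fastforce simp: bounded_iff)
  have B0: "0 \<le> B" using B[of 0] t by force
  show FI: "set_integrable lborel {0..t} (\<lambda>s. F' (P s) * g s)"
  proof -
    have m1[measurable]: "(\<lambda>s. indicator {0..t} s *\<^sub>R F' (P s)) \<in> borel_measurable borel"
      by (rule borel_measurable_continuous_on_indicator) (auto intro: FPc)
    have m2[measurable]: "(\<lambda>s. indicator {0..t} s *\<^sub>R g s) \<in> borel_measurable borel"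
      using borel_measurable_integrable[OF g[unfolded set_integrable_def]] by simp
    have "integrable lborel (\<lambda>s. B * norm (indicator {0..t} s *\<^sub>R g s))"
      using g unfolding set_integrable_def by (intro integrable_mult_right integrable_norm)
    then show ?thesis unfolding set_integrable_def
    proof (rule Bochner_Integration.integrable_bound)
      have "(\<lambda>s. (indicator {0..t} s *\<^sub>R F' (P s)) * (indicator {0..t} s *\<^sub>R g s)) \<in> borel_measurable borel" by measurable
      moreover have "(\<lambda>s. (indicator {0..t} s *\<^sub>R F' (P s)) * (indicator {0..t} s *\<^sub>R g s)) = (\<lambda>s. indicator {0..t} s *\<^sub>R (F' (P s) * g s))"
        by (auto simp: indicator_def)
      ultimately show "(\<lambda>s. indicator {0..t} s *\<^sub>R (F' (P s) * g s)) \<in> borel_measurable lborel" by simp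
      show "AE s in lborel. norm (indicator {0..t} s *\<^sub>R (F' (P s) * g s)) \<le> norm (B * norm (indicator {0..t} s *\<^sub>R g s))"
        using B B0 by (intro AE_I2) (auto simp: indicator_def abs_mult intro!: mult_right_mono)
    qed
  qed
  have FIi: "(\<lambda>s. F' (P s) * g s) integrable_on {0..t}" using set_borel_integral_eq_integral(1)[OF FI] .
  have ga: "(\<lambda>s. \<bar>g s\<bar>) integrable_on {0..t}"
    using set_borel_integral_eq_integral(1)[OF set_integrable_abs[OF g]] .
  have sub: "f integrable_on {a..b}" if "f integrable_on {0..t}" "0 \<le> a" "b \<le> t" for f :: "real \<Rightarrow> real" and a b
    using that by (intro integrable_on_subinterval[OF that(1)]) auto
  have main: "\<bar>F (P t) - F (P 0) - integral {0..t} (\<lambda>s. F' (P s) * g s)\<bar> \<le> \<epsilon> * integral {0..t} (\<lambda>s. \<bar>g s\<bar>)"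
    if e: "\<epsilon> > 0" for \<epsilon>
  proof -
    define Q where "Q = (\<lambda>a b. 0 \<le> a \<longrightarrow> b \<le> t \<longrightarrow>
      \<bar>F (P b) - F (P a) - integral {a..b} (\<lambda>s. F' (P s) * g s)\<bar> \<le> \<epsilon> * integral {a..b} (\<lambda>s. \<bar>g s\<bar>))"
    have "Q 0 t"
    proof (rule Bolzano[OF t])
      fix a b c assume q: "Q a b" "Q b c" and ab: "a \<le> b" "b \<le> c"
      show "Q a c" unfolding Q_def
      proof (intro impI)
        assume ac: "0 \<le> a" "c \<le> t"
        have 1: "integral {a..c} f = integral {a..b} f + integral {b..c} f" if "f integrable_on {0..t}" for f :: "real \<Rightarrow> real"
          using Henstock_Kurzweil_Integration.integral_combine[OF ab sub[OF that ac]] by simp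
        show "\<bar>F (P c) - F (P a) - integral {a..c} (\<lambda>s. F' (P s) * g s)\<bar> \<le> \<epsilon> * integral {a..c} (\<lambda>s. \<bar>g s\<bar>)"
          using q ac ab unfolding Q_def 1[OF FIi] 1[OF ga] by (simp add: distrib_left)
      qed
    next
      fix x assume x: "0 \<le> x" "x \<le> t"
      have "isCont F' (P x)" using F' by (simp add: continuous_on_eq_continuous_at)
      then obtain \<eta> where \<eta>: "\<eta> > 0" "\<And>y. \<bar>y - P x\<bar> < \<eta> \<Longrightarrow> \<bar>F' y - F' (P x)\<bar> < \<epsilon> / 2"
        using e unfolding continuous_at_eps_delta dist_real_def by (metis half_gt_zero)
      obtain d where d: "d > 0" "\<And>s. s \<in> {0..t} \<Longrightarrow> \<bar>s - x\<bar> < d \<Longrightarrow> \<bar>P s - P x\<bar> < \<eta>"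
        using Pc \<eta>(1) x unfolding continuous_on_iff dist_real_def by (metis atLeastAtMost_iff)
      show "\<exists>d>0. \<forall>a b. a \<le> x \<and> x \<le> b \<and> b - a < d \<longrightarrow> Q a b"
      proof (intro exI[of _ d] conjI d(1) allI impI)
        fix a b assume ab: "a \<le> x \<and> x \<le> b \<and> b - a < d"
        show "Q a b" unfolding Q_def
        proof (intro impI)
          assume ab': "0 \<le> a" "b \<le> t"
          have near: "\<bar>P s - P x\<bar> < \<eta>" if "s \<in> {a..b}" for s using that ab ab' by (intro d(2)) auto
          \<comment> \<open>Mean value theorem for \<open>F\<close> between P a and P b in either
            order. When the two values coincide, any point close to P x serves.\<close>
          have "\<exists>\<xi>. \<bar>\<xi> - P x\<bar> < \<eta> \<and> F (P b) - F (P a) = F' \<xi> * (P b - P a)"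
          proof (cases "P a" "P b" rule: linorder_cases)
            case less
            then obtain z where "P a < z" "z < P b" "F (P b) - F (P a) = (P b - P a) * F' z"
              using MVT2[OF less F] by blast
            then show ?thesis using near[of a] near[of b] ab by (intro exI[of _ z]) auto
          next
            case equal
            then show ?thesis using \<eta>(1) by (intro exI[of _ "P x"]) auto
          next
            case greater
            then obtain z where "P b < z" "z < P a" "F (P a) - F (P b) = (P a - P b) * F' z"
              using MVT2[OF greater F] by blast
            then show ?thesis using near[of a] near[of b] ab by (intro exI[of _ z]) (auto simp: algebra_simps)
          qed
          then obtain \<xi> where \<xi>: "\<bar>\<xi> - P x\<bar> < \<eta>" "F (P b) - F (P a) = F' \<xi> * (P b - P a)" by blast
          have "P b - P a = integral {a..b} g"
            using Pi[of a] Pi[of b] ab ab' Henstock_Kurzweil_Integration.integral_combine[of 0 a b g, OF _ _ sub[OF gi, of 0 b]] by simp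
          then have eq: "F (P b) - F (P a) - integral {a..b} (\<lambda>s. F' (P s) * g s) = integral {a..b} (\<lambda>s. F' \<xi> * g s - F' (P s) * g s)"
            using sub[OF gi ab'] sub[OF FIi ab'] unfolding \<xi>(2)
            by (subst Henstock_Kurzweil_Integration.integral_diff) (auto intro: integrable_on_mult_right)
          have "\<bar>integral {a..b} (\<lambda>s. F' \<xi> * g s - F' (P s) * g s)\<bar> \<le> integral {a..b} (\<lambda>s. \<epsilon> * \<bar>g s\<bar>)"
            unfolding real_norm_def[symmetric]
          proof (rule integral_norm_bound_integral)
            show "(\<lambda>s. F' \<xi> * g s - F' (P s) * g s) integrable_on {a..b}"
              using sub[OF gi ab'] sub[OF FIi ab'] by (intro integrable_diff integrable_on_mult_right) auto
            show "(\<lambda>s. \<epsilon> * norm (g s)) integrable_on {a..b}" using sub[OF ga ab'] by (intro integrable_on_mult_right) auto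
            fix s assume "s \<in> {a..b}"
            then have "\<bar>F' \<xi> - F' (P s)\<bar> \<le> \<epsilon>" using \<eta>(2)[OF \<xi>(1)] \<eta>(2)[OF near[of s]] by linarith
            then have "\<bar>F' \<xi> - F' (P s)\<bar> * \<bar>g s\<bar> \<le> \<epsilon> * \<bar>g s\<bar>" by (intro mult_right_mono) auto
            then show "norm (F' \<xi> * g s - F' (P s) * g s) \<le> \<epsilon> * norm (g s)"
              by (simp add: left_diff_distrib[symmetric] abs_mult)
          qed
          then show "\<bar>F (P b) - F (P a) - integral {a..b} (\<lambda>s. F' (P s) * g s)\<bar> \<le> \<epsilon> * integral {a..b} (\<lambda>s. \<bar>g s\<bar>)"
            unfolding eq by simp
        qed
      qed
    qed
    then show ?thesis using t by (simp add: Q_def)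
  qed
  have "F (P t) - F (P 0) - integral {0..t} (\<lambda>s. F' (P s) * g s) = 0"
  proof (rule ccontr)
    assume ne: "\<not> ?thesis"
    define d where "d = \<bar>F (P t) - F (P 0) - integral {0..t} (\<lambda>s. F' (P s) * g s)\<bar>"
    define G where "G = integral {0..t} (\<lambda>s. \<bar>g s\<bar>)"
    have d: "d > 0" using ne by (simp add: d_def)
    have G: "G \<ge> 0" unfolding G_def by (intro integral_nonneg ga) auto
    \<comment> \<open>Adding 1 keeps the denominator positive even if the integral \<open>G\<close>
      of |g| is zero.\<close>
    have "d \<le> d / (2 * (G + 1)) * G" using main[of "d / (2 * (G + 1))"] d G unfolding d_def[symmetric] G_def[symmetric] by simp
    also have "\<dots> < d" using d G by (simp add: field_simps add_nonneg_pos)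
    finally show False by simp
  qed
  then show "F (P t) - F (P 0) = (LINT s:{0..t}|lborel. F' (P s) * g s)"
    using set_borel_integral_eq_integral(2)[OF FI] by simp
qed

section \<open>Integration over a period cell\<close>

text \<open>On almost every line p(x + s e) agrees for almost every \<open>s\<close> with the
  continuous primitive \<open>P\<close>, to which the one-dimensional chain rule applies. The values
  at the two endpoints must agree exactly and are checked separately.\<close>

lemma dir_deriv_chain:
  fixes p g :: "'a::euclidean_space \<Rightarrow> real"
  assumes [measurable]: "p \<in> borel_measurable borel" "g \<in> borel_measurable borel"
    and pg: "dir_deriv e p g"
    and F: "\<And>y. (F has_real_derivative F' y) (at y)" and F': "continuous_on UNIV F'"
  shows "dir_deriv e (\<lambda>x. F (p x)) (\<lambda>x. F' (p x) * g x)"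
  unfolding dir_deriv_def
proof (intro allI impI)
  fix t :: real assume t: "0 \<le> t"
  have m[measurable]: "(\<lambda>z. LINT r:{0..snd z}|lborel. g (fst z + r *\<^sub>R e)) \<in> borel_measurable (lborel \<Otimes>\<^sub>M lborel)"
  proof -
    have "(\<lambda>y. (if 0 \<le> snd y \<and> snd y \<le> snd (fst y) then 1 else 0) *\<^sub>R g (fst (fst y) + snd y *\<^sub>R e)) \<in> borel_measurable ((lborel \<Otimes>\<^sub>M lborel) \<Otimes>\<^sub>M lborel)"
      by measurable
    then show ?thesis 
      unfolding set_lebesgue_integral_def indicator_def atLeastAtMost_iff
      by (intro lborel.borel_measurable_lebesgue_integral) (simp add: case_prod_unfold)
  qed
  \<comment> \<open>The null set in \<open>dir_deriv\<close> depends on \<open>s\<close>. Exchanging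
    the quantifiers makes this a statement about almost every line.\<close>
  have "AE s in lborel. AE x in lborel. s \<ge> 0 \<longrightarrow> p (x + s *\<^sub>R e) - p x = (LINT r:{0..s}|lborel. g (x + r *\<^sub>R e))"
  proof (rule AE_I2)
    fix s show "AE x in lborel. s \<ge> 0 \<longrightarrow> p (x + s *\<^sub>R e) - p x = (LINT r:{0..s}|lborel. g (x + r *\<^sub>R e))"
      using pg unfolding dir_deriv_def by (cases "s \<ge> 0") auto
  qed
  then have "AE x in lborel. AE s in lborel. s \<ge> 0 \<longrightarrow> p (x + s *\<^sub>R e) - p x = (LINT r:{0..s}|lborel. g (x + r *\<^sub>R e))"
    by (rule iffD2[OF lborel_pair.AE_commute, rotated]) measurable
  moreover have "AE x in lborel. set_integrable lborel {0..t} (\<lambda>s. g (x + s *\<^sub>R e)) \<and>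
      p (x + t *\<^sub>R e) - p x = (LINT s:{0..t}|lborel. g (x + s *\<^sub>R e))"
    using pg t unfolding dir_deriv_def by blast
  ultimately show "AE x in lborel. set_integrable lborel {0..t} (\<lambda>s. F' (p (x + s *\<^sub>R e)) * g (x + s *\<^sub>R e)) \<and>
      F (p (x + t *\<^sub>R e)) - F (p x) = (LINT s:{0..t}|lborel. F' (p (x + s *\<^sub>R e)) * g (x + s *\<^sub>R e))"
  proof eventually_elim
    case (elim x)
    define P where "P = (\<lambda>s. p x + (LINT r:{0..s}|lborel. g (x + r *\<^sub>R e)))"
    have F'm[measurable]: "F' \<in> borel_measurable borel" by (rule borel_measurable_continuous_onI[OF F'])
    have ae: "AE s in lborel. s \<ge> 0 \<longrightarrow> p (x + s *\<^sub>R e) = P s" using elim(1) by (auto simp: P_def algebra_simps)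
    have P0: "P 0 = p x"
    proof -
      have "(LINT r:{0::real..0}|lborel. g (x + r *\<^sub>R e)) = 0"
        unfolding set_lebesgue_integral_def
        by (rule integral_eq_zero_AE) (use AE_lborel_singleton[of "0::real"] in \<open>auto elim!: eventually_mono\<close>)
      then show ?thesis by (simp add: P_def)
    qed
    have Pt: "P t = p (x + t *\<^sub>R e)" using elim(2) by (simp add: P_def algebra_simps)
    note cr = chain_rule_indefinite_integral[OF t conjunct1[OF elim(2)], of P "p x" F F', OF _ F F']
    have Pm[measurable]: "P \<in> borel_measurable borel"
      unfolding P_def set_lebesgue_integral_def indicator_def atLeastAtMost_iff by measurable
    have ae2: "AE s in lborel. indicator {0..t} s *\<^sub>R (F' (P s) * g (x + s *\<^sub>R e)) = indicator {0..t} s *\<^sub>R (F' (p (x + s *\<^sub>R e)) * g (x + s *\<^sub>R e))"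
      using ae by eventually_elim (auto simp: indicator_def)
    have "set_integrable lborel {0..t} (\<lambda>s. F' (p (x + s *\<^sub>R e)) * g (x + s *\<^sub>R e))"
      using cr(1) unfolding set_integrable_def P_def[symmetric]
      by (subst integrable_cong_AE[OF _ _ AE_symmetric[OF ae2]]) (auto simp: P_def)
    moreover have "F (P t) - F (P 0) = (LINT s:{0..t}|lborel. F' (p (x + s *\<^sub>R e)) * g (x + s *\<^sub>R e))"
      unfolding cr(2)[OF P_def[THEN fun_cong]] set_lebesgue_integral_def
      by (rule integral_cong_AE[OF _ _ ae2]) measurable
    ultimately show ?case by (simp add: Pt P0)
  qed
qed

section \<open>Periodic functions on the circle and on the cylinder\<close>

lemma integral_eq_of_nn_integral_eq:
  fixes f :: "'a \<Rightarrow> real" and g :: "'b \<Rightarrow> real"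
  assumes [measurable]: "f \<in> borel_measurable M" "g \<in> borel_measurable N"
    and p: "(\<integral>\<^sup>+x. ennreal (f x) \<partial>M) = (\<integral>\<^sup>+x. ennreal (g x) \<partial>N)"
    and n: "(\<integral>\<^sup>+x. ennreal (- f x) \<partial>M) = (\<integral>\<^sup>+x. ennreal (- g x) \<partial>N)"
  shows "integrable M f \<longleftrightarrow> integrable N g" "(\<integral>x. f x \<partial>M) = (\<integral>x. g x \<partial>N)"
proof -
  show i: "integrable M f \<longleftrightarrow> integrable N g"
    unfolding real_integrable_def by (simp add: p n)
  show "(\<integral>x. f x \<partial>M) = (\<integral>x. g x \<partial>N)"
    using i by (cases "integrable M f") (auto simp: real_lebesgue_integral_def p n not_integrable_integral_eq)
qed

lemma nn_integral_periodic_shift: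
  fixes f :: "real \<Rightarrow> ennreal"
  assumes [measurable]: "f \<in> borel_measurable borel" and per: "\<And>x. f (x + 1) = f x"
  shows "(\<integral>\<^sup>+x\<in>{0..<1}. f (x + c) \<partial>lborel) = (\<integral>\<^sup>+x\<in>{0..<1}. f x \<partial>lborel)"
proof -
  have pern: "f (x + real n) = f x" for x n
  proof (induction n)
    case (Suc n) then show ?case using per[of "x + real n"] by (simp add: add.assoc add.commute[of 1])
  qed simp
  have peri: "f (x + of_int k) = f x" for x k
  proof (cases "k \<ge> 0")
    case True then show ?thesis using pern[of x "nat k"] by simp
  next
    case False then show ?thesis using pern[of "x + of_int k" "nat (- k)"] by simp
  qed
  \<comment> \<open>Only the fractional part of \<open>c\<close> matters. The piece of [r, 1 + r)
    beyond 1 is then moved back by one period.\<close>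
  define r where "r = frac c"
  have r: "0 \<le> r" "r < 1" by (auto simp: r_def frac_lt_1)
  have fr: "f (x + c) = f (x + r)" for x
    using peri[of "x + r" "\<lfloor>c\<rfloor>"] by (simp add: r_def frac_def)
  have "(\<integral>\<^sup>+x\<in>{0..<1}. f (x + c) \<partial>lborel) = (\<integral>\<^sup>+x. f ((x + r)) * indicator {r..<1+r} (x + r) \<partial>lborel)"
    unfolding fr by (intro nn_integral_cong) (auto simp: indicator_def)
  also have "\<dots> = (\<integral>\<^sup>+x. f x * indicator {r..<1+r} x \<partial>lborel)"
    by (rule nn_integral_shift) measurable
  also have "\<dots> = (\<integral>\<^sup>+x. f x * indicator {r..<1} x + f x * indicator {1..<1+r} x \<partial>lborel)"
    using r by (intro nn_integral_cong) (auto simp: indicator_def)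
  also have "\<dots> = (\<integral>\<^sup>+x. f x * indicator {r..<1} x \<partial>lborel) + (\<integral>\<^sup>+x. f x * indicator {1..<1+r} x \<partial>lborel)"
    by (rule nn_integral_add) measurable
  also have "(\<integral>\<^sup>+x. f x * indicator {1..<1+r} x \<partial>lborel) = (\<integral>\<^sup>+x. f (x + 1) * indicator {1..<1+r} (x + 1) \<partial>lborel)"
    by (rule nn_integral_shift[symmetric]) measurable
  also have "\<dots> = (\<integral>\<^sup>+x. f x * indicator {0..<r} x \<partial>lborel)"
    by (intro nn_integral_cong) (auto simp: indicator_def per)
  also have "(\<integral>\<^sup>+x. f x * indicator {r..<1} x \<partial>lborel) + (\<integral>\<^sup>+x. f x * indicator {0..<r} x \<partial>lborel)
      = (\<integral>\<^sup>+x. f x * indicator {r..<1} x + f x * indicator {0..<r} x \<partial>lborel)"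
    by (rule nn_integral_add[symmetric]) measurable
  also have "\<dots> = (\<integral>\<^sup>+x\<in>{0..<1}. f x \<partial>lborel)"
    using r by (intro nn_integral_cong) (auto simp: indicator_def)
  finally show ?thesis .
qed

lemma set_integral_periodic_shift:
  fixes f :: "real \<Rightarrow> real"
  assumes [measurable]: "f \<in> borel_measurable borel" and per: "\<And>x. f (x + 1) = f x"
  shows "set_integrable lborel {0..1} (\<lambda>x. f (x + c)) \<longleftrightarrow> set_integrable lborel {0..1} f"
    "(LINT x:{0..1}|lborel. f (x + c)) = (LINT x:{0..1}|lborel. f x)"
proof -
  have ae: "AE x in lborel. x \<noteq> (1::real)" by (rule AE_lborel_singleton)
  \<comment> \<open>Means over a period use the closed interval, the tiling argument the half-open
    one; they differ by the null set {1}. Taking \<open>a\<close> as 1 and as -1 reaches the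
    positive and the negative part.\<close>
  have *: "(\<integral>\<^sup>+x. ennreal (a * (indicator {0..1} x *\<^sub>R h x)) \<partial>lborel) = (\<integral>\<^sup>+x\<in>{0..<1}. ennreal (a * h x) \<partial>lborel)" for h :: "real \<Rightarrow> real" and a
    by (rule nn_integral_cong_AE) (use ae in \<open>eventually_elim, auto simp: indicator_def\<close>)
  have "(\<integral>\<^sup>+x. ennreal (a * (indicator {0..1} x *\<^sub>R f (x + c))) \<partial>lborel) = (\<integral>\<^sup>+x. ennreal (a * (indicator {0..1} x *\<^sub>R f x)) \<partial>lborel)" for a
    unfolding * by (rule nn_integral_periodic_shift) (auto simp: per)
  from this[of 1] this[of "-1"]
  have "(\<integral>\<^sup>+x. ennreal (indicator {0..1} x *\<^sub>R f (x + c)) \<partial>lborel) = (\<integral>\<^sup>+x. ennreal (indicator {0..1} x *\<^sub>R f x) \<partial>lborel)"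
    "(\<integral>\<^sup>+x. ennreal (- (indicator {0..1} x *\<^sub>R f (x + c))) \<partial>lborel) = (\<integral>\<^sup>+x. ennreal (- (indicator {0..1} x *\<^sub>R f x)) \<partial>lborel)"
    by simp_all
  from integral_eq_of_nn_integral_eq[OF _ _ this]
  show "set_integrable lborel {0..1} (\<lambda>x. f (x + c)) \<longleftrightarrow> set_integrable lborel {0..1} f"
    "(LINT x:{0..1}|lborel. f (x + c)) = (LINT x:{0..1}|lborel. f x)"
    unfolding set_integrable_def set_lebesgue_integral_def by auto
qed

text \<open>The half-open strip contains one point of each orbit of the period, so its integer
  translates tile the plane; the closed \<open>cell\<close> differs from it by a null set. Making it
  a measure of its own gives direct access to Fubini on the cylinder.\<close>

definition cellm :: "R2 measure" where
  "cellm = density lborel (indicator (UNIV \<times> {0..<1}))"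

lemma sets_cellm[measurable_cong, simp]: "sets cellm = sets borel" by (simp add: cellm_def)
lemma space_cellm[simp]: "space cellm = UNIV" by (simp add: cellm_def)
lemma strip_sets[measurable, simp]: "(UNIV :: real set) \<times> {0..<1::real} \<in> sets borel"
  by (simp add: borel_prod[symmetric])

lemma nn_integral_cellm:
  "f \<in> borel_measurable borel \<Longrightarrow> (\<integral>\<^sup>+x. f x \<partial>cellm) = (\<integral>\<^sup>+x\<in>UNIV \<times> {0..<1}. f x \<partial>lborel)"
  unfolding cellm_def by (simp add: nn_integral_density mult.commute)

lemma nn_integral_cellm_iterated:
  assumes [measurable]: "f \<in> borel_measurable borel"
  shows "(\<integral>\<^sup>+x. f x \<partial>cellm) = (\<integral>\<^sup>+x1. (\<integral>\<^sup>+x2\<in>{0..<1}. f (x1, x2) \<partial>lborel) \<partial>lborel)"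
proof -
  have [measurable]: "f \<in> borel_measurable (borel \<Otimes>\<^sub>M borel)" by (simp add: borel_prod)
  have [measurable]: "(UNIV :: real set) \<times> {0..<1::real} \<in> sets (borel \<Otimes>\<^sub>M borel)" by simp
  have "(\<integral>\<^sup>+x. f x \<partial>cellm) = (\<integral>\<^sup>+x. f x * indicator (UNIV \<times> {0..<1}) x \<partial>(lborel \<Otimes>\<^sub>M lborel))"
    by (simp add: nn_integral_cellm lborel_prod)
  also have "\<dots> = (\<integral>\<^sup>+x1. (\<integral>\<^sup>+x2. f (x1, x2) * indicator (UNIV \<times> {0..<1}) (x1, x2) \<partial>lborel) \<partial>lborel)"
    by (rule lborel.nn_integral_fst[symmetric]) measurable
  finally show ?thesis by (simp add: indicator_def)
qed

lemma AE_snd_neq: "AE x in lborel. snd (x :: R2) \<noteq> c"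
proof -
  have "AE x in lborel \<Otimes>\<^sub>M lborel. snd (x :: R2) \<noteq> c"
  proof (rule lborel_pair.AE_pair_measure)
    show "{x \<in> space (lborel \<Otimes>\<^sub>M lborel). snd (x::R2) \<noteq> c} \<in> sets (lborel \<Otimes>\<^sub>M lborel)" by measurable
  qed (simp add: AE_lborel_singleton)
  then show ?thesis by (simp only: lborel_prod)
qed

lemma nn_integral_cell:
  assumes [measurable]: "f \<in> borel_measurable borel"
  shows "(\<integral>\<^sup>+x\<in>cell. f x \<partial>lborel) = (\<integral>\<^sup>+x. f x \<partial>cellm)"
  unfolding nn_integral_cellm[OF assms]
  by (rule nn_integral_cong_AE) (use AE_snd_neq[of 1] in \<open>eventually_elim, auto simp: indicator_def cell_def\<close>)

lemma nn_integral_cellm_shift: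
  assumes [measurable]: "f \<in> borel_measurable borel" and per: "periodic2 f"
  shows "(\<integral>\<^sup>+x. f (x + c) \<partial>cellm) = (\<integral>\<^sup>+x. f x \<partial>cellm)"
proof -
  have [measurable]: "f \<in> borel_measurable (borel \<Otimes>\<^sub>M borel)" by (simp add: borel_prod)
  obtain c1 c2 where c: "c = (c1, c2)" by force
  have "(\<integral>\<^sup>+x. f (x + c) \<partial>cellm) = (\<integral>\<^sup>+x1. (\<integral>\<^sup>+x2\<in>{0..<1}. f (x1 + c1, x2 + c2) \<partial>lborel) \<partial>lborel)"
    by (simp add: nn_integral_cellm_iterated c)
  also have "\<dots> = (\<integral>\<^sup>+x1. (\<integral>\<^sup>+x2\<in>{0..<1}. f (x1 + c1, x2) \<partial>lborel) \<partial>lborel)"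
    using per by (intro nn_integral_cong nn_integral_periodic_shift) (auto simp: periodic2_def)
  also have "\<dots> = (\<integral>\<^sup>+x1. (\<integral>\<^sup>+x2\<in>{0..<1}. f (x1, x2) \<partial>lborel) \<partial>lborel)"
    by (rule nn_integral_shift[of "\<lambda>x1. \<integral>\<^sup>+x2\<in>{0..<1}. f (x1, x2) \<partial>lborel"]) measurable
  finally show ?thesis by (simp add: nn_integral_cellm_iterated)
qed

lemma integral_cellm_shift:
  fixes f :: "R2 \<Rightarrow> real"
  assumes [measurable]: "f \<in> borel_measurable borel" and per: "periodic2 f"
  shows "integrable cellm (\<lambda>x. f (x + c)) \<longleftrightarrow> integrable cellm f"
    "(\<integral>x. f (x + c) \<partial>cellm) = (\<integral>x. f x \<partial>cellm)"
proof -
  have 1: "(\<integral>\<^sup>+x. ennreal (f (x + c)) \<partial>cellm) = (\<integral>\<^sup>+x. ennreal (f x) \<partial>cellm)"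
    "(\<integral>\<^sup>+x. ennreal (- f (x + c)) \<partial>cellm) = (\<integral>\<^sup>+x. ennreal (- f x) \<partial>cellm)"
    using per by (auto intro!: nn_integral_cellm_shift[of "\<lambda>x. ennreal (f x)"] nn_integral_cellm_shift[of "\<lambda>x. ennreal (- f x)"] simp: periodic2_def)
  show "integrable cellm (\<lambda>x. f (x + c)) \<longleftrightarrow> integrable cellm f" "(\<integral>x. f (x + c) \<partial>cellm) = (\<integral>x. f x \<partial>cellm)"
    by (rule integral_eq_of_nn_integral_eq[OF _ _ 1]; measurable)+
qed

lemma sigma_finite_cellm: "sigma_finite_measure cellm"
  unfolding cellm_def
  by (subst sigma_finite_measure.sigma_finite_iff_density_finite[OF lborel.sigma_finite_measure_axioms]) (auto simp: indicator_def)

interpretation cellm: sigma_finite_measure cellm by (rule sigma_finite_cellm)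
interpretation lborel_cellm: pair_sigma_finite "lborel :: real measure" cellm ..

lemma AE_cellm: "AE x in lborel. P x \<Longrightarrow> AE x in cellm. P x"
  unfolding cellm_def by (subst AE_density) (auto elim: eventually_mono)

lemma AE_cellm_periodic:
  assumes "AE x in cellm. P x" and per: "periodic2 P"
  shows "AE x in lborel. P x"
proof -
  have pern: "P (x1, x2 + real n) = P (x1, x2)" for x1 x2 n
  proof (induction n)
    case (Suc n) then show ?case using per[unfolded periodic2_def, rule_format, of x1 "x2 + real n"] by (simp add: add.assoc add.commute[of 1])
  qed simp
  have peri: "P (x1, x2 + of_int k) = P (x1, x2)" for x1 x2 k
  proof (cases "k \<ge> 0")
    case True then show ?thesis using pern[of x1 x2 "nat k"] by simp
  next
    case False then show ?thesis using pern[of x1 "x2 + of_int k" "nat (- k)"] by simp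
  qed
  have "AE x in lborel. x \<in> UNIV \<times> {0..<1} \<longrightarrow> P x"
    using assms(1) unfolding cellm_def by (subst (asm) AE_density) (auto simp: indicator_def elim: eventually_mono)
  then have "AE x in lborel. \<forall>k::int. x + (0, of_int k) \<in> UNIV \<times> {0..<1} \<longrightarrow> P (x + (0, of_int k))"
    by (subst AE_all_countable) (intro allI AE_shift)
  then show ?thesis
  proof eventually_elim
    case (elim x)
    obtain x1 x2 where x: "x = (x1, x2)" by force
    show ?case using elim[rule_format, of "- \<lfloor>x2\<rfloor>"] peri[of x1 x2 "- \<lfloor>x2\<rfloor>"] frac_lt_1[of x2] frac_ge_0[of x2]
      by (simp add: x frac_def)
  qed
qed

section \<open>Square integrable functions\<close>

lemma square_integrable_mult:
  fixes f g :: "'a \<Rightarrow> real"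
  assumes [measurable]: "f \<in> borel_measurable M" "g \<in> borel_measurable M"
    and f: "integrable M (\<lambda>x. (f x)\<^sup>2)" and g: "integrable M (\<lambda>x. (g x)\<^sup>2)"
  shows "integrable M (\<lambda>x. f x * g x)"
proof (rule Bochner_Integration.integrable_bound[OF Bochner_Integration.integrable_add[OF f g]])
  show "AE x in M. norm (f x * g x) \<le> norm ((f x)\<^sup>2 + (g x)\<^sup>2)"
  proof (rule AE_I2)
    fix x
    have "0 \<le> (\<bar>f x\<bar> - \<bar>g x\<bar>)\<^sup>2" by simp
    then have "2 * (\<bar>f x\<bar> * \<bar>g x\<bar>) \<le> (f x)\<^sup>2 + (g x)\<^sup>2" by (simp add: power2_diff)
    moreover have "0 \<le> \<bar>f x\<bar> * \<bar>g x\<bar>" by simp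
    ultimately show "norm (f x * g x) \<le> norm ((f x)\<^sup>2 + (g x)\<^sup>2)" unfolding real_norm_def abs_mult by linarith
  qed
qed measurable

lemma square_integrable_add:
  fixes f g :: "'a \<Rightarrow> real"
  assumes [measurable]: "f \<in> borel_measurable M" "g \<in> borel_measurable M"
    and f: "integrable M (\<lambda>x. (f x)\<^sup>2)" and g: "integrable M (\<lambda>x. (g x)\<^sup>2)"
  shows "integrable M (\<lambda>x. (f x + g x)\<^sup>2)"
  unfolding power2_sum
  using f g integrable_mult_right[OF square_integrable_mult[OF assms], of 2] by (simp add: mult.assoc)

lemma integral_Cauchy_Schwarz:
  fixes f g :: "'a \<Rightarrow> real"
  assumes [measurable]: "f \<in> borel_measurable M" "g \<in> borel_measurable M"
    and f: "integrable M (\<lambda>x. (f x)\<^sup>2)" and g: "integrable M (\<lambda>x. (g x)\<^sup>2)"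
  shows "(\<integral>x. f x * g x \<partial>M)\<^sup>2 \<le> (\<integral>x. (f x)\<^sup>2 \<partial>M) * (\<integral>x. (g x)\<^sup>2 \<partial>M)"
proof -
  note fg = square_integrable_mult[OF assms]
  define a b c where "a = (\<integral>x. (g x)\<^sup>2 \<partial>M)" and "b = (\<integral>x. f x * g x \<partial>M)" and "c = (\<integral>x. (f x)\<^sup>2 \<partial>M)"
  have q: "0 \<le> c + 2 * r * b + r\<^sup>2 * a" for r
  proof -
    have "0 \<le> (\<integral>x. (f x + r * g x)\<^sup>2 \<partial>M)" by simp
    also have "\<dots> = (\<integral>x. (f x)\<^sup>2 + (2 * r) * (f x * g x) + r\<^sup>2 * (g x)\<^sup>2 \<partial>M)"
      by (simp add: power2_sum power_mult_distrib algebra_simps)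
    also have "\<dots> = c + 2 * r * b + r\<^sup>2 * a"
      using f g fg by (simp add: a_def b_def c_def)
    finally show ?thesis .
  qed
  have a: "0 \<le> a" and c: "0 \<le> c" by (simp_all add: a_def c_def)
  have "b\<^sup>2 \<le> c * a"
  proof (cases "a = 0")
    case True
    have "b = 0"
    proof (rule ccontr)
      assume "b \<noteq> 0"
      \<comment> \<open>This value of \<open>r\<close> makes c + 2 r b equal to -1.\<close>
      then show False using q[of "- (c + 1) / (2 * b)"] True c by (simp add: field_simps)
    qed
    then show ?thesis using a c by simp
  next
    case False
    then have "0 \<le> (c + 2 * (- b / a) * b + (- b / a)\<^sup>2 * a) * a" using mult_nonneg_nonneg[OF q[of "- b / a"] a] by simp
    also have "\<dots> = c * a - b\<^sup>2" using False by (simp add: field_simps power2_eq_square)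
    finally show ?thesis by simp
  qed
  then show ?thesis by (simp add: a_def b_def c_def)
qed

text \<open>Cauchy-Schwarz against the indicator of the interval. The right-hand side may be
  infinite, so that the estimate can be integrated over base points before finiteness is
  known.\<close>

lemma Jensen_interval:
  fixes g :: "real \<Rightarrow> real"
  assumes t: "t > 0" and gi: "set_integrable lborel {0..t} g"
  shows "ennreal ((LINT s:{0..t}|lborel. g s)\<^sup>2) \<le> ennreal t * (\<integral>\<^sup>+s\<in>{0..t}. ennreal ((g s)\<^sup>2) \<partial>lborel)"
proof -
  define G where "G = (\<lambda>s. indicator {0..t} s *\<^sub>R g s)"
  have [measurable]: "G \<in> borel_measurable lborel"
    using gi by (auto simp: G_def set_integrable_def)
  have nn: "(\<integral>\<^sup>+s\<in>{0..t}. ennreal ((g s)\<^sup>2) \<partial>lborel) = (\<integral>\<^sup>+s. ennreal ((G s)\<^sup>2) \<partial>lborel)"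
    by (intro nn_integral_cong) (auto simp: G_def indicator_def)
  show ?thesis
  proof (cases "(\<integral>\<^sup>+s. ennreal ((G s)\<^sup>2) \<partial>lborel) = \<infinity>")
    case True
    then show ?thesis using t unfolding nn by (simp add: ennreal_mult_eq_top_iff ennreal_top_mult)
  next
    case False
    then have i: "integrable lborel (\<lambda>s. (G s)\<^sup>2)"
      by (intro integrableI_bounded) (auto simp: less_top)
    have i1: "integrable lborel (\<lambda>s. (indicat_real {0..t} s)\<^sup>2)"
    proof -
      have "(\<lambda>s. (indicat_real {0..t} s)\<^sup>2) = indicat_real {0..t}" by (auto simp: indicator_def)
      then show ?thesis by (simp add: emeasure_lborel_Icc_eq)
    qed
    have "(\<integral>s. indicat_real {0..t} s * G s \<partial>lborel)\<^sup>2 \<le> (\<integral>s. (indicat_real {0..t} s)\<^sup>2 \<partial>lborel) * (\<integral>s. (G s)\<^sup>2 \<partial>lborel)"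
      by (rule integral_Cauchy_Schwarz[OF _ _ i1 i]) measurable
    moreover have "(\<lambda>s. indicat_real {0..t} s * G s) = G" by (auto simp: G_def indicator_def)
    moreover have "(\<integral>s. (indicat_real {0..t} s)\<^sup>2 \<partial>lborel) = t"
    proof -
      have "(\<lambda>s. (indicat_real {0..t} s)\<^sup>2) = indicat_real {0..t}" by (auto simp: indicator_def)
      then show ?thesis using t by simp
    qed
    ultimately have "(LINT s:{0..t}|lborel. g s)\<^sup>2 \<le> t * (\<integral>s. (G s)\<^sup>2 \<partial>lborel)"
      by (simp add: set_lebesgue_integral_def G_def)
    then have "ennreal ((LINT s:{0..t}|lborel. g s)\<^sup>2) \<le> ennreal (t * (\<integral>s. (G s)\<^sup>2 \<partial>lborel))"
      by (rule ennreal_leI)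
    also have "\<dots> = ennreal t * (\<integral>\<^sup>+s. ennreal ((G s)\<^sup>2) \<partial>lborel)"
      using t i by (simp add: ennreal_mult nn_integral_eq_integral)
    finally show ?thesis unfolding nn .
  qed
qed

text \<open>First truncate \<open>f\<close> in range and in space, with convergence by domination.
  Then replace \<open>f\<close> inside the truncation by continuous functions converging to it
  almost everywhere: the truncation is bounded with bounded support, so this limit is dominated
  too.\<close>

lemma continuous_dense_L2:
  fixes f :: "'a::euclidean_space \<Rightarrow> real"
  assumes [measurable]: "f \<in> borel_measurable borel" and fi: "integrable lborel (\<lambda>x. (f x)\<^sup>2)" and e: "\<epsilon> > 0"
  obtains g R where "continuous_on UNIV g" "\<And>x. norm x > R \<Longrightarrow> g x = 0"
    "(\<integral>\<^sup>+x. ennreal ((f x - g x)\<^sup>2) \<partial>lborel) < ennreal \<epsilon>"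
proof -
  define T where "T = (\<lambda>(n::nat) (y::real). max (- real n) (min (real n) y))"
  define cut where "cut = (\<lambda>(n::nat) (x::'a). max 0 (min 1 (real n + 1 - norm x)))"
  have cutm[measurable]: "cut n \<in> borel_measurable borel" for n unfolding cut_def by measurable
  have Tm[measurable]: "T n \<in> borel_measurable borel" for n unfolding T_def by measurable
  have cut01: "0 \<le> cut n x" "cut n x \<le> 1" for n x by (auto simp: cut_def)
  have Tabs: "\<bar>T n y\<bar> \<le> \<bar>y\<bar>" "\<bar>T n y\<bar> \<le> real n" for n y by (auto simp: T_def)
  have "(\<lambda>n. \<integral>x. (f x - cut n x * T n (f x))\<^sup>2 \<partial>lborel) \<longlonglongrightarrow> (\<integral>x. 0 \<partial>(lborel::'a measure))"
  proof (rule integral_dominated_convergence[where w="\<lambda>x. 4 * (f x)\<^sup>2"])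
    show "integrable lborel (\<lambda>x. 4 * (f x)\<^sup>2)" using fi by simp
    show "AE x in lborel. (\<lambda>n. (f x - cut n x * T n (f x))\<^sup>2) \<longlonglongrightarrow> 0"
    proof (rule AE_I2)
      fix x
      obtain m :: nat where m: "norm x + \<bar>f x\<bar> \<le> real m" using real_arch_simple by blast
      have "eventually (\<lambda>n. (f x - cut n x * T n (f x))\<^sup>2 = 0) sequentially"
        using eventually_ge_at_top[of m]
      proof eventually_elim
        case (elim n)
        then have "real m \<le> real n" by simp
        then have "norm x \<le> real n" "\<bar>f x\<bar> \<le> real n" using m norm_ge_zero[of x] abs_ge_zero[of "f x"] by linarith+
        then show ?case by (auto simp: cut_def T_def)
      qed
      then show "(\<lambda>n. (f x - cut n x * T n (f x))\<^sup>2) \<longlonglongrightarrow> 0" by (rule tendsto_eventually)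
    qed
    show "AE x in lborel. norm ((f x - cut n x * T n (f x))\<^sup>2) \<le> 4 * (f x)\<^sup>2" for n
    proof (rule AE_I2)
      fix x
      have "\<bar>cut n x * T n (f x)\<bar> \<le> \<bar>f x\<bar>"
        using cut01[of n x] Tabs(1)[of n "f x"] by (simp add: abs_mult mult_left_le_one_le order_trans[OF mult_left_le_one_le])
      then have "\<bar>f x - cut n x * T n (f x)\<bar> \<le> 2 * \<bar>f x\<bar>" by linarith
      then have "(f x - cut n x * T n (f x))\<^sup>2 \<le> (2 * \<bar>f x\<bar>)\<^sup>2" using abs_le_square_iff by fastforce
      then show "norm ((f x - cut n x * T n (f x))\<^sup>2) \<le> 4 * (f x)\<^sup>2" by (simp add: power_mult_distrib)
    qed
  qed measurable
  then have "\<forall>\<^sub>F n in sequentially. (\<integral>x. (f x - cut n x * T n (f x))\<^sup>2 \<partial>lborel) < \<epsilon> / 4"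
    by (rule order_tendstoD(2)) (use e in simp)
  then obtain n where n: "(\<integral>x. (f x - cut n x * T n (f x))\<^sup>2 \<partial>lborel) < \<epsilon> / 4"
    by (auto simp: eventually_sequentially)
  \<comment> \<open>Measurability in the sense of gauge integration supplies continuous functions
    converging to \<open>f\<close> off a negligible set.\<close>
  have "f measurable_on UNIV"
    by (rule lebesgue_measurable_imp_measurable_on_real) (auto intro: measurable_completion)
  then obtain N G where N: "negligible N" and G: "\<And>k. continuous_on UNIV (G k)" "\<And>x. x \<notin> N \<Longrightarrow> (\<lambda>k. G k x) \<longlonglongrightarrow> f x"
    unfolding measurable_on_def by auto
  have Gm[measurable]: "G k \<in> borel_measurable borel" for k using G(1) by (rule borel_measurable_continuous_onI)
  have Nae: "AE x in lborel. x \<notin> N"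
  proof -
    have "AE x in lebesgue. x \<notin> N" using N by (intro AE_not_in) (simp add: negligible_iff_null_sets)
    then show ?thesis by (simp add: AE_completion_iff)
  qed
  have ball: "emeasure lborel (cball (0::'a) (real n + 1)) < \<infinity>" using emeasure_bounded_finite[OF bounded_cball] by simp
  have "(\<lambda>k. \<integral>x. (cut n x * T n (f x) - cut n x * T n (G k x))\<^sup>2 \<partial>lborel) \<longlonglongrightarrow> (\<integral>x. 0 \<partial>(lborel::'a measure))"
  proof (rule integral_dominated_convergence[where w="\<lambda>x. (2 * real n)\<^sup>2 * indicator (cball 0 (real n + 1)) x"])
    show "integrable lborel (\<lambda>x. (2 * real n)\<^sup>2 * indicat_real (cball (0::'a) (real n + 1)) x)" using ball by simp
    show "AE x in lborel. (\<lambda>k. (cut n x * T n (f x) - cut n x * T n (G k x))\<^sup>2) \<longlonglongrightarrow> 0"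
      using Nae
    proof eventually_elim
      case (elim x)
      have "(\<lambda>k. (cut n x * T n (f x) - cut n x * T n (G k x))\<^sup>2) \<longlonglongrightarrow> (cut n x * T n (f x) - cut n x * T n (f x))\<^sup>2"
        unfolding T_def by (intro tendsto_intros G(2)[OF elim])
      then show ?case by simp
    qed
    show "AE x in lborel. norm ((cut n x * T n (f x) - cut n x * T n (G k x))\<^sup>2) \<le> (2 * real n)\<^sup>2 * indicator (cball 0 (real n + 1)) x" for k
    proof (rule AE_I2)
      fix x :: 'a
      show "norm ((cut n x * T n (f x) - cut n x * T n (G k x))\<^sup>2) \<le> (2 * real n)\<^sup>2 * indicator (cball 0 (real n + 1)) x"
      proof (cases "norm x \<le> real n + 1")
        case True
        have "\<bar>cut n x * T n y\<bar> \<le> real n" for y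
          using cut01[of n x] Tabs(2)[of n y] by (simp add: abs_mult mult_left_le_one_le order_trans[OF mult_left_le_one_le])
        from this[of "f x"] this[of "G k x"]
        have "\<bar>cut n x * T n (f x) - cut n x * T n (G k x)\<bar> \<le> \<bar>2 * real n\<bar>" by linarith
        then have "(cut n x * T n (f x) - cut n x * T n (G k x))\<^sup>2 \<le> (2 * real n)\<^sup>2" by (simp only: abs_le_square_iff)
        then show ?thesis using True by simp
      next
        case False then show ?thesis by (simp add: cut_def)
      qed
    qed
  qed measurable
  then have "\<forall>\<^sub>F k in sequentially. (\<integral>x. (cut n x * T n (f x) - cut n x * T n (G k x))\<^sup>2 \<partial>lborel) < \<epsilon> / 4"
    by (rule order_tendstoD(2)) (use e in simp)
  then obtain k where k: "(\<integral>x. (cut n x * T n (f x) - cut n x * T n (G k x))\<^sup>2 \<partial>lborel) < \<epsilon> / 4"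
    by (auto simp: eventually_sequentially)
  show thesis
  proof (rule that)
    show "continuous_on UNIV (\<lambda>x. cut n x * T n (G k x))"
      unfolding cut_def T_def by (intro continuous_intros G(1))
    show "cut n x * T n (G k x) = 0" if "norm x > real n + 1" for x using that by (simp add: cut_def)
    have cutT: "\<bar>cut n x * T n y\<bar> \<le> real n * indicator (cball 0 (real n + 1)) x" for x y
      using cut01[of n x] Tabs(2)[of n y]
      by (cases "norm x \<le> real n + 1") (auto simp: abs_mult cut_def intro: order_trans[OF mult_left_le_one_le])
    have i1: "integrable lborel (\<lambda>x. (cut n x * T n (H x))\<^sup>2)" if [measurable]: "H \<in> borel_measurable borel" for H
    proof (rule Bochner_Integration.integrable_bound[where f="\<lambda>x. (real n)\<^sup>2 * indicator (cball 0 (real n + 1)) x"])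
      show "AE x in lborel. norm ((cut n x * T n (H x))\<^sup>2) \<le> norm ((real n)\<^sup>2 * indicat_real (cball 0 (real n + 1)) x)"
      proof (rule AE_I2)
        fix x
        have "(cut n x * T n (H x))\<^sup>2 \<le> (real n * indicator (cball 0 (real n + 1)) x)\<^sup>2"
          using cutT[of x "H x"] by (metis abs_ge_zero abs_of_nonneg power2_abs power_mono)
        then show "norm ((cut n x * T n (H x))\<^sup>2) \<le> norm ((real n)\<^sup>2 * indicat_real (cball 0 (real n + 1)) x)"
          by (cases "norm x \<le> real n + 1") (simp_all add: power_mult_distrib)
      qed
    qed (use ball in auto)
    have I1: "integrable lborel (\<lambda>x. (f x - cut n x * T n (f x))\<^sup>2)"
      using square_integrable_add[of f lborel "\<lambda>x. - (cut n x * T n (f x))"] fi i1[of f] by simp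
    have I2: "integrable lborel (\<lambda>x. (cut n x * T n (f x) - cut n x * T n (G k x))\<^sup>2)"
      using square_integrable_add[of "\<lambda>x. cut n x * T n (f x)" lborel "\<lambda>x. - (cut n x * T n (G k x))"] i1[of "G k"] i1[of f] by simp
    have I3: "integrable lborel (\<lambda>x. (f x - cut n x * T n (G k x))\<^sup>2)"
      using square_integrable_add[of f lborel "\<lambda>x. - (cut n x * T n (G k x))"] fi i1[of "G k"] by simp
    have le: "(f x - cut n x * T n (G k x))\<^sup>2 \<le> 2 * (f x - cut n x * T n (f x))\<^sup>2 + 2 * (cut n x * T n (f x) - cut n x * T n (G k x))\<^sup>2" for x
    proof -
      have "(a + b)\<^sup>2 \<le> 2 * a\<^sup>2 + 2 * b\<^sup>2" for a b :: real
        using zero_le_power2[of "a - b"] by (simp add: power2_sum power2_diff)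
      from this[of "f x - cut n x * T n (f x)" "cut n x * T n (f x) - cut n x * T n (G k x)"] show ?thesis by simp
    qed
    have "(\<integral>x. (f x - cut n x * T n (G k x))\<^sup>2 \<partial>lborel) \<le> (\<integral>x. 2 * (f x - cut n x * T n (f x))\<^sup>2 + 2 * (cut n x * T n (f x) - cut n x * T n (G k x))\<^sup>2 \<partial>lborel)"
      by (rule integral_mono[OF I3 _ le]) (intro Bochner_Integration.integrable_add integrable_mult_right I1 I2)
    also have "\<dots> = 2 * (\<integral>x. (f x - cut n x * T n (f x))\<^sup>2 \<partial>lborel) + 2 * (\<integral>x. (cut n x * T n (f x) - cut n x * T n (G k x))\<^sup>2 \<partial>lborel)"
      by (subst Bochner_Integration.integral_add) (intro integrable_mult_right I1 I2, intro integrable_mult_right I1 I2, simp)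
    also have "\<dots> < \<epsilon>" using n k by linarith
    finally show "(\<integral>\<^sup>+x. ennreal ((f x - cut n x * T n (G k x))\<^sup>2) \<partial>lborel) < ennreal \<epsilon>"
      using I3 e
      by (simp add: nn_integral_eq_integral ennreal_lessI)
  qed
qed

section \<open>Continuity of translations in mean square and difference quotients\<close>

lemma square_add3_le: "((a::real) + b + c)\<^sup>2 \<le> 3 * a\<^sup>2 + 3 * b\<^sup>2 + 3 * c\<^sup>2"
proof -
  have "0 \<le> (a - b)\<^sup>2 + (b - c)\<^sup>2 + (a - c)\<^sup>2" by simp
  then show ?thesis by (simp add: power2_eq_square algebra_simps)
qed

lemma L2_translation_continuous:
  fixes f :: "'a::euclidean_space \<Rightarrow> real"
  assumes [measurable]: "f \<in> borel_measurable borel" and fi: "integrable lborel (\<lambda>x. (f x)\<^sup>2)" and e: "\<epsilon> > 0"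
  shows "\<exists>\<delta>>0. \<forall>h. norm h < \<delta> \<longrightarrow> (\<integral>\<^sup>+x. ennreal ((f (x + h) - f x)\<^sup>2) \<partial>lborel) \<le> ennreal \<epsilon>"
proof -
  obtain g R where gc: "continuous_on UNIV g" and gR: "\<And>x. norm x > R \<Longrightarrow> g x = 0"
    and fg: "(\<integral>\<^sup>+x. ennreal ((f x - g x)\<^sup>2) \<partial>lborel) < ennreal (\<epsilon> / 9)"
    by (rule continuous_dense_L2[OF assms(1) fi, of "\<epsilon> / 9"]) (use e in auto)
  have [measurable]: "g \<in> borel_measurable borel" using gc by (rule borel_measurable_continuous_onI)
  define B where "B = cball (0::'a) (R + 1)"
  have [measurable]: "B \<in> sets borel" by (simp add: B_def)
  define V where "V = measure lborel B"
  have V: "V \<ge> 0" "emeasure lborel B = ennreal V"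
    using emeasure_bounded_finite[OF bounded_cball, of "0::'a" "R + 1"]
    by (auto simp: V_def B_def emeasure_eq_ennreal_measure)
  \<comment> \<open>By \<open>square_add3_le\<close> each of three errors enters with the factor 3,
    so each may be \<epsilon> / 9. This \<eta> achieves it for the middle one, a uniform bound times
    the volume of the ball \<open>B\<close>; the radius R + 1 leaves room for shifts of length below
    1.\<close>
  define \<eta> where "\<eta> = sqrt (\<epsilon> / (9 * (V + 1)))"
  have \<eta>: "\<eta> > 0" using e V by (simp add: \<eta>_def)
  have \<eta>2: "\<eta>\<^sup>2 * V \<le> \<epsilon> / 9" using e V by (simp add: \<eta>_def field_simps)
  have "uniformly_continuous_on (cball 0 (R + 2)) g"
    by (intro compact_uniformly_continuous continuous_on_subset[OF gc]) auto
  then obtain d where d: "d > 0" "\<And>x y. norm x \<le> R + 2 \<Longrightarrow> norm y \<le> R + 2 \<Longrightarrow> dist y x < d \<Longrightarrow> dist (g y) (g x) < \<eta>"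
    unfolding uniformly_continuous_on_def using \<eta> by (metis mem_cball_0)
  have "(\<integral>\<^sup>+x. ennreal ((f (x + h) - f x)\<^sup>2) \<partial>lborel) \<le> ennreal \<epsilon>" if h: "norm h < min 1 d" for h
  proof -
    have gb: "(g (x + h) - g x)\<^sup>2 \<le> \<eta>\<^sup>2 * indicator B x" for x
    proof (cases "norm x \<le> R + 1")
      case True
      then have "norm (x + h) \<le> R + 2" using h norm_triangle_ineq[of x h] by simp
      then have "\<bar>g (x + h) - g x\<bar> < \<eta>" using d(2)[of x "x + h"] True h by (simp add: dist_norm)
      then have "\<bar>g (x + h) - g x\<bar>\<^sup>2 \<le> \<eta>\<^sup>2" by (intro power_mono) auto
      then show ?thesis using True by (simp add: B_def)
    next
      case False
      then have "norm (x + h) > R" using h norm_triangle_ineq4[of "x + h" h] by simp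
      then show ?thesis using gR[of x] gR[of "x + h"] False by simp
    qed
    have "(\<integral>\<^sup>+x. ennreal ((f (x + h) - f x)\<^sup>2) \<partial>lborel) \<le>
        (\<integral>\<^sup>+x. 3 * ennreal ((f (x + h) - g (x + h))\<^sup>2) + 3 * ennreal (\<eta>\<^sup>2) * indicator B x + 3 * ennreal ((f x - g x)\<^sup>2) \<partial>lborel)"
    proof (rule nn_integral_mono)
      fix x
      have "(f (x + h) - f x)\<^sup>2 \<le> 3 * (f (x + h) - g (x + h))\<^sup>2 + 3 * (g (x + h) - g x)\<^sup>2 + 3 * (f x - g x)\<^sup>2"
        using square_add3_le[of "f (x + h) - g (x + h)" "g (x + h) - g x" "g x - f x"] by (simp add: power2_commute[of "g x"])
      also have "\<dots> \<le> 3 * (f (x + h) - g (x + h))\<^sup>2 + 3 * (\<eta>\<^sup>2 * indicator B x) + 3 * (f x - g x)\<^sup>2"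
        using gb[of x] by simp
      finally have "ennreal ((f (x + h) - f x)\<^sup>2) \<le> ennreal (3 * (f (x + h) - g (x + h))\<^sup>2 + 3 * (\<eta>\<^sup>2 * indicator B x) + 3 * (f x - g x)\<^sup>2)"
        by (rule ennreal_leI)
      also have "\<dots> = 3 * ennreal ((f (x + h) - g (x + h))\<^sup>2) + 3 * ennreal (\<eta>\<^sup>2) * indicator B x + 3 * ennreal ((f x - g x)\<^sup>2)"
        by (simp add: ennreal_plus ennreal_mult' mult.assoc indicator_def)
      finally show "ennreal ((f (x + h) - f x)\<^sup>2) \<le> 3 * ennreal ((f (x + h) - g (x + h))\<^sup>2) + 3 * ennreal (\<eta>\<^sup>2) * indicator B x + 3 * ennreal ((f x - g x)\<^sup>2)" .
    qed
    also have "\<dots> = 3 * (\<integral>\<^sup>+x. ennreal ((f (x + h) - g (x + h))\<^sup>2) \<partial>lborel) + 3 * ennreal (\<eta>\<^sup>2) * emeasure lborel B + 3 * (\<integral>\<^sup>+x. ennreal ((f x - g x)\<^sup>2) \<partial>lborel)"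
      by (simp add: nn_integral_add nn_integral_cmult nn_integral_cmult_indicator)
    also have "(\<integral>\<^sup>+x. ennreal ((f (x + h) - g (x + h))\<^sup>2) \<partial>lborel) = (\<integral>\<^sup>+x. ennreal ((f x - g x)\<^sup>2) \<partial>lborel)"
      by (rule nn_integral_shift[of "\<lambda>x. ennreal ((f x - g x)\<^sup>2)"]) measurable
    also have "3 * (\<integral>\<^sup>+x. ennreal ((f x - g x)\<^sup>2) \<partial>lborel) + 3 * ennreal (\<eta>\<^sup>2) * emeasure lborel B + 3 * (\<integral>\<^sup>+x. ennreal ((f x - g x)\<^sup>2) \<partial>lborel)
        \<le> 3 * ennreal (\<epsilon> / 9) + 3 * ennreal (\<epsilon> / 9) + 3 * ennreal (\<epsilon> / 9)"
    proof -
      have "ennreal (\<eta>\<^sup>2) * emeasure lborel B \<le> ennreal (\<epsilon> / 9)"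
        using \<eta>2 V by (simp add: ennreal_mult[symmetric] ennreal_leI)
      then show ?thesis using fg by (intro add_mono mult_left_mono) (auto simp: mult.assoc intro: mult_left_mono)
    qed
    also have "\<dots> = ennreal \<epsilon>"
    proof -
      have "3 * ennreal (\<epsilon> / 9) = ennreal (\<epsilon> / 3)" using e ennreal_mult[of 3 "\<epsilon> / 9"] by simp
      then show ?thesis using e by (simp flip: ennreal_plus)
    qed
    finally show ?thesis .
  qed
  then show ?thesis using d(1) by (intro exI[of _ "min 1 d"]) auto
qed

text \<open>A nonzero periodic function is not square integrable on the plane. It is cut off to
  three adjacent period strips: a shift shorter than one period does not leave them when it starts
  in the middle one.\<close>

lemma L2_translation_continuous_cellm:
  fixes g :: "R2 \<Rightarrow> real"
  assumes [measurable]: "g \<in> borel_measurable borel" and per: "periodic2 g"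
    and gi: "integrable cellm (\<lambda>x. (g x)\<^sup>2)" and e: "\<epsilon> > 0"
  shows "\<exists>\<delta>>0. \<forall>h. norm h < \<delta> \<longrightarrow> (\<integral>\<^sup>+x. ennreal ((g (x + h) - g x)\<^sup>2) \<partial>cellm) \<le> ennreal \<epsilon>"
proof -
  define S where "S = (\<lambda>k::real. (UNIV::real set) \<times> {k..<k+1})"
  have [measurable]: "S k \<in> sets borel" for k by (simp add: S_def borel_prod[symmetric])
  define G where "G = (\<lambda>x. indicator (S (-1) \<union> S 0 \<union> S 1) x * g x)"
  have [measurable]: "G \<in> borel_measurable borel" unfolding G_def by measurable
  have per': "g (x + (0, 1)) = g x" "g (x + (0, - 1)) = g x" for x
    using per[unfolded periodic2_def, rule_format, of "fst x" "snd x"]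
      per[unfolded periodic2_def, rule_format, of "fst x" "snd x - 1"] by (auto simp: plus_prod_def)
  have fin: "(\<integral>\<^sup>+x. ennreal ((g x)\<^sup>2) \<partial>cellm) < \<infinity>"
    using gi by (simp add: integrable_iff_bounded)
  have S0: "(\<integral>\<^sup>+x. ennreal ((g x)\<^sup>2) * indicator (S 0) x \<partial>lborel) < \<infinity>"
    using fin by (simp add: nn_integral_cellm S_def)
  have S1: "(\<integral>\<^sup>+x. ennreal ((g x)\<^sup>2) * indicator (S 1) x \<partial>lborel) < \<infinity>"
  proof -
    have "(\<integral>\<^sup>+x. ennreal ((g x)\<^sup>2) * indicator (S 1) x \<partial>lborel) = (\<integral>\<^sup>+x. ennreal ((g (x + (0,1)))\<^sup>2) * indicator (S 1) (x + (0,1)) \<partial>lborel)"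
      by (rule nn_integral_shift[symmetric]) measurable
    also have "\<dots> = (\<integral>\<^sup>+x. ennreal ((g x)\<^sup>2) * indicator (S 0) x \<partial>lborel)"
      unfolding per' by (intro nn_integral_cong) (auto simp: S_def indicator_def)
    finally show ?thesis using S0 by simp
  qed
  have Sm: "(\<integral>\<^sup>+x. ennreal ((g x)\<^sup>2) * indicator (S (-1)) x \<partial>lborel) < \<infinity>"
  proof -
    have "(\<integral>\<^sup>+x. ennreal ((g x)\<^sup>2) * indicator (S (-1)) x \<partial>lborel) = (\<integral>\<^sup>+x. ennreal ((g (x + (0,-1)))\<^sup>2) * indicator (S (-1)) (x + (0,-1)) \<partial>lborel)"
      by (rule nn_integral_shift[symmetric]) measurable
    also have "\<dots> = (\<integral>\<^sup>+x. ennreal ((g x)\<^sup>2) * indicator (S 0) x \<partial>lborel)"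
      unfolding per' by (intro nn_integral_cong) (auto simp: S_def indicator_def)
    finally show ?thesis using S0 by simp
  qed
  have "integrable lborel (\<lambda>x. (G x)\<^sup>2)"
  proof (rule integrableI_bounded)
    have "(\<integral>\<^sup>+x. ennreal (norm ((G x)\<^sup>2)) \<partial>lborel) = (\<integral>\<^sup>+x. ennreal ((g x)\<^sup>2) * indicator (S (-1)) x + ennreal ((g x)\<^sup>2) * indicator (S 0) x + ennreal ((g x)\<^sup>2) * indicator (S 1) x \<partial>lborel)"
      by (intro nn_integral_cong) (auto simp: G_def S_def indicator_def)
    also have "\<dots> < \<infinity>" using S0 S1 Sm by (simp add: nn_integral_add)
    finally show "(\<integral>\<^sup>+x. ennreal (norm ((G x)\<^sup>2)) \<partial>lborel) < \<infinity>" .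
  qed measurable
  from L2_translation_continuous[OF _ this e]
  obtain d where d: "d > 0" "\<And>h. norm h < d \<Longrightarrow> (\<integral>\<^sup>+x. ennreal ((G (x + h) - G x)\<^sup>2) \<partial>lborel) \<le> ennreal \<epsilon>" by auto
  have "(\<integral>\<^sup>+x. ennreal ((g (x + h) - g x)\<^sup>2) \<partial>cellm) \<le> ennreal \<epsilon>" if h: "norm h < min 1 d" for h
  proof -
    have "\<bar>snd h\<bar> < 1" using h norm_snd_le[of "snd h" "fst h"] by simp
    then have "G x = g x" "G (x + h) = g (x + h)" if "x \<in> UNIV \<times> {0..<1}" for x
      using that by (cases x; cases h; auto simp: G_def S_def indicator_def)+
    then have "(\<integral>\<^sup>+x. ennreal ((g (x + h) - g x)\<^sup>2) \<partial>cellm) \<le> (\<integral>\<^sup>+x. ennreal ((G (x + h) - G x)\<^sup>2) \<partial>lborel)"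
      by (subst nn_integral_cellm, measurable, intro nn_integral_mono) (simp add: indicator_def)
    then show ?thesis using d(2)[of h] h by simp
  qed
  then show ?thesis using d(1) by (intro exI[of _ "min 1 d"]) auto
qed

text \<open>The constant \<open>c\<close> covers two uses: with c = 1 difference quotients converge
  to \<open>g\<close>, with c = 0 they are bounded by \<open>g\<close>. Jensen in the line parameter
  and Tonelli reduce both to an estimate for each single shift.\<close>

lemma dir_deriv_difference_quotient:
  fixes p g :: "R2 \<Rightarrow> real"
  assumes [measurable]: "p \<in> borel_measurable borel" "g \<in> borel_measurable borel"
    and pg: "dir_deriv e p g" and t: "t > 0"
    and le: "\<And>s. 0 \<le> s \<Longrightarrow> s \<le> t \<Longrightarrow> (\<integral>\<^sup>+x. ennreal ((g (x + s *\<^sub>R e) - c * g x)\<^sup>2) \<partial>cellm) \<le> \<epsilon>"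
  shows "(\<integral>\<^sup>+x. ennreal (((p (x + t *\<^sub>R e) - p x) / t - c * g x)\<^sup>2) \<partial>cellm) \<le> \<epsilon>"
proof -
  have J: "(\<lambda>(s, x). ennreal ((g (x + s *\<^sub>R e) - c * g x)\<^sup>2) * indicator {0..t} s) \<in> borel_measurable (lborel \<Otimes>\<^sub>M cellm)"
    by measurable
  have "AE x in cellm. set_integrable lborel {0..t} (\<lambda>s. g (x + s *\<^sub>R e)) \<and> p (x + t *\<^sub>R e) - p x = (LINT s:{0..t}|lborel. g (x + s *\<^sub>R e))"
    using pg t unfolding dir_deriv_def by (intro AE_cellm) simp
  then have "AE x in cellm. ennreal (((p (x + t *\<^sub>R e) - p x) / t - c * g x)\<^sup>2) \<le> ennreal (1 / t) * (\<integral>\<^sup>+s\<in>{0..t}. ennreal ((g (x + s *\<^sub>R e) - c * g x)\<^sup>2) \<partial>lborel)"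
  proof eventually_elim
    case (elim x)
    have c: "set_integrable lborel {0..t} (\<lambda>s. c * g x)" by (intro borel_integrable_atLeastAtMost' continuous_intros)
    have i: "set_integrable lborel {0..t} (\<lambda>s. g (x + s *\<^sub>R e) - c * g x)"
      using elim c by (intro set_integral_diff) auto
    have "(LINT s:{0..t}|lborel. g (x + s *\<^sub>R e) - c * g x) = p (x + t *\<^sub>R e) - p x - t * (c * g x)"
      using elim c t by (subst set_integral_diff) (auto simp: set_lebesgue_integral_def)
    then have eq: "(p (x + t *\<^sub>R e) - p x) / t - c * g x = (1 / t) * (LINT s:{0..t}|lborel. g (x + s *\<^sub>R e) - c * g x)"
      using t by (simp add: field_simps)
    have "ennreal (((p (x + t *\<^sub>R e) - p x) / t - c * g x)\<^sup>2) = ennreal ((1 / t)\<^sup>2) * ennreal ((LINT s:{0..t}|lborel. g (x + s *\<^sub>R e) - c * g x)\<^sup>2)"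
      unfolding eq power_mult_distrib by (rule ennreal_mult) auto
    also have "\<dots> \<le> ennreal ((1 / t)\<^sup>2) * (ennreal t * (\<integral>\<^sup>+s\<in>{0..t}. ennreal ((g (x + s *\<^sub>R e) - c * g x)\<^sup>2) \<partial>lborel))"
      by (intro mult_left_mono Jensen_interval[OF t i]) auto
    also have "\<dots> = ennreal (1 / t) * (\<integral>\<^sup>+s\<in>{0..t}. ennreal ((g (x + s *\<^sub>R e) - c * g x)\<^sup>2) \<partial>lborel)"
    proof -
      have "(1 / t)\<^sup>2 * t = 1 / t" using t by (simp add: power2_eq_square)
      then show ?thesis using t by (simp add: mult.assoc[symmetric] ennreal_mult[symmetric])
    qed
    finally show ?case .
  qed
  then have "(\<integral>\<^sup>+x. ennreal (((p (x + t *\<^sub>R e) - p x) / t - c * g x)\<^sup>2) \<partial>cellm) \<le> (\<integral>\<^sup>+x. ennreal (1 / t) * (\<integral>\<^sup>+s\<in>{0..t}. ennreal ((g (x + s *\<^sub>R e) - c * g x)\<^sup>2) \<partial>lborel) \<partial>cellm)"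
    by (rule nn_integral_mono_AE)
  also have "\<dots> = ennreal (1 / t) * (\<integral>\<^sup>+x. (\<integral>\<^sup>+s\<in>{0..t}. ennreal ((g (x + s *\<^sub>R e) - c * g x)\<^sup>2) \<partial>lborel) \<partial>cellm)"
    by (rule nn_integral_cmult) measurable
  also have "(\<integral>\<^sup>+x. (\<integral>\<^sup>+s\<in>{0..t}. ennreal ((g (x + s *\<^sub>R e) - c * g x)\<^sup>2) \<partial>lborel) \<partial>cellm)
     = (\<integral>\<^sup>+s. (\<integral>\<^sup>+x. ennreal ((g (x + s *\<^sub>R e) - c * g x)\<^sup>2) * indicator {0..t} s \<partial>cellm) \<partial>lborel)"
    using lborel_cellm.Fubini'[OF J] by simp
  also have "\<dots> \<le> (\<integral>\<^sup>+s. \<epsilon> * indicator {0..t} s \<partial>lborel)"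
    by (intro nn_integral_mono) (auto simp: indicator_def le)
  also have "\<dots> = \<epsilon> * ennreal t" using t by (simp add: nn_integral_cmult_indicator)
  also have "ennreal (1 / t) * (\<epsilon> * ennreal t) = \<epsilon>"
  proof -
    have "ennreal (1 / t) * ennreal t = 1" using t by (simp add: ennreal_mult[symmetric])
    then show ?thesis by (metis mult.commute mult.left_commute mult_1)
  qed
  finally show ?thesis by (simp add: mult_left_mono)
qed

text \<open>The difference of the products splits into (f - F)(g - G) and two mixed terms, each
  controlled by Cauchy-Schwarz. The convergence hypotheses give square integrable differences only
  from some index on, hence the eventual formulation.\<close>

lemma L2_product_limit:
  fixes f g :: "nat \<Rightarrow> 'a \<Rightarrow> real"
  assumes m[measurable]: "\<And>n. f n \<in> borel_measurable M" "\<And>n. g n \<in> borel_measurable M" "F \<in> borel_measurable M" "G \<in> borel_measurable M"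
    and F: "integrable M (\<lambda>x. (F x)\<^sup>2)" and G: "integrable M (\<lambda>x. (G x)\<^sup>2)"
    and f: "(\<lambda>n. \<integral>\<^sup>+x. ennreal ((f n x - F x)\<^sup>2) \<partial>M) \<longlonglongrightarrow> 0"
    and g: "(\<lambda>n. \<integral>\<^sup>+x. ennreal ((g n x - G x)\<^sup>2) \<partial>M) \<longlonglongrightarrow> 0"
  shows "(\<lambda>n. \<integral>x. f n x * g n x \<partial>M) \<longlonglongrightarrow> (\<integral>x. F x * G x \<partial>M)"
proof -
  have ev: "\<forall>\<^sub>F n in sequentially. integrable M (\<lambda>x. (h n x - H x)\<^sup>2)"
    and lim: "(\<lambda>n. \<integral>x. (h n x - H x)\<^sup>2 \<partial>M) \<longlonglongrightarrow> 0"
    if [measurable]: "\<And>n. h n \<in> borel_measurable M" "H \<in> borel_measurable M"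
    and h: "(\<lambda>n. \<integral>\<^sup>+x. ennreal ((h n x - H x)\<^sup>2) \<partial>M) \<longlonglongrightarrow> 0" for h :: "nat \<Rightarrow> 'a \<Rightarrow> real" and H
  proof -
    have "\<forall>\<^sub>F n in sequentially. (\<integral>\<^sup>+x. ennreal ((h n x - H x)\<^sup>2) \<partial>M) < \<infinity>"
      by (rule order_tendstoD(2)[OF h]) simp
    then show "\<forall>\<^sub>F n in sequentially. integrable M (\<lambda>x. (h n x - H x)\<^sup>2)"
      by eventually_elim (auto intro!: integrableI_bounded)
    have "(\<lambda>n. enn2real (\<integral>\<^sup>+x. ennreal ((h n x - H x)\<^sup>2) \<partial>M)) \<longlonglongrightarrow> 0"
      using h by (intro tendsto_enn2real) simp_all
    then show "(\<lambda>n. \<integral>x. (h n x - H x)\<^sup>2 \<partial>M) \<longlonglongrightarrow> 0"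
      by (simp add: integral_eq_nn_integral)
  qed
  note ef = ev[OF m(1,3) f] and lf = lim[OF m(1,3) f] and eg = ev[OF m(2,4) g] and lg = lim[OF m(2,4) g]
  define a where "a = (\<lambda>n. \<integral>x. (f n x - F x)\<^sup>2 \<partial>M)"
  define b where "b = (\<lambda>n. \<integral>x. (g n x - G x)\<^sup>2 \<partial>M)"
  have a: "a \<longlonglongrightarrow> 0" and b: "b \<longlonglongrightarrow> 0" using lf lg by (simp_all add: a_def b_def)
  define e where "e = (\<lambda>n. sqrt (a n * b n) + sqrt (a n * (\<integral>x. (G x)\<^sup>2 \<partial>M)) + sqrt ((\<integral>x. (F x)\<^sup>2 \<partial>M) * b n))"
  have "e \<longlonglongrightarrow> sqrt (0 * 0) + sqrt (0 * (\<integral>x. (G x)\<^sup>2 \<partial>M)) + sqrt ((\<integral>x. (F x)\<^sup>2 \<partial>M) * 0)"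
    unfolding e_def by (intro tendsto_intros a b)
  then have e: "e \<longlonglongrightarrow> 0" by simp
  have "\<forall>\<^sub>F n in sequentially. norm ((\<integral>x. f n x * g n x \<partial>M) - (\<integral>x. F x * G x \<partial>M)) \<le> e n"
    using ef eg
  proof eventually_elim
    case (elim n)
    have cs: "\<bar>\<integral>x. h x * k x \<partial>M\<bar> \<le> sqrt ((\<integral>x. (h x)\<^sup>2 \<partial>M) * (\<integral>x. (k x)\<^sup>2 \<partial>M))"
      if "h \<in> borel_measurable M" "k \<in> borel_measurable M" "integrable M (\<lambda>x. (h x)\<^sup>2)" "integrable M (\<lambda>x. (k x)\<^sup>2)" for h k :: "'a \<Rightarrow> real"
      using integral_Cauchy_Schwarz[OF that] by (intro real_le_rsqrt) simp
    have i1: "integrable M (\<lambda>x. (f n x - F x) * (g n x - G x))" using elim by (intro square_integrable_mult) auto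
    have i2: "integrable M (\<lambda>x. (f n x - F x) * G x)" using elim G by (intro square_integrable_mult) auto
    have i3: "integrable M (\<lambda>x. F x * (g n x - G x))" using elim F by (intro square_integrable_mult) auto
    have i4: "integrable M (\<lambda>x. F x * G x)" using F G by (intro square_integrable_mult) auto
    have "(\<integral>x. f n x * g n x \<partial>M) = (\<integral>x. (f n x - F x) * (g n x - G x) + (f n x - F x) * G x + F x * (g n x - G x) + F x * G x \<partial>M)"
      by (intro Bochner_Integration.integral_cong refl) (simp add: algebra_simps)
    also have "\<dots> = (\<integral>x. (f n x - F x) * (g n x - G x) \<partial>M) + (\<integral>x. (f n x - F x) * G x \<partial>M) + (\<integral>x. F x * (g n x - G x) \<partial>M) + (\<integral>x. F x * G x \<partial>M)"
      using i1 i2 i3 i4 by simp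
    finally have eq: "(\<integral>x. f n x * g n x \<partial>M) - (\<integral>x. F x * G x \<partial>M) = (\<integral>x. (f n x - F x) * (g n x - G x) \<partial>M) + (\<integral>x. (f n x - F x) * G x \<partial>M) + (\<integral>x. F x * (g n x - G x) \<partial>M)" by simp
    have "\<bar>\<integral>x. (f n x - F x) * (g n x - G x) \<partial>M\<bar> \<le> sqrt (a n * b n)"
      unfolding a_def b_def using elim by (intro cs) auto
    moreover have "\<bar>\<integral>x. (f n x - F x) * G x \<partial>M\<bar> \<le> sqrt (a n * (\<integral>x. (G x)\<^sup>2 \<partial>M))"
      unfolding a_def using elim G by (intro cs) auto
    moreover have "\<bar>\<integral>x. F x * (g n x - G x) \<partial>M\<bar> \<le> sqrt ((\<integral>x. (F x)\<^sup>2 \<partial>M) * b n)"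
      unfolding b_def using elim F by (intro cs) auto
    ultimately show ?case unfolding eq e_def real_norm_def by linarith
  qed
  then have "(\<lambda>n. (\<integral>x. f n x * g n x \<partial>M) - (\<integral>x. F x * G x \<partial>M)) \<longlonglongrightarrow> 0"
    by (rule Lim_null_comparison[OF _ e])
  then show ?thesis by (simp add: LIM_zero_iff)
qed

section \<open>The null Lagrangian\<close>

lemma periodic2_shift: "periodic2 f \<Longrightarrow> periodic2 (\<lambda>x. f (x + c))"
proof -
  assume f: "periodic2 f"
  obtain c1 c2 where c: "c = (c1, c2)" by force
  have "f (x1 + c1, x2 + 1 + c2) = f (x1 + c1, x2 + c2)" for x1 x2
    using f[unfolded periodic2_def, rule_format, of "x1 + c1" "x2 + c2"] by (simp add: ac_simps)
  then show ?thesis by (simp add: periodic2_def c)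
qed

lemma periodic2_comp2: "periodic2 f \<Longrightarrow> periodic2 g \<Longrightarrow> periodic2 (\<lambda>x. h (f x) (g x))"
  by (simp add: periodic2_def)

lemma periodic2_comp: "periodic2 f \<Longrightarrow> periodic2 (\<lambda>x. h (f x))"
  by (simp add: periodic2_def)

lemma difference_quotient_L2_limit:
  fixes p g :: "R2 \<Rightarrow> real"
  assumes [measurable]: "p \<in> borel_measurable borel" "g \<in> borel_measurable borel"
    and per: "periodic2 g" and pg: "dir_deriv e p g" and g: "integrable cellm (\<lambda>x. (g x)\<^sup>2)"
  shows "(\<lambda>n. \<integral>\<^sup>+x. ennreal (((p (x + (1 / real (Suc n)) *\<^sub>R e) - p x) / (1 / real (Suc n)) - g x)\<^sup>2) \<partial>cellm) \<longlonglongrightarrow> 0"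
proof (rule order_tendstoI)
  fix a :: ennreal assume "0 < a"
  then obtain b where b: "0 < b" "b < a" using dense by blast
  define \<epsilon> where "\<epsilon> = enn2real b"
  have bt: "b < top" using b(2) by (rule order_less_le_trans) simp
  have e: "\<epsilon> > 0" "ennreal \<epsilon> < a" using b bt by (simp_all add: \<epsilon>_def enn2real_positive_iff)
  obtain \<delta> where d: "\<delta> > 0" "\<And>h. norm h < \<delta> \<Longrightarrow> (\<integral>\<^sup>+x. ennreal ((g (x + h) - g x)\<^sup>2) \<partial>cellm) \<le> ennreal \<epsilon>"
    using L2_translation_continuous_cellm[OF assms(2) per g e(1)] by blast
  have "(\<lambda>n. norm e * (1 / real (Suc n))) \<longlonglongrightarrow> norm e * 0"
    by (intro tendsto_intros LIMSEQ_Suc[OF lim_1_over_n])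
  then have "\<forall>\<^sub>F n in sequentially. norm e * (1 / real (Suc n)) < \<delta>"
    by (rule order_tendstoD(2)) (use d in simp)
  then show "\<forall>\<^sub>F n in sequentially. (\<integral>\<^sup>+x. ennreal (((p (x + (1 / real (Suc n)) *\<^sub>R e) - p x) / (1 / real (Suc n)) - g x)\<^sup>2) \<partial>cellm) < a"
  proof eventually_elim
    case (elim n)
    have "(\<integral>\<^sup>+x. ennreal (((p (x + (1 / real (Suc n)) *\<^sub>R e) - p x) / (1 / real (Suc n)) - 1 * g x)\<^sup>2) \<partial>cellm) \<le> ennreal \<epsilon>"
    proof (rule dir_deriv_difference_quotient[OF _ _ pg])
      fix s assume s: "0 \<le> s" "s \<le> 1 / real (Suc n)"
      have "s * norm e \<le> (1 / real (Suc n)) * norm e" using s by (intro mult_right_mono) auto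
      then have "norm (s *\<^sub>R e) < \<delta>" using elim s by (simp add: mult.commute)
      then show "(\<integral>\<^sup>+x. ennreal ((g (x + s *\<^sub>R e) - 1 * g x)\<^sup>2) \<partial>cellm) \<le> ennreal \<epsilon>" using d(2) by simp
    qed auto
    then show ?case using e(2) by simp
  qed
qed simp

lemma dir_deriv_increment_L2:
  fixes p g :: "R2 \<Rightarrow> real"
  assumes [measurable]: "p \<in> borel_measurable borel" "g \<in> borel_measurable borel"
    and per: "periodic2 g" and pg: "dir_deriv e p g" and t: "t > 0"
  shows "(\<integral>\<^sup>+x. ennreal (((p (x + t *\<^sub>R e) - p x) / t)\<^sup>2) \<partial>cellm) \<le> (\<integral>\<^sup>+x. ennreal ((g x)\<^sup>2) \<partial>cellm)"
proof -
  have "(\<integral>\<^sup>+x. ennreal (((p (x + t *\<^sub>R e) - p x) / t - 0 * g x)\<^sup>2) \<partial>cellm) \<le> (\<integral>\<^sup>+x. ennreal ((g x)\<^sup>2) \<partial>cellm)"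
  proof (rule dir_deriv_difference_quotient[OF _ _ pg t])
    fix s
    have "(\<integral>\<^sup>+x. ennreal ((g (x + s *\<^sub>R e))\<^sup>2) \<partial>cellm) = (\<integral>\<^sup>+x. ennreal ((g x)\<^sup>2) \<partial>cellm)"
      using per by (intro nn_integral_cellm_shift[of "\<lambda>x. ennreal ((g x)\<^sup>2)"]) (auto simp: periodic2_def)
    then show "(\<integral>\<^sup>+x. ennreal ((g (x + s *\<^sub>R e) - 0 * g x)\<^sup>2) \<partial>cellm) \<le> (\<integral>\<^sup>+x. ennreal ((g x)\<^sup>2) \<partial>cellm)" by simp
  qed auto
  then show ?thesis by simp
qed

lemma square_integrable_shift_increment:
  fixes p g :: "R2 \<Rightarrow> real"
  assumes [measurable]: "p \<in> borel_measurable borel" "g \<in> borel_measurable borel"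
    and per: "periodic2 g" and pg: "dir_deriv e p g" and t: "t > 0" and g: "integrable cellm (\<lambda>x. (g x)\<^sup>2)"
  shows "integrable cellm (\<lambda>x. (p (x + t *\<^sub>R e) - p x)\<^sup>2)"
proof -
  have "integrable cellm (\<lambda>x. ((p (x + t *\<^sub>R e) - p x) / t)\<^sup>2)"
  proof (rule integrableI_bounded)
    have "(\<integral>\<^sup>+x. ennreal (((p (x + t *\<^sub>R e) - p x) / t)\<^sup>2) \<partial>cellm) \<le> (\<integral>\<^sup>+x. ennreal ((g x)\<^sup>2) \<partial>cellm)"
      by (rule dir_deriv_increment_L2[OF assms(1-5)])
    also have "\<dots> < \<infinity>" using g by (simp add: integrable_iff_bounded)
    finally show "(\<integral>\<^sup>+x. ennreal (norm (((p (x + t *\<^sub>R e) - p x) / t)\<^sup>2)) \<partial>cellm) < \<infinity>" by simp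
  qed measurable
  then have "integrable cellm (\<lambda>x. t\<^sup>2 * ((p (x + t *\<^sub>R e) - p x) / t)\<^sup>2)" by (rule integrable_mult_right)
  then show ?thesis using t by (simp add: power_divide)
qed

text \<open>The null Lagrangian property of the determinant, for a single pair of derivatives:
  differences in the two directions commute and can be shifted from one factor to the other.\<close>
lemma integral_mixed_derivatives_swap:
  fixes a b :: "R2 \<Rightarrow> real"
  assumes m[measurable]: "a \<in> borel_measurable borel" "b \<in> borel_measurable borel"
      "a1 \<in> borel_measurable borel" "a2 \<in> borel_measurable borel" "b1 \<in> borel_measurable borel" "b2 \<in> borel_measurable borel"
    and per: "periodic2 a" "periodic2 b" "periodic2 a1" "periodic2 a2" "periodic2 b1" "periodic2 b2"
    and d: "dir_deriv e a a1" "dir_deriv (- f) a (\<lambda>x. - a2 x)" "dir_deriv f b b2" "dir_deriv (- e) b (\<lambda>x. - b1 x)"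
    and bi: "integrable cellm (\<lambda>x. (b x)\<^sup>2)"
    and i: "integrable cellm (\<lambda>x. (a1 x)\<^sup>2)" "integrable cellm (\<lambda>x. (a2 x)\<^sup>2)" "integrable cellm (\<lambda>x. (b1 x)\<^sup>2)" "integrable cellm (\<lambda>x. (b2 x)\<^sup>2)"
  shows "(\<integral>x. a1 x * b2 x \<partial>cellm) = (\<integral>x. a2 x * b1 x \<partial>cellm)"
proof -
  have per': "periodic2 (\<lambda>x. - a2 x)" "periodic2 (\<lambda>x. - b1 x)" using per by (auto simp: periodic2_def)
  have i': "integrable cellm (\<lambda>x. (- a2 x)\<^sup>2)" "integrable cellm (\<lambda>x. (- b1 x)\<^sup>2)" using i by simp_all
  let ?t = "\<lambda>n. 1 / real (Suc n)"
  \<comment> \<open>Summation by parts: both integrals equal that of \<open>b\<close> times the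
    mixed second difference of \<open>a\<close>. A difference reverses direction when it moves to
    the other factor, which is why the right-hand side has backward quotients; their two minus signs
    cancel in the limit.\<close>
  have id: "(\<integral>x. (a (x + t *\<^sub>R e) - a x) * (b (x + t *\<^sub>R f) - b x) \<partial>cellm)
      = (\<integral>x. (a (x + t *\<^sub>R (- f)) - a x) * (b (x + t *\<^sub>R (- e)) - b x) \<partial>cellm)" if t: "t > 0" for t
  proof -
    define A where "A = (\<lambda>x. a (x + t *\<^sub>R e) - a x)"
    define A' where "A' = (\<lambda>x. a (x + t *\<^sub>R (- f)) - a x)"
    have [measurable]: "A \<in> borel_measurable borel" "A' \<in> borel_measurable borel" unfolding A_def A'_def by measurable
    have pA: "periodic2 A" "periodic2 A'"
      unfolding A_def A'_def by (intro periodic2_comp2[of _ _ "(-)"] periodic2_shift per(1))+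
    have iA: "integrable cellm (\<lambda>x. (A x)\<^sup>2)" unfolding A_def
      by (rule square_integrable_shift_increment[OF _ _ per(3) d(1) t i(1)]) measurable
    have iA': "integrable cellm (\<lambda>x. (A' x)\<^sup>2)" unfolding A'_def
      by (rule square_integrable_shift_increment[OF _ _ per'(1) d(2) t i'(1)]) measurable
    have sh: "(\<integral>x. H x * (b (x + c) - b x) \<partial>cellm) = (\<integral>x. (H (x - c) - H x) * b x \<partial>cellm)"
      if [measurable]: "H \<in> borel_measurable borel" and pH: "periodic2 H" and iH: "integrable cellm (\<lambda>x. (H x)\<^sup>2)" for H c
    proof -
      have ibc: "integrable cellm (\<lambda>x. (b (x + c))\<^sup>2)"
        using bi by (subst integral_cellm_shift(1)[of "\<lambda>x. (b x)\<^sup>2"]) (auto intro: periodic2_comp[OF per(2)])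
      have iHc: "integrable cellm (\<lambda>x. (H (x - c))\<^sup>2)"
        using iH integral_cellm_shift(1)[of "\<lambda>x. (H x)\<^sup>2" "- c", OF _ periodic2_comp[OF pH]] by simp
      have j1: "integrable cellm (\<lambda>x. H x * b (x + c))" by (rule square_integrable_mult[OF _ _ iH ibc]) measurable
      have j2: "integrable cellm (\<lambda>x. H x * b x)" by (rule square_integrable_mult[OF _ _ iH bi]) measurable
      have j3: "integrable cellm (\<lambda>x. H (x - c) * b x)" by (rule square_integrable_mult[OF _ _ iHc bi]) measurable
      have "periodic2 (\<lambda>x. H (x - c) * b x)" using periodic2_comp2[OF periodic2_shift[OF pH, of "- c"] per(2), of "(*)"] by simp
      then have "(\<integral>x. H (x + c - c) * b (x + c) \<partial>cellm) = (\<integral>x. H (x - c) * b x \<partial>cellm)"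
        by (intro integral_cellm_shift(2)[of "\<lambda>x. H (x - c) * b x" c]) auto
      then show ?thesis using j1 j2 j3 by (simp add: right_diff_distrib left_diff_distrib)
    qed
    have "(\<integral>x. A x * (b (x + t *\<^sub>R f) - b x) \<partial>cellm) = (\<integral>x. (A (x - t *\<^sub>R f) - A x) * b x \<partial>cellm)"
      by (rule sh[OF _ pA(1) iA]) measurable
    also have "\<dots> = (\<integral>x. (A' (x - t *\<^sub>R (- e)) - A' x) * b x \<partial>cellm)"
      by (intro Bochner_Integration.integral_cong refl) (simp add: A_def A'_def algebra_simps)
    also have "\<dots> = (\<integral>x. A' x * (b (x + t *\<^sub>R (- e)) - b x) \<partial>cellm)"
      by (rule sh[OF _ pA(2) iA', symmetric]) measurable
    finally show ?thesis by (simp only: A_def A'_def)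
  qed
  have l1: "(\<lambda>n. \<integral>x. ((a (x + ?t n *\<^sub>R e) - a x) / ?t n) * ((b (x + ?t n *\<^sub>R f) - b x) / ?t n) \<partial>cellm) \<longlonglongrightarrow> (\<integral>x. a1 x * b2 x \<partial>cellm)"
    by (rule L2_product_limit[OF _ _ _ _ i(1) i(4) difference_quotient_L2_limit[OF _ _ per(3) d(1) i(1)] difference_quotient_L2_limit[OF _ _ per(6) d(3) i(4)]]) measurable
  have l2: "(\<lambda>n. \<integral>x. ((a (x + ?t n *\<^sub>R (- f)) - a x) / ?t n) * ((b (x + ?t n *\<^sub>R (- e)) - b x) / ?t n) \<partial>cellm) \<longlonglongrightarrow> (\<integral>x. (- a2 x) * (- b1 x) \<partial>cellm)"
    by (rule L2_product_limit[OF _ _ _ _ i' difference_quotient_L2_limit[OF _ _ per'(1) d(2) i'(1)] difference_quotient_L2_limit[OF _ _ per'(2) d(4) i'(2)]]) measurable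
  have idt: "(\<integral>x. ((a (x + t *\<^sub>R e) - a x) / t) * ((b (x + t *\<^sub>R f) - b x) / t) \<partial>cellm)
     = (\<integral>x. ((a (x + t *\<^sub>R (- f)) - a x) / t) * ((b (x + t *\<^sub>R (- e)) - b x) / t) \<partial>cellm)" if "t > 0" for t
    using id[OF that] by (simp add: times_divide_times_eq)
  have "(\<lambda>n. \<integral>x. ((a (x + ?t n *\<^sub>R e) - a x) / ?t n) * ((b (x + ?t n *\<^sub>R f) - b x) / ?t n) \<partial>cellm)
    = (\<lambda>n. \<integral>x. ((a (x + ?t n *\<^sub>R (- f)) - a x) / ?t n) * ((b (x + ?t n *\<^sub>R (- e)) - b x) / ?t n) \<partial>cellm)" by (intro ext idt) simp
  with l1 have "(\<lambda>n. \<integral>x. ((a (x + ?t n *\<^sub>R (- f)) - a x) / ?t n) * ((b (x + ?t n *\<^sub>R (- e)) - b x) / ?t n) \<partial>cellm) \<longlonglongrightarrow> (\<integral>x. a1 x * b2 x \<partial>cellm)"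
    by simp
  from LIMSEQ_unique[OF this l2] show ?thesis by simp
qed

section \<open>Means over a period and fluxes\<close>

lemma borel_measurable_fst_R2[measurable]:
  "f \<in> borel_measurable M \<Longrightarrow> (\<lambda>x. fst (f x :: R2)) \<in> borel_measurable M"
  by (rule measurable_compose[OF _ borel_measurable_continuous_onI]) (auto intro: continuous_intros)

lemma borel_measurable_snd_R2[measurable]:
  "f \<in> borel_measurable M \<Longrightarrow> (\<lambda>x. snd (f x :: R2)) \<in> borel_measurable M"
  by (rule measurable_compose[OF _ borel_measurable_continuous_onI]) (auto intro: continuous_intros)

definition xmean :: "(R2 \<Rightarrow> real) \<Rightarrow> real \<Rightarrow> real" where
  "xmean p x1 = (LINT r:{0..1}|lborel. p (x1, r))"

lemma loc_int_measurable[measurable_dest]: "loc_int p \<Longrightarrow> p \<in> borel_measurable borel"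
  by (simp add: loc_int_def)

lemma xmean_measurable[measurable]:
  assumes [measurable]: "p \<in> borel_measurable borel"
  shows "xmean p \<in> borel_measurable borel"
proof -
  have [measurable]: "p \<in> borel_measurable (borel \<Otimes>\<^sub>M borel)" by (simp add: borel_prod)
  show ?thesis unfolding xmean_def[abs_def] set_lebesgue_integral_def by measurable
qed

lemma loc_int_rectangle:
  assumes p: "loc_int (p :: R2 \<Rightarrow> real)"
  shows "integrable (lborel \<Otimes>\<^sub>M lborel) (\<lambda>(x1, x2). indicator {a..b} x1 * (indicator {c..d} x2 * p (x1, x2)))"
proof -
  have "bounded ({a..b} \<times> {c..d})" by (intro bounded_Times) auto
  moreover have "{a..b} \<times> {c..d} \<in> sets borel" by (intro borel_closed closed_Times) auto
  ultimately have "integrable lborel (\<lambda>x. indicator ({a..b} \<times> {c..d}) x *\<^sub>R p x)"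
    using p by (simp add: loc_int_def set_integrable_def)
  moreover have "(\<lambda>x. indicator ({a..b} \<times> {c..d}) x *\<^sub>R p x) = (\<lambda>(x1, x2). indicator {a..b} x1 * (indicator {c..d} x2 * p (x1, x2)))"
    by (auto simp: indicator_def)
  ultimately show ?thesis by (simp add: lborel_prod)
qed

lemma AE_slice_integrable:
  assumes p: "loc_int (p :: R2 \<Rightarrow> real)"
  shows "AE x1 in lborel. set_integrable lborel {0..1} (\<lambda>r. p (x1, r))"
proof -
  have "AE x1 in lborel. \<forall>n::nat. integrable lborel (\<lambda>x2. indicator {- real n..real n} x1 * (indicator {0..1} x2 * p (x1, x2)))"
    by (subst AE_all_countable, intro allI lborel_pair.AE_integrable_fst[OF loc_int_rectangle[OF p]])
  then show ?thesis
  proof eventually_elim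
    case (elim x1)
    obtain n :: nat where "\<bar>x1\<bar> \<le> real n" using real_arch_simple by blast
    then have "x1 \<in> {- real n..real n}" by auto
    then show ?case using elim[rule_format, of n] by (simp add: set_integrable_def)
  qed
qed

lemma AE_fst: "AE x1 in lborel. P x1 \<Longrightarrow> AE x in (lborel :: (real \<times> real) measure). P (fst x)"
proof -
  assume "AE x1 in lborel. P x1"
  then obtain N where N: "N \<in> null_sets lborel" "{x. \<not> P x} \<subseteq> N" unfolding eventually_ae_filter by auto
  have "emeasure (lborel \<Otimes>\<^sub>M lborel) (N \<times> (UNIV :: real set)) = 0"
    using N(1) by (subst lborel.emeasure_pair_measure_Times) (auto simp: null_sets_def)
  then have "N \<times> (UNIV :: real set) \<in> null_sets lborel"
    using N(1) unfolding lborel_prod by (auto simp: null_sets_def borel_prod[symmetric])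
  then show ?thesis by (rule AE_I') (use N(2) in auto)
qed

lemma integrable_cellm_local:
  assumes p: "loc_int p"
  shows "integrable cellm (\<lambda>x. indicator {a..b} (fst x) * p x)"
proof -
  have [measurable]: "p \<in> borel_measurable borel" using p by measurable
  have 1: "integrable lborel (\<lambda>x. indicator {a..b} (fst x) * (indicator {0..1} (snd x) * p x))"
    using loc_int_rectangle[OF p, of a b 0 1] by (simp add: lborel_prod case_prod_unfold)
  have "integrable lborel (\<lambda>x. indicator (UNIV \<times> {0..<1}) x * (indicator {a..b} (fst x) * p x))"
  proof (rule Bochner_Integration.integrable_bound[OF 1])
    show "(\<lambda>x. indicator (UNIV \<times> {0..<1}) x * (indicator {a..b} (fst x) * p x)) \<in> borel_measurable lborel"
      by measurable
  qed (auto intro!: AE_I2 simp: indicator_def)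
  moreover have "(\<lambda>x. indicator (UNIV \<times> {0..<1}) x) = (\<lambda>x::R2. ennreal (indicator (UNIV \<times> {0..<1}) x))"
    by (auto simp: indicator_def)
  moreover have "(\<lambda>x. indicator {a..b} (fst x) * p x) \<in> borel_measurable lborel" by measurable
  ultimately show ?thesis unfolding cellm_def
    by (simp add: integrable_density)
qed

text \<open>The deviation of \<open>p\<close> from its mean is, up to sign, the average of the
  increments p(x + s e2) - p(x) over a period, and each of these is bounded in L^2 by
  \<open>g\<close>. The crude constant 1 is enough.\<close>

lemma Poincare_cellm:
  fixes p g :: "R2 \<Rightarrow> real"
  assumes p: "loc_int p" and pp: "periodic2 p" and gm[measurable]: "g \<in> borel_measurable borel" and gp: "periodic2 g"
    and pg: "dir_deriv (0, 1) p g"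
  shows "(\<integral>\<^sup>+x. ennreal ((p x - xmean p (fst x))\<^sup>2) \<partial>cellm) \<le> (\<integral>\<^sup>+x. ennreal ((g x)\<^sup>2) \<partial>cellm)"
proof -
  have pm[measurable]: "p \<in> borel_measurable borel" using p by measurable
  have [measurable]: "p \<in> borel_measurable (borel \<Otimes>\<^sub>M borel)" by (simp add: borel_prod)
  have J: "(\<lambda>(s, x). ennreal ((p (x + s *\<^sub>R (0, 1)) - p x)\<^sup>2) * indicator {0..1} s) \<in> borel_measurable (lborel \<Otimes>\<^sub>M cellm)"
    by measurable
  have "AE x in cellm. set_integrable lborel {0..1} (\<lambda>r. p (fst x, r))"
    by (intro AE_cellm AE_fst AE_slice_integrable p)
  then have "AE x in cellm. ennreal ((p x - xmean p (fst x))\<^sup>2) \<le> (\<integral>\<^sup>+s\<in>{0..1}. ennreal ((p (x + s *\<^sub>R (0, 1)) - p x)\<^sup>2) \<partial>lborel)"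
  proof eventually_elim
    case (elim x)
    obtain x1 x2 where x: "x = (x1, x2)" by force
    have per: "p (x1, r + 1) = p (x1, r)" for r using pp by (simp add: periodic2_def)
    have i: "set_integrable lborel {0..1} (\<lambda>s. p (x1, s + x2))"
      using set_integral_periodic_shift(1)[of "\<lambda>r. p (x1, r)" x2] per elim x by simp
    have c: "set_integrable lborel {0..1::real} (\<lambda>s. p x)" by (intro borel_integrable_atLeastAtMost' continuous_on_const)
    have i2: "set_integrable lborel {0..1} (\<lambda>s. p (x + s *\<^sub>R (0, 1)) - p x)"
      using i c by (intro set_integral_diff) (auto simp: x add.commute)
    have "(LINT s:{0..1}|lborel. p (x + s *\<^sub>R (0, 1)) - p x) = (LINT s:{0..1}|lborel. p (x1, s + x2)) - (LINT s:{0..1::real}|lborel. p x)"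
      using set_integral_diff(2)[OF i c] by (simp add: x add.commute)
    also have "(LINT s:{0..1}|lborel. p (x1, s + x2)) = xmean p x1"
      unfolding xmean_def using set_integral_periodic_shift(2)[of "\<lambda>r. p (x1, r)" x2] per by simp
    also have "(LINT s:{0..1::real}|lborel. p x) = p x" by (simp add: set_lebesgue_integral_def)
    finally have "(p x - xmean p (fst x))\<^sup>2 = (LINT s:{0..1}|lborel. p (x + s *\<^sub>R (0, 1)) - p x)\<^sup>2"
      by (simp add: x power2_commute)
    then show ?case using Jensen_interval[OF _ i2] by simp
  qed
  then have "(\<integral>\<^sup>+x. ennreal ((p x - xmean p (fst x))\<^sup>2) \<partial>cellm) \<le> (\<integral>\<^sup>+x. (\<integral>\<^sup>+s\<in>{0..1}. ennreal ((p (x + s *\<^sub>R (0, 1)) - p x)\<^sup>2) \<partial>lborel) \<partial>cellm)"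
    by (rule nn_integral_mono_AE)
  also have "\<dots> = (\<integral>\<^sup>+s. (\<integral>\<^sup>+x. ennreal ((p (x + s *\<^sub>R (0, 1)) - p x)\<^sup>2) * indicator {0..1} s \<partial>cellm) \<partial>lborel)"
    using lborel_cellm.Fubini'[OF J] by simp
  also have "\<dots> \<le> (\<integral>\<^sup>+s. (\<integral>\<^sup>+x. ennreal ((g x)\<^sup>2) \<partial>cellm) * indicator {0..1::real} s \<partial>lborel)"
  proof (rule nn_integral_mono)
    fix s :: real
    have "(\<integral>\<^sup>+x. ennreal ((p (x + s *\<^sub>R (0, 1)) - p x)\<^sup>2) \<partial>cellm) \<le> (\<integral>\<^sup>+x. ennreal ((g x)\<^sup>2) \<partial>cellm)" if s: "0 \<le> s" "s \<le> 1"
    proof (cases "s = 0")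
      case False
      \<comment> \<open>Since s is at most 1, dividing by \<open>s\<close> only enlarges the
        increment and brings in the bound for difference quotients.\<close>
      have "(p (x + s *\<^sub>R (0, 1)) - p x)\<^sup>2 \<le> ((p (x + s *\<^sub>R (0, 1)) - p x) / s)\<^sup>2" for x
      proof -
        have "\<bar>y\<bar> \<le> \<bar>y / s\<bar>" for y using s False by (simp add: field_simps mult_left_le mult_left_le_one_le)
        then show ?thesis by (simp only: abs_le_square_iff)
      qed
      then have "(\<integral>\<^sup>+x. ennreal ((p (x + s *\<^sub>R (0, 1)) - p x)\<^sup>2) \<partial>cellm) \<le> (\<integral>\<^sup>+x. ennreal (((p (x + s *\<^sub>R (0, 1)) - p x) / s)\<^sup>2) \<partial>cellm)"
        by (intro nn_integral_mono ennreal_leI)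
      also have "\<dots> \<le> (\<integral>\<^sup>+x. ennreal ((g x)\<^sup>2) \<partial>cellm)"
        using s False by (intro dir_deriv_increment_L2[OF pm gm gp pg]) auto
      finally show ?thesis .
    qed (simp flip: zero_prod_def)
    then show "(\<integral>\<^sup>+x. ennreal ((p (x + s *\<^sub>R (0, 1)) - p x)\<^sup>2) * indicator {0..1} s \<partial>cellm) \<le> (\<integral>\<^sup>+x. ennreal ((g x)\<^sup>2) \<partial>cellm) * indicator {0..1} s"
      by (auto simp: indicator_def)
  qed
  also have "\<dots> = (\<integral>\<^sup>+x. ennreal ((g x)\<^sup>2) \<partial>cellm)" by (simp add: nn_integral_cmult_indicator)
  finally show ?thesis .
qed

text \<open>Increments of the mean are integrals of the mean of \<open>g\<close>. The intended case
  is the first component of \<open>u\<close>, whose x1-derivative has mean zero because the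
  divergence vanishes.\<close>

lemma xmean_shift_invariant:
  fixes p g :: "R2 \<Rightarrow> real"
  assumes p: "loc_int p" and g: "loc_int g" and pg: "dir_deriv (1, 0) p g"
    and g0: "AE x1 in lborel. xmean g x1 = 0" and t: "t \<ge> 0"
  shows "AE x1 in lborel. xmean p (x1 + t) = xmean p x1"
proof -
  have [measurable]: "p \<in> borel_measurable (borel \<Otimes>\<^sub>M borel)" "g \<in> borel_measurable (borel \<Otimes>\<^sub>M borel)"
    using p g by (simp_all add: borel_prod loc_int_def)
  have "AE x in lborel \<Otimes>\<^sub>M lborel. p (x + t *\<^sub>R (1, 0)) - p x = (LINT s:{0..t}|lborel. g (x + s *\<^sub>R (1, 0)))"
  proof -
    have "AE x in lborel. p (x + t *\<^sub>R (1, 0)) - p x = (LINT s:{0..t}|lborel. g (x + s *\<^sub>R (1, 0)))"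
      using pg t unfolding dir_deriv_def by simp
    then show ?thesis by (simp only: lborel_prod)
  qed
  then have "AE x1 in lborel. AE x2 in lborel. p ((x1, x2) + t *\<^sub>R (1, 0)) - p (x1, x2) = (LINT s:{0..t}|lborel. g ((x1, x2) + s *\<^sub>R (1, 0)))"
    by (rule lborel_pair.AE_pair)
  moreover note AE_slice_integrable[OF p] AE_shift[OF AE_slice_integrable[OF p], of t]
  ultimately show ?thesis
  proof eventually_elim
    case (elim x1)
    have 1: "integrable (lborel \<Otimes>\<^sub>M lborel) (\<lambda>(s, r). indicator {0..t} s * (indicator {0..1} r * g (x1 + s, r)))"
    proof -
      define h where "h = (\<lambda>x. indicator {x1..x1 + t} (fst x) * (indicator {0..1} (snd x) * g x))"
      have hm[measurable]: "h \<in> borel_measurable borel"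
        using loc_int_measurable[OF g] unfolding h_def by measurable
      have "integrable lborel h"
        using loc_int_rectangle[OF g, of x1 "x1 + t" 0 1] by (simp add: lborel_prod case_prod_unfold h_def)
      then have "integrable lborel (\<lambda>x. h (x + (x1, 0)))" by (simp add: integrable_shift)
      moreover have "(\<lambda>x. h (x + (x1, 0))) = (\<lambda>(s, r). indicator {0..t} s * (indicator {0..1} r * g (x1 + s, r)))"
        by (auto simp: h_def indicator_def add.commute)
      ultimately show ?thesis by (simp add: lborel_prod)
    qed
    have "xmean p (x1 + t) - xmean p x1 = (LINT r:{0..1}|lborel. p (x1 + t, r) - p (x1, r))"
      unfolding xmean_def using elim by (subst set_integral_diff(2)) auto
    also have "\<dots> = (\<integral>r. (\<integral>s. indicator {0..t} s * (indicator {0..1} r * g (x1 + s, r)) \<partial>lborel) \<partial>lborel)"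
      unfolding set_lebesgue_integral_def
    proof (rule integral_cong_AE)
      show "AE r in lborel. indicator {0..1} r *\<^sub>R (p (x1 + t, r) - p (x1, r)) = (\<integral>s. indicator {0..t} s * (indicator {0..1} r * g (x1 + s, r)) \<partial>lborel)"
        using elim(1)
      proof eventually_elim
        case (elim r)
        then have "p (x1 + t, r) - p (x1, r) = (\<integral>s. indicator {0..t} s * g (x1 + s, r) \<partial>lborel)"
          by (simp add: set_lebesgue_integral_def)
        then show ?case by (cases "r \<in> {0..1}") auto
      qed
    qed measurable
    also have "\<dots> = (\<integral>s. (\<integral>r. indicator {0..t} s * (indicator {0..1} r * g (x1 + s, r)) \<partial>lborel) \<partial>lborel)"
      using lborel_pair.Fubini_integral[OF 1] by simp
    also have "\<dots> = (\<integral>s. indicator {0..t} s * xmean g (s + x1) \<partial>lborel)"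
      by (simp add: xmean_def set_lebesgue_integral_def add.commute)
    also have "\<dots> = 0"
      by (rule integral_eq_zero_AE) (use AE_shift[OF g0, of x1] in \<open>auto elim: eventually_mono\<close>)
    finally show ?case by simp
  qed
qed

text \<open>The time that the strip [c, c + 1], moving right with unit speed during [0, t], spends
  over \<open>x1\<close>.\<close>

definition sweep :: "real \<Rightarrow> real \<Rightarrow> real \<Rightarrow> real" where
  "sweep c t x1 = (LINT s:{0..t}|lborel. indicator {c..c+1} (x1 - s))"

lemma sweep_bounds:
  assumes "t \<ge> 0"
  shows "0 \<le> sweep c t x1" "sweep c t x1 \<le> 1"
proof -
  \<comment> \<open>The strip has unit width, so it covers a given abscissa for a time at most 1,
    however long the motion lasts.\<close>
  have eq: "sweep c t x1 = measure lborel ({0..t} \<inter> {x1 - c - 1..x1 - c})"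
  proof -
    have "(\<lambda>s. indicator {0..t} s *\<^sub>R indicat_real {c..c+1} (x1 - s)) = indicat_real ({0..t} \<inter> {x1 - c - 1..x1 - c})"
      by (rule ext) (auto simp: indicator_def)
    then show ?thesis by (simp add: sweep_def set_lebesgue_integral_def)
  qed
  show "0 \<le> sweep c t x1" by (simp add: eq)
  have "measure lborel ({0..t} \<inter> {x1 - c - 1..x1 - c}) \<le> measure lborel {x1 - c - 1..x1 - c}"
    by (rule measure_mono_fmeasurable) (auto simp: fmeasurable_def emeasure_lborel_Icc_eq)
  then show "sweep c t x1 \<le> 1" by (simp add: eq)
qed

lemma flux_identity:
  fixes P G :: "R2 \<Rightarrow> real"
  assumes [measurable]: "P \<in> borel_measurable borel" "G \<in> borel_measurable borel"
    and pP: "periodic2 P" and pG: "periodic2 G" and PG: "dir_deriv e P G" and e: "fst e = 1" and t: "t \<ge> 0"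
    and iP: "\<And>a b. integrable cellm (\<lambda>x. indicator {a..b} (fst x) * P x)"
    and iG: "\<And>a b. integrable cellm (\<lambda>x. indicator {a..b} (fst x) * G x)"
  shows "(\<integral>x. indicator {c+t..c+1+t} (fst x) * P x \<partial>cellm) - (\<integral>x. indicator {c..c+1} (fst x) * P x \<partial>cellm) = (\<integral>x. sweep c t (fst x) * G x \<partial>cellm)"
    and "integrable cellm (\<lambda>x. sweep c t (fst x) * G x)"
proof -
  let ?I = "indicat_real {c..c+1}"
  let ?J = "\<lambda>(s, x). indicat_real {0..t} s * (?I (fst x) * G (x + s *\<^sub>R e))"
  let ?K = "\<lambda>(s, x). indicat_real {0..t} s * (?I (fst x - s) * G x)"
  have K: "integrable (lborel \<Otimes>\<^sub>M cellm) ?K"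
  proof (rule Bochner_Integration.integrable_bound[where f="\<lambda>(s, x). indicat_real {0..t} s * norm (indicat_real {c..c+1+t} (fst x) * G x)"])
    show "integrable (lborel \<Otimes>\<^sub>M cellm) (\<lambda>(s, x). indicat_real {0..t} s * norm (indicat_real {c..c+1+t} (fst x) * G x))"
    proof (rule lborel_cellm.Fubini_integrable)
      show "integrable lborel (\<lambda>s. \<integral>x. norm (case (s, x) of (s, x) \<Rightarrow> indicat_real {0..t} s * norm (indicat_real {c..c+1+t} (fst x) * G x)) \<partial>cellm)"
        by (simp add: abs_mult emeasure_lborel_Icc_eq)
      show "AE s in lborel. integrable cellm (\<lambda>x. case (s, x) of (s, x) \<Rightarrow> indicat_real {0..t} s * norm (indicat_real {c..c+1+t} (fst x) * G x))"
        using iG by (auto intro!: AE_I2 integrable_mult_right integrable_norm simp del: real_norm_def)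
    qed measurable
    show "AE z in lborel \<Otimes>\<^sub>M cellm. norm (?K z) \<le> norm (case z of (s, x) \<Rightarrow> indicat_real {0..t} s * norm (indicat_real {c..c+1+t} (fst x) * G x))"
      by (auto intro!: AE_I2 simp: indicator_def)
  qed measurable
  have eq: "(\<integral>x. f (?J (s, x)) \<partial>cellm) = (\<integral>x. f (?K (s, x)) \<partial>cellm)"
    and ieq: "integrable cellm (\<lambda>x. f (?J (s, x))) \<longleftrightarrow> integrable cellm (\<lambda>x. f (?K (s, x)))"
    if [measurable]: "(f :: real \<Rightarrow> real) \<in> borel_measurable borel" for s f
  proof -
    have pe: "periodic2 (\<lambda>x. f (indicat_real {0..t} s * (?I (fst x - s) * G x)))" using pG by (simp add: periodic2_def)
    show "(\<integral>x. f (?J (s, x)) \<partial>cellm) = (\<integral>x. f (?K (s, x)) \<partial>cellm)"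
      using integral_cellm_shift(2)[OF _ pe, of "s *\<^sub>R e"] e by simp
    show "integrable cellm (\<lambda>x. f (?J (s, x))) \<longleftrightarrow> integrable cellm (\<lambda>x. f (?K (s, x)))"
      using integral_cellm_shift(1)[OF _ pe, of "s *\<^sub>R e"] e by simp
  qed
  have J: "integrable (lborel \<Otimes>\<^sub>M cellm) ?J"
  proof (rule lborel_cellm.Fubini_integrable)
    show "integrable lborel (\<lambda>s. \<integral>x. norm (?J (s, x)) \<partial>cellm)"
      using lborel_cellm.integrable_fst'[OF integrable_norm[OF K]] eq[of norm] by simp
    show "AE s in lborel. integrable cellm (\<lambda>x. ?J (s, x))"
      using lborel_cellm.AE_integrable_fst'[OF K] ieq[of "\<lambda>x. x"] by simp
  qed measurable
  have KC: "(\<integral>s. ?K (s, x) \<partial>lborel) = sweep c t (fst x) * G x" for x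
    by (simp add: sweep_def set_lebesgue_integral_def mult.assoc[symmetric])
  show "integrable cellm (\<lambda>x. sweep c t (fst x) * G x)"
    using lborel_cellm.integrable_snd[of "\<lambda>s x. ?K (s, x)"] K unfolding KC by simp
  have Psh: "integrable cellm (\<lambda>x. ?I (fst x) * P (x + t *\<^sub>R e))"
    and Psh2: "(\<integral>x. ?I (fst x) * P (x + t *\<^sub>R e) \<partial>cellm) = (\<integral>x. indicator {c+t..c+1+t} (fst x) * P x \<partial>cellm)"
  proof -
    have pe: "periodic2 (\<lambda>x. indicat_real {c+t..c+1+t} (fst x) * P x)" using pP by (simp add: periodic2_def)
    have "(\<lambda>x. indicat_real {c+t..c+1+t} (fst (x + t *\<^sub>R e)) * P (x + t *\<^sub>R e)) = (\<lambda>x. ?I (fst x) * P (x + t *\<^sub>R e))"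
      using e by (auto simp: indicator_def)
    then show "integrable cellm (\<lambda>x. ?I (fst x) * P (x + t *\<^sub>R e))"
      "(\<integral>x. ?I (fst x) * P (x + t *\<^sub>R e) \<partial>cellm) = (\<integral>x. indicator {c+t..c+1+t} (fst x) * P x \<partial>cellm)"
      using integral_cellm_shift[OF _ pe, of "t *\<^sub>R e"] iP by simp_all
  qed
  have "(\<integral>x. indicator {c+t..c+1+t} (fst x) * P x \<partial>cellm) - (\<integral>x. ?I (fst x) * P x \<partial>cellm) = (\<integral>x. ?I (fst x) * (P (x + t *\<^sub>R e) - P x) \<partial>cellm)"
    using Psh iP[of c "c+1"] by (simp add: right_diff_distrib Psh2)
  also have "\<dots> = (\<integral>x. (\<integral>s. ?J (s, x) \<partial>lborel) \<partial>cellm)"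
  proof (rule integral_cong_AE)
    have "AE x in cellm. P (x + t *\<^sub>R e) - P x = (LINT s:{0..t}|lborel. G (x + s *\<^sub>R e))"
      using PG t unfolding dir_deriv_def by (intro AE_cellm) simp
    then show "AE x in cellm. ?I (fst x) * (P (x + t *\<^sub>R e) - P x) = (\<integral>s. ?J (s, x) \<partial>lborel)"
    proof eventually_elim
      case (elim x)
      then show ?case by (cases "fst x \<in> {c..c+1}") (auto simp: set_lebesgue_integral_def)
    qed
  qed measurable
  also have "\<dots> = (\<integral>s. (\<integral>x. ?J (s, x) \<partial>cellm) \<partial>lborel)"
    using lborel_cellm.Fubini_integral[of "\<lambda>s x. ?J (s, x)"] J by simp
  also have "\<dots> = (\<integral>s. (\<integral>x. ?K (s, x) \<partial>cellm) \<partial>lborel)"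
    by (rule Bochner_Integration.integral_cong[OF refl]) (rule eq[of "\<lambda>x. x"], measurable)
  also have "\<dots> = (\<integral>x. (\<integral>s. ?K (s, x) \<partial>lborel) \<partial>cellm)"
    using lborel_cellm.Fubini_integral[of "\<lambda>s x. ?K (s, x)"] K by simp
  finally show "(\<integral>x. indicator {c+t..c+1+t} (fst x) * P x \<partial>cellm) - (\<integral>x. indicator {c..c+1} (fst x) * P x \<partial>cellm) = (\<integral>x. sweep c t (fst x) * G x \<partial>cellm)"
    unfolding KC .
qed

section \<open>Strip averages near the two ends of the cylinder\<close>

lemma loc_int_const: "loc_int (\<lambda>x. c)"
  unfolding loc_int_def set_integrable_def
proof (intro conjI ballI impI)
  fix S :: "'a set" assume S: "S \<in> sets borel" "bounded S"
  have "integrable lborel (indicat_real S)" using S emeasure_bounded_finite[OF S(2)] by simp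
  then show "integrable lborel (\<lambda>x. indicat_real S x *\<^sub>R c)" by simp
qed simp

lemma integrable_cellm_local_L2:
  fixes g :: "R2 \<Rightarrow> real"
  assumes [measurable]: "g \<in> borel_measurable borel" and g: "integrable cellm (\<lambda>x. (g x)\<^sup>2)"
  shows "integrable cellm (\<lambda>x. indicator {a..b} (fst x) * g x)"
proof (rule square_integrable_mult)
  from integrable_cellm_local[OF loc_int_const, of a b 1]
  have "integrable cellm (\<lambda>x. indicat_real {a..b} (fst x))" by simp
  moreover have "(\<lambda>x::R2. (indicat_real {a..b} (fst x))\<^sup>2) = (\<lambda>x. indicat_real {a..b} (fst x))" by (auto simp: indicator_def)
  ultimately show "integrable cellm (\<lambda>x. (indicat_real {a..b} (fst x))\<^sup>2)" by simp
qed (use g in auto)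

lemma loc_int_Lipschitz:
  assumes p: "loc_int p" and [measurable]: "F \<in> borel_measurable borel" and L: "\<And>y z. \<bar>F y - F z\<bar> \<le> L * \<bar>y - z\<bar>"
  shows "loc_int (\<lambda>x. F (p x))"
  unfolding loc_int_def
proof (intro conjI ballI impI)
  have [measurable]: "p \<in> borel_measurable borel" using p by measurable
  show "(\<lambda>x. F (p x)) \<in> borel_measurable borel" by measurable
  fix S :: "'a set" assume [measurable]: "S \<in> sets borel" and S: "bounded S"
  have 1: "integrable lborel (\<lambda>x. L * norm (indicator S x *\<^sub>R p x) + \<bar>F 0\<bar> * indicator S x)"
    using p S emeasure_bounded_finite[OF S]
    by (intro Bochner_Integration.integrable_add integrable_mult_right integrable_norm) (auto simp: loc_int_def set_integrable_def)
  show "set_integrable lborel S (\<lambda>x. F (p x))" unfolding set_integrable_def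
  proof (rule Bochner_Integration.integrable_bound[OF 1])
    show "AE x in lborel. norm (indicator S x *\<^sub>R F (p x)) \<le> norm (L * norm (indicator S x *\<^sub>R p x) + \<bar>F 0\<bar> * indicator S x)"
    proof (rule AE_I2)
      fix x
      have "\<bar>F (p x)\<bar> \<le> L * \<bar>p x\<bar> + \<bar>F 0\<bar>" using L[of "p x" 0] by simp
      moreover have "0 \<le> L * \<bar>p x\<bar>" using L[of "p x" 0] by (smt (verit) abs_ge_zero)
      ultimately show "norm (indicator S x *\<^sub>R F (p x)) \<le> norm (L * norm (indicator S x *\<^sub>R p x) + \<bar>F 0\<bar> * indicator S x)"
        by (auto simp: indicator_def)
    qed
  qed measurable
qed

text \<open>Shifts by natural numbers carry almost every point into the region controlled by the
  essential limit, at the price of countably many null sets.\<close>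

lemma xmean_eq_ess_limit:
  fixes m :: "real \<Rightarrow> real"
  assumes inv: "\<And>t. t \<ge> 0 \<Longrightarrow> AE x1 in lborel. m (x1 + t) = m x1"
    and lim: "\<And>\<epsilon>. \<epsilon> > 0 \<Longrightarrow> \<exists>R::real. AE t in lborel. t > R \<longrightarrow> \<bar>m t - a\<bar> < \<epsilon>"
  shows "AE x1 in lborel. m x1 = (a::real)"
proof -
  have "AE x1 in lborel. \<bar>m x1 - a\<bar> < 1 / real (Suc k)" for k
  proof -
    obtain R where R: "AE t in lborel. t > R \<longrightarrow> \<bar>m t - a\<bar> < 1 / real (Suc k)" using lim[of "1 / real (Suc k)"] by auto
    have "AE x in lborel. \<forall>n::nat. (x + real n > R \<longrightarrow> \<bar>m (x + real n) - a\<bar> < 1 / real (Suc k))"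
      by (subst AE_all_countable) (intro allI AE_shift[OF R])
    moreover have "AE x in lborel. \<forall>n::nat. m (x + real n) = m x"
      by (subst AE_all_countable) (intro allI inv, simp)
    ultimately show ?thesis
    proof eventually_elim
      case (elim x)
      obtain n :: nat where "real n > R - x" using reals_Archimedean2 by blast
      then have "x + real n > R" by simp
      then show ?case using elim by metis
    qed
  qed
  then have "AE x1 in lborel. \<forall>k. \<bar>m x1 - a\<bar> < 1 / real (Suc k)" by (subst AE_all_countable) auto
  then show ?thesis
  proof eventually_elim
    case (elim x)
    have "(\<lambda>k. 1 / real (Suc k)) \<longlonglongrightarrow> 0" by (rule LIMSEQ_Suc[OF lim_1_over_n])
    then have "\<bar>m x - a\<bar> \<le> 0" using elim by (intro LIMSEQ_le_const) (auto intro: less_imp_le)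
    then show ?case by simp
  qed
qed

lemma strip_measure:
  "integrable cellm (\<lambda>x. indicat_real {c..c + 1} (fst x))" "(\<integral>x. indicat_real {c..c + 1} (fst x) \<partial>cellm) = 1"
proof -
  show "integrable cellm (\<lambda>x. indicat_real {c..c + 1} (fst x))"
    using integrable_cellm_local[OF loc_int_const, of c "c + 1" 1] by simp
  have "(\<integral>\<^sup>+x. ennreal (indicat_real {c..c + 1} (fst x)) \<partial>cellm) = (\<integral>\<^sup>+x1. indicator {c..c + 1} x1 \<partial>lborel)"
  proof -
    have m: "(\<lambda>x::R2. ennreal (indicat_real {c..c + 1} (fst x))) \<in> borel_measurable borel" by measurable
    have "(\<integral>\<^sup>+x. ennreal (indicat_real {c..c + 1} (fst x)) \<partial>cellm) = (\<integral>\<^sup>+x1. (\<integral>\<^sup>+x2. ennreal (indicat_real {c..c + 1} x1) * indicator {0..<1::real} x2 \<partial>lborel) \<partial>lborel)"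
      by (simp only: nn_integral_cellm_iterated[OF m] fst_conv)
    also have "\<dots> = (\<integral>\<^sup>+x1. ennreal (indicat_real {c..c + 1} x1) \<partial>lborel)" by (simp add: nn_integral_cmult_indicator)
    finally show ?thesis by (simp add: ennreal_indicator)
  qed
  also have "\<dots> = 1" by simp
  finally show "(\<integral>x. indicat_real {c..c + 1} (fst x) \<partial>cellm) = 1" by (subst integral_eq_nn_integral) auto
qed

text \<open>Far out in the cylinder a Lipschitz function of \<open>u\<close> averages to its value at the limit:
  the fluctuation is square integrable by the Poincare inequality.\<close>
lemma strip_average_limit:
  fixes p :: "R2 \<Rightarrow> real"
  assumes p: "loc_int p" and fl: "integrable cellm (\<lambda>x. (p x - m (fst x))\<^sup>2)" and [measurable]: "m \<in> borel_measurable borel"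
    and lim: "\<And>\<epsilon>. \<epsilon> > 0 \<Longrightarrow> \<forall>\<^sub>F n in sequentially. AE t in lborel. t \<in> {c n..c n + 1} \<longrightarrow> \<bar>m t - l\<bar> < \<epsilon>"
    and c: "filterlim (\<lambda>n. \<bar>c n\<bar>) at_top sequentially"
  shows "(\<lambda>n. \<integral>x. indicator {c n..c n + 1} (fst x) * \<bar>p x - l\<bar> \<partial>cellm) \<longlonglongrightarrow> 0"
proof -
  have [measurable]: "p \<in> borel_measurable borel" using p by measurable
  let ?S = "\<lambda>n (x::R2). indicat_real {c n..c n + 1} (fst x)"
  define q where "q = (\<lambda>n. \<integral>x. ?S n x * (p x - m (fst x))\<^sup>2 \<partial>cellm)"
  have "q \<longlonglongrightarrow> (\<integral>x. 0 \<partial>cellm)" unfolding q_def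
  proof (rule integral_dominated_convergence[OF _ _ fl])
    show "AE x in cellm. (\<lambda>n. ?S n x * (p x - m (fst x))\<^sup>2) \<longlonglongrightarrow> 0"
    proof (rule AE_I2)
      fix x :: R2
      have "\<forall>\<^sub>F n in sequentially. \<bar>c n\<bar> \<ge> \<bar>fst x\<bar> + 2" using c by (simp add: filterlim_at_top)
      then have "\<forall>\<^sub>F n in sequentially. ?S n x * (p x - m (fst x))\<^sup>2 = 0"
        by eventually_elim (auto simp: indicator_def)
      then show "(\<lambda>n. ?S n x * (p x - m (fst x))\<^sup>2) \<longlonglongrightarrow> 0" by (rule tendsto_eventually)
    qed
  qed (auto simp: indicator_def)
  then have q: "q \<longlonglongrightarrow> 0" by simp
  note one = strip_measure[of "c n" for n]
  have ps: "integrable cellm (\<lambda>x. ?S n x * \<bar>p x - l\<bar>)" for n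
  proof -
    have "loc_int (\<lambda>x. \<bar>p x - l\<bar>)" by (rule loc_int_Lipschitz[OF p, of "\<lambda>y. \<bar>y - l\<bar>" 1]) auto
    then show ?thesis by (rule integrable_cellm_local)
  qed
  show ?thesis
  proof (rule tendstoI)
    fix \<epsilon> :: real assume e: "\<epsilon> > 0"
    have "\<forall>\<^sub>F n in sequentially. q n < (\<epsilon> / 4)\<^sup>2" by (rule order_tendstoD(2)[OF q]) (use e in simp)
    moreover have "\<forall>\<^sub>F n in sequentially. AE t in lborel. t \<in> {c n..c n + 1} \<longrightarrow> \<bar>m t - l\<bar> < \<epsilon> / 4" using lim[of "\<epsilon> / 4"] e by simp
    ultimately show "\<forall>\<^sub>F n in sequentially. dist (\<integral>x. ?S n x * \<bar>p x - l\<bar> \<partial>cellm) 0 < \<epsilon>"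
    proof eventually_elim
      case (elim n)
      have i2: "integrable cellm (\<lambda>x. ?S n x * (p x - m (fst x))\<^sup>2)"
        by (rule Bochner_Integration.integrable_bound[OF fl]) (auto simp: indicator_def)
      have "(\<integral>x. ?S n x * \<bar>p x - l\<bar> \<partial>cellm) \<le> (\<integral>x. (\<epsilon> / 2) * ?S n x + (1 / \<epsilon>) * (?S n x * (p x - m (fst x))\<^sup>2) \<partial>cellm)"
      proof (rule integral_mono_AE[OF ps])
        show "integrable cellm (\<lambda>x. (\<epsilon> / 2) * ?S n x + (1 / \<epsilon>) * (?S n x * (p x - m (fst x))\<^sup>2))"
          by (intro Bochner_Integration.integrable_add integrable_mult_right one i2)
        have "AE x in cellm. fst x \<in> {c n..c n + 1} \<longrightarrow> \<bar>m (fst x) - l\<bar> < \<epsilon> / 4"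
          by (intro AE_cellm AE_fst elim(2))
        then show "AE x in cellm. ?S n x * \<bar>p x - l\<bar> \<le> (\<epsilon> / 2) * ?S n x + (1 / \<epsilon>) * (?S n x * (p x - m (fst x))\<^sup>2)"
        proof eventually_elim
          case (elim x)
          define y where "y = \<bar>p x - m (fst x)\<bar>"
          have y2: "y\<^sup>2 = (p x - m (fst x))\<^sup>2" by (simp add: y_def)
          \<comment> \<open>Young's inequality y <= \<epsilon>/4 + y^2/\<epsilon> trades the
            fluctuation for its square, whose strip integral \<open>q n\<close> tends to zero. The
            threshold (\<epsilon>/4)^2 for \<open>q n\<close> makes the last term smaller than
            \<epsilon>/16.\<close>
          have "0 \<le> (y - \<epsilon> / 2)\<^sup>2" by simp
          then have "y * \<epsilon> \<le> (\<epsilon> / 2)\<^sup>2 + y\<^sup>2" by (simp add: power2_diff algebra_simps)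
          then have "y \<le> \<epsilon> / 4 + (1 / \<epsilon>) * y\<^sup>2" using e by (simp add: field_simps power2_eq_square)
          moreover have "\<bar>p x - l\<bar> \<le> y + \<epsilon> / 4" if "fst x \<in> {c n..c n + 1}"
            using elim that unfolding y_def by linarith
          ultimately have "\<bar>p x - l\<bar> \<le> \<epsilon> / 2 + (1 / \<epsilon>) * (p x - m (fst x))\<^sup>2" if "fst x \<in> {c n..c n + 1}"
            using that unfolding y2 by fastforce
          then show ?case by (auto simp: indicator_def)
        qed
      qed
      also have "\<dots> = \<epsilon> / 2 + (1 / \<epsilon>) * q n"
        using one i2 by (simp add: q_def)
      also have "\<dots> < \<epsilon>"
      proof -
        have "(1 / \<epsilon>) * q n < (1 / \<epsilon>) * (\<epsilon> / 4)\<^sup>2" using elim e by (intro mult_strict_left_mono) auto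
        also have "\<dots> = \<epsilon> / 16" using e by (simp add: power2_eq_square)
        finally show ?thesis using e by linarith
      qed
      finally show ?case by (simp add: Bochner_Integration.integral_nonneg indicator_def)
    qed
  qed
qed

lemma strip_Lipschitz_limit:
  fixes p :: "R2 \<Rightarrow> real"
  assumes p: "loc_int p" and [measurable]: "F \<in> borel_measurable borel" and L: "\<And>y z. \<bar>F y - F z\<bar> \<le> L * \<bar>y - z\<bar>"
    and lim: "(\<lambda>n. \<integral>x. indicator {c n..c n + 1} (fst x) * \<bar>p x - l\<bar> \<partial>cellm) \<longlonglongrightarrow> 0"
  shows "(\<lambda>n. \<integral>x. indicator {c n..c n + 1} (fst x) * F (p x) \<partial>cellm) \<longlonglongrightarrow> F l"
proof -
  have [measurable]: "p \<in> borel_measurable borel" using p by measurable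
  let ?S = "\<lambda>n (x::R2). indicat_real {c n..c n + 1} (fst x)"
  have iF: "integrable cellm (\<lambda>x. ?S n x * F (p x))" for n by (intro integrable_cellm_local loc_int_Lipschitz[OF p _ L]) measurable
  have ip: "integrable cellm (\<lambda>x. ?S n x * \<bar>p x - l\<bar>)" for n
    by (intro integrable_cellm_local loc_int_Lipschitz[OF p, of "\<lambda>y. \<bar>y - l\<bar>" 1]) auto
  note one = strip_measure[of "c n" for n]
  have "norm ((\<integral>x. ?S n x * F (p x) \<partial>cellm) - F l) \<le> L * (\<integral>x. ?S n x * \<bar>p x - l\<bar> \<partial>cellm)" for n
  proof -
    have "(\<integral>x. ?S n x * F (p x) \<partial>cellm) - F l = (\<integral>x. ?S n x * F (p x) - ?S n x * F l \<partial>cellm)"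
      using iF one by simp
    then have "\<bar>(\<integral>x. ?S n x * F (p x) \<partial>cellm) - F l\<bar> = \<bar>\<integral>x. ?S n x * F (p x) - ?S n x * F l \<partial>cellm\<bar>" by (rule arg_cong)
    also have "\<dots> \<le> (\<integral>x. \<bar>?S n x * F (p x) - ?S n x * F l\<bar> \<partial>cellm)"
      by (rule integral_abs_bound)
    also have "\<dots> \<le> (\<integral>x. L * (?S n x * \<bar>p x - l\<bar>) \<partial>cellm)"
    proof (rule integral_mono)
      fix x :: R2
      have "\<bar>?S n x * F (p x) - ?S n x * F l\<bar> = ?S n x * \<bar>F (p x) - F l\<bar>"
        unfolding right_diff_distrib[symmetric] abs_mult by simp
      also have "\<dots> \<le> ?S n x * (L * \<bar>p x - l\<bar>)" by (intro mult_left_mono L) simp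
      finally show "\<bar>?S n x * F (p x) - ?S n x * F l\<bar> \<le> L * (?S n x * \<bar>p x - l\<bar>)" unfolding mult.left_commute[of L] .
    next
      show "integrable cellm (\<lambda>x. \<bar>?S n x * F (p x) - ?S n x * F l\<bar>)"
        by (intro integrable_abs Bochner_Integration.integrable_diff iF integrable_mult_left one)
      show "integrable cellm (\<lambda>x. L * (?S n x * \<bar>p x - l\<bar>))" by (intro integrable_mult_right ip)
    qed
    finally show ?thesis by simp
  qed
  from Lim_null_comparison[OF always_eventually[OF allI[OF this]]]
  have "(\<lambda>n. (\<integral>x. ?S n x * F (p x) \<partial>cellm) - F l) \<longlonglongrightarrow> 0"
    using tendsto_mult[OF tendsto_const[of L] lim] by simp
  then show ?thesis by (simp add: LIM_zero_iff)
qed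

lemma Lipschitz_of_bounded_derivative:
  fixes F f :: "real \<Rightarrow> real"
  assumes "\<And>y. (F has_real_derivative f y) (at y)" "\<And>y. \<bar>f y\<bar> \<le> L"
  shows "\<bar>F y - F z\<bar> \<le> L * \<bar>y - z\<bar>"
proof -
  have "norm (F y - F z) \<le> L * norm (y - z)"
    by (rule field_differentiable_bound[of UNIV F f L]) (use assms in \<open>auto intro: has_field_derivative_at_within\<close>)
  then show ?thesis by simp
qed

text \<open>Each of \<open>F\<close> and \<open>H\<close> is differentiated along its own
  characteristic direction only. Subtracting the two flux identities produces the density (f + h) s,
  bounded by s^2/2 + (f + h)^2/2, and the strip averages at the ends converge to the values of
  \<open>F\<close> and \<open>H\<close> at the limits.\<close>

lemma calibration_bound:
  fixes u1 u2 s Wu :: "R2 \<Rightarrow> real" and F f H h :: "real \<Rightarrow> real"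
  assumes u: "loc_int u1" "loc_int u2" and pu: "periodic2 u1" "periodic2 u2"
    and [measurable]: "s \<in> borel_measurable borel" and ps: "periodic2 s" and s2: "integrable cellm (\<lambda>x. (s x)\<^sup>2)"
    and d1: "dir_deriv (1, 1) (\<lambda>x. u1 x + u2 x) s" and d2: "dir_deriv (1, -1) (\<lambda>x. u1 x - u2 x) (\<lambda>x. - s x)"
    and F: "\<And>y. (F has_real_derivative f y) (at y)" and f: "continuous_on UNIV f" "\<And>y. \<bar>f y\<bar> \<le> L"
    and H: "\<And>y. (H has_real_derivative h y) (at y)" and h: "continuous_on UNIV h" "\<And>y. \<bar>h y\<bar> \<le> L"
    and Wi: "integrable cellm Wu" and W: "\<And>x. (f (u1 x + u2 x) + h (u1 x - u2 x))\<^sup>2 \<le> 2 * Wu x"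
    and lp: "(\<lambda>n. \<integral>x. indicator {real n..real n + 1} (fst x) * \<bar>u1 x - a\<bar> \<partial>cellm) \<longlonglongrightarrow> 0"
       "(\<lambda>n. \<integral>x. indicator {real n..real n + 1} (fst x) * \<bar>u2 x - bp\<bar> \<partial>cellm) \<longlonglongrightarrow> 0"
    and lm: "(\<lambda>n. \<integral>x. indicator {- real n - 1..- real n - 1 + 1} (fst x) * \<bar>u1 x - a\<bar> \<partial>cellm) \<longlonglongrightarrow> 0"
       "(\<lambda>n. \<integral>x. indicator {- real n - 1..- real n - 1 + 1} (fst x) * \<bar>u2 x - bm\<bar> \<partial>cellm) \<longlonglongrightarrow> 0"
  shows "(F (a + bp) - H (a - bp)) - (F (a + bm) - H (a - bm)) \<le> (\<integral>x. (s x)\<^sup>2 / 2 + Wu x \<partial>cellm)"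
proof -
  have [measurable]: "u1 \<in> borel_measurable borel" "u2 \<in> borel_measurable borel" using u by measurable
  have [measurable]: "f \<in> borel_measurable borel" "h \<in> borel_measurable borel"
    using f(1) h(1) by (auto intro: borel_measurable_continuous_onI)
  have Fc: "continuous_on UNIV F" "continuous_on UNIV H"
    using F H by (meson DERIV_continuous_on has_field_derivative_at_within)+
  then have [measurable]: "F \<in> borel_measurable borel" "H \<in> borel_measurable borel"
    by (auto intro: borel_measurable_continuous_onI)
  note FL = Lipschitz_of_bounded_derivative[OF F f(2)] and HL = Lipschitz_of_bounded_derivative[OF H h(2)]
  have lin: "loc_int (\<lambda>x. u1 x + k * u2 x)" for k
    using u unfolding loc_int_def set_integrable_def
    by (auto simp: distrib_left mult.left_commute intro!: Bochner_Integration.integrable_add)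
  have lp': "loc_int (\<lambda>x. u1 x + u2 x)" "loc_int (\<lambda>x. u1 x - u2 x)" using lin[of 1] lin[of "-1"] by simp_all
  \<comment> \<open>One statement for both combinations and both ends: k = 1 gives u1 + u2 and k =
    -1 gives u1 - u2.\<close>
  have lim: "(\<lambda>n. \<integral>x. indicator {c n..c n + 1} (fst x) * F' (u1 x + k * u2 x) \<partial>cellm) \<longlonglongrightarrow> F' (a + k * l)"
    if k: "\<bar>k\<bar> = 1" and F'm: "F' \<in> borel_measurable borel" and F'L: "\<And>y z. \<bar>F' y - F' z\<bar> \<le> L * \<bar>y - z\<bar>"
    and l1: "(\<lambda>n. \<integral>x. indicator {c n..c n + 1} (fst x) * \<bar>u1 x - a\<bar> \<partial>cellm) \<longlonglongrightarrow> 0"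
    and l2: "(\<lambda>n. \<integral>x. indicator {c n..c n + 1} (fst x) * \<bar>u2 x - l\<bar> \<partial>cellm) \<longlonglongrightarrow> 0"
    for k l :: real and F' :: "real \<Rightarrow> real" and c :: "nat \<Rightarrow> real"
  proof (rule strip_Lipschitz_limit[OF lin F'm F'L])
    let ?S = "\<lambda>n (x::R2). indicat_real {c n..c n + 1} (fst x)"
    have i1: "integrable cellm (\<lambda>x. ?S n x * \<bar>q x - b\<bar>)" if "loc_int q" for n q b
      by (intro integrable_cellm_local loc_int_Lipschitz[OF that, of "\<lambda>y. \<bar>y - b\<bar>" 1]) auto
    have "norm (\<integral>x. ?S n x * \<bar>u1 x + k * u2 x - (a + k * l)\<bar> \<partial>cellm) \<le> (\<integral>x. ?S n x * \<bar>u1 x - a\<bar> \<partial>cellm) + (\<integral>x. ?S n x * \<bar>u2 x - l\<bar> \<partial>cellm)" for n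
    proof -
      have "(\<integral>x. ?S n x * \<bar>u1 x + k * u2 x - (a + k * l)\<bar> \<partial>cellm) \<le> (\<integral>x. ?S n x * \<bar>u1 x - a\<bar> + ?S n x * \<bar>u2 x - l\<bar> \<partial>cellm)"
      proof (rule integral_mono)
        fix x :: R2
        have "\<bar>k * (u2 x - l)\<bar> = \<bar>u2 x - l\<bar>" using k by (simp add: abs_mult)
        then have "\<bar>u1 x + k * u2 x - (a + k * l)\<bar> \<le> \<bar>u1 x - a\<bar> + \<bar>u2 x - l\<bar>" by (simp add: algebra_simps)
        then show "?S n x * \<bar>u1 x + k * u2 x - (a + k * l)\<bar> \<le> ?S n x * \<bar>u1 x - a\<bar> + ?S n x * \<bar>u2 x - l\<bar>" by (auto simp: indicator_def)
      qed (intro Bochner_Integration.integrable_add i1 lin u)+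
      also have "\<dots> = (\<integral>x. ?S n x * \<bar>u1 x - a\<bar> \<partial>cellm) + (\<integral>x. ?S n x * \<bar>u2 x - l\<bar> \<partial>cellm)"
        by (intro Bochner_Integration.integral_add i1 u)
      finally show ?thesis by (simp add: Bochner_Integration.integral_nonneg)
    qed
    from Lim_null_comparison[OF always_eventually[OF allI[OF this]]]
    show "(\<lambda>n. \<integral>x. ?S n x * \<bar>u1 x + k * u2 x - (a + k * l)\<bar> \<partial>cellm) \<longlonglongrightarrow> 0"
      using tendsto_add[OF l1 l2] by simp
  qed
  note Fp = lim[of 1, OF _ _ FL lp, simplified] and Hp = lim[of "-1", OF _ _ HL lp, simplified]
    and Fm = lim[of 1, OF _ _ FL lm, simplified] and Hm = lim[of "-1", OF _ _ HL lm, simplified]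
  let ?p = "\<lambda>n (x::R2). indicat_real {real n..real n + 1} (fst x)"
  let ?m = "\<lambda>n (x::R2). indicat_real {- real n - 1..- real n} (fst x)"
  define D where "D = (\<lambda>n. ((\<integral>x. ?p n x * F (u1 x + u2 x) \<partial>cellm) - (\<integral>x. ?p n x * H (u1 x - u2 x) \<partial>cellm))
      - ((\<integral>x. ?m n x * F (u1 x + u2 x) \<partial>cellm) - (\<integral>x. ?m n x * H (u1 x - u2 x) \<partial>cellm)))"
  have D: "D \<longlonglongrightarrow> (F (a + bp) - H (a - bp)) - (F (a + bm) - H (a - bm))"
    unfolding D_def using Fp Hp Fm Hm by (intro tendsto_diff) simp_all
  have "D n \<le> (\<integral>x. (s x)\<^sup>2 / 2 + Wu x \<partial>cellm)" for n
  proof -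
    \<comment> \<open>With these values the strip [-n - 1, -n] is swept exactly onto
      [n, n + 1].\<close>
    let ?c = "- real n - 1" and ?t = "2 * real n + 1"
    have gs: "integrable cellm (\<lambda>x. (G x * s x)\<^sup>2)" if [measurable]: "G \<in> borel_measurable borel" and G: "\<And>x. \<bar>G x\<bar> \<le> L" for G :: "R2 \<Rightarrow> real"
    proof (rule Bochner_Integration.integrable_bound[OF integrable_mult_right[OF s2, of "L\<^sup>2"]])
      show "AE x in cellm. norm ((G x * s x)\<^sup>2) \<le> norm (L\<^sup>2 * (s x)\<^sup>2)"
      proof (rule AE_I2)
        fix x
        have "(G x)\<^sup>2 \<le> L\<^sup>2" using G[of x] by (metis abs_ge_zero power2_abs power_mono)
        then show "norm ((G x * s x)\<^sup>2) \<le> norm (L\<^sup>2 * (s x)\<^sup>2)" by (simp add: power_mult_distrib mult_right_mono)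
      qed
    qed measurable
    have iG: "integrable cellm (\<lambda>x. indicator {a..b} (fst x) * (G x * s x))" if [measurable]: "G \<in> borel_measurable borel" and G: "\<And>x. \<bar>G x\<bar> \<le> L" for G :: "R2 \<Rightarrow> real" and a b
      by (rule integrable_cellm_local_L2[OF _ gs[OF that]]) measurable
    have c1: "dir_deriv (1, 1) (\<lambda>x. F (u1 x + u2 x)) (\<lambda>x. f (u1 x + u2 x) * s x)"
      by (rule dir_deriv_chain[OF _ _ d1 F f(1)]) measurable
    have c2: "dir_deriv (1, -1) (\<lambda>x. H (u1 x - u2 x)) (\<lambda>x. h (u1 x - u2 x) * (- s x))"
      by (rule dir_deriv_chain[OF _ _ d2 H h(1)]) measurable
    have fl1: "(\<integral>x. indicator {?c + ?t..?c + 1 + ?t} (fst x) * F (u1 x + u2 x) \<partial>cellm) - (\<integral>x. indicator {?c..?c + 1} (fst x) * F (u1 x + u2 x) \<partial>cellm) = (\<integral>x. sweep ?c ?t (fst x) * (f (u1 x + u2 x) * s x) \<partial>cellm)"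
      and fi1: "integrable cellm (\<lambda>x. sweep ?c ?t (fst x) * (f (u1 x + u2 x) * s x))"
    proof -
      have a: "periodic2 (\<lambda>x. F (u1 x + u2 x))" "periodic2 (\<lambda>x. f (u1 x + u2 x) * s x)" using pu ps by (simp_all add: periodic2_def)
      have b: "integrable cellm (\<lambda>x. indicator {a..b} (fst x) * F (u1 x + u2 x))" for a b
        by (intro integrable_cellm_local loc_int_Lipschitz[OF lp'(1) _ FL]) measurable
      have c: "integrable cellm (\<lambda>x. indicator {a..b} (fst x) * (f (u1 x + u2 x) * s x))" for a b by (intro iG f) measurable
      show "(\<integral>x. indicator {?c + ?t..?c + 1 + ?t} (fst x) * F (u1 x + u2 x) \<partial>cellm) - (\<integral>x. indicator {?c..?c + 1} (fst x) * F (u1 x + u2 x) \<partial>cellm) = (\<integral>x. sweep ?c ?t (fst x) * (f (u1 x + u2 x) * s x) \<partial>cellm)"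
        "integrable cellm (\<lambda>x. sweep ?c ?t (fst x) * (f (u1 x + u2 x) * s x))"
        by (rule flux_identity[OF _ _ a c1 _ _ b c]; simp)+
    qed
    have fl2: "(\<integral>x. indicator {?c + ?t..?c + 1 + ?t} (fst x) * H (u1 x - u2 x) \<partial>cellm) - (\<integral>x. indicator {?c..?c + 1} (fst x) * H (u1 x - u2 x) \<partial>cellm) = (\<integral>x. sweep ?c ?t (fst x) * (h (u1 x - u2 x) * (- s x)) \<partial>cellm)"
      and fi2: "integrable cellm (\<lambda>x. sweep ?c ?t (fst x) * (h (u1 x - u2 x) * (- s x)))"
    proof -
      have a: "periodic2 (\<lambda>x. H (u1 x - u2 x))" "periodic2 (\<lambda>x. h (u1 x - u2 x) * (- s x))" using pu ps by (simp_all add: periodic2_def)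
      have b: "integrable cellm (\<lambda>x. indicator {a..b} (fst x) * H (u1 x - u2 x))" for a b
        by (intro integrable_cellm_local loc_int_Lipschitz[OF lp'(2) _ HL]) measurable
      have c: "integrable cellm (\<lambda>x. indicator {a..b} (fst x) * (h (u1 x - u2 x) * (- s x)))" for a b
        using iG[of "\<lambda>x. - h (u1 x - u2 x)" a b] h by simp
      show "(\<integral>x. indicator {?c + ?t..?c + 1 + ?t} (fst x) * H (u1 x - u2 x) \<partial>cellm) - (\<integral>x. indicator {?c..?c + 1} (fst x) * H (u1 x - u2 x) \<partial>cellm) = (\<integral>x. sweep ?c ?t (fst x) * (h (u1 x - u2 x) * (- s x)) \<partial>cellm)"
        "integrable cellm (\<lambda>x. sweep ?c ?t (fst x) * (h (u1 x - u2 x) * (- s x)))"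
        by (rule flux_identity[OF _ _ a c2 _ _ b c]; simp)+
    qed
    have "D n = (\<integral>x. sweep ?c ?t (fst x) * (f (u1 x + u2 x) * s x) \<partial>cellm) - (\<integral>x. sweep ?c ?t (fst x) * (h (u1 x - u2 x) * (- s x)) \<partial>cellm)"
      using fl1 fl2 unfolding D_def by (simp add: algebra_simps)
    also have "\<dots> = (\<integral>x. sweep ?c ?t (fst x) * (f (u1 x + u2 x) * s x) - sweep ?c ?t (fst x) * (h (u1 x - u2 x) * (- s x)) \<partial>cellm)"
      using fi1 fi2 by simp
    also have "\<dots> \<le> (\<integral>x. (s x)\<^sup>2 / 2 + Wu x \<partial>cellm)"
    proof (rule integral_mono)
      fix x
      define r where "r = f (u1 x + u2 x) + h (u1 x - u2 x)"
      have r2: "r\<^sup>2 \<le> 2 * Wu x" using W[of x] by (simp add: r_def)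
      have "sweep ?c ?t (fst x) * (f (u1 x + u2 x) * s x) - sweep ?c ?t (fst x) * (h (u1 x - u2 x) * (- s x)) = sweep ?c ?t (fst x) * (r * s x)"
        by (simp add: r_def algebra_simps)
      \<comment> \<open>The sign of \<open>r * s x\<close> is not known, so the absolute value is
        taken before the weight, which is at most 1, is discarded.\<close>
      also have "\<dots> \<le> sweep ?c ?t (fst x) * \<bar>r * s x\<bar>" using sweep_bounds(1)[of ?t ?c "fst x"] by (intro mult_left_mono) auto
      also have "\<dots> \<le> \<bar>r * s x\<bar>" using sweep_bounds[of ?t ?c "fst x"] by (intro mult_left_le_one_le) auto
      also have "\<dots> \<le> (s x)\<^sup>2 / 2 + r\<^sup>2 / 2"
      proof -
        have "0 \<le> (\<bar>r\<bar> - \<bar>s x\<bar>)\<^sup>2" by simp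
        then show ?thesis by (simp add: power2_diff abs_mult)
      qed
      also have "\<dots> \<le> (s x)\<^sup>2 / 2 + Wu x" using r2 by simp
      finally show "sweep ?c ?t (fst x) * (f (u1 x + u2 x) * s x) - sweep ?c ?t (fst x) * (h (u1 x - u2 x) * (- s x)) \<le> (s x)\<^sup>2 / 2 + Wu x" .
    qed (use fi1 fi2 s2 Wi in auto)
    finally show ?thesis .
  qed
  then show ?thesis using D by (intro LIMSEQ_le_const2[OF D]) auto
qed

section \<open>From weak gradients to directional derivatives\<close>

lemma C1test_imp_test2:
  fixes \<phi> :: "R2 \<Rightarrow> real"
  assumes "C1test \<phi> \<phi>'"
  shows "test2 \<phi> (\<lambda>z. \<phi>' z (1, 0)) (\<lambda>z. \<phi>' z (0, 1))"
    and "\<phi>' z h = fst h * \<phi>' z (1, 0) + snd h * \<phi>' z (0, 1)"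
proof -
  have d: "(\<phi> has_derivative \<phi>' x) (at x)" for x using assms unfolding C1test_def by blast
  show lin: "\<phi>' z h = fst h * \<phi>' z (1, 0) + snd h * \<phi>' z (0, 1)" for z h
  proof -
    have l: "linear (\<phi>' z)" using d has_derivative_linear by blast
    have "h = fst h *\<^sub>R (1, 0) + snd h *\<^sub>R (0, 1)" by (simp add: prod_eq_iff)
    then have "\<phi>' z h = \<phi>' z (fst h *\<^sub>R (1, 0) + snd h *\<^sub>R (0, 1))" by (rule arg_cong)
    then show ?thesis using l by (simp only: linear_add linear_scale real_scaleR_def)
  qed
  have "\<phi>' z = (\<lambda>h. \<phi>' z (1, 0) * fst h + \<phi>' z (0, 1) * snd h)" for z
    by (rule ext) (subst lin, simp add: mult.commute)
  then have "(\<phi> has_derivative (\<lambda>h. \<phi>' z (1, 0) * fst h + \<phi>' z (0, 1) * snd h)) (at z)" for z using d by metis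
  then show "test2 \<phi> (\<lambda>z. \<phi>' z (1, 0)) (\<lambda>z. \<phi>' z (0, 1))"
    using assms unfolding test2_def C1test_def by blast
qed

text \<open>Contraction with a direction \<open>e\<close> and a vector \<open>v\<close> treats all
  scalar derivatives together; the cases that matter are e = v = (1, 1) and e = v = (1, -1), besides
  the coordinate ones.\<close>

lemma weak_grad2_imp_weak_dir:
  assumes w: "weak_grad2 u Du1 Du2"
  shows "weak_dir e (\<lambda>x. u x \<bullet> v) (\<lambda>x. fst e * (Du1 x \<bullet> v) + snd e * (Du2 x \<bullet> v))"
  unfolding weak_dir_def
proof (intro allI impI conjI)
  fix \<phi> :: "R2 \<Rightarrow> real" and \<phi>' assume T: "C1test \<phi> \<phi>'"
  note t = w[unfolded weak_grad2_def, rule_format, OF C1test_imp_test2(1)[OF T]]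
  have i: "integrable lborel (\<lambda>x. (\<phi>' x (1, 0) *\<^sub>R u x) \<bullet> v)" "integrable lborel (\<lambda>x. (\<phi>' x (0, 1) *\<^sub>R u x) \<bullet> v)"
    "integrable lborel (\<lambda>x. (\<phi> x *\<^sub>R Du1 x) \<bullet> v)" "integrable lborel (\<lambda>x. (\<phi> x *\<^sub>R Du2 x) \<bullet> v)"
    by (intro integrable_inner_left; use t in blast)+
  have in_eq: "(\<integral>x. (\<phi>' x (1, 0) *\<^sub>R u x) \<bullet> v \<partial>lborel) = (\<integral>x. \<phi>' x (1, 0) *\<^sub>R u x \<partial>lborel) \<bullet> v"
    "(\<integral>x. (\<phi>' x (0, 1) *\<^sub>R u x) \<bullet> v \<partial>lborel) = (\<integral>x. \<phi>' x (0, 1) *\<^sub>R u x \<partial>lborel) \<bullet> v"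
    "(\<integral>x. (\<phi> x *\<^sub>R Du1 x) \<bullet> v \<partial>lborel) = (\<integral>x. \<phi> x *\<^sub>R Du1 x \<partial>lborel) \<bullet> v"
    "(\<integral>x. (\<phi> x *\<^sub>R Du2 x) \<bullet> v \<partial>lborel) = (\<integral>x. \<phi> x *\<^sub>R Du2 x \<partial>lborel) \<bullet> v"
    by (intro integral_inner_left; use t in blast)+
  have eg: "(\<lambda>x. \<phi> x * (fst e * (Du1 x \<bullet> v) + snd e * (Du2 x \<bullet> v))) = (\<lambda>x. fst e * ((\<phi> x *\<^sub>R Du1 x) \<bullet> v) + snd e * ((\<phi> x *\<^sub>R Du2 x) \<bullet> v))"
    by (auto simp: algebra_simps)
  have ep: "(\<lambda>x. \<phi>' x e * (u x \<bullet> v)) = (\<lambda>x. fst e * ((\<phi>' x (1, 0) *\<^sub>R u x) \<bullet> v) + snd e * ((\<phi>' x (0, 1) *\<^sub>R u x) \<bullet> v))"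
    by (rule ext) (simp add: C1test_imp_test2(2)[OF T, of _ e] algebra_simps)
  show "integrable lborel (\<lambda>x. \<phi> x * (fst e * (Du1 x \<bullet> v) + snd e * (Du2 x \<bullet> v)))"
    unfolding eg using i by (intro Bochner_Integration.integrable_add integrable_mult_right)
  have "(\<integral>x. \<phi>' x e * (u x \<bullet> v) \<partial>lborel) = fst e * ((\<integral>x. \<phi>' x (1, 0) *\<^sub>R u x \<partial>lborel) \<bullet> v) + snd e * ((\<integral>x. \<phi>' x (0, 1) *\<^sub>R u x \<partial>lborel) \<bullet> v)"
    unfolding ep by (subst Bochner_Integration.integral_add, intro integrable_mult_right i, intro integrable_mult_right i)
      (simp only: integral_mult_right_zero in_eq)
  also have "\<dots> = - (fst e * ((\<integral>x. \<phi> x *\<^sub>R Du1 x \<partial>lborel) \<bullet> v) + snd e * ((\<integral>x. \<phi> x *\<^sub>R Du2 x \<partial>lborel) \<bullet> v))"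
    using t by simp
  also have "\<dots> = - (\<integral>x. \<phi> x * (fst e * (Du1 x \<bullet> v) + snd e * (Du2 x \<bullet> v)) \<partial>lborel)"
    unfolding eg by (subst Bochner_Integration.integral_add, intro integrable_mult_right i, intro integrable_mult_right i)
      (simp only: integral_mult_right_zero in_eq)
  finally show "(\<integral>x. \<phi>' x e * (u x \<bullet> v) \<partial>lborel) = - (\<integral>x. \<phi> x * (fst e * (Du1 x \<bullet> v) + snd e * (Du2 x \<bullet> v)) \<partial>lborel)" .
qed

lemma weak_dir_cong_AE:
  assumes w: "weak_dir e p g" and ae: "AE x in lborel. g x = g' x"
    and [measurable]: "g \<in> borel_measurable borel" "g' \<in> borel_measurable borel"
  shows "weak_dir e p g'"
  unfolding weak_dir_def
proof (intro allI impI)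
  fix \<phi> \<phi>' assume T: "C1test \<phi> (\<phi>' :: 'a \<Rightarrow> 'a \<Rightarrow> real)"
  have [measurable]: "\<phi> \<in> borel_measurable borel" using C1test_bounded[OF T] by blast
  have ae': "AE x in lborel. \<phi> x * g x = \<phi> x * g' x" using ae by eventually_elim simp
  have "integrable lborel (\<lambda>x. \<phi> x * g x) \<longleftrightarrow> integrable lborel (\<lambda>x. \<phi> x * g' x)"
    by (rule integrable_cong_AE[OF _ _ ae']) measurable
  moreover have "(\<integral>x. \<phi> x * g x \<partial>lborel) = (\<integral>x. \<phi> x * g' x \<partial>lborel)"
    by (rule integral_cong_AE[OF _ _ ae']) measurable
  ultimately show "integrable lborel (\<lambda>x. \<phi> x * g' x) \<and> (\<integral>x. \<phi>' x e * p x \<partial>lborel) = - (\<integral>x. \<phi> x * g' x \<partial>lborel)"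
    using w T unfolding weak_dir_def by metis
qed

text \<open>Admissibility asks for periodicity of \<open>u\<close> only. A weak derivative is
  determined up to null sets, so it inherits any translation symmetry of the function almost
  everywhere.\<close>

lemma weak_dir_shift_AE:
  fixes p g :: "'a::euclidean_space \<Rightarrow> real"
  assumes w: "weak_dir e p g" and [measurable]: "p \<in> borel_measurable borel" "g \<in> borel_measurable borel"
    and ae: "AE x in lborel. p (x + c) = p x"
  shows "AE x in lborel. g (x + c) = g x"
proof -
  have "AE x in lborel. g (x + c) - g x = 0"
  proof (rule AE_eq_0_of_tests)
    fix \<phi> \<phi>' assume T: "C1test \<phi> (\<phi>' :: 'a \<Rightarrow> 'a \<Rightarrow> real)"
    have [measurable]: "\<phi> \<in> borel_measurable borel" using C1test_bounded[OF T] by blast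
    have c': "continuous_on UNIV (\<lambda>x. \<phi>' x e)" using T by (simp add: C1test_def)
    then have [measurable]: "(\<lambda>x. \<phi>' x e) \<in> borel_measurable borel" by (rule borel_measurable_continuous_onI)
    have T2: "C1test (\<lambda>x. \<phi> (x - c)) (\<lambda>x. \<phi>' (x - c))"
      unfolding C1test_def
    proof (intro conjI allI)
      show "((\<lambda>x. \<phi> (x - c)) has_derivative \<phi>' (x - c)) (at x)" for x
      proof -
        have 1: "((\<lambda>x. x - c) has_derivative (\<lambda>h. h)) (at x)" by (auto intro!: derivative_eq_intros)
        have 2: "(\<phi> has_derivative \<phi>' (x - c)) (at (x - c))" using T by (simp add: C1test_def)
        show ?thesis using has_derivative_compose[OF 1 2] by simp
      qed
      show "continuous_on UNIV (\<lambda>x. \<phi>' (x - c) h)" for h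
      proof -
        have "continuous_on UNIV (\<lambda>x. \<phi>' x h)" using T by (simp add: C1test_def)
        then show ?thesis by (rule continuous_on_compose2) (auto intro: continuous_intros)
      qed
      obtain R where R: "\<And>x. norm x > R \<Longrightarrow> \<phi> x = 0" using T by (auto simp: C1test_def)
      have "\<phi> (x - c) = 0" if "norm x > R + norm c" for x
        using norm_triangle_ineq2[of x c] that by (intro R) linarith
      then show "\<exists>R. \<forall>x. norm x > R \<longrightarrow> \<phi> (x - c) = 0" by blast
    qed
    note w1 = w[unfolded weak_dir_def, rule_format, OF T] and w2 = w[unfolded weak_dir_def, rule_format, OF T2]
    have i: "integrable lborel (\<lambda>x. \<phi> x * g (x + c))"
      using w2 integrable_shift[of "\<lambda>x. \<phi> (x - c) * g x" c] by simp
    then show "integrable lborel (\<lambda>x. \<phi> x * (g (x + c) - g x))"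
      using w1 by (simp add: right_diff_distrib)
    have "(\<integral>x. \<phi> x * g (x + c) \<partial>lborel) = (\<integral>x. \<phi> (x - c) * g x \<partial>lborel)"
      using integral_shift_lborel[of "\<lambda>x. \<phi> (x - c) * g x" c] by simp
    also have "\<dots> = - (\<integral>x. \<phi>' (x - c) e * p x \<partial>lborel)" using w2 by simp
    also have "(\<integral>x. \<phi>' (x - c) e * p x \<partial>lborel) = (\<integral>x. \<phi>' x e * p (x + c) \<partial>lborel)"
      using integral_shift_lborel[of "\<lambda>x. \<phi>' (x - c) e * p x" c] by simp
    also have "\<dots> = (\<integral>x. \<phi>' x e * p x \<partial>lborel)"
      by (rule integral_cong_AE) (use ae in \<open>auto elim: eventually_mono\<close>)
    also have "\<dots> = - (\<integral>x. \<phi> x * g x \<partial>lborel)" using w1 by simp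
    finally show "(\<integral>x. \<phi> x * (g (x + c) - g x) \<partial>lborel) = 0"
      using i w1 by (simp add: right_diff_distrib)
  qed measurable
  then show ?thesis by eventually_elim simp
qed

text \<open>Weak derivatives of a periodic function are periodic only almost everywhere; this picks
  a representative with the exact periodicity that shifting integrals over \<open>cellm\<close>
  requires.\<close>

definition periodization :: "(R2 \<Rightarrow> real) \<Rightarrow> R2 \<Rightarrow> real" where
  "periodization f x = f (fst x, frac (snd x))"

lemma periodic2_periodization: "periodic2 (periodization f)"
  by (simp add: periodic2_def periodization_def frac_1_eq)

lemma periodization_measurable[measurable]:
  assumes [measurable]: "f \<in> borel_measurable borel"
  shows "periodization f \<in> borel_measurable borel"
proof -
  have [measurable]: "f \<in> borel_measurable (borel \<Otimes>\<^sub>M borel)" by (simp add: borel_prod)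
  show ?thesis unfolding periodization_def[abs_def] frac_def by measurable
qed

lemma AE_eq_periodization:
  assumes "AE x in lborel. f (x + (0, 1)) = f x"
  shows "AE x in lborel. f x = periodization f x"
proof -
  have "AE x in lborel. \<forall>k::int. f (x + (0, of_int k) + (0, 1)) = f (x + (0, of_int k))"
    by (subst AE_all_countable) (intro allI AE_shift[OF assms])
  then show ?thesis
  proof eventually_elim
    case (elim x)
    have s: "f (x + (0, of_int (k + 1))) = f (x + (0, of_int k))" for k :: int
      using elim[rule_format, of k] by (simp add: add.assoc)
    have "f (x + (0, of_int k)) = f x" for k :: int
    proof (induction k rule: int_induct[where k=0])
      case base then show ?case by (simp flip: zero_prod_def)
    next
      case (step1 i) then show ?case using s[of i] by simp
    next
      case (step2 i) then show ?case using s[of "i - 1"] by simp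
    qed
    from this[of "- \<lfloor>snd x\<rfloor>"] show ?case by (cases x) (simp add: periodization_def frac_def)
  qed
qed

lemma loc_int_inner:
  fixes u :: "R2 \<Rightarrow> R2"
  assumes [measurable]: "u \<in> borel_measurable borel"
    and K: "\<And>K. compact K \<Longrightarrow> (\<integral>\<^sup>+z\<in>K. ennreal ((norm (u z))\<^sup>2) \<partial>lborel) < \<infinity>"
  shows "loc_int (\<lambda>x. u x \<bullet> v)"
  unfolding loc_int_def
proof (intro conjI ballI impI)
  show "(\<lambda>x. u x \<bullet> v) \<in> borel_measurable borel" by measurable
  fix S :: "R2 set" assume [measurable]: "S \<in> sets borel" and S: "bounded S"
  have [measurable]: "closure S \<in> sets borel" by simp
  have c: "compact (closure S)" using S by (simp add: compact_closure)
  have 1: "integrable lborel (\<lambda>x. indicat_real (closure S) x * (norm (u x))\<^sup>2)"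
  proof (rule integrableI_bounded)
    have "(\<integral>\<^sup>+x. ennreal (norm (indicat_real (closure S) x * (norm (u x))\<^sup>2)) \<partial>lborel) = (\<integral>\<^sup>+z\<in>closure S. ennreal ((norm (u z))\<^sup>2) \<partial>lborel)"
      by (intro nn_integral_cong) (auto simp: indicator_def)
    then show "(\<integral>\<^sup>+x. ennreal (norm (indicat_real (closure S) x * (norm (u x))\<^sup>2)) \<partial>lborel) < \<infinity>" using K[OF c] by simp
  qed measurable
  have 2: "integrable lborel (\<lambda>x. norm v * indicat_real S x + norm v * (indicat_real (closure S) x * (norm (u x))\<^sup>2))"
    using S emeasure_bounded_finite[OF S] 1 by (intro Bochner_Integration.integrable_add integrable_mult_right) auto
  show "set_integrable lborel S (\<lambda>x. u x \<bullet> v)" unfolding set_integrable_def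
  proof (rule Bochner_Integration.integrable_bound[OF 2])
    show "AE x in lborel. norm (indicat_real S x *\<^sub>R (u x \<bullet> v)) \<le> norm (norm v * indicat_real S x + norm v * (indicat_real (closure S) x * (norm (u x))\<^sup>2))"
    proof (rule AE_I2)
      fix x
      have "0 \<le> (norm (u x) - 1)\<^sup>2" by simp
      then have "norm (u x) \<le> 1 + (norm (u x))\<^sup>2" by (simp add: power2_diff) (smt (verit) zero_le_power2 norm_ge_zero)
      then have "norm (u x) * norm v \<le> (1 + (norm (u x))\<^sup>2) * norm v" by (intro mult_right_mono) auto
      then have "\<bar>u x \<bullet> v\<bar> \<le> norm v + norm v * (norm (u x))\<^sup>2"
        using Cauchy_Schwarz_ineq2[of "u x" v] by (simp add: algebra_simps)
      moreover have "x \<in> closure S" if "x \<in> S" using that closure_subset by blast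
      ultimately show "norm (indicat_real S x *\<^sub>R (u x \<bullet> v)) \<le> norm (norm v * indicat_real S x + norm v * (indicat_real (closure S) x * (norm (u x))\<^sup>2))"
        by (cases "x \<in> S") auto
    qed
  qed measurable
qed

text \<open>The restriction to almost every \<open>t\<close> is genuine: on a slice where one
  component fails to be integrable, the vector integral is 0 by convention, while the mean of the
  other component may be anything.\<close>

lemma ubar_components:
  fixes u :: "R2 \<Rightarrow> R2"
  assumes um[measurable]: "u \<in> borel_measurable borel" and l: "loc_int (\<lambda>x. fst (u x))" "loc_int (\<lambda>x. snd (u x))"
  shows "AE t in lborel. ubar u t = (xmean (\<lambda>x. fst (u x)) t, xmean (\<lambda>x. snd (u x)) t)"
  using AE_slice_integrable[OF l(1)] AE_slice_integrable[OF l(2)]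
proof eventually_elim
  case (elim t)
  have [measurable]: "u \<in> borel_measurable (borel \<Otimes>\<^sub>M borel)" by (simp add: borel_prod)
  let ?v = "\<lambda>r. indicat_real {0..1} r *\<^sub>R u (t, r)"
  have i: "integrable lborel ?v"
  proof (rule Bochner_Integration.integrable_bound[OF Bochner_Integration.integrable_add[OF integrable_norm[OF elim(1)[unfolded set_integrable_def]] integrable_norm[OF elim(2)[unfolded set_integrable_def]]]])
    show "AE r in lborel. norm (?v r) \<le> norm (norm (indicat_real {0..1} r *\<^sub>R fst (u (t, r))) + norm (indicat_real {0..1} r *\<^sub>R snd (u (t, r))))"
    proof (rule AE_I2)
      fix r
      have "norm (u (t, r)) \<le> \<bar>fst (u (t, r))\<bar> + \<bar>snd (u (t, r))\<bar>"
        using norm_Pair_le[of "fst (u (t, r))" "snd (u (t, r))"] by simp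
      then show "norm (?v r) \<le> norm (norm (indicat_real {0..1} r *\<^sub>R fst (u (t, r))) + norm (indicat_real {0..1} r *\<^sub>R snd (u (t, r))))"
        by (auto simp: indicator_def)
    qed
  qed measurable
  have "ubar u t = (\<integral>r. ?v r \<partial>lborel)"
    unfolding ubar_def by (subst integral_restrict_space) auto
  moreover have "fst (\<integral>r. ?v r \<partial>lborel) = xmean (\<lambda>x. fst (u x)) t"
    unfolding xmean_def set_lebesgue_integral_def using integral_bounded_linear[OF bounded_linear_fst i] by simp
  moreover have "snd (\<integral>r. ?v r \<partial>lborel) = xmean (\<lambda>x. snd (u x)) t"
    unfolding xmean_def set_lebesgue_integral_def using integral_bounded_linear[OF bounded_linear_snd i] by simp
  ultimately show ?case by (simp add: prod_eq_iff)
qed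

lemma square_integrable_of_le:
  fixes f g :: "'a \<Rightarrow> real"
  assumes "integrable M g" "f \<in> borel_measurable M" "AE x in M. (f x)\<^sup>2 \<le> g x"
  shows "integrable M (\<lambda>x. (f x)\<^sup>2)"
proof (rule Bochner_Integration.integrable_bound[OF assms(1)])
  show "(\<lambda>x. (f x)\<^sup>2) \<in> borel_measurable M" using assms(2) by simp
  show "AE x in M. norm ((f x)\<^sup>2) \<le> norm (g x)" using assms(3) by eventually_elim simp
qed

text \<open>An energy not above the flux of the calibration leaves no room for the excess 2 C^2, so
  the diagonal derivatives vanish. The statement takes arbitrary bounded continuous \<open>f\<close>
  and \<open>h\<close>, because they enter only through their flux and the bound by
  \<open>W\<close>.\<close>

lemma rigidity:
  fixes W :: "R2 \<Rightarrow> real" and F f H h :: "real \<Rightarrow> real"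
  assumes adm: "admP um up u Du1 Du2" and um: "fst um = a" and up: "fst up = a"
    and Wc: "continuous_on UNIV W" and W0: "\<And>z. W z \<ge> 0"
    and F: "\<And>y. (F has_real_derivative f y) (at y)" and f: "continuous_on UNIV f" "\<And>y. \<bar>f y\<bar> \<le> L"
    and H: "\<And>y. (H has_real_derivative h y) (at y)" and h: "continuous_on UNIV h" "\<And>y. \<bar>h y\<bar> \<le> L"
    and W: "\<And>z. (f (fst z + snd z) + h (fst z - snd z))\<^sup>2 \<le> 2 * W z"
    and E: "energyP W u Du1 Du2 \<le> ennreal ((F (a + snd up) - H (a - snd up)) - (F (a + snd um) - H (a - snd um)))"
  shows "AE x in lborel. fst (u x) = a" "AE x in lborel. snd (Du2 x) = 0" "AE x in lborel. fst (Du1 x) = 0"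
proof -
  have um_[measurable]: "u \<in> borel_measurable borel" and [measurable]: "Du1 \<in> borel_measurable borel" "Du2 \<in> borel_measurable borel"
    and pu: "periodic2 u" and w: "weak_grad2 u Du1 Du2"
    and Kf: "\<And>K. compact K \<Longrightarrow> (\<integral>\<^sup>+z\<in>K. ennreal ((norm (u z))\<^sup>2) \<partial>lborel) < \<infinity>"
    and dv: "AE z in lborel. fst (Du1 z) + snd (Du2 z) = 0"
    and lb: "ess_lim_bot (ubar u) um" and lt: "ess_lim_top (ubar u) up"
    using adm unfolding admP_def by auto
  have [measurable]: "W \<in> borel_measurable borel" using Wc by (rule borel_measurable_continuous_onI)
  define u1 where "u1 = (\<lambda>x. fst (u x))"
  define u2 where "u2 = (\<lambda>x. snd (u x))"
  have ein: "(\<lambda>x. u x \<bullet> (1, 0)) = u1" "(\<lambda>x. u x \<bullet> (0, 1)) = u2" by (auto simp: u1_def u2_def inner_prod_def)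
  have l1: "loc_int u1" using loc_int_inner[OF um_ Kf, of "(1, 0)"] by (simp add: ein)
  have l2: "loc_int u2" using loc_int_inner[OF um_ Kf, of "(0, 1)"] by (simp add: ein)
  have [measurable]: "u1 \<in> borel_measurable borel" "u2 \<in> borel_measurable borel" by (simp_all add: u1_def u2_def)
  have p1: "periodic2 u1" and p2: "periodic2 u2" using pu by (simp_all add: periodic2_def u1_def u2_def)
  have wu1: "weak_dir e u1 (\<lambda>x. fst e * fst (Du1 x) + snd e * fst (Du2 x))" for e
    using weak_grad2_imp_weak_dir[OF w, of e "(1, 0)"] by (simp add: u1_def inner_prod_def)
  have wu2: "weak_dir e u2 (\<lambda>x. fst e * snd (Du1 x) + snd e * snd (Du2 x))" for e
    using weak_grad2_imp_weak_dir[OF w, of e "(0, 1)"] by (simp add: u2_def inner_prod_def)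
  have sh: "AE x in lborel. p (x + (0, 1)) = p x" if "periodic2 p" for p :: "R2 \<Rightarrow> real"
    using that by (intro AE_I2) (auto simp: periodic2_def)
  \<comment> \<open>A, B and C are periodic representatives of d1 u2, d2 u1 and d1 u1; the
    divergence condition makes - C a representative of d2 u2.\<close>
  define A where "A = periodization (\<lambda>x. snd (Du1 x))"
  define B where "B = periodization (\<lambda>x. fst (Du2 x))"
  define C where "C = periodization (\<lambda>x. fst (Du1 x))"
  have [measurable]: "A \<in> borel_measurable borel" "B \<in> borel_measurable borel" "C \<in> borel_measurable borel"
    unfolding A_def B_def C_def by measurable
  have per: "periodic2 A" "periodic2 B" "periodic2 C" by (simp_all add: A_def B_def C_def periodic2_periodization)
  have eqA: "AE x in lborel. snd (Du1 x) = A x" unfolding A_def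
    by (rule AE_eq_periodization, rule weak_dir_shift_AE[of "(1, 0)" u2]) (use wu2[of "(1, 0)"] sh[OF p2] in auto)
  have eqB: "AE x in lborel. fst (Du2 x) = B x" unfolding B_def
    by (rule AE_eq_periodization, rule weak_dir_shift_AE[of "(0, 1)" u1]) (use wu1[of "(0, 1)"] sh[OF p1] in auto)
  have eqC: "AE x in lborel. fst (Du1 x) = C x" unfolding C_def
    by (rule AE_eq_periodization, rule weak_dir_shift_AE[of "(1, 0)" u1]) (use wu1[of "(1, 0)"] sh[OF p1] in auto)
  have eqD: "AE x in lborel. snd (Du2 x) = - C x" using eqC dv by eventually_elim simp
  have W1: "weak_dir e u1 (\<lambda>x. fst e * C x + snd e * B x)" for e
    by (rule weak_dir_cong_AE[OF wu1]) (use eqB eqC in \<open>auto elim!: eventually_elim2\<close>)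
  have W2: "weak_dir e u2 (\<lambda>x. fst e * A x - snd e * C x)" for e
    by (rule weak_dir_cong_AE[OF wu2]) (use eqA eqD in \<open>auto elim!: eventually_elim2\<close>)
  have D1: "dir_deriv e u1 (\<lambda>x. fst e * C x + snd e * B x)" for e
    by (rule weak_dir_imp_dir_deriv(2)[OF l1 _ W1]) measurable
  have D2: "dir_deriv e u2 (\<lambda>x. fst e * A x - snd e * C x)" for e
    by (rule weak_dir_imp_dir_deriv(2)[OF l2 _ W2]) measurable
  have lC: "loc_int C" using weak_dir_imp_dir_deriv(1)[OF l1 _ W1[of "(1, 0)"]] by simp
  define \<kappa> where "\<kappa> = (F (a + snd up) - H (a - snd up)) - (F (a + snd um) - H (a - snd um))"
  \<comment> \<open>The two diagonal derivatives are opposite, so their half squares add up to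
    C^2.\<close>
  define d where "d = (\<lambda>x. (A x)\<^sup>2 / 2 + (B x)\<^sup>2 / 2 + (C x)\<^sup>2 + W (u x))"
  have [measurable]: "d \<in> borel_measurable borel" unfolding d_def by measurable
  have d0: "d x \<ge> 0" for x using W0[of "u x"] by (simp add: d_def)
  have Ed: "energyP W u Du1 Du2 = (\<integral>\<^sup>+x. ennreal (d x) \<partial>cellm)"
  proof -
    have "energyP W u Du1 Du2 = (\<integral>\<^sup>+x. ennreal ((1/2) * ((norm (Du1 x))\<^sup>2 + (norm (Du2 x))\<^sup>2) + W (u x)) \<partial>cellm)"
      unfolding energyP_def by (rule nn_integral_cell) measurable
    also have "\<dots> = (\<integral>\<^sup>+x. ennreal (d x) \<partial>cellm)"
    proof (rule nn_integral_cong_AE, rule AE_cellm)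
      show "AE x in lborel. ennreal ((1/2) * ((norm (Du1 x))\<^sup>2 + (norm (Du2 x))\<^sup>2) + W (u x)) = ennreal (d x)"
        using eqA eqB eqC eqD
      proof eventually_elim
        case (elim x)
        have "(norm z)\<^sup>2 = (fst z)\<^sup>2 + (snd z)\<^sup>2" for z :: R2 by (simp add: norm_prod_def)
        then show ?case using elim by (simp add: d_def field_simps)
      qed
    qed
    finally show ?thesis .
  qed
  have di: "integrable cellm d"
    by (rule integrableI_bounded) (use E d0 in \<open>auto simp: Ed top.not_eq_extremum intro: order_le_less_trans\<close>)
  have "ennreal (\<integral>x. d x \<partial>cellm) \<le> ennreal \<kappa>"
    using E unfolding Ed \<kappa>_def by (subst (asm) nn_integral_eq_integral[OF di]) (auto simp: d0)
  moreover have "0 \<le> (\<integral>x. d x \<partial>cellm)" using d0 by (simp add: Bochner_Integration.integral_nonneg)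
  \<comment> \<open>\<open>ennreal\<close> sends negative reals to 0. If \<kappa> were negative, the
    estimate in extended reals would only say that the energy is zero, which is kept as a second
    alternative.\<close>
  ultimately have dk: "(\<integral>x. d x \<partial>cellm) \<le> \<kappa> \<or> \<kappa> < 0 \<and> (\<integral>x. d x \<partial>cellm) = 0"
    by (cases "\<kappa> \<ge> 0") (auto simp: ennreal_le_iff ennreal_neg)
  have dle: "(A x)\<^sup>2 \<le> 2 * d x" "(B x)\<^sup>2 \<le> 2 * d x" "(C x)\<^sup>2 \<le> 2 * d x" "W (u x) \<le> d x" for x
  proof -
    have g: "p \<le> 2 * (p / 2 + q / 2 + r + w) \<and> q \<le> 2 * (p / 2 + q / 2 + r + w) \<and> r \<le> 2 * (p / 2 + q / 2 + r + w) \<and> w \<le> p / 2 + q / 2 + r + w"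
      if "0 \<le> p" "0 \<le> q" "0 \<le> r" "0 \<le> w" for p q r w :: real using that by auto
    show "(A x)\<^sup>2 \<le> 2 * d x" "(B x)\<^sup>2 \<le> 2 * d x" "(C x)\<^sup>2 \<le> 2 * d x" "W (u x) \<le> d x"
      using g[OF zero_le_power2 zero_le_power2 zero_le_power2 W0] unfolding d_def by blast+
  qed
  note sq = square_integrable_of_le[OF integrable_mult_right[OF di, of 2]]
  have A2: "integrable cellm (\<lambda>x. (A x)\<^sup>2)" by (rule sq) (simp_all add: dle)
  have B2: "integrable cellm (\<lambda>x. (B x)\<^sup>2)" by (rule sq) (simp_all add: dle)
  have C2: "integrable cellm (\<lambda>x. (C x)\<^sup>2)" by (rule sq) (simp_all add: dle)
  have Wi: "integrable cellm (\<lambda>x. W (u x))"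
    by (rule Bochner_Integration.integrable_bound[OF di]) (use W0 d0 dle(4) in auto)
  have AB: "integrable cellm (\<lambda>x. A x * B x)" by (rule square_integrable_mult[OF _ _ A2 B2]) measurable
  have s2: "integrable cellm (\<lambda>x. (A x + B x)\<^sup>2)" by (rule square_integrable_add[OF _ _ A2 B2]) measurable
  have uc: "AE t in lborel. ubar u t = (xmean u1 t, xmean u2 t)"
    using ubar_components[OF um_ l1[unfolded u1_def] l2[unfolded u2_def]] unfolding u1_def u2_def .
  have top: "\<exists>R. AE t in lborel. t > R \<longrightarrow> \<bar>xmean u1 t - a\<bar> < \<epsilon> \<and> \<bar>xmean u2 t - snd up\<bar> < \<epsilon>" if eps: "\<epsilon> > 0" for \<epsilon>
  proof -
    obtain R where "AE t in lborel. t > R \<longrightarrow> norm (ubar u t - up) < \<epsilon>" using lt[unfolded ess_lim_top_def, rule_format, OF eps] by blast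
    then have "AE t in lborel. t > R \<longrightarrow> \<bar>xmean u1 t - a\<bar> < \<epsilon> \<and> \<bar>xmean u2 t - snd up\<bar> < \<epsilon>"
      using uc
    proof eventually_elim
      case (elim t)
      have "\<bar>fst z\<bar> \<le> norm z" "\<bar>snd z\<bar> \<le> norm z" for z :: R2
        using norm_fst_le[of "fst z" "snd z"] norm_snd_le[of "snd z" "fst z"] by simp_all
      from this[of "ubar u t - up"] elim up show ?case by auto
    qed
    then show ?thesis by blast
  qed
  have bot: "\<exists>R. AE t in lborel. t < R \<longrightarrow> \<bar>xmean u1 t - a\<bar> < \<epsilon> \<and> \<bar>xmean u2 t - snd um\<bar> < \<epsilon>" if eps: "\<epsilon> > 0" for \<epsilon>
  proof -
    obtain R where "AE t in lborel. t < R \<longrightarrow> norm (ubar u t - um) < \<epsilon>" using lb[unfolded ess_lim_bot_def, rule_format, OF eps] by blast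
    then have "AE t in lborel. t < R \<longrightarrow> \<bar>xmean u1 t - a\<bar> < \<epsilon> \<and> \<bar>xmean u2 t - snd um\<bar> < \<epsilon>"
      using uc
    proof eventually_elim
      case (elim t)
      have "\<bar>fst z\<bar> \<le> norm z" "\<bar>snd z\<bar> \<le> norm z" for z :: R2
        using norm_fst_le[of "fst z" "snd z"] norm_snd_le[of "snd z" "fst z"] by simp_all
      from this[of "ubar u t - um"] elim um show ?case by auto
    qed
    then show ?thesis by blast
  qed
  \<comment> \<open>Over a full period \<open>u2\<close> returns to its value, so the integral of
    its x2-derivative - C over the period is zero.\<close>
  have mC: "AE t in lborel. xmean C t = 0"
  proof -
    have D2e: "dir_deriv (0, 1) u2 (\<lambda>x. - C x)" using D2[of "(0, 1)"] by simp
    have "AE x in lborel. u2 (x + 1 *\<^sub>R (0, 1)) - u2 x = (LINT s:{0..1}|lborel. - C (x + s *\<^sub>R (0, 1)))"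
      using D2e[unfolded dir_deriv_def, rule_format, of 1] by simp
    then have "AE x in lborel. xmean C (fst (x::R2)) = 0"
    proof eventually_elim
      case (elim x)
      obtain x1 x2 where x: "x = (x1, x2)" by force
      have "(LINT s:{0..1}|lborel. C (x1, s + x2)) = xmean C x1"
        unfolding xmean_def
      proof (rule set_integral_periodic_shift(2))
        have "C \<in> borel_measurable (borel \<Otimes>\<^sub>M borel)" by (simp add: borel_prod)
        then show "(\<lambda>r. C (x1, r)) \<in> borel_measurable borel" by measurable
      qed (use per(3) in \<open>simp add: periodic2_def\<close>)
      moreover have "u2 (x + 1 *\<^sub>R (0, 1)) - u2 x = 0" using p2 by (simp add: x periodic2_def)
      moreover have "(LINT s:{0..1}|lborel. - C (x + s *\<^sub>R (0, 1))) = - (LINT s:{0..1}|lborel. C (x1, s + x2))"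
        by (simp add: x set_lebesgue_integral_def add.commute)
      ultimately show ?case using elim by (simp add: x)
    qed
    then have "AE x in lborel \<Otimes>\<^sub>M lborel. xmean C (fst (x::R2)) = 0" by (simp only: lborel_prod)
    from lborel_pair.AE_pair[OF this] show ?thesis
      by (rule eventually_mono) (simp add: eventually_const_iff ae_filter_eq_bot_iff)
  qed
  have m1: "AE t in lborel. xmean u1 t = a"
  proof (rule xmean_eq_ess_limit)
    show "AE x1 in lborel. xmean u1 (x1 + t) = xmean u1 x1" if "t \<ge> 0" for t
      by (rule xmean_shift_invariant[OF l1 lC _ mC that]) (use D1[of "(1, 0)"] in simp)
    show "\<exists>R. AE t in lborel. t > R \<longrightarrow> \<bar>xmean u1 t - a\<bar> < \<epsilon>" if "\<epsilon> > 0" for \<epsilon>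
      using top[OF that] by (auto elim!: eventually_mono)
  qed
  have D1e: "dir_deriv (0, 1) u1 B" using D1[of "(0, 1)"] by simp
  have D2e: "dir_deriv (0, 1) u2 (\<lambda>x. - C x)" using D2[of "(0, 1)"] by simp
  have C2': "integrable cellm (\<lambda>x. (- C x)\<^sup>2)" using C2 by simp
  have perC': "periodic2 (\<lambda>x. - C x)" using per(3) by (simp add: periodic2_def)
  have fl: "integrable cellm (\<lambda>x. (p x - xmean p (fst x))\<^sup>2)"
    if "loc_int p" "periodic2 p" "g \<in> borel_measurable borel" "periodic2 g" "dir_deriv (0, 1) p g" "integrable cellm (\<lambda>x. (g x)\<^sup>2)" for p g
  proof (rule integrableI_bounded)
    have [measurable]: "p \<in> borel_measurable borel" using that by measurable
    show "(\<lambda>x. (p x - xmean p (fst x))\<^sup>2) \<in> borel_measurable cellm" by measurable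
    have "(\<integral>\<^sup>+x. ennreal ((p x - xmean p (fst x))\<^sup>2) \<partial>cellm) \<le> (\<integral>\<^sup>+x. ennreal ((g x)\<^sup>2) \<partial>cellm)"
      by (rule Poincare_cellm[OF that(1-5)])
    also have "\<dots> < \<infinity>" using that(6) by (simp add: integrable_iff_bounded)
    finally show "(\<integral>\<^sup>+x. ennreal (norm ((p x - xmean p (fst x))\<^sup>2)) \<partial>cellm) < \<infinity>" by simp
  qed
  have fl1: "integrable cellm (\<lambda>x. (u1 x - xmean u1 (fst x))\<^sup>2)" by (rule fl[OF l1 p1 _ per(2) D1e B2]) measurable
  have fl2: "integrable cellm (\<lambda>x. (u2 x - xmean u2 (fst x))\<^sup>2)" by (rule fl[OF l2 p2 _ perC' D2e C2']) measurable
  \<comment> \<open>The Poincare inequality controls the deviation of \<open>u1\<close> from its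
    mean, and that mean is \<open>a\<close>.\<close>
  have b2: "integrable cellm (\<lambda>x. (u1 x - a)\<^sup>2)"
  proof -
    have "AE x in cellm. (u1 x - xmean u1 (fst x))\<^sup>2 = (u1 x - a)\<^sup>2"
      using AE_cellm[OF AE_fst[OF m1]] by eventually_elim simp
    from integrable_cong_AE[OF _ _ this] fl1 show ?thesis by simp
  qed
  have det: "(\<integral>x. A x * B x \<partial>cellm) = - (\<integral>x. (C x)\<^sup>2 \<partial>cellm)"
  proof -
    \<comment> \<open>The null Lagrangian identity needs one square integrable function besides the
      derivatives. This is u1 - a, which has the same increments as \<open>u1\<close>.\<close>
    have shd: "dir_deriv e (\<lambda>x. u1 x - a) g \<longleftrightarrow> dir_deriv e u1 g" for e g by (simp add: dir_deriv_def)
    have "(\<integral>x. A x * B x \<partial>cellm) = (\<integral>x. (- C x) * C x \<partial>cellm)"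
    proof (rule integral_mixed_derivatives_swap[where a=u2 and b="\<lambda>x. u1 x - a" and e="(1, 0)" and f="(0, 1)"])
      show "dir_deriv (1, 0) u2 A" using D2[of "(1, 0)"] by simp
      show "dir_deriv (- (0, 1)) u2 (\<lambda>x. - (- C x))" using D2[of "(0, -1)"] by simp
      show "dir_deriv (0, 1) (\<lambda>x. u1 x - a) B" using D1e by (simp add: shd)
      show "dir_deriv (- (1, 0)) (\<lambda>x. u1 x - a) (\<lambda>x. - C x)" using D1[of "(-1, 0)"] by (simp add: shd)
      show "periodic2 (\<lambda>x. u1 x - a)" using p1 by (simp add: periodic2_def)
    qed (use p2 per perC' b2 A2 B2 C2 in auto)
    then show ?thesis by (simp add: power2_eq_square)
  qed
  have lim_strip: "(\<lambda>n. \<integral>x. indicator {real n..real n + 1} (fst x) * \<bar>u1 x - a\<bar> \<partial>cellm) \<longlonglongrightarrow> 0"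
    "(\<lambda>n. \<integral>x. indicator {real n..real n + 1} (fst x) * \<bar>u2 x - snd up\<bar> \<partial>cellm) \<longlonglongrightarrow> 0"
    "(\<lambda>n. \<integral>x. indicator {- real n - 1..- real n - 1 + 1} (fst x) * \<bar>u1 x - a\<bar> \<partial>cellm) \<longlonglongrightarrow> 0"
    "(\<lambda>n. \<integral>x. indicator {- real n - 1..- real n - 1 + 1} (fst x) * \<bar>u2 x - snd um\<bar> \<partial>cellm) \<longlonglongrightarrow> 0"
  proof -
    have fp: "filterlim (\<lambda>n. \<bar>real n\<bar>) at_top sequentially" using filterlim_real_sequentially by simp
    have fm: "filterlim (\<lambda>n. \<bar>- real n - 1\<bar>) at_top sequentially"
      by (rule filterlim_at_top_mono[OF filterlim_real_sequentially]) auto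
    have ep: "\<forall>\<^sub>F n in sequentially. AE t in lborel. t \<in> {real n..real n + 1} \<longrightarrow> \<bar>m t - l\<bar> < \<epsilon>"
      if ex: "\<exists>R. AE t in lborel. t > R \<longrightarrow> \<bar>m t - l\<bar> < \<epsilon>" for m :: "real \<Rightarrow> real" and l \<epsilon>
    proof -
      obtain R :: real where R: "AE t in lborel. t > R \<longrightarrow> \<bar>m t - l\<bar> < \<epsilon>" using ex by blast
      have "\<forall>\<^sub>F n in sequentially. real n > R" using filterlim_real_sequentially unfolding filterlim_at_top_dense by blast
      then show ?thesis by eventually_elim (use R in \<open>auto elim!: eventually_mono\<close>)
    qed
    have em: "\<forall>\<^sub>F n in sequentially. AE t in lborel. t \<in> {- real n - 1..- real n - 1 + 1} \<longrightarrow> \<bar>m t - l\<bar> < \<epsilon>"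
      if ex: "\<exists>R. AE t in lborel. t < R \<longrightarrow> \<bar>m t - l\<bar> < \<epsilon>" for m :: "real \<Rightarrow> real" and l \<epsilon>
    proof -
      obtain R :: real where R: "AE t in lborel. t < R \<longrightarrow> \<bar>m t - l\<bar> < \<epsilon>" using ex by blast
      have "\<forall>\<^sub>F n in sequentially. real n > - R" using filterlim_real_sequentially unfolding filterlim_at_top_dense by blast
      then show ?thesis by eventually_elim (use R in \<open>auto elim!: eventually_mono\<close>)
    qed
    have t1: "\<exists>R. AE t in lborel. t > R \<longrightarrow> \<bar>xmean u1 t - a\<bar> < \<epsilon>" and t2: "\<exists>R. AE t in lborel. t > R \<longrightarrow> \<bar>xmean u2 t - snd up\<bar> < \<epsilon>"
      if "\<epsilon> > 0" for \<epsilon> using top[OF that] by (auto elim!: eventually_mono)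
    have t3: "\<exists>R. AE t in lborel. t < R \<longrightarrow> \<bar>xmean u1 t - a\<bar> < \<epsilon>" and t4: "\<exists>R. AE t in lborel. t < R \<longrightarrow> \<bar>xmean u2 t - snd um\<bar> < \<epsilon>"
      if "\<epsilon> > 0" for \<epsilon> using bot[OF that] by (auto elim!: eventually_mono)
    show "(\<lambda>n. \<integral>x. indicator {real n..real n + 1} (fst x) * \<bar>u1 x - a\<bar> \<partial>cellm) \<longlonglongrightarrow> 0"
      by (rule strip_average_limit[OF l1 fl1 _ ep[OF t1] fp]) auto
    show "(\<lambda>n. \<integral>x. indicator {real n..real n + 1} (fst x) * \<bar>u2 x - snd up\<bar> \<partial>cellm) \<longlonglongrightarrow> 0"
      by (rule strip_average_limit[OF l2 fl2 _ ep[OF t2] fp]) auto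
    show "(\<lambda>n. \<integral>x. indicator {- real n - 1..- real n - 1 + 1} (fst x) * \<bar>u1 x - a\<bar> \<partial>cellm) \<longlonglongrightarrow> 0"
      by (rule strip_average_limit[OF l1 fl1 _ em[OF t3] fm]) auto
    show "(\<lambda>n. \<integral>x. indicator {- real n - 1..- real n - 1 + 1} (fst x) * \<bar>u2 x - snd um\<bar> \<partial>cellm) \<longlonglongrightarrow> 0"
      by (rule strip_average_limit[OF l2 fl2 _ em[OF t4] fm]) auto
  qed
  have cal: "\<kappa> \<le> (\<integral>x. (A x + B x)\<^sup>2 / 2 + W (u x) \<partial>cellm)"
    unfolding \<kappa>_def
  proof (rule calibration_bound[OF l1 l2 p1 p2 _ _ s2 _ _ F f H h Wi _ lim_strip])
    have s: "dir_deriv e (\<lambda>x. u x \<bullet> v) (\<lambda>x. fst e * ((C x, A x) \<bullet> v) + snd e * ((B x, - C x) \<bullet> v))" for e v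
    proof (rule weak_dir_imp_dir_deriv(2)[OF loc_int_inner[OF um_ Kf] _ weak_dir_cong_AE[OF weak_grad2_imp_weak_dir[OF w]]])
      show "AE x in lborel. fst e * (Du1 x \<bullet> v) + snd e * (Du2 x \<bullet> v) = fst e * ((C x, A x) \<bullet> v) + snd e * ((B x, - C x) \<bullet> v)"
        using eqA eqB eqC eqD by eventually_elim (simp add: inner_prod_def)
    qed auto
    show "dir_deriv (1, 1) (\<lambda>x. u1 x + u2 x) (\<lambda>x. A x + B x)"
      using s[of "(1, 1)" "(1, 1)"] by (simp add: inner_prod_def u1_def u2_def algebra_simps)
    show "dir_deriv (1, -1) (\<lambda>x. u1 x - u2 x) (\<lambda>x. - (A x + B x))"
      using s[of "(1, -1)" "(1, -1)"] by (simp add: inner_prod_def u1_def u2_def algebra_simps)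
    show "periodic2 (\<lambda>x. A x + B x)" using per by (simp add: periodic2_def)
    show "(f (u1 x + u2 x) + h (u1 x - u2 x))\<^sup>2 \<le> 2 * W (u x)" for x using W[of "u x"] by (simp add: u1_def u2_def)
  qed measurable
  have int1: "(\<integral>x. (A x + B x)\<^sup>2 / 2 + W (u x) \<partial>cellm) = (1/2) * (\<integral>x. (A x)\<^sup>2 \<partial>cellm) + (1/2) * (\<integral>x. (B x)\<^sup>2 \<partial>cellm) + (\<integral>x. A x * B x \<partial>cellm) + (\<integral>x. W (u x) \<partial>cellm)"
  proof -
    have "(\<integral>x. (A x + B x)\<^sup>2 / 2 + W (u x) \<partial>cellm) = (\<integral>x. (1/2) * (A x)\<^sup>2 + (1/2) * (B x)\<^sup>2 + A x * B x + W (u x) \<partial>cellm)"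
      by (intro Bochner_Integration.integral_cong refl) (simp add: power2_sum field_simps)
    then show ?thesis using A2 B2 AB Wi by simp
  qed
  have int2: "(\<integral>x. d x \<partial>cellm) = (1/2) * (\<integral>x. (A x)\<^sup>2 \<partial>cellm) + (1/2) * (\<integral>x. (B x)\<^sup>2 \<partial>cellm) + (\<integral>x. (C x)\<^sup>2 \<partial>cellm) + (\<integral>x. W (u x) \<partial>cellm)"
    unfolding d_def using A2 B2 C2 Wi by (simp add: distrib_left)
  have nonneg: "0 \<le> (\<integral>x. (A x)\<^sup>2 \<partial>cellm)" "0 \<le> (\<integral>x. (B x)\<^sup>2 \<partial>cellm)" "0 \<le> (\<integral>x. (C x)\<^sup>2 \<partial>cellm)" "0 \<le> (\<integral>x. W (u x) \<partial>cellm)"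
    using W0 by (simp_all add: Bochner_Integration.integral_nonneg)
  have "(\<integral>x. (C x)\<^sup>2 \<partial>cellm) = 0"
  proof -
    \<comment> \<open>In the first case dd <= k <= s gives r <= m = - r. In the second the energy is
      a sum of nonnegative terms equal to zero.\<close>
    have g: "r = 0" if "dd \<le> k \<or> k < 0 \<and> dd = 0" "k \<le> s" "s = (1/2) * p + (1/2) * q + m + w" "dd = (1/2) * p + (1/2) * q + r + w"
      "m = - r" "0 \<le> p" "0 \<le> q" "0 \<le> r" "0 \<le> w" for dd k s p q r m w :: real
      using that by auto
    show ?thesis by (rule g[OF dk cal int1 int2 det nonneg])
  qed
  then have "AE x in cellm. (C x)\<^sup>2 = 0"
    using integral_nonneg_eq_0_iff_AE[OF C2] by simp
  then have "AE x in cellm. C x = 0" by simp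
  then have C0: "AE x in lborel. C x = 0" by (rule AE_cellm_periodic) (use per in \<open>simp add: periodic2_def\<close>)
  show "AE x in lborel. snd (Du2 x) = 0" using eqD C0 by eventually_elim simp
  show "AE x in lborel. fst (Du1 x) = 0" using eqC C0 by eventually_elim simp
  show "AE x in lborel. fst (u x) = a"
  proof -
    \<comment> \<open>As d1 u1 = 0, the integral of |u1 - a| over a unit strip does not change when
      the strip moves right, and far out it tends to zero. So it is zero over every strip, and the
      absolute value makes this conclusive.\<close>
    define P where "P = (\<lambda>x. \<bar>u1 x - a\<bar>)"
    have [measurable]: "P \<in> borel_measurable borel" unfolding P_def by measurable
    have pP: "periodic2 P" using p1 by (simp add: P_def periodic2_def)
    have lP: "loc_int P" unfolding P_def by (rule loc_int_Lipschitz[OF l1, of "\<lambda>y. \<bar>y - a\<bar>" 1]) auto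
    have "weak_dir (1, 0) u1 (\<lambda>x. 0)"
      by (rule weak_dir_cong_AE[OF W1[of "(1, 0)"]]) (use C0 in auto)
    then have dd: "dir_deriv (1, 0) u1 (\<lambda>x. 0)" by (intro weak_dir_imp_dir_deriv(2)[OF l1]) auto
    have dP: "dir_deriv (1, 0) P (\<lambda>x. 0)" unfolding dir_deriv_def
    proof (intro allI impI)
      fix t :: real assume t: "t \<ge> 0"
      show "AE x in lborel. set_integrable lborel {0..t} (\<lambda>s. 0::real) \<and> P (x + t *\<^sub>R (1, 0)) - P x = (LINT s:{0..t}|lborel. 0)"
        using dd[unfolded dir_deriv_def, rule_format, OF t]
        by eventually_elim (auto simp: P_def set_lebesgue_integral_def)
    qed
    have const: "(\<integral>x. indicator {c+t..c+1+t} (fst x) * P x \<partial>cellm) = (\<integral>x. indicator {c..c+1} (fst x) * P x \<partial>cellm)" if t: "t \<ge> 0" for c t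
    proof -
      have "(\<integral>x. indicator {c+t..c+1+t} (fst x) * P x \<partial>cellm) - (\<integral>x. indicator {c..c+1} (fst x) * P x \<partial>cellm) = (\<integral>x. sweep c t (fst x) * 0 \<partial>cellm)"
        by (rule flux_identity(1)[OF _ _ pP _ dP _ t]) (auto simp: periodic2_def intro: integrable_cellm_local lP)
      then show ?thesis by simp
    qed
    have z: "(\<integral>x. indicator {of_int k..of_int k + 1} (fst x) * P x \<partial>cellm) = 0" for k :: int
    proof -
      have "\<forall>\<^sub>F n in sequentially. (\<integral>x. indicator {real n..real n + 1} (fst x) * P x \<partial>cellm) = (\<integral>x. indicator {of_int k..of_int k + 1} (fst x) * P x \<partial>cellm)"
        using eventually_ge_at_top[of "nat k"]
      proof eventually_elim
        case (elim n)
        then have "real n - of_int k \<ge> 0" by linarith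
        from const[OF this, of "of_int k"] show ?case by (simp add: algebra_simps)
      qed
      then have "(\<lambda>n. \<integral>x. indicator {real n..real n + 1} (fst x) * P x \<partial>cellm) \<longlonglongrightarrow> (\<integral>x. indicator {of_int k..of_int k + 1} (fst x) * P x \<partial>cellm)"
        by (rule tendsto_eventually)
      from LIMSEQ_unique[OF this] lim_strip(1) show ?thesis by (simp add: P_def)
    qed
    have "AE x in cellm. indicator {of_int k..of_int k + 1} (fst x) * P x = 0" for k :: int
      using z[of k] integral_nonneg_eq_0_iff_AE[OF integrable_cellm_local[OF lP, of "of_int k" "of_int k + 1"]] by (simp add: P_def)
    then have "AE x in cellm. \<forall>k::int. indicat_real {of_int k..of_int k + 1} (fst x) * P x = 0" by (subst AE_all_countable) blast
    then have "AE x in cellm. u1 x = a"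
    proof eventually_elim
      case (elim x)
      have "fst x \<in> {of_int \<lfloor>fst x\<rfloor>..of_int \<lfloor>fst x\<rfloor> + 1}" by (auto intro: less_imp_le)
      then show ?case using elim[rule_format, of "\<lfloor>fst x\<rfloor>"] by (simp add: P_def)
    qed
    then have "AE x in lborel. u1 x = a" by (rule AE_cellm_periodic) (use p1 in \<open>simp add: periodic2_def\<close>)
    then show ?thesis by (simp add: u1_def)
  qed
qed

section \<open>The wave equation and the optimal profile\<close>

text \<open>Schwarz's theorem, required because \<open>C2_partials\<close> names the two mixed
  derivatives separately. The second difference of \<open>w\<close> over a small square is evaluated
  by mean values in both orders; the two points so found shrink to \<open>z\<close>.\<close>

lemma C2_mixed_partials_eq:
  assumes C2: "C2_partials w w1 w2 w11 w12 w21 w22"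
  shows "w12 z = w21 z"
proof -
  have d: "(w has_derivative (\<lambda>h. w1 z * fst h + w2 z * snd h)) (at z)"
    "(w1 has_derivative (\<lambda>h. w11 z * fst h + w12 z * snd h)) (at z)"
    "(w2 has_derivative (\<lambda>h. w21 z * fst h + w22 z * snd h)) (at z)" for z
    using C2 unfolding C2_partials_def by blast+
  have px: "((\<lambda>s. f (s, y)) has_real_derivative f1 (s, y)) (at s)"
    and py: "((\<lambda>s. f (x, s)) has_real_derivative f2 (x, s)) (at s)"
    if f: "\<And>z. (f has_derivative (\<lambda>h. f1 z * fst h + f2 z * snd h)) (at z)" for f f1 f2 :: "R2 \<Rightarrow> real" and x y s
  proof -
    have "((\<lambda>s. (s, y)) has_derivative (\<lambda>h. (h, 0))) (at s)" by (auto intro!: derivative_eq_intros)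
    from has_derivative_compose[OF this f] show "((\<lambda>s. f (s, y)) has_real_derivative f1 (s, y)) (at s)"
      by (simp add: has_field_derivative_def)
    have "((\<lambda>s. (x, s)) has_derivative (\<lambda>h. (0, h))) (at s)" by (auto intro!: derivative_eq_intros)
    from has_derivative_compose[OF this f] show "((\<lambda>s. f (x, s)) has_real_derivative f2 (x, s)) (at s)"
      by (simp add: has_field_derivative_def)
  qed
  obtain x y where z: "z = (x, y)" by force
  have ex: "\<exists>p q. norm (p - z) \<le> 2 * h \<and> norm (q - z) \<le> 2 * h \<and> w12 p = w21 q" if h: "h > 0" for h
  proof -
    define D where "D = w (x + h, y + h) - w (x + h, y) - (w (x, y + h) - w (x, y))"
    have "((\<lambda>s. w (s, y + h) - w (s, y)) has_real_derivative w1 (s, y + h) - w1 (s, y)) (at s)" for s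
      by (intro DERIV_diff px[OF d(1)])
    then obtain \<xi> where \<xi>: "x < \<xi>" "\<xi> < x + h" "D = h * (w1 (\<xi>, y + h) - w1 (\<xi>, y))"
      using MVT2[of x "x + h" "\<lambda>s. w (s, y + h) - w (s, y)" "\<lambda>s. w1 (s, y + h) - w1 (s, y)"] h by (auto simp: D_def)
    obtain \<eta> where \<eta>: "y < \<eta>" "\<eta> < y + h" "w1 (\<xi>, y + h) - w1 (\<xi>, y) = h * w12 (\<xi>, \<eta>)"
      using MVT2[of y "y + h" "\<lambda>s. w1 (\<xi>, s)" "\<lambda>s. w12 (\<xi>, s)"] py[OF d(2)] h by auto
    have "((\<lambda>s. w (x + h, s) - w (x, s)) has_real_derivative w2 (x + h, s) - w2 (x, s)) (at s)" for s
      by (intro DERIV_diff py[OF d(1)])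
    then obtain \<eta>' where \<eta>': "y < \<eta>'" "\<eta>' < y + h" "D = h * (w2 (x + h, \<eta>') - w2 (x, \<eta>'))"
      using MVT2[of y "y + h" "\<lambda>s. w (x + h, s) - w (x, s)" "\<lambda>s. w2 (x + h, s) - w2 (x, s)"] h by (auto simp: D_def)
    obtain \<xi>' where \<xi>': "x < \<xi>'" "\<xi>' < x + h" "w2 (x + h, \<eta>') - w2 (x, \<eta>') = h * w21 (\<xi>', \<eta>')"
      using MVT2[of x "x + h" "\<lambda>s. w2 (s, \<eta>')" "\<lambda>s. w21 (s, \<eta>')"] px[OF d(3)] h by auto
    have "w12 (\<xi>, \<eta>) = w21 (\<xi>', \<eta>')" using \<xi>(3) \<eta>(3) \<eta>'(3) \<xi>'(3) h by simp
    moreover have "norm ((p1, p2) - z) \<le> 2 * h" if "x < p1" "p1 < x + h" "y < p2" "p2 < y + h" for p1 p2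
      using norm_Pair_le[of "p1 - x" "p2 - y"] that by (simp add: z)
    ultimately show ?thesis using \<xi> \<eta> \<xi>' \<eta>' by blast
  qed
  define H where "H = (\<lambda>n. 1 / real (Suc n))"
  have "\<forall>n. \<exists>pq. norm (fst pq - z) \<le> 2 * H n \<and> norm (snd pq - z) \<le> 2 * H n \<and> w12 (fst pq) = w21 (snd pq)"
  proof
    fix n
    have "H n > 0" by (simp add: H_def)
    from ex[OF this] obtain p q where "norm (p - z) \<le> 2 * H n \<and> norm (q - z) \<le> 2 * H n \<and> w12 p = w21 q" by blast
    then show "\<exists>pq. norm (fst pq - z) \<le> 2 * H n \<and> norm (snd pq - z) \<le> 2 * H n \<and> w12 (fst pq) = w21 (snd pq)"
      by (intro exI[of _ "(p, q)"]) simp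
  qed
  then obtain pq where pq: "\<And>n. norm (fst (pq n) - z) \<le> 2 * H n" "\<And>n. norm (snd (pq n) - z) \<le> 2 * H n"
    "\<And>n. w12 (fst (pq n)) = w21 (snd (pq n))" by metis
  have H: "(\<lambda>n. 2 * H n) \<longlonglongrightarrow> 0"
    using tendsto_mult[OF tendsto_const[of 2] LIMSEQ_Suc[OF lim_1_over_n]] by (simp add: H_def)
  have l1: "(\<lambda>n. fst (pq n)) \<longlonglongrightarrow> z" and l2: "(\<lambda>n. snd (pq n)) \<longlonglongrightarrow> z"
    using Lim_null_comparison[OF always_eventually[OF allI[OF pq(1)]] H] Lim_null_comparison[OF always_eventually[OF allI[OF pq(2)]] H]
    by (simp_all add: LIM_zero_iff)
  have c: "isCont w12 z" "isCont w21 z" using C2 unfolding C2_partials_def continuous_on_eq_continuous_at[OF open_UNIV] by blast+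
  from isCont_tendsto_compose[OF c(1) l1] isCont_tendsto_compose[OF c(2) l2] show ?thesis
    unfolding pq(3) using LIMSEQ_unique by blast
qed

text \<open>In the coordinates s = z1 + z2 and t = z1 - z2 the wave equation says that the mixed
  derivative of \<open>w\<close> vanishes, so \<open>w\<close> is determined by its values on the
  two characteristics through the origin. The value w(0, 0) lies on both and is subtracted
  once.\<close>

lemma d_Alembert:
  assumes C2: "C2_partials w w1 w2 w11 w12 w21 w22" and wave: "\<And>z. w11 z - w22 z = 0"
  shows "w z = w ((fst z + snd z) / 2, (fst z + snd z) / 2) + (w ((fst z - snd z) / 2, - ((fst z - snd z) / 2)) - w (0, 0))"
proof -
  have d: "(w has_derivative (\<lambda>h. w1 z * fst h + w2 z * snd h)) (at z)"
    "(w1 has_derivative (\<lambda>h. w11 z * fst h + w12 z * snd h)) (at z)"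
    "(w2 has_derivative (\<lambda>h. w21 z * fst h + w22 z * snd h)) (at z)" for z
    using C2 unfolding C2_partials_def by blast+
  \<comment> \<open>Twice the derivative of \<open>w\<close> in the coordinate \<open>s\<close>; the
    wave equation and the symmetry of mixed derivatives make it independent of
    \<open>t\<close>.\<close>
  define D where "D = (\<lambda>s t. w1 ((s + t) / 2, (s - t) / 2) + w2 ((s + t) / 2, (s - t) / 2))"
  have "((\<lambda>t. D s t) has_real_derivative 0) (at t)" for s t
  proof -
    let ?z = "((s + t) / 2, (s - t) / 2)"
    have "((\<lambda>t. ((s + t) / 2, (s - t) / 2)) has_derivative (\<lambda>h. (h / 2, - h / 2))) (at t)"
      by (auto intro!: derivative_eq_intros)
    from has_derivative_add[OF has_derivative_compose[OF this d(2)] has_derivative_compose[OF this d(3)]]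
    have "((\<lambda>t. D s t) has_derivative (\<lambda>h. w11 ?z * (h / 2) + w12 ?z * (- h / 2) + (w21 ?z * (h / 2) + w22 ?z * (- h / 2)))) (at t)"
      by (simp add: D_def)
    moreover have "(\<lambda>h. w11 ?z * (h / 2) + w12 ?z * (- h / 2) + (w21 ?z * (h / 2) + w22 ?z * (- h / 2))) = (\<lambda>h. 0 * h)"
      using wave[of ?z] C2_mixed_partials_eq[OF C2, of ?z] by (auto simp: algebra_simps)
    ultimately show ?thesis unfolding has_field_derivative_def by metis
  qed
  then have Dc: "D s t = D s 0" for s t by (rule DERIV_isconst_all[OF allI])
  \<comment> \<open>The difference of \<open>w\<close> at (s, t) and at (s, 0) in characteristic
    coordinates; by the previous step it does not depend on \<open>s\<close>.\<close>
  define r where "r = (\<lambda>t s. w ((s + t) / 2, (s - t) / 2) - w (s / 2, s / 2))"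
  have "(r t has_real_derivative 0) (at s)" for s t
  proof -
    have "((\<lambda>s. ((s + t) / 2, (s - t) / 2)) has_derivative (\<lambda>h. (h / 2, h / 2))) (at s)" for t
      by (auto intro!: derivative_eq_intros)
    from has_derivative_compose[OF this d(1)]
    have "((\<lambda>s. w ((s + t) / 2, (s - t) / 2)) has_derivative (\<lambda>h. D s t * (h / 2))) (at s)" for t
      by (simp add: D_def distrib_right add_divide_distrib)
    from has_derivative_diff[OF this[of t] this[of 0]] show ?thesis
      by (simp add: r_def[abs_def] Dc[of s t] has_field_derivative_def flip: lambda_zero)
  qed
  then have rc: "r t s = r t 0" for s t by (rule DERIV_isconst_all[OF allI])
  from rc[of "fst z - snd z" "fst z + snd z"] show ?thesis by (simp add: r_def minus_divide_left)
qed

section \<open>Separation of variables for the profile equation\<close>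

lemma ex_antiderivative:
  fixes f :: "real \<Rightarrow> real"
  assumes "continuous_on UNIV f"
  obtains F where "\<And>y. (F has_real_derivative f y) (at y)"
proof -
  have "\<exists>F. \<forall>x::real. -\<infinity> < ereal x \<longrightarrow> ereal x < \<infinity> \<longrightarrow> (F has_vector_derivative f x) (at x)"
    by (rule einterval_antiderivative) (use assms in \<open>auto simp: continuous_on_eq_continuous_at\<close>)
  then show thesis using that by (auto simp: has_real_derivative_iff_has_vector_derivative)
qed

text \<open>The time map \<open>G\<close> is a primitive of 1/c and \<open>g\<close> is its inverse.
  The linear bounds on \<open>c\<close> make 1/c non-integrable at both ends, so \<open>G\<close> is
  onto the whole line and the solution takes infinite time to reach either end.\<close>

lemma autonomous_ode_increasing:
  fixes c :: "real \<Rightarrow> real"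
  assumes lr: "l < r" and cc: "\<And>y. y \<in> {l<..<r} \<Longrightarrow> isCont c y" and cpos: "\<And>y. y \<in> {l<..<r} \<Longrightarrow> c y > 0"
    and L: "\<And>y. y \<in> {l<..<r} \<Longrightarrow> c y \<le> L * (y - l)" "\<And>y. y \<in> {l<..<r} \<Longrightarrow> c y \<le> L * (r - y)"
  obtains g G where "\<And>t. g t \<in> {l<..<r}" "\<And>t. (g has_real_derivative c (g t)) (at t)"
    "(g \<longlongrightarrow> l) at_bot" "(g \<longlongrightarrow> r) at_top"
    "\<And>y. y \<in> {l<..<r} \<Longrightarrow> (G has_real_derivative 1 / c y) (at y)" "\<And>t. G (g t) = t" "\<And>y. y \<in> {l<..<r} \<Longrightarrow> g (G y) = y"
proof -
  have "\<exists>G. \<forall>x::real. ereal l < ereal x \<longrightarrow> ereal x < ereal r \<longrightarrow> (G has_vector_derivative 1 / c x) (at x)"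
  proof (rule einterval_antiderivative)
    fix x :: real assume "ereal l < ereal x" "ereal x < ereal r"
    then have "x \<in> {l<..<r}" by simp
    then show "isCont (\<lambda>x. 1 / c x) x" using cc[of x] cpos[of x] by (intro continuous_intros) auto
  qed (use lr in simp)
  then obtain G where G: "\<And>y. y \<in> {l<..<r} \<Longrightarrow> (G has_real_derivative 1 / c y) (at y)"
    by (auto simp: has_real_derivative_iff_has_vector_derivative)
  have Gmono: "G x < G y" if "x \<in> {l<..<r}" "y \<in> {l<..<r}" "x < y" for x y
  proof (rule DERIV_pos_imp_increasing[OF \<open>x < y\<close>])
    fix s assume "x \<le> s" "s \<le> y"
    then have "s \<in> {l<..<r}" using that by auto
    then show "\<exists>v. (G has_real_derivative v) (at s) \<and> 0 < v" using G cpos by (intro exI[of _ "1 / c s"]) auto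
  qed
  define m where "m = (l + r) / 2"
  have m: "m \<in> {l<..<r}" using lr by (auto simp: m_def)
  have L0: "L > 0"
  proof -
    have "0 < L * (m - l)" using cpos[OF m] L(1)[OF m] by linarith
    then show ?thesis using m by (simp add: zero_less_mult_iff)
  qed
  \<comment> \<open>Comparison of 1/c with 1 / (L (r - s)), whose primitive is logarithmic:
    \<open>G\<close> is forced to infinity at \<open>r\<close>.\<close>
  have Glow: "G m + (ln (r - m) - ln (r - y)) / L \<le> G y" if y: "y \<in> {l<..<r}" "m \<le> y" for y
  proof -
    have "G m + ln (r - m) / L \<le> G y + ln (r - y) / L"
    proof (rule DERIV_nonneg_imp_nondecreasing[OF y(2)])
      fix s assume "m \<le> s" "s \<le> y"
      then have s: "s \<in> {l<..<r}" using m y by auto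
      have "((\<lambda>s. ln (r - s)) has_real_derivative - 1 / (r - s)) (at s)"
        using s by (auto intro!: derivative_eq_intros)
      from DERIV_add[OF G[OF s] DERIV_cdivide[OF this]]
      have "((\<lambda>s. G s + ln (r - s) / L) has_real_derivative 1 / c s + (- 1 / (r - s)) / L) (at s)" .
      moreover have "1 / (L * (r - s)) \<le> 1 / c s" using L(2)[OF s] cpos[OF s] by (intro divide_left_mono mult_pos_pos) (use L0 s in auto)
      ultimately show "\<exists>v. ((\<lambda>s. G s + ln (r - s) / L) has_real_derivative v) (at s) \<and> 0 \<le> v"
        by (intro exI[of _ "1 / c s + (- 1 / (r - s)) / L"]) (auto simp: field_simps)
    qed
    then show ?thesis by (simp add: diff_divide_distrib)
  qed
  have Gup: "G y \<le> G m - (ln (m - l) - ln (y - l)) / L" if y: "y \<in> {l<..<r}" "y \<le> m" for y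
  proof -
    have "G y - ln (y - l) / L \<le> G m - ln (m - l) / L"
    proof (rule DERIV_nonneg_imp_nondecreasing[OF y(2)])
      fix s assume "y \<le> s" "s \<le> m"
      then have s: "s \<in> {l<..<r}" using m y by auto
      have "((\<lambda>s. ln (s - l)) has_real_derivative 1 / (s - l)) (at s)"
        using s by (auto intro!: derivative_eq_intros)
      from DERIV_diff[OF G[OF s] DERIV_cdivide[OF this]]
      have "((\<lambda>s. G s - ln (s - l) / L) has_real_derivative 1 / c s - (1 / (s - l)) / L) (at s)" .
      moreover have "1 / (L * (s - l)) \<le> 1 / c s" using L(1)[OF s] cpos[OF s] by (intro divide_left_mono mult_pos_pos) (use L0 s in auto)
      ultimately show "\<exists>v. ((\<lambda>s. G s - ln (s - l) / L) has_real_derivative v) (at s) \<and> 0 \<le> v"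
        by (intro exI[of _ "1 / c s - (1 / (s - l)) / L"]) (auto simp: field_simps)
    qed
    then show ?thesis by (simp add: diff_divide_distrib)
  qed
  have surj: "\<exists>y\<in>{l<..<r}. G y = t" for t
  proof -
    obtain y1 where y1: "y1 \<in> {l<..<r}" "m \<le> y1" "t \<le> G y1"
    proof
      \<comment> \<open>Chosen so that the logarithmic bound \<open>Glow\<close> at r - e reads G m
        + |t - G m|. The absolute value keeps r - e to the right of \<open>m\<close>, where the
        bound is valid.\<close>
      define e where "e = exp (ln (r - m) - L * (\<bar>t - G m\<bar>))"
      have "e \<le> exp (ln (r - m))" unfolding e_def using L0 by simp
      also have "exp (ln (r - m)) = r - m" using m by simp
      finally have e: "0 < e" "e \<le> r - m" by (simp_all add: e_def)
      show "r - e \<in> {l<..<r}" "m \<le> r - e" using e m by auto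
      from Glow[OF this] have "G m + \<bar>t - G m\<bar> \<le> G (r - e)" using L0 by (simp add: e_def)
      then show "t \<le> G (r - e)" by linarith
    qed
    obtain y0 where y0: "y0 \<in> {l<..<r}" "y0 \<le> m" "G y0 \<le> t"
    proof
      define e where "e = exp (ln (m - l) - L * (\<bar>t - G m\<bar>))"
      have "e \<le> exp (ln (m - l))" unfolding e_def using L0 by simp
      also have "exp (ln (m - l)) = m - l" using m by simp
      finally have e: "0 < e" "e \<le> m - l" by (simp_all add: e_def)
      show "l + e \<in> {l<..<r}" "l + e \<le> m" using e m by auto
      from Gup[OF this] have "G (l + e) \<le> G m - \<bar>t - G m\<bar>" using L0 by (simp add: e_def)
      then show "G (l + e) \<le> t" by linarith
    qed
    have "\<forall>s. y0 \<le> s \<and> s \<le> y1 \<longrightarrow> isCont G s"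
    proof (intro allI impI)
      fix s assume "y0 \<le> s \<and> s \<le> y1"
      then have "s \<in> {l<..<r}" using y0 y1 by auto
      then show "isCont G s" by (rule DERIV_isCont[OF G])
    qed
    then obtain y where "y0 \<le> y" "y \<le> y1" "G y = t" using IVT[of G y0 t y1] y0 y1 by auto
    then show ?thesis using y0 y1 by (intro bexI[of _ y]) auto
  qed
  have "\<forall>t. \<exists>y. y \<in> {l<..<r} \<and> G y = t" using surj by blast
  then obtain g where g: "\<And>t. g t \<in> {l<..<r}" "\<And>t. G (g t) = t" by metis
  have gG: "g (G y) = y" if "y \<in> {l<..<r}" for y
    using Gmono[of "g (G y)" y] Gmono[of y "g (G y)"] g[of "G y"] that by (metis linorder_neqE order_less_irrefl)
  have gd: "(g has_real_derivative c (g t)) (at t)" for t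
  proof -
    have "(g has_derivative (*) (c (g t))) (at (G (g t)))"
    proof (rule has_derivative_inverse_strong[of "{l<..<r}" "g t" G g "(*) (1 / c (g t))"])
      show "continuous_on {l<..<r} G" by (intro continuous_at_imp_continuous_on ballI DERIV_isCont[OF G])
      show "(G has_derivative (*) (1 / c (g t))) (at (g t))" using G[OF g(1)] by (simp add: has_field_derivative_def)
      show "(*) (1 / c (g t)) \<circ> (*) (c (g t)) = id" using cpos[OF g(1), of t] by (auto simp: o_def)
    qed (use g gG in auto)
    then show ?thesis by (simp add: g has_field_derivative_def)
  qed
  have gmono: "g s < g t" if "s < t" for s t
    using DERIV_pos_imp_increasing[OF that, of g] gd cpos[OF g(1)] by blast
  have top: "(g \<longlongrightarrow> r) at_top"
  proof (rule order_tendstoI)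
    fix y assume "y < r"
    define z where "z = max y m"
    have z: "z \<in> {l<..<r}" "y \<le> z" using \<open>y < r\<close> m by (auto simp: z_def)
    show "\<forall>\<^sub>F t in at_top. y < g t" using eventually_gt_at_top[of "G z"]
      by eventually_elim (use gmono[of "G z"] gG[OF z(1)] z in force)
  next
    fix y assume "r < y"
    then show "\<forall>\<^sub>F t in at_top. g t < y" using g(1) by (intro always_eventually) (force intro: less_trans)
  qed
  have bot: "(g \<longlongrightarrow> l) at_bot"
  proof (rule order_tendstoI)
    fix y assume "l < y"
    define z where "z = min y m"
    have z: "z \<in> {l<..<r}" "z \<le> y" using \<open>l < y\<close> m by (auto simp: z_def)
    show "\<forall>\<^sub>F t in at_bot. g t < y" using eventually_gt_at_bot[of "G z"]
      by eventually_elim (use gmono[of _ "G z"] gG[OF z(1)] z in force)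
  next
    fix y assume "y < l"
    then show "\<forall>\<^sub>F t in at_bot. y < g t" using g(1) by (intro always_eventually) (force intro: less_trans)
  qed
  show thesis using that[OF g(1) gd bot top G g(2) gG] .
qed

section \<open>The one-dimensional problem\<close>

lemma C1test_imp_test1:
  fixes \<phi> :: "real \<Rightarrow> real"
  assumes "C1test \<phi> \<phi>'"
  shows "test1 \<phi> (\<lambda>x. \<phi>' x 1)"
proof -
  have d: "(\<phi> has_derivative \<phi>' x) (at x)" for x using assms by (simp add: C1test_def)
  have "\<phi>' x = (\<lambda>h. \<phi>' x 1 * h)" for x
  proof
    fix h
    have l: "linear (\<phi>' x)" using d has_derivative_linear by blast
    show "\<phi>' x h = \<phi>' x 1 * h" using linear_scale[OF l, of h 1] by simp
  qed
  then have "(\<phi> has_real_derivative \<phi>' x 1) (at x)" for x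
    using d[of x] unfolding has_field_derivative_def by metis
  then show ?thesis using assms unfolding test1_def C1test_def by auto
qed

lemma set_integral_shift:
  fixes k :: "real \<Rightarrow> real"
  assumes [measurable]: "k \<in> borel_measurable borel"
  shows "(LINT s:{0..t}|lborel. k (x + s)) = (LINT s:{x..x+t}|lborel. k s)"
    and "set_integrable lborel {0..t} (\<lambda>s. k (x + s)) \<longleftrightarrow> set_integrable lborel {x..x+t} k"
proof -
  have eq: "(\<lambda>s. indicator {0..t} s *\<^sub>R k (x + s)) = (\<lambda>s. indicator {x..x+t} (s + x) *\<^sub>R k (s + x))"
    by (rule ext) (auto simp: indicator_def add.commute)
  show "(LINT s:{0..t}|lborel. k (x + s)) = (LINT s:{x..x+t}|lborel. k s)"
    unfolding set_lebesgue_integral_def eq by (rule integral_shift_lborel[of "\<lambda>s. indicator {x..x+t} s *\<^sub>R k s"]) measurable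
  show "set_integrable lborel {0..t} (\<lambda>s. k (x + s)) \<longleftrightarrow> set_integrable lborel {x..x+t} k"
    unfolding set_integrable_def eq by (rule integrable_shift[of "\<lambda>s. indicator {x..x+t} s *\<^sub>R k s"]) measurable
qed

text \<open>By Fubini almost every \<open>x\<close> is a good base point: to the right of it
  \<open>D\<close> equals D x almost everywhere. No single base point covers the line, so a sequence
  going to minus infinity is used; the values agree because the half-lines overlap.\<close>

lemma AE_const_of_shift_invariant:
  fixes D :: "real \<Rightarrow> real"
  assumes [measurable]: "D \<in> borel_measurable borel" and inv: "\<And>t. t \<ge> 0 \<Longrightarrow> AE x in lborel. D (x + t) = D x"
  shows "\<exists>d. AE x in lborel. D x = d"
proof -
  have "AE t in lborel. AE x in lborel. t \<ge> 0 \<longrightarrow> D (x + t) = D x"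
  proof (rule AE_I2)
    fix t :: real show "AE x in lborel. t \<ge> 0 \<longrightarrow> D (x + t) = D x" using inv[of t] by (cases "t \<ge> 0") auto
  qed
  then have "AE x in lborel. AE t in lborel. t \<ge> 0 \<longrightarrow> D (x + t) = D x"
    by (rule iffD2[OF lborel_pair.AE_commute, rotated]) measurable
  then have good: "AE x in lborel. AE y in lborel. y \<ge> x \<longrightarrow> D y = D x"
  proof eventually_elim
    case (elim x)
    from AE_shift[OF elim, of "- x"] show ?case by simp
  qed
  have "\<exists>x < - real n. AE y in lborel. y \<ge> x \<longrightarrow> D y = D x" for n
  proof (rule ccontr)
    assume n: "\<not> ?thesis"
    have "AE x in lborel. x \<notin> {- real n - 1<..<- real n}" using good by eventually_elim (use n in auto)
    then have "{- real n - 1<..<- real n} \<in> null_sets lborel"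
      by (subst AE_iff_null_sets) auto
    then show False by (simp add: null_sets_def)
  qed
  then obtain X where X: "\<And>n. X n < - real n" "\<And>n. AE y in lborel. y \<ge> X n \<longrightarrow> D y = D (X n)" by metis
  have same: "D (X n) = D (X 0)" for n
  proof -
    have "AE y in lborel. y \<ge> max (X n) (X 0) \<longrightarrow> D (X n) = D (X 0)"
      using X(2)[of n] X(2)[of 0] by eventually_elim auto
    then have "D (X n) = D (X 0) \<or> (AE y in lborel. y < max (X n) (X 0))"
      by (cases "D (X n) = D (X 0)") (auto elim!: eventually_mono)
    moreover have "\<not> (AE y in lborel. y < max (X n) (X 0))"
    proof
      assume "AE y in lborel. y < max (X n) (X 0)"
      then have "AE y in lborel. y \<notin> {max (X n) (X 0)..max (X n) (X 0) + 1}" by eventually_elim auto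
      then have "{max (X n) (X 0)..max (X n) (X 0) + 1} \<in> null_sets lborel" by (subst AE_iff_null_sets) auto
      then show False by (simp add: null_sets_def)
    qed
    ultimately show ?thesis by blast
  qed
  have "AE y in lborel. \<forall>n. y \<ge> X n \<longrightarrow> D y = D (X n)" using X(2) by (subst AE_all_countable) blast
  then have "AE y in lborel. D y = D (X 0)"
  proof eventually_elim
    case (elim y)
    obtain n where "- y < real n" using reals_Archimedean2 by blast
    then have "y \<ge> X n" using X(1)[of n] by linarith
    then show ?case using elim same[of n] by simp
  qed
  then show ?thesis by blast
qed

lemma continuous_AE_le:
  fixes Y :: "real \<Rightarrow> real"
  assumes Y: "continuous_on UNIV Y" and S: "open S" and ae: "AE t in lborel. t \<in> S \<longrightarrow> Y t \<le> b" and t: "t \<in> S"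
  shows "Y t \<le> b"
proof (rule ccontr)
  assume n: "\<not> ?thesis"
  define U where "U = S \<inter> {t. b < Y t}"
  have U: "open U" unfolding U_def using Y by (intro open_Int S open_Collect_less continuous_intros)
  then have [measurable]: "U \<in> sets borel" by simp
  have "AE t in lborel. t \<notin> U" using ae by eventually_elim (auto simp: U_def)
  then have "U \<in> null_sets lborel" by (subst AE_iff_null_sets) auto
  then have "negligible U" by (simp add: negligible_iff_null_sets null_sets_completionI)
  moreover have "U \<noteq> {}" using t n by (auto simp: U_def)
  ultimately show False using open_not_negligible[OF U] by blast
qed

text \<open>The curve is known only almost everywhere, so it is replaced by a primitive of its weak
  derivative. For this continuous representative increments are exact between any two points and the
  essential limits become genuine ones.\<close>

lemma adm1_representative:
  assumes adm: "adm1 a um up \<eta> \<eta>'"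
  obtains Y where "continuous_on UNIV Y" "AE t in lborel. \<eta> t = (a, Y t)"
    "\<And>x t. t \<ge> 0 \<Longrightarrow> set_integrable lborel {0..t} (\<lambda>s. snd (\<eta>' (x + s))) \<and> Y (x + t) - Y x = (LINT s:{0..t}|lborel. snd (\<eta>' (x + s)))"
    "(Y \<longlongrightarrow> snd um) at_bot" "(Y \<longlongrightarrow> snd up) at_top"
proof -
  have [measurable]: "\<eta> \<in> borel_measurable borel" "\<eta>' \<in> borel_measurable borel"
    and fin: "\<And>s t. (\<integral>\<^sup>+r\<in>{s..t}. ennreal (norm (\<eta> r)) \<partial>lborel) < \<infinity>"
    and wd: "weak_deriv1 \<eta> \<eta>'" and ea: "AE t in lborel. fst (\<eta> t) = a"
    and lb: "ess_lim_bot \<eta> um" and lt: "ess_lim_top \<eta> up"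
    using adm unfolding adm1_def by auto
  define y where "y = (\<lambda>t. snd (\<eta> t))"
  define y' where "y' = (\<lambda>t. snd (\<eta>' t))"
  have [measurable]: "y \<in> borel_measurable borel" "y' \<in> borel_measurable borel" unfolding y_def y'_def by measurable
  have ly: "loc_int y" unfolding loc_int_def
  proof (intro conjI ballI impI)
    fix S :: "real set" assume [measurable]: "S \<in> sets borel" and "bounded S"
    then obtain R where R: "\<And>x. x \<in> S \<Longrightarrow> \<bar>x\<bar> \<le> R" by (auto simp: bounded_iff)
    show "set_integrable lborel S y" unfolding set_integrable_def
    proof (rule integrableI_bounded)
      have "(\<integral>\<^sup>+x. ennreal (norm (indicator S x *\<^sub>R y x)) \<partial>lborel) \<le> (\<integral>\<^sup>+r\<in>{-R..R}. ennreal (norm (\<eta> r)) \<partial>lborel)"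
      proof (rule nn_integral_mono)
        fix x
        have "\<bar>y x\<bar> \<le> norm (\<eta> x)" unfolding y_def using norm_snd_le[of "snd (\<eta> x)" "fst (\<eta> x)"] by simp
        then show "ennreal (norm (indicator S x *\<^sub>R y x)) \<le> ennreal (norm (\<eta> x)) * indicator {-R..R} x"
          using R[of x] by (cases "x \<in> S") (auto intro: ennreal_leI simp: indicator_def abs_le_iff)
      qed
      then show "(\<integral>\<^sup>+x. ennreal (norm (indicator S x *\<^sub>R y x)) \<partial>lborel) < \<infinity>" using fin by (rule order_le_less_trans)
    qed measurable
  qed measurable
  have ww: "weak_dir 1 y y'" unfolding weak_dir_def
  proof (intro allI impI)
    fix \<phi> :: "real \<Rightarrow> real" and \<phi>' assume T: "C1test \<phi> \<phi>'"
    note t = wd[unfolded weak_deriv1_def, rule_format, OF C1test_imp_test1[OF T]]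
    have i: "integrable lborel (\<lambda>t. \<phi> t *\<^sub>R \<eta>' t)" "integrable lborel (\<lambda>t. \<phi>' t 1 *\<^sub>R \<eta> t)" using t by blast+
    have e: "(\<integral>t. \<phi>' t 1 *\<^sub>R \<eta> t \<partial>lborel) = - (\<integral>t. \<phi> t *\<^sub>R \<eta>' t \<partial>lborel)" using t by blast
    have "integrable lborel (\<lambda>x. snd (\<phi> x *\<^sub>R \<eta>' x))" by (rule integrable_bounded_linear[OF bounded_linear_snd i(1)])
    moreover have "(\<integral>x. snd (\<phi>' x 1 *\<^sub>R \<eta> x) \<partial>lborel) = snd (\<integral>t. \<phi>' t 1 *\<^sub>R \<eta> t \<partial>lborel)"
      by (rule integral_bounded_linear[OF bounded_linear_snd i(2)])
    moreover have "(\<integral>x. snd (\<phi> x *\<^sub>R \<eta>' x) \<partial>lborel) = snd (\<integral>t. \<phi> t *\<^sub>R \<eta>' t \<partial>lborel)"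
      by (rule integral_bounded_linear[OF bounded_linear_snd i(1)])
    ultimately show "integrable lborel (\<lambda>x. \<phi> x * y' x) \<and> (\<integral>x. \<phi>' x 1 * y x \<partial>lborel) = - (\<integral>x. \<phi> x * y' x \<partial>lborel)"
      unfolding y_def y'_def using e by simp
  qed
  have ly': "loc_int y'" and dd: "dir_deriv 1 y y'" using weak_dir_imp_dir_deriv[OF ly _ ww] by simp_all
  have iy': "set_integrable lborel {s..t} y'" for s t using ly' by (simp add: loc_int_def)
  \<comment> \<open>The oriented integral from 0 to \<open>t\<close>: for either sign of
    \<open>t\<close> at most one of the two intervals has positive length.\<close>
  define Z where "Z = (\<lambda>t. (LINT s:{0..t}|lborel. y' s) - (LINT s:{t..0}|lborel. y' s))"
  have Zd: "Z (x + t) - Z x = (LINT s:{x..x+t}|lborel. y' s)" if t: "t \<ge> 0" for x t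
  proof -
    have i: "integrable lborel (\<lambda>s. indicator {p..q} s *\<^sub>R y' s)" for p q using iy'[of p q] by (simp add: set_integrable_def)
    have "Z (x + t) - Z x = (\<integral>s. (indicator {0..x+t} s *\<^sub>R y' s - indicator {x+t..0} s *\<^sub>R y' s) - (indicator {0..x} s *\<^sub>R y' s - indicator {x..0} s *\<^sub>R y' s) \<partial>lborel)"
      unfolding Z_def set_lebesgue_integral_def using i by simp
    also have "\<dots> = (\<integral>s. indicator {x..x+t} s *\<^sub>R y' s \<partial>lborel)"
    proof (rule integral_cong_AE)
      have "AE s in lborel. s \<noteq> 0 \<and> s \<noteq> x \<and> s \<noteq> x + t"
        using AE_lborel_singleton[of 0] AE_lborel_singleton[of x] AE_lborel_singleton[of "x + t"] by eventually_elim simp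
      then show "AE s in lborel. (indicator {0..x+t} s *\<^sub>R y' s - indicator {x+t..0} s *\<^sub>R y' s) - (indicator {0..x} s *\<^sub>R y' s - indicator {x..0} s *\<^sub>R y' s) = indicator {x..x+t} s *\<^sub>R y' s"
        by eventually_elim (use t in \<open>auto simp: indicator_def\<close>)
    qed measurable
    finally show ?thesis by (simp add: set_lebesgue_integral_def)
  qed
  have Zc: "continuous_on UNIV Z"
  proof -
    have "isCont Z x" for x
    proof -
      have "continuous_on {x-1..x+1} (\<lambda>t. Z (x - 1) + integral {x-1..t} y')"
        by (intro continuous_intros indefinite_integral_continuous_1 set_borel_integral_eq_integral(1)[OF iy'])
      moreover have "Z (x - 1) + integral {x-1..t} y' = Z t" if "t \<in> {x-1..x+1}" for t
        using Zd[of "t - (x - 1)" "x - 1"] that set_borel_integral_eq_integral(2)[OF iy', of "x - 1" t] by simp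
      ultimately have "continuous_on {x-1..x+1} Z" by (rule continuous_on_eq)
      then have "continuous_on {x-1<..<x+1} Z" by (rule continuous_on_subset) auto
      then show ?thesis by (simp add: continuous_on_eq_continuous_at)
    qed
    then show ?thesis by (simp add: continuous_at_imp_continuous_on)
  qed
  have [measurable]: "Z \<in> borel_measurable borel" using Zc by (rule borel_measurable_continuous_onI)
  have "\<exists>d. AE x in lborel. y x - Z x = d"
  proof (rule AE_const_of_shift_invariant)
    fix t :: real assume t: "t \<ge> 0"
    have "AE x in lborel. y (x + t) - y x = (LINT s:{0..t}|lborel. y' (x + s))"
      using dd[unfolded dir_deriv_def, rule_format, OF t] by eventually_elim simp
    then show "AE x in lborel. y (x + t) - Z (x + t) = y x - Z x"
    proof eventually_elim
      case (elim x)
      then show ?case using Zd[OF t, of x] set_integral_shift(1)[of y' t x] by simp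
    qed
  qed measurable
  then obtain d where d: "AE x in lborel. y x - Z x = d" by blast
  define Y where "Y = (\<lambda>t. Z t + d)"
  have Yc: "continuous_on UNIV Y" unfolding Y_def using Zc by (intro continuous_intros)
  have Yae: "AE t in lborel. \<eta> t = (a, Y t)"
    using d ea by eventually_elim (auto simp: Y_def y_def prod_eq_iff)
  have Yd: "set_integrable lborel {0..t} (\<lambda>s. y' (x + s)) \<and> Y (x + t) - Y x = (LINT s:{0..t}|lborel. y' (x + s))" if "t \<ge> 0" for x t
    using Zd[OF that, of x] set_integral_shift[of y' t x] iy' by (simp add: Y_def)
  have close: "\<bar>Y t - l\<bar> \<le> \<epsilon>" if "open S" "AE t in lborel. t \<in> S \<longrightarrow> \<bar>Y t - l\<bar> < \<epsilon>" "t \<in> S" for S l \<epsilon> t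
    by (rule continuous_AE_le[OF _ that(1) _ that(3), of "\<lambda>t. \<bar>Y t - l\<bar>"]) (use Yc that(2) in \<open>auto intro!: continuous_intros elim!: eventually_mono\<close>)
  have sn: "\<bar>snd z\<bar> \<le> norm z" for z :: R2 using norm_snd_le[of "snd z" "fst z"] by simp
  have "(Y \<longlongrightarrow> snd up) at_top"
  proof (rule tendstoI)
    fix e :: real assume e: "e > 0"
    then have e2: "e / 2 > 0" by simp
    obtain R where "AE t in lborel. t > R \<longrightarrow> norm (\<eta> t - up) < e / 2" using lt[unfolded ess_lim_top_def, rule_format, OF e2] by blast
    then have "AE t in lborel. t \<in> {R<..} \<longrightarrow> \<bar>Y t - snd up\<bar> < e / 2"
      using Yae
    proof eventually_elim
      case (elim t) then show ?case using sn[of "\<eta> t - up"] by auto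
    qed
    from close[OF open_greaterThan this] have cl: "\<bar>Y t - snd up\<bar> \<le> e / 2" if "t > R" for t using that by simp
    show "\<forall>\<^sub>F t in at_top. dist (Y t) (snd up) < e"
      using eventually_gt_at_top[of R]
    proof eventually_elim
      case (elim t)
      have "\<bar>Y t - l\<bar> < e" if "\<bar>Y t - l\<bar> \<le> e / 2" for l using that e by linarith
      then show ?case using cl[OF elim] by (simp add: dist_real_def)
    qed
  qed
  moreover have "(Y \<longlongrightarrow> snd um) at_bot"
  proof (rule tendstoI)
    fix e :: real assume e: "e > 0"
    then have e2: "e / 2 > 0" by simp
    obtain R where "AE t in lborel. t < R \<longrightarrow> norm (\<eta> t - um) < e / 2" using lb[unfolded ess_lim_bot_def, rule_format, OF e2] by blast
    then have "AE t in lborel. t \<in> {..<R} \<longrightarrow> \<bar>Y t - snd um\<bar> < e / 2"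
      using Yae
    proof eventually_elim
      case (elim t) then show ?case using sn[of "\<eta> t - um"] by auto
    qed
    from close[OF open_lessThan this] have cl: "\<bar>Y t - snd um\<bar> \<le> e / 2" if "t < R" for t using that by simp
    show "\<forall>\<^sub>F t in at_bot. dist (Y t) (snd um) < e"
      using eventually_gt_at_bot[of R]
    proof eventually_elim
      case (elim t)
      have "\<bar>Y t - l\<bar> < e" if "\<bar>Y t - l\<bar> \<le> e / 2" for l using that e by linarith
      then show ?case using cl[OF elim] by (simp add: dist_real_def)
    qed
  qed
  ultimately show thesis using that Yc Yae Yd unfolding y'_def by blast
qed

text \<open>Completing the square: y'^2/2 + c^2/2 equals c y' + (y' - c)^2/2, where c y' integrates
  to an increment of \<Psi>. Energy above this increment therefore pays for the square, and equality
  forces the first order equation y' = c(y).\<close>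

lemma energy1_calibration:
  fixes c \<Psi> :: "real \<Rightarrow> real" and W :: "R2 \<Rightarrow> real"
  assumes adm: "adm1 a um up \<eta> \<eta>'" and Wc: "continuous_on UNIV W" and W0: "\<And>z. W z \<ge> 0"
    and cc: "continuous_on UNIV c" and P: "\<And>y. (\<Psi> has_real_derivative c y) (at y)" and cW: "\<And>y. (c y)\<^sup>2 \<le> 2 * W (a, y)"
    and E: "energy1 W \<eta> \<eta>' \<le> ennreal E0" and E0: "E0 \<ge> 0"
  shows "\<Psi> (snd up) - \<Psi> (snd um) \<le> E0"
    and "E0 \<le> \<Psi> (snd up) - \<Psi> (snd um) \<Longrightarrow> \<exists>Y. (AE t in lborel. \<eta> t = (a, Y t)) \<and> (\<forall>t. (Y has_real_derivative c (Y t)) (at t)) \<and>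
      (Y \<longlongrightarrow> snd um) at_bot \<and> (Y \<longlongrightarrow> snd up) at_top"
proof -
  obtain Y where Yc: "continuous_on UNIV Y" and Yae: "AE t in lborel. \<eta> t = (a, Y t)"
    and Yd: "\<And>x t. t \<ge> 0 \<Longrightarrow> set_integrable lborel {0..t} (\<lambda>s. snd (\<eta>' (x + s))) \<and> Y (x + t) - Y x = (LINT s:{0..t}|lborel. snd (\<eta>' (x + s)))"
    and lb: "(Y \<longlongrightarrow> snd um) at_bot" and lt: "(Y \<longlongrightarrow> snd up) at_top"
    using adm1_representative[OF adm] by blast
  have [measurable]: "\<eta> \<in> borel_measurable borel" "\<eta>' \<in> borel_measurable borel" using adm by (auto simp: adm1_def)
  have [measurable]: "W \<in> borel_measurable borel" "c \<in> borel_measurable borel" "Y \<in> borel_measurable borel"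
    using Wc cc Yc by (auto intro: borel_measurable_continuous_onI)
  define y' where "y' = (\<lambda>t. snd (\<eta>' t))"
  have [measurable]: "y' \<in> borel_measurable borel" unfolding y'_def by measurable
  have cY: "continuous_on UNIV (\<lambda>s. c (Y s))" by (rule continuous_on_compose2[OF cc Yc]) auto
  define e where "e = (\<lambda>t. (1/2) * (norm (\<eta>' t))\<^sup>2 + W (\<eta> t))"
  have e0: "e t \<ge> 0" for t using W0 by (simp add: e_def)
  have em[measurable]: "e \<in> borel_measurable borel" unfolding e_def by measurable
  have nn: "(\<integral>\<^sup>+t. ennreal (e t) \<partial>lborel) \<le> ennreal E0" using E by (simp add: energy1_def e_def)
  have ei: "integrable lborel e"
    by (rule integrableI_bounded) (use nn e0 in \<open>auto intro: order_le_less_trans\<close>)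
  have eE: "(\<integral>t. e t \<partial>lborel) \<le> E0"
    using nn E0 e0 by (subst (asm) nn_integral_eq_integral[OF ei]) auto
  \<comment> \<open>The defect in the profile equation; c(Y) y' + q is y'^2/2 + c(Y)^2/2.\<close>
  define q where "q = (\<lambda>s. (1/2) * (y' s - c (Y s))\<^sup>2)"
  have qm[measurable]: "q \<in> borel_measurable borel" unfolding q_def by measurable
  have q0: "q s \<ge> 0" for s by (simp add: q_def)
  have y2: "integrable lborel (\<lambda>s. (y' s)\<^sup>2)"
  proof (rule Bochner_Integration.integrable_bound[OF integrable_mult_right[OF ei, of 2]])
    show "AE s in lborel. norm ((y' s)\<^sup>2) \<le> norm (2 * e s)"
    proof (rule AE_I2)
      fix s
      have "\<bar>y' s\<bar> \<le> norm (\<eta>' s)" unfolding y'_def using norm_snd_le[of "snd (\<eta>' s)" "fst (\<eta>' s)"] by simp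
      then have "(y' s)\<^sup>2 \<le> (norm (\<eta>' s))\<^sup>2" by (metis abs_ge_zero power2_abs power_mono)
      also have "\<dots> \<le> 2 * e s" using W0[of "\<eta> s"] by (simp add: e_def)
      finally show "norm ((y' s)\<^sup>2) \<le> norm (2 * e s)" using e0[of s] by simp
    qed
  qed measurable
  have key: "\<Psi> (Y b) - \<Psi> (Y x) + (LINT s:{x..b}|lborel. q s) \<le> E0" and qi: "set_integrable lborel {x..b} q" if xb: "x \<le> b" for x b
  proof -
    define t where "t = b - x"
    have t: "t \<ge> 0" using xb by (simp add: t_def)
    have b: "x + t = b" by (simp add: t_def)
    have gi: "set_integrable lborel {0..t} (\<lambda>s. y' (x + s))" using Yd[OF t, of x] by (simp add: y'_def)
    have rep: "Y (x + s) = Y x + (LINT r:{0..s}|lborel. y' (x + r))" if "s \<in> {0..t}" for s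
      using Yd[of s x] that by (simp add: y'_def)
    note cr = chain_rule_indefinite_integral[OF t gi, of "\<lambda>s. Y (x + s)" "Y x" \<Psi> c, OF rep P cc]
    have ci: "set_integrable lborel {x..b} (\<lambda>s. c (Y s) * y' s)"
      using cr(1) set_integral_shift(2)[of "\<lambda>s. c (Y s) * y' s" t x] by (simp add: b)
    have cE: "\<Psi> (Y b) - \<Psi> (Y x) = (LINT s:{x..b}|lborel. c (Y s) * y' s)"
      using cr(2) set_integral_shift(1)[of "\<lambda>s. c (Y s) * y' s" t x] by (simp add: b)
    have y2i: "set_integrable lborel {x..b} (\<lambda>s. (y' s)\<^sup>2)"
      unfolding set_integrable_def using y2 by (intro integrable_mult_indicator) auto
    have c2i: "set_integrable lborel {x..b} (\<lambda>s. (c (Y s))\<^sup>2)"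
      by (intro borel_integrable_atLeastAtMost' continuous_intros continuous_on_subset[OF cY]) auto
    have qeq: "q = (\<lambda>s. (1/2) * (y' s)\<^sup>2 + (1/2) * (c (Y s))\<^sup>2 - c (Y s) * y' s)"
      by (auto simp: q_def power2_diff field_simps)
    show qi: "set_integrable lborel {x..b} q"
      unfolding qeq using ci y2i c2i by (intro set_integral_diff(1) set_integral_add(1)) auto
    have "\<Psi> (Y b) - \<Psi> (Y x) + (LINT s:{x..b}|lborel. q s) = (LINT s:{x..b}|lborel. c (Y s) * y' s + q s)"
      unfolding cE using set_integral_add(2)[OF ci qi] by simp
    also have "\<dots> = (\<integral>s. indicator {x..b} s *\<^sub>R (c (Y s) * y' s + q s) \<partial>lborel)" by (simp add: set_lebesgue_integral_def)
    also have "\<dots> \<le> (\<integral>s. e s \<partial>lborel)"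
    proof (rule integral_mono_AE[OF _ ei])
      show "integrable lborel (\<lambda>s. indicator {x..b} s *\<^sub>R (c (Y s) * y' s + q s))"
        using set_integral_add(1)[OF ci qi] by (simp only: set_integrable_def)
      show "AE s in lborel. indicator {x..b} s *\<^sub>R (c (Y s) * y' s + q s) \<le> e s" using Yae
      proof eventually_elim
        case (elim s)
        have "\<bar>y' s\<bar> \<le> norm (\<eta>' s)" unfolding y'_def using norm_snd_le[of "snd (\<eta>' s)" "fst (\<eta>' s)"] by simp
        then have "(y' s)\<^sup>2 \<le> (norm (\<eta>' s))\<^sup>2" by (metis abs_ge_zero power2_abs power_mono)
        moreover have "c (Y s) * y' s + q s = (y' s)\<^sup>2 / 2 + (c (Y s))\<^sup>2 / 2" by (simp add: qeq)
        moreover have "(c (Y s))\<^sup>2 \<le> 2 * W (\<eta> s)" using cW[of "Y s"] elim by simp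
        ultimately have "c (Y s) * y' s + q s \<le> e s" by (simp add: e_def)
        then show ?case using e0[of s] by (auto simp: indicator_def)
      qed
    qed
    finally show "\<Psi> (Y b) - \<Psi> (Y x) + (LINT s:{x..b}|lborel. q s) \<le> E0" using eE by simp
  qed
  have \<Psi>c: "isCont \<Psi> z" for z using P DERIV_isCont by blast
  have lt': "(\<lambda>n. \<Psi> (Y (real n))) \<longlonglongrightarrow> \<Psi> (snd up)"
    by (rule isCont_tendsto_compose[OF \<Psi>c filterlim_compose[OF lt filterlim_real_sequentially]])
  have "filterlim (\<lambda>n. - real n) at_bot sequentially"
    using filterlim_real_sequentially by (simp add: filterlim_uminus_at_top)
  from isCont_tendsto_compose[OF \<Psi>c filterlim_compose[OF lb this]]
  have lb': "(\<lambda>n. \<Psi> (Y (- real n))) \<longlonglongrightarrow> \<Psi> (snd um)" .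
  have lim: "(\<lambda>n. \<Psi> (Y (real n)) - \<Psi> (Y (- real n))) \<longlonglongrightarrow> \<Psi> (snd up) - \<Psi> (snd um)"
    by (rule tendsto_diff[OF lt' lb'])
  have Q0: "(LINT s:{x..b}|lborel. q s) \<ge> 0" for x b
    unfolding set_lebesgue_integral_def using q0 by (intro Bochner_Integration.integral_nonneg) auto
  have "\<Psi> (Y (real n)) - \<Psi> (Y (- real n)) \<le> E0" for n
    using key[of "- real n" "real n"] Q0[of "- real n" "real n"] by simp
  then show "\<Psi> (snd up) - \<Psi> (snd um) \<le> E0" by (intro LIMSEQ_le_const2[OF lim]) auto
  assume le: "E0 \<le> \<Psi> (snd up) - \<Psi> (snd um)"
  have "(LINT s:{- real k..real k}|lborel. q s) = 0" for k
  proof -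
    \<comment> \<open>The window for the defect stays fixed while the endpoints in \<Psi> go to
      infinity.\<close>
    have "(LINT s:{- real k..real k}|lborel. q s) \<le> E0 - (\<Psi> (Y (real n)) - \<Psi> (Y (- real n)))" if "n \<ge> k" for n
    proof -
      have "(LINT s:{- real k..real k}|lborel. q s) \<le> (LINT s:{- real n..real n}|lborel. q s)"
        unfolding set_lebesgue_integral_def
        using qi[of "- real k" "real k"] qi[of "- real n" "real n"] q0 that
        by (intro integral_mono) (auto simp: set_integrable_def indicator_def)
      then show ?thesis using key[of "- real n" "real n"] by simp
    qed
    moreover have "(\<lambda>n. E0 - (\<Psi> (Y (real n)) - \<Psi> (Y (- real n)))) \<longlonglongrightarrow> E0 - (\<Psi> (snd up) - \<Psi> (snd um))"
      by (intro tendsto_diff tendsto_const lim)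
    ultimately have "(LINT s:{- real k..real k}|lborel. q s) \<le> E0 - (\<Psi> (snd up) - \<Psi> (snd um))"
      by (intro LIMSEQ_le_const) auto
    then show ?thesis using le Q0[of "- real k" "real k"] by linarith
  qed
  then have "AE s in lborel. indicator {- real k..real k} s *\<^sub>R q s = 0" for k
    using qi[of "- real k" "real k"] q0 unfolding set_lebesgue_integral_def set_integrable_def
    by (subst integral_nonneg_eq_0_iff_AE[symmetric]) auto
  then have "AE s in lborel. \<forall>k. indicator {- real k..real k} s *\<^sub>R q s = 0" by (subst AE_all_countable) blast
  then have ode: "AE s in lborel. y' s = c (Y s)"
  proof eventually_elim
    case (elim s)
    obtain k where "\<bar>s\<bar> \<le> real k" using real_arch_simple by blast
    then have "s \<in> {- real k..real k}" by auto
    then have "q s = 0" using elim[rule_format, of k] by simp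
    then show ?case by (simp add: q_def)
  qed
  have "(Y has_real_derivative c (Y x)) (at x)" for x
  proof -
    \<comment> \<open>\<open>Y\<close> is now a primitive of the continuous function c(Y), so the
      equation holds everywhere and not only almost everywhere.\<close>
    have Yi: "Y t = Y (x - 1) + integral {x-1..t} (\<lambda>s. c (Y s))" if "t \<ge> x - 1" for t
    proof -
      have si: "set_integrable lborel {x-1..t} (\<lambda>s. c (Y s))"
        by (intro borel_integrable_atLeastAtMost' continuous_on_subset[OF cY]) auto
      have "Y (x - 1 + (t - (x - 1))) - Y (x - 1) = (LINT s:{0..t - (x - 1)}|lborel. y' (x - 1 + s))"
        using Yd[of "t - (x - 1)" "x - 1"] that by (simp add: y'_def)
      also have "\<dots> = (LINT s:{x-1..t}|lborel. y' s)" using set_integral_shift(1)[of y' "t - (x - 1)" "x - 1"] by simp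
      also have "\<dots> = (LINT s:{x-1..t}|lborel. c (Y s))"
        unfolding set_lebesgue_integral_def by (rule integral_cong_AE) (use ode in \<open>auto elim!: eventually_mono\<close>)
      also have "\<dots> = integral {x-1..t} (\<lambda>s. c (Y s))" by (rule set_borel_integral_eq_integral(2)[OF si])
      finally show ?thesis by simp
    qed
    have "((\<lambda>t. integral {x-1..t} (\<lambda>s. c (Y s))) has_real_derivative c (Y x)) (at x within {x-1..x+1})"
      by (rule integral_has_real_derivative) (auto intro: continuous_on_subset[OF cY])
    then have "((\<lambda>t. integral {x-1..t} (\<lambda>s. c (Y s))) has_real_derivative c (Y x)) (at x)"
      by (simp add: at_within_Icc_at)
    then have d: "((\<lambda>t. Y (x - 1) + integral {x-1..t} (\<lambda>s. c (Y s))) has_real_derivative c (Y x)) (at x)"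
      by (auto intro!: derivative_eq_intros)
    show ?thesis
      by (rule has_field_derivative_transform_within_open[OF d, of "{x-1<..}"]) (auto intro: Yi[symmetric])
  qed
  then show "\<exists>Y. (AE t in lborel. \<eta> t = (a, Y t)) \<and> (\<forall>t. (Y has_real_derivative c (Y t)) (at t)) \<and>
      (Y \<longlongrightarrow> snd um) at_bot \<and> (Y \<longlongrightarrow> snd up) at_top"
    using Yae lb lt by (intro exI[of _ Y]) blast
qed

text \<open>\<open>c\<close> is not assumed Lipschitz, so uniqueness comes from the time map: G(Y t)
  - t is locally constant while \<open>Y\<close> stays in \<open>I\<close>. The set where
  \<open>Y\<close> agrees with the translate is open and closed, which also proves that
  \<open>Y\<close> never leaves \<open>I\<close>.\<close>

lemma ode_solution_translate:
  fixes c g G Y :: "real \<Rightarrow> real"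
  assumes I: "open I" and g: "\<And>t. g t \<in> I" and gc: "continuous_on UNIV g"
    and G: "\<And>y. y \<in> I \<Longrightarrow> (G has_real_derivative 1 / c y) (at y)" and c0: "\<And>y. y \<in> I \<Longrightarrow> c y \<noteq> 0"
    and Gg: "\<And>t. G (g t) = t" and gG: "\<And>y. y \<in> I \<Longrightarrow> g (G y) = y"
    and Y: "\<And>t. (Y has_real_derivative c (Y t)) (at t)" and t0: "Y t0 \<in> I"
  shows "\<exists>\<tau>. \<forall>t. Y t = g (t + \<tau>)"
proof -
  define \<tau> where "\<tau> = G (Y t0) - t0"
  have Yc: "continuous_on UNIV Y" using Y by (meson DERIV_isCont continuous_at_imp_continuous_on)
  define S where "S = {t. Y t = g (t + \<tau>)}"
  have "t0 \<in> S" using gG[OF t0] by (simp add: S_def \<tau>_def)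
  moreover have "closed S" unfolding S_def
    by (intro closed_Collect_eq Yc continuous_on_compose2[OF gc] continuous_intros) auto
  moreover have "open S"
  proof (subst open_contains_ball, intro ballI)
    fix t1 assume t1: "t1 \<in> S"
    have "open (Y -` I)" using Yc I by (simp add: continuous_on_open_vimage)
    moreover have "t1 \<in> Y -` I" using t1 g by (simp add: S_def)
    ultimately obtain e where e: "e > 0" "ball t1 e \<subseteq> Y -` I" unfolding open_contains_ball by blast
    have d: "((\<lambda>t. G (Y t) - t) has_real_derivative 0) (at t)" if "t \<in> ball t1 e" for t
    proof -
      have yi: "Y t \<in> I" using e(2) that by auto
      have "((\<lambda>t. G (Y t)) has_real_derivative 1 / c (Y t) * c (Y t)) (at t)"
        by (rule DERIV_chain2[OF G[OF yi] Y])
      then show ?thesis using c0[OF yi] by (auto intro!: derivative_eq_intros)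
    qed
    have "t \<in> S" if t: "t \<in> ball t1 e" for t
    proof -
      have dw: "\<And>s. s \<in> ball t1 e \<Longrightarrow> ((\<lambda>t. G (Y t) - t) has_field_derivative 0) (at s within ball t1 e)"
        by (rule has_field_derivative_at_within[OF d])
      from has_field_derivative_zero_constant[OF convex_ball this]
      obtain k where "\<And>s. s \<in> ball t1 e \<Longrightarrow> G (Y s) - s = k" by blast
      then have "G (Y t) - t = G (Y t1) - t1" using t e(1) by simp
      moreover have "G (Y t1) = t1 + \<tau>" using t1 Gg by (simp add: S_def)
      ultimately have "G (Y t) = t + \<tau>" by simp
      moreover have "Y t \<in> I" using e(2) t by auto
      ultimately show ?thesis using gG[of "Y t"] by (simp add: S_def)
    qed
    then show "\<exists>e>0. ball t1 e \<subseteq> S" using e(1) by blast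
  qed
  ultimately have "S = UNIV" using clopen by blast
  then show ?thesis unfolding S_def by blast
qed

section \<open>The competitor\<close>

text \<open>Averaging the derivative over a unit segment along \<open>e\<close> leaves its integral
  unchanged, by the kernel lemma with the constant 1, and turns it into the difference of \<psi> and
  a translate, which integrates to zero.\<close>

lemma C1test_derivative_integral_0:
  fixes \<psi> :: "'a::euclidean_space \<Rightarrow> real"
  assumes T: "C1test \<psi> \<psi>'"
  shows "integrable lborel (\<lambda>x. \<psi>' x e)" "(\<integral>x. \<psi>' x e \<partial>lborel) = 0"
proof -
  obtain C0 R where C0: "\<And>x. \<bar>\<psi> x\<bar> \<le> C0" and R: "\<And>x. norm x > R \<Longrightarrow> \<psi> x = 0"
    and "continuous_on UNIV \<psi>" and [measurable]: "\<psi> \<in> borel_measurable borel"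
    by (rule C1test_bounded[OF T], rule that)
  have c: "continuous_on UNIV (\<lambda>x. \<psi>' x e)" using T by (simp add: C1test_def)
  then have [measurable]: "(\<lambda>x. \<psi>' x e) \<in> borel_measurable borel" by (rule borel_measurable_continuous_onI)
  have z: "\<psi>' x e = 0" if x: "norm x > R" for x
  proof -
    have d: "(\<psi> has_derivative \<psi>' x) (at x)" using T by (simp add: C1test_def)
    have "((\<lambda>x. 0) has_derivative \<psi>' x) (at x)"
    proof (rule has_derivative_transform_within_open[OF d, of "{x. norm x > R}"])
      show "open {x::'a. R < norm x}" by (intro open_Collect_less continuous_intros)
    qed (use x R in auto)
    moreover have "((\<lambda>x. 0) has_derivative (\<lambda>h. 0::real)) (at x)" by simp
    ultimately have "\<psi>' x = (\<lambda>h. 0)" by (rule has_derivative_unique)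
    then show ?thesis by simp
  qed
  have "compact ((\<lambda>x. \<psi>' x e) ` cball 0 R)" by (intro compact_continuous_image continuous_on_subset[OF c]) auto
  then obtain C where "\<And>x. norm x \<le> R \<Longrightarrow> \<bar>\<psi>' x e\<bar> \<le> C" using compact_imp_bounded by (fastforce simp: bounded_iff)
  then have C: "\<bar>\<psi>' x e\<bar> \<le> max 0 C" for x using z[of x] by (cases "norm x \<le> R") (auto simp: le_max_iff_disj)
  have i: "integrable lborel (\<lambda>x. \<psi>' x e * 1)" by (rule loc_int_bounded_mult[OF loc_int_const _ C z]) auto
  then show "integrable lborel (\<lambda>x. \<psi>' x e)" by simp
  have i0: "integrable lborel (\<lambda>x. \<psi> x * 1)" by (rule loc_int_bounded_mult[OF loc_int_const _ C0 R]) auto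
  have s: "(LINT s:{0..1::real}|lborel. \<psi>' (x - s *\<^sub>R e) e) = \<psi> x - \<psi> (x - e)" for x
  proof -
    have "set_integrable lborel {0..1} (\<lambda>s. \<psi>' (x - s *\<^sub>R e) e)"
      by (intro borel_integrable_atLeastAtMost' continuous_on_compose2[OF c] continuous_intros) auto
    from set_borel_integral_eq_integral(2)[OF this] show ?thesis using C1test_shift_average(2)[OF T, of 1 x e] by simp
  qed
  have "(\<integral>x. \<psi>' x e * (LINT s:{0..1::real}|lborel. 1) \<partial>lborel) = (\<integral>x. (LINT s:{0..1::real}|lborel. \<psi>' (x - s *\<^sub>R e) e) * 1 \<partial>lborel)"
    by (rule shift_kernel_integrable(3)[where b="\<lambda>x. \<psi>' x e", OF loc_int_const _ C z]) auto
  then have "(\<integral>x. \<psi>' x e \<partial>lborel) = (\<integral>x. \<psi> x - \<psi> (x - e) \<partial>lborel)"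
    by (simp add: s) (simp add: set_lebesgue_integral_def)
  also have "\<dots> = 0"
    using i0 integrable_shift[of \<psi> "- e"] integral_shift_lborel[of \<psi> "- e"] by simp
  finally show "(\<integral>x. \<psi>' x e \<partial>lborel) = 0" .
qed

lemma nn_integral_cellm_fst:
  assumes [measurable]: "k \<in> borel_measurable borel"
  shows "(\<integral>\<^sup>+x. k (fst x) \<partial>cellm) = (\<integral>\<^sup>+t. k t \<partial>lborel)"
proof -
  have m: "(\<lambda>x::R2. k (fst x)) \<in> borel_measurable borel" by measurable
  have "(\<integral>\<^sup>+x. k (fst x) \<partial>cellm) = (\<integral>\<^sup>+x1. (\<integral>\<^sup>+x2. k x1 * indicator {0..<1::real} x2 \<partial>lborel) \<partial>lborel)"
    by (simp only: nn_integral_cellm_iterated[OF m] fst_conv)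
  then show ?thesis by (simp add: nn_integral_cmult_indicator)
qed

lemma integrable_continuous_compact_support:
  fixes f :: "'a::euclidean_space \<Rightarrow> 'b::{banach, second_countable_topology}"
  assumes "continuous_on UNIV f" "\<And>x. norm x > R \<Longrightarrow> f x = 0"
  shows "integrable lborel f"
proof -
  have "integrable lborel (\<lambda>x. indicator (cball 0 R) x *\<^sub>R f x)"
    by (rule borel_integrable_compact) (auto intro: continuous_on_subset[OF assms(1)])
  moreover have "(\<lambda>x. indicator (cball 0 R) x *\<^sub>R f x) = f" using assms(2) by (auto simp: indicator_def)
  ultimately show ?thesis by simp
qed

lemma integral_pair_eqI:
  fixes f g :: "'a \<Rightarrow> R2"
  assumes f: "integrable M f" and g: "integrable M g"
    and "(\<integral>x. fst (f x) \<partial>M) = - (\<integral>x. fst (g x) \<partial>M)" "(\<integral>x. snd (f x) \<partial>M) = - (\<integral>x. snd (g x) \<partial>M)"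
  shows "(\<integral>x. f x \<partial>M) = - (\<integral>x. g x \<partial>M)"
proof (rule prod_eqI)
  show "fst (\<integral>x. f x \<partial>M) = fst (- (\<integral>x. g x \<partial>M))"
    unfolding fst_uminus integral_bounded_linear[OF bounded_linear_fst f, symmetric] integral_bounded_linear[OF bounded_linear_fst g, symmetric]
    by (rule assms(3))
  show "snd (\<integral>x. f x \<partial>M) = snd (- (\<integral>x. g x \<partial>M))"
    unfolding snd_uminus integral_bounded_linear[OF bounded_linear_snd f, symmetric] integral_bounded_linear[OF bounded_linear_snd g, symmetric]
    by (rule assms(4))
qed

text \<open>The product of a test function with g(x1) is again a test function, so integration by
  parts reduces to the vanishing integral of its derivative and the product rule.\<close>

lemma competitor_weak_grad:
  fixes g g' :: "real \<Rightarrow> real"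
  assumes g: "\<And>t. (g has_real_derivative g' t) (at t)" and g': "continuous_on UNIV g'"
  shows "weak_grad2 (\<lambda>x. (a, g (fst x))) (\<lambda>x. (0, g' (fst x))) (\<lambda>x. (0, 0))"
  unfolding weak_grad2_def
proof (intro allI impI)
  fix \<phi> \<phi>1 \<phi>2 assume t: "test2 \<phi> \<phi>1 \<phi>2"
  have gc: "continuous_on UNIV g" using g by (meson DERIV_isCont continuous_at_imp_continuous_on)
  have c1: "continuous_on UNIV \<phi>1" and c2: "continuous_on UNIV \<phi>2"
    and d: "\<And>z. (\<phi> has_derivative (\<lambda>h. \<phi>1 z * fst h + \<phi>2 z * snd h)) (at z)"
    using t unfolding test2_def by blast+
  obtain R where R: "\<And>z. norm z > R \<Longrightarrow> \<phi> z = 0" using t unfolding test2_def by blast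
  have c0: "continuous_on UNIV \<phi>" using d by (meson continuous_at_imp_continuous_on has_derivative_continuous)
  define \<phi>' where "\<phi>' = (\<lambda>z h. \<phi>1 z * fst h + \<phi>2 z * snd h)"
  have T: "C1test \<phi> \<phi>'" unfolding C1test_def
  proof (intro conjI allI)
    show "(\<phi> has_derivative \<phi>' z) (at z)" for z using d[of z] by (simp add: \<phi>'_def)
    show "continuous_on UNIV (\<lambda>z. \<phi>' z h)" for h unfolding \<phi>'_def by (intro continuous_intros c1 c2)
    show "\<exists>R. \<forall>z. norm z > R \<longrightarrow> \<phi> z = 0" using R by blast
  qed
  define \<psi>' where "\<psi>' = (\<lambda>z h. \<phi> z * (g' (fst z) * fst h) + \<phi>' z h * g (fst z))"
  have T2: "C1test (\<lambda>z. \<phi> z * g (fst z)) \<psi>'" unfolding C1test_def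
  proof (intro conjI allI)
    show "((\<lambda>z. \<phi> z * g (fst z)) has_derivative \<psi>' z) (at z)" for z :: R2
    proof -
      have f: "(fst has_derivative fst) (at z)" by (rule has_derivative_fst[OF has_derivative_ident])
      have "((\<lambda>z. g (fst z)) has_derivative (\<lambda>h. g' (fst z) * fst h)) (at z)"
        using has_derivative_compose[OF f, of g "(*) (g' (fst z))"] g[of "fst z"] by (simp add: has_field_derivative_def)
      from has_derivative_mult[OF _ this, of \<phi> "\<phi>' z"] d[of z] show ?thesis by (simp add: \<psi>'_def \<phi>'_def)
    qed
    show "continuous_on UNIV (\<lambda>z. \<psi>' z h)" for h unfolding \<psi>'_def \<phi>'_def
      by (intro continuous_intros c0 c1 c2 continuous_on_compose2[OF g'] continuous_on_compose2[OF gc]) auto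
    show "\<exists>R. \<forall>z. norm z > R \<longrightarrow> \<phi> z * g (fst z) = 0" using R by (metis mult_zero_left)
  qed
  note supp = C1test_derivative_integral_0[OF T] C1test_derivative_integral_0[OF T2]
  have z: "\<phi>1 z = 0 \<and> \<phi>2 z = 0" if x: "norm z > R" for z
  proof -
    have "((\<lambda>x. 0) has_derivative (\<lambda>h. \<phi>1 z * fst h + \<phi>2 z * snd h)) (at z)"
    proof (rule has_derivative_transform_within_open[OF d, of "{x. norm x > R}"])
      show "open {x::R2. R < norm x}" by (intro open_Collect_less continuous_intros)
    qed (use x R in auto)
    moreover have "((\<lambda>x. 0) has_derivative (\<lambda>h. 0::real)) (at z)" by simp
    ultimately have "(\<lambda>h. \<phi>1 z * fst h + \<phi>2 z * snd h) = (\<lambda>h. 0)" by (rule has_derivative_unique)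
    from fun_cong[OF this, of "(1, 0)"] fun_cong[OF this, of "(0, 1)"] show ?thesis by simp
  qed
  have gf: "continuous_on UNIV (\<lambda>z::R2. g (fst z))" "continuous_on UNIV (\<lambda>z::R2. g' (fst z))"
    by (intro continuous_on_compose2[OF gc] continuous_on_compose2[OF g'] continuous_intros; auto)+
  have i1: "integrable lborel (\<lambda>z. \<phi>1 z *\<^sub>R (a, g (fst z)))"
    by (rule integrable_continuous_compact_support[of _ R]) (use z in \<open>auto intro!: continuous_intros c1 gf simp: zero_prod_def\<close>)
  have i2: "integrable lborel (\<lambda>z. \<phi>2 z *\<^sub>R (a, g (fst z)))"
    by (rule integrable_continuous_compact_support[of _ R]) (use z in \<open>auto intro!: continuous_intros c2 gf simp: zero_prod_def\<close>)
  have i3: "integrable lborel (\<lambda>z. \<phi> z *\<^sub>R (0::real, g' (fst z)))"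
    by (rule integrable_continuous_compact_support[of _ R]) (use R in \<open>auto intro!: continuous_intros c0 gf simp: zero_prod_def\<close>)
  have i4: "integrable lborel (\<lambda>z. \<phi> z *\<^sub>R (0::real, 0::real))" by (simp flip: zero_prod_def)
  have g1: "integrable lborel (\<lambda>z. \<phi>1 z * g (fst z))" using integrable_bounded_linear[OF bounded_linear_snd i1] by simp
  have g3: "integrable lborel (\<lambda>z. \<phi> z * g' (fst z))" using integrable_bounded_linear[OF bounded_linear_snd i3] by simp
  have e1: "(\<integral>z. \<phi>1 z \<partial>lborel) = 0" "(\<integral>z. \<phi>2 z \<partial>lborel) = 0"
    using supp(2)[of "(1, 0)"] supp(2)[of "(0, 1)"] by (simp_all add: \<phi>'_def)
  have e2: "(\<integral>z. \<phi> z * g' (fst z) + \<phi>1 z * g (fst z) \<partial>lborel) = 0" "(\<integral>z. \<phi>2 z * g (fst z) \<partial>lborel) = 0"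
    using supp(4)[of "(1, 0)"] supp(4)[of "(0, 1)"] by (simp_all add: \<phi>'_def \<psi>'_def)
  have e3: "(\<integral>z. \<phi>1 z * g (fst z) \<partial>lborel) = - (\<integral>z. \<phi> z * g' (fst z) \<partial>lborel)"
    using e2(1) g1 g3 by simp
  have "(\<integral>z. \<phi>1 z *\<^sub>R (a, g (fst z)) \<partial>lborel) = - (\<integral>z. \<phi> z *\<^sub>R (0, g' (fst z)) \<partial>lborel)"
    by (rule integral_pair_eqI[OF i1 i3]) (simp_all add: e1 e3)
  moreover have "(\<integral>z. \<phi>2 z *\<^sub>R (a, g (fst z)) \<partial>lborel) = - (\<integral>z. \<phi> z *\<^sub>R (0, 0) \<partial>lborel)"
    by (rule integral_pair_eqI[OF i2 i4]) (simp_all add: e1 e2)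
  ultimately show "integrable lborel (\<lambda>z. \<phi>1 z *\<^sub>R (a, g (fst z))) \<and> integrable lborel (\<lambda>z. \<phi>2 z *\<^sub>R (a, g (fst z))) \<and>
        integrable lborel (\<lambda>z. \<phi> z *\<^sub>R (0::real, g' (fst z))) \<and> integrable lborel (\<lambda>z. \<phi> z *\<^sub>R (0::real, 0::real)) \<and>
        (\<integral>z. \<phi>1 z *\<^sub>R (a, g (fst z)) \<partial>lborel) = - (\<integral>z. \<phi> z *\<^sub>R (0, g' (fst z)) \<partial>lborel) \<and>
        (\<integral>z. \<phi>2 z *\<^sub>R (a, g (fst z)) \<partial>lborel) = - (\<integral>z. \<phi> z *\<^sub>R (0, 0) \<partial>lborel)"
    using i1 i2 i3 i4 by blast
qed

lemma nn_integral_profile: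
  fixes N n :: "real \<Rightarrow> real"
  assumes N: "\<And>t. (N has_real_derivative n t) (at t)" and n0: "\<And>t. n t \<ge> 0" and [measurable]: "n \<in> borel_measurable borel"
    and lt: "(N \<longlongrightarrow> p) at_top" and lb: "(N \<longlongrightarrow> m) at_bot"
  shows "(\<integral>\<^sup>+t. ennreal (n t) \<partial>lborel) \<le> ennreal (p - m)"
proof -
  have mono: "N s \<le> N t" if "s \<le> t" for s t
    by (rule DERIV_nonneg_imp_nondecreasing[OF that]) (use N n0 in blast)
  have Np: "N t \<le> p" for t
    by (rule tendsto_lowerbound[OF lt]) (use mono in \<open>auto intro: eventually_mono[OF eventually_ge_at_top[of t]]\<close>)
  have Nm: "m \<le> N t" for t
    by (rule tendsto_upperbound[OF lb]) (use mono in \<open>auto intro: eventually_mono[OF eventually_le_at_bot[of t]]\<close>)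
  have I: "(\<integral>\<^sup>+t. ennreal (n t) * indicator {- real k..real k} t \<partial>lborel) \<le> ennreal (p - m)" for k
  proof -
    have "(\<integral>\<^sup>+t. ennreal (n t) * indicator {- real k..real k} t \<partial>lborel) = ennreal (N (real k) - N (- real k))"
      by (rule nn_integral_FTC_Icc) (use N n0 in auto)
    also have "\<dots> \<le> ennreal (p - m)" using Np[of "real k"] Nm[of "- real k"] by (intro ennreal_leI) linarith
    finally show ?thesis .
  qed
  have "(\<integral>\<^sup>+t. ennreal (n t) \<partial>lborel) = (\<integral>\<^sup>+t. (SUP k. ennreal (n t) * indicator {- real k..real k} t) \<partial>lborel)"
  proof (rule nn_integral_cong)
    fix t
    obtain k :: nat where k: "\<bar>t\<bar> \<le> real k" using real_arch_simple by blast
    then have tk: "t \<in> {- real k..real k}" by auto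
    show "ennreal (n t) = (SUP k. ennreal (n t) * indicator {- real k..real k} t)"
    proof (rule antisym)
      show "ennreal (n t) \<le> (SUP k. ennreal (n t) * indicator {- real k..real k} t)"
        by (rule SUP_upper2[of k]) (use tk in auto)
      show "(SUP k. ennreal (n t) * indicator {- real k..real k} t) \<le> ennreal (n t)"
        by (rule SUP_least) (auto simp: indicator_def)
    qed
  qed
  also have "\<dots> = (SUP k. \<integral>\<^sup>+t. ennreal (n t) * indicator {- real k..real k} t \<partial>lborel)"
    by (rule nn_integral_monotone_convergence_SUP) (auto simp: incseq_def le_fun_def indicator_def)
  also have "\<dots> \<le> ennreal (p - m)" by (rule SUP_least) (rule I)
  finally show ?thesis .
qed

text \<open>Along the profile the kinetic and the potential part are equal, so the energy density is
  c(g)^2, which is the derivative of \<Psi>(g).\<close>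

lemma competitor:
  fixes g c \<Psi> :: "real \<Rightarrow> real"
  assumes um: "fst um = a" and up: "fst up = a" and Wc: "continuous_on UNIV W"
    and g: "\<And>t. (g has_real_derivative c (g t)) (at t)" and cc: "continuous_on UNIV c"
    and gb: "\<And>t. \<bar>g t\<bar> \<le> K" and lb: "(g \<longlongrightarrow> snd um) at_bot" and lt: "(g \<longlongrightarrow> snd up) at_top"
    and P: "\<And>y. (\<Psi> has_real_derivative c y) (at y)" and W: "\<And>t. W (a, g t) = (1/2) * (c (g t))\<^sup>2"
  shows "admP um up (\<lambda>x. (a, g (fst x))) (\<lambda>x. (0, c (g (fst x)))) (\<lambda>x. (0, 0))"
    and "energyP W (\<lambda>x. (a, g (fst x))) (\<lambda>x. (0, c (g (fst x)))) (\<lambda>x. (0, 0)) \<le> ennreal (\<Psi> (snd up) - \<Psi> (snd um))"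
proof -
  have gc: "continuous_on UNIV g" using g by (meson DERIV_isCont continuous_at_imp_continuous_on)
  have cg: "continuous_on UNIV (\<lambda>t. c (g t))" by (rule continuous_on_compose2[OF cc gc]) auto
  have [measurable]: "g \<in> borel_measurable borel" "(\<lambda>t. c (g t)) \<in> borel_measurable borel" "W \<in> borel_measurable borel"
    using gc cg Wc by (auto intro: borel_measurable_continuous_onI)
  have cgf: "(\<lambda>x::R2. c (g (fst x))) \<in> borel_measurable borel" "(\<lambda>x::R2. g (fst x)) \<in> borel_measurable borel"
    by (intro borel_measurable_continuous_onI continuous_on_compose2[OF cg] continuous_on_compose2[OF gc] continuous_intros; auto)+
  note [measurable] = cgf
  have pm: "(\<lambda>x::R2. (p, h x)) \<in> borel_measurable borel" if [measurable]: "h \<in> borel_measurable borel" for p :: real and h :: "R2 \<Rightarrow> real"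
    unfolding borel_prod[symmetric] by (intro measurable_Pair) (auto simp: borel_prod)
  have I: "(\<integral>\<^sup>+t. ennreal ((c (g t))\<^sup>2) \<partial>lborel) \<le> ennreal (\<Psi> (snd up) - \<Psi> (snd um))"
  proof (rule nn_integral_profile[of "\<lambda>t. \<Psi> (g t)"])
    show "((\<lambda>t. \<Psi> (g t)) has_real_derivative (c (g t))\<^sup>2) (at t)" for t
      using DERIV_chain2[OF P g, of t] by (simp add: power2_eq_square)
    have \<Psi>c: "isCont \<Psi> z" for z using P DERIV_isCont by blast
    show "((\<lambda>t. \<Psi> (g t)) \<longlongrightarrow> \<Psi> (snd up)) at_top" by (rule isCont_tendsto_compose[OF \<Psi>c lt])
    show "((\<lambda>t. \<Psi> (g t)) \<longlongrightarrow> \<Psi> (snd um)) at_bot" by (rule isCont_tendsto_compose[OF \<Psi>c lb])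
  qed auto
  have Ic: "(\<integral>\<^sup>+x. ennreal ((c (g (fst x)))\<^sup>2) \<partial>cellm) \<le> ennreal (\<Psi> (snd up) - \<Psi> (snd um))"
    using I nn_integral_cellm_fst[of "\<lambda>t. ennreal ((c (g t))\<^sup>2)"] by simp
  have nP: "(norm (0::real, z::real))\<^sup>2 = z\<^sup>2" for z by (simp add: norm_Pair)
  have "energyP W (\<lambda>x. (a, g (fst x))) (\<lambda>x. (0, c (g (fst x)))) (\<lambda>x. (0, 0)) = (\<integral>\<^sup>+x\<in>cell. ennreal ((c (g (fst x)))\<^sup>2) \<partial>lborel)"
    unfolding energyP_def nP W by simp
  also have "\<dots> = (\<integral>\<^sup>+x. ennreal ((c (g (fst x)))\<^sup>2) \<partial>cellm)" by (rule nn_integral_cell) measurable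
  finally show "energyP W (\<lambda>x. (a, g (fst x))) (\<lambda>x. (0, c (g (fst x)))) (\<lambda>x. (0, 0)) \<le> ennreal (\<Psi> (snd up) - \<Psi> (snd um))"
    using Ic by simp
  have ub: "ubar (\<lambda>x. (a, g (fst x))) t = (a, g t)" for t
    by (simp add: ubar_def measure_restrict_space)
  show "admP um up (\<lambda>x. (a, g (fst x))) (\<lambda>x. (0, c (g (fst x)))) (\<lambda>x. (0, 0))"
    unfolding admP_def
  proof (intro conjI allI impI)
    show "periodic2 (\<lambda>x. (a, g (fst x)))" by (simp add: periodic2_def)
    show "(\<lambda>x::R2. (a, g (fst x))) \<in> borel_measurable lborel" "(\<lambda>x::R2. (0::real, c (g (fst x)))) \<in> borel_measurable lborel"
      using pm[OF cgf(2)] pm[OF cgf(1)] by simp_all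
    show "(\<lambda>x::R2. (0::real, 0::real)) \<in> borel_measurable lborel" by simp
    show "weak_grad2 (\<lambda>x. (a, g (fst x))) (\<lambda>x. (0, c (g (fst x)))) (\<lambda>x. (0, 0))" by (rule competitor_weak_grad[OF g cg])
    show "AE z::R2 in lborel. fst (0::real, c (g (fst z))) + snd (0::real, 0::real) = 0" by simp
    fix K' :: "R2 set" assume K': "compact K'"
    have "(\<integral>\<^sup>+z\<in>K'. ennreal ((norm (a, g (fst z)))\<^sup>2) \<partial>lborel) \<le> (\<integral>\<^sup>+z. ennreal (a\<^sup>2 + K\<^sup>2) * indicator K' z \<partial>lborel)"
    proof (intro nn_integral_mono mult_right_mono ennreal_leI)
      fix z :: R2
      have "(g (fst z))\<^sup>2 \<le> K\<^sup>2" using gb[of "fst z"] by (metis abs_ge_zero power2_abs power_mono)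
      then show "(norm (a, g (fst z)))\<^sup>2 \<le> a\<^sup>2 + K\<^sup>2" by (simp add: norm_Pair)
    qed auto
    also have "\<dots> = ennreal (a\<^sup>2 + K\<^sup>2) * emeasure lborel K'" using K' by (intro nn_integral_cmult_indicator) (auto intro: borel_compact)
    also have "\<dots> < \<infinity>" using emeasure_compact_finite[OF K'] by (simp add: ennreal_mult_less_top)
    finally show "(\<integral>\<^sup>+z\<in>K'. ennreal ((norm (a, g (fst z)))\<^sup>2) \<partial>lborel) < \<infinity>" .
  next
    have "(\<integral>\<^sup>+z\<in>cell. ennreal ((norm (0::real, c (g (fst z))))\<^sup>2 + (norm (0::real, 0::real))\<^sup>2) \<partial>lborel) = (\<integral>\<^sup>+x\<in>cell. ennreal ((c (g (fst x)))\<^sup>2) \<partial>lborel)"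
      unfolding nP by simp
    also have "\<dots> = (\<integral>\<^sup>+x. ennreal ((c (g (fst x)))\<^sup>2) \<partial>cellm)" by (rule nn_integral_cell) measurable
    also have "\<dots> < \<infinity>" using Ic by (rule order_le_less_trans) simp
    finally show "(\<integral>\<^sup>+z\<in>cell. ennreal ((norm (0::real, c (g (fst z))))\<^sup>2 + (norm (0::real, 0::real))\<^sup>2) \<partial>lborel) < \<infinity>" .
  next
    show "ess_lim_bot (ubar (\<lambda>x. (a, g (fst x)))) um" unfolding ess_lim_bot_def ub
    proof (intro allI impI)
      fix e :: real assume "e > 0"
      from tendstoD[OF lb this] obtain R where R: "\<And>t. t \<le> R \<Longrightarrow> dist (g t) (snd um) < e" by (auto simp: eventually_at_bot_linorder)
      have "norm ((a, g t) - um) < e" if "t < R" for t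
        using R[of t] that um by (cases um) (simp add: norm_Pair dist_real_def)
      then show "\<exists>R. AE t in lborel. t < R \<longrightarrow> norm ((a, g t) - um) < e" by (intro exI[of _ R] AE_I2) auto
    qed
    show "ess_lim_top (ubar (\<lambda>x. (a, g (fst x)))) up" unfolding ess_lim_top_def ub
    proof (intro allI impI)
      fix e :: real assume "e > 0"
      from tendstoD[OF lt this] obtain R where R: "\<And>t. t \<ge> R \<Longrightarrow> dist (g t) (snd up) < e" by (auto simp: eventually_at_top_linorder)
      have "norm ((a, g t) - up) < e" if "t > R" for t
        using R[of t] that up by (cases up) (simp add: norm_Pair dist_real_def)
      then show "\<exists>R. AE t in lborel. t > R \<longrightarrow> norm ((a, g t) - up) < e" by (intro exI[of _ R] AE_I2) auto
    qed
  qed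
qed

section \<open>Reduction to one dimension\<close>

text \<open>After exchanging quantifiers, the vertical slice through almost every \<open>x\<close>
  is almost everywhere equal to p x, hence so is its mean. Negative shifts are obtained from
  positive ones by translation.\<close>

lemma AE_eq_xmean:
  fixes p :: "R2 \<Rightarrow> real"
  assumes [measurable]: "p \<in> borel_measurable borel" and inv: "\<And>t. t \<ge> 0 \<Longrightarrow> AE x in lborel. p (x + (0, t)) = p x"
  shows "AE x in lborel. p x = xmean p (fst x)"
proof -
  have pm[measurable]: "p \<in> borel_measurable (borel \<Otimes>\<^sub>M borel)" by (simp add: borel_prod)
  have all: "AE x in lborel. p (x + (0, t)) = p x" for t
  proof (cases "t \<ge> 0")
    case False
    then have "AE x in lborel. p (x + (0, - t)) = p x" by (intro inv) simp
    from AE_shift[OF this, of "(0, t)"] show ?thesis by (simp add: add.assoc flip: zero_prod_def) (auto elim: eventually_mono)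
  qed (use inv in blast)
  have "AE t in lborel. AE x in lborel. p (x + (0, t)) = p x" by (rule AE_I2) (rule all)
  then have "AE x in lborel. AE t in lborel. p (x + (0, t)) = p x"
    by (rule iffD2[OF lborel_pair.AE_commute, rotated]) measurable
  then show ?thesis
  proof eventually_elim
    case (elim x)
    obtain x1 x2 where x: "x = (x1, x2)" by force
    have r: "AE r in lborel. p (x1, r) = p x" using AE_shift[OF elim, of "- x2"] by (simp add: x)
    have "xmean p x1 = (\<integral>r. indicator {0..1} r *\<^sub>R p x \<partial>(lborel :: real measure))"
      unfolding xmean_def set_lebesgue_integral_def
    proof (rule integral_cong_AE)
      show "AE r in lborel. indicator {0..1} r *\<^sub>R p (x1, r) = indicator {0..1} r *\<^sub>R p x" using r by eventually_elim simp
    qed measurable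
    then show ?case by (simp add: x)
  qed
qed

lemma loc_int_of_cellm:
  fixes y :: "real \<Rightarrow> real"
  assumes [measurable]: "y \<in> borel_measurable borel"
    and fin: "\<And>n::nat. (\<integral>\<^sup>+x. ennreal (\<bar>y (fst x)\<bar>) * indicator {- real n..real n} (fst x) \<partial>cellm) < \<infinity>"
  shows "loc_int y"
  unfolding loc_int_def
proof (intro conjI ballI impI)
  fix S :: "real set" assume [measurable]: "S \<in> sets borel" and "bounded S"
  then obtain R where R: "\<And>x. x \<in> S \<Longrightarrow> \<bar>x\<bar> \<le> R" by (auto simp: bounded_iff)
  obtain n :: nat where n: "R \<le> real n" using real_arch_simple by blast
  show "set_integrable lborel S y" unfolding set_integrable_def
  proof (rule integrableI_bounded)
    have "(\<integral>\<^sup>+t. ennreal (norm (indicator S t *\<^sub>R y t)) \<partial>lborel) \<le> (\<integral>\<^sup>+t. ennreal (\<bar>y t\<bar>) * indicator {- real n..real n} t \<partial>lborel)"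
    proof (rule nn_integral_mono)
      fix t
      show "ennreal (norm (indicator S t *\<^sub>R y t)) \<le> ennreal (\<bar>y t\<bar>) * indicator {- real n..real n} t"
        using R[of t] n by (cases "t \<in> S") (auto simp: indicator_def abs_le_iff)
    qed
    also have "\<dots> = (\<integral>\<^sup>+x. ennreal (\<bar>y (fst x)\<bar>) * indicator {- real n..real n} (fst x) \<partial>cellm)"
      by (rule nn_integral_cellm_fst[symmetric]) measurable
    finally show "(\<integral>\<^sup>+t. ennreal (norm (indicator S t *\<^sub>R y t)) \<partial>lborel) < \<infinity>" using fin[of n] by simp
  qed measurable
qed measurable

lemma loc_int_xmean:
  assumes p: "loc_int p" and ae: "AE x in lborel. p x = xmean p (fst x)"
  shows "loc_int (xmean p)"
proof (rule loc_int_of_cellm)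
  have [measurable]: "p \<in> borel_measurable borel" using p by measurable
  show "xmean p \<in> borel_measurable borel" by measurable
  fix n :: nat
  have "(\<integral>\<^sup>+x. ennreal (\<bar>xmean p (fst x)\<bar>) * indicator {- real n..real n} (fst x) \<partial>cellm) = (\<integral>\<^sup>+x. ennreal (norm (indicator {- real n..real n} (fst x) * p x)) \<partial>cellm)"
    by (rule nn_integral_cong_AE) (use AE_cellm[OF ae] in \<open>eventually_elim, auto simp: indicator_def\<close>)
  also have "\<dots> < \<infinity>" using integrable_cellm_local[OF p, of "- real n" "real n"] by (simp add: integrable_iff_bounded)
  finally show "(\<integral>\<^sup>+x. ennreal (\<bar>xmean p (fst x)\<bar>) * indicator {- real n..real n} (fst x) \<partial>cellm) < \<infinity>" .
qed

section \<open>Product test functions and the passage to curves\<close>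

lemma test1_imp_C1test:
  assumes "test1 \<phi> \<phi>'"
  shows "C1test \<phi> (\<lambda>x h. \<phi>' x * h)"
  using assms unfolding test1_def C1test_def has_field_derivative_def by (auto intro!: continuous_intros)

lemma C1test_product:
  assumes p: "C1test \<phi> \<phi>'" and q: "C1test \<psi> \<psi>'"
  shows "C1test (\<lambda>x. \<phi> (fst x) * \<psi> (snd x)) (\<lambda>x h. \<phi> (fst x) * \<psi>' (snd x) (snd h) + \<phi>' (fst x) (fst h) * \<psi> (snd x))"
  unfolding C1test_def
proof (intro conjI allI)
  have pd: "(\<phi> has_derivative \<phi>' x) (at x)" and pc': "continuous_on UNIV (\<lambda>x. \<phi>' x h)" for x h using p by (simp_all add: C1test_def)
  have qd: "(\<psi> has_derivative \<psi>' x) (at x)" and qc': "continuous_on UNIV (\<lambda>x. \<psi>' x h)" for x h using q by (simp_all add: C1test_def)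
  have pc: "continuous_on UNIV \<phi>" by (meson continuous_at_imp_continuous_on pd has_derivative_continuous)
  have qc: "continuous_on UNIV \<psi>" by (meson continuous_at_imp_continuous_on qd has_derivative_continuous)
  show "((\<lambda>x. \<phi> (fst x) * \<psi> (snd x)) has_derivative (\<lambda>h. \<phi> (fst x) * \<psi>' (snd x) (snd h) + \<phi>' (fst x) (fst h) * \<psi> (snd x))) (at x)" for x
    by (rule has_derivative_mult[OF has_derivative_compose[OF has_derivative_fst[OF has_derivative_ident] pd]
      has_derivative_compose[OF has_derivative_snd[OF has_derivative_ident] qd]])
  show "continuous_on UNIV (\<lambda>x. \<phi> (fst x) * \<psi>' (snd x) (snd h) + \<phi>' (fst x) (fst h) * \<psi> (snd x))" for h
    by (intro continuous_intros continuous_on_compose2[OF pc] continuous_on_compose2[OF qc] continuous_on_compose2[OF pc'] continuous_on_compose2[OF qc']) auto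
  obtain R1 where R1: "\<And>x. norm x > R1 \<Longrightarrow> \<phi> x = 0" using p by (auto simp: C1test_def)
  obtain R2 where R2: "\<And>x. norm x > R2 \<Longrightarrow> \<psi> x = 0" using q by (auto simp: C1test_def)
  have "\<phi> (fst x) * \<psi> (snd x) = 0" if "norm x > \<bar>R1\<bar> + \<bar>R2\<bar>" for x
  proof (cases "norm (fst x) > R1")
    case False
    then have "norm (snd x) > R2" using that norm_Pair_le[of "fst x" "snd x"] by simp
    then show ?thesis using R2 by simp
  qed (use R1 in simp)
  then show "\<exists>R. \<forall>x. norm x > R \<longrightarrow> \<phi> (fst x) * \<psi> (snd x) = 0" by blast
qed

lemma integral_fst_snd_product:
  fixes f k :: "real \<Rightarrow> real"
  assumes f: "integrable lborel f" and k: "integrable lborel k"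
  shows "integrable lborel (\<lambda>x. f (fst x) * k (snd x))" "(\<integral>x. f (fst x) * k (snd x) \<partial>lborel) = (\<integral>t. f t \<partial>lborel) * (\<integral>t. k t \<partial>lborel)"
proof -
  have [measurable]: "f \<in> borel_measurable borel" "k \<in> borel_measurable borel" using f k by auto
  have i: "integrable (lborel \<Otimes>\<^sub>M lborel) (\<lambda>x. f (fst x) * k (snd x))"
  proof (rule lborel_pair.Fubini_integrable)
    show "integrable lborel (\<lambda>x. \<integral>y. norm (f (fst (x, y)) * k (snd (x, y))) \<partial>lborel)"
      using integrable_norm[OF f] by (simp add: abs_mult)
    show "AE x in lborel. integrable lborel (\<lambda>y. f (fst (x, y)) * k (snd (x, y)))" using k by simp
  qed measurable
  then show "integrable lborel (\<lambda>x. f (fst x) * k (snd x))" by (simp add: lborel_prod)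
  have "(\<integral>x. f (fst x) * k (snd x) \<partial>(lborel \<Otimes>\<^sub>M lborel)) = (\<integral>x. (\<integral>y. f x * k y \<partial>lborel) \<partial>lborel)"
    using lborel_pair.integral_fst'[OF i] by simp
  then show "(\<integral>x. f (fst x) * k (snd x) \<partial>lborel) = (\<integral>t. f t \<partial>lborel) * (\<integral>t. k t \<partial>lborel)"
    by (simp add: lborel_prod)
qed

text \<open>When \<open>u\<close> does not depend on x2, neither does its x1-derivative, so both may
  be replaced by their means over a period. The weak derivative of the resulting curve is recovered
  from product test functions.\<close>

lemma one_dimensional_reduction:
  fixes W :: "R2 \<Rightarrow> real"
  assumes adm: "admP um up u Du1 Du2" and um: "fst um = a" and up: "fst up = a"
    and Wc: "continuous_on UNIV W" and W0: "\<And>z. W z \<ge> 0"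
    and u1: "AE x in lborel. fst (u x) = a" and D2: "AE x in lborel. snd (Du2 x) = 0"
  obtains \<gamma> \<gamma>' where "\<And>t. fst (\<gamma> t) = a" "adm1 a um up \<gamma> \<gamma>'" "energy1 W \<gamma> \<gamma>' \<le> energyP W u Du1 Du2" "AE x in lborel. u x = \<gamma> (fst x)"
proof -
  have um_[measurable]: "u \<in> borel_measurable borel" and [measurable]: "Du1 \<in> borel_measurable borel" "Du2 \<in> borel_measurable borel"
    and w: "weak_grad2 u Du1 Du2"
    and Kf: "\<And>K. compact K \<Longrightarrow> (\<integral>\<^sup>+z\<in>K. ennreal ((norm (u z))\<^sup>2) \<partial>lborel) < \<infinity>"
    and fin: "(\<integral>\<^sup>+z\<in>cell. ennreal ((norm (Du1 z))\<^sup>2 + (norm (Du2 z))\<^sup>2) \<partial>lborel) < \<infinity>"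
    and lb: "ess_lim_bot (ubar u) um" and lt: "ess_lim_top (ubar u) up"
    using adm unfolding admP_def by auto
  have [measurable]: "W \<in> borel_measurable borel" using Wc by (rule borel_measurable_continuous_onI)
  define u2 where "u2 = (\<lambda>x. snd (u x))"
  define A where "A = (\<lambda>x. snd (Du1 x))"
  have ein: "(\<lambda>x. u x \<bullet> (1, 0)) = (\<lambda>x. fst (u x))" "(\<lambda>x. u x \<bullet> (0, 1)) = u2" by (auto simp: u2_def inner_prod_def)
  have l1: "loc_int (\<lambda>x. fst (u x))" using loc_int_inner[OF um_ Kf, of "(1, 0)"] unfolding ein .
  have l2: "loc_int u2" using loc_int_inner[OF um_ Kf, of "(0, 1)"] unfolding ein .
  have [measurable]: "u2 \<in> borel_measurable borel" "A \<in> borel_measurable borel" unfolding u2_def A_def by measurable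
  have wu2: "weak_dir e u2 (\<lambda>x. fst e * A x + snd e * snd (Du2 x))" for e
    using weak_grad2_imp_weak_dir[OF w, of e "(0, 1)"] by (simp add: u2_def A_def inner_prod_def)
  have "weak_dir (0, 1) u2 (\<lambda>x. 0)" by (rule weak_dir_cong_AE[OF wu2]) (use D2 in auto)
  then have dd: "dir_deriv (0, 1) u2 (\<lambda>x. 0)" by (intro weak_dir_imp_dir_deriv(2)[OF l2]) auto
  have inv: "AE x in lborel. u2 (x + (0, t)) = u2 x" if "t \<ge> 0" for t
    using dd[unfolded dir_deriv_def, rule_format, OF that] by eventually_elim (simp add: set_lebesgue_integral_def)
  have wA: "weak_dir (1, 0) u2 A" using wu2[of "(1, 0)"] by simp
  have lA: "loc_int A" by (rule weak_dir_imp_dir_deriv(1)[OF l2 _ wA]) measurable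
  have invA: "AE x in lborel. A (x + (0, t)) = A x" if "t \<ge> 0" for t
    by (rule weak_dir_shift_AE[OF wA _ _ inv[OF that]]) auto
  define y where "y = xmean u2"
  define m where "m = xmean A"
  have [measurable]: "y \<in> borel_measurable borel" "m \<in> borel_measurable borel" unfolding y_def m_def by measurable
  have uy: "AE x in lborel. u2 x = y (fst x)" unfolding y_def by (rule AE_eq_xmean[OF _ inv]) auto
  have Am: "AE x in lborel. A x = m (fst x)" unfolding m_def by (rule AE_eq_xmean[OF _ invA]) auto
  have ly: "loc_int y" unfolding y_def by (rule loc_int_xmean[OF l2 uy[unfolded y_def]])
  have lm: "loc_int m" unfolding m_def by (rule loc_int_xmean[OF lA Am[unfolded m_def]])
  define \<gamma> where "\<gamma> = (\<lambda>t. (a, y t))"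
  define \<gamma>' where "\<gamma>' = (\<lambda>t. (0::real, m t))"
  have pm: "(\<lambda>t. (p, h t)) \<in> borel_measurable borel" if [measurable]: "h \<in> borel_measurable borel" for p :: real and h :: "real \<Rightarrow> real"
    unfolding borel_prod[symmetric] by measurable
  have [measurable]: "\<gamma> \<in> borel_measurable borel" "\<gamma>' \<in> borel_measurable borel" unfolding \<gamma>_def \<gamma>'_def by (auto intro: pm)
  have u\<gamma>: "AE x in lborel. u x = \<gamma> (fst x)" using u1 uy by eventually_elim (auto simp: \<gamma>_def u2_def prod_eq_iff)
  have nm: "(norm (0::real, z::real))\<^sup>2 = z\<^sup>2" for z by (simp add: norm_Pair)
  have A2: "(A x)\<^sup>2 \<le> (norm (Du1 x))\<^sup>2" for x
  proof -
    have "\<bar>A x\<bar> \<le> norm (Du1 x)" unfolding A_def using norm_snd_le[of "snd (Du1 x)" "fst (Du1 x)"] by simp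
    then show ?thesis by (metis abs_ge_zero power2_abs power_mono)
  qed
  have m2: "(\<integral>\<^sup>+t. ennreal ((norm (\<gamma>' t))\<^sup>2) \<partial>lborel) < \<infinity>"
  proof -
    have "(\<integral>\<^sup>+t. ennreal ((norm (\<gamma>' t))\<^sup>2) \<partial>lborel) = (\<integral>\<^sup>+x. ennreal ((norm (\<gamma>' (fst x)))\<^sup>2) \<partial>cellm)"
      by (rule nn_integral_cellm_fst[symmetric]) measurable
    also have "\<dots> \<le> (\<integral>\<^sup>+x. ennreal ((norm (Du1 x))\<^sup>2 + (norm (Du2 x))\<^sup>2) \<partial>cellm)"
    proof (rule nn_integral_mono_AE)
      show "AE x in cellm. ennreal ((norm (\<gamma>' (fst x)))\<^sup>2) \<le> ennreal ((norm (Du1 x))\<^sup>2 + (norm (Du2 x))\<^sup>2)"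
        using AE_cellm[OF Am]
      proof eventually_elim
        case (elim x)
        show ?case using A2[of x] elim by (intro ennreal_leI) (simp add: \<gamma>'_def nm add_increasing2)
      qed
    qed
    also have "\<dots> < \<infinity>" using fin by (subst (asm) nn_integral_cell) auto
    finally show ?thesis .
  qed
  \<comment> \<open>An inequality suffices, as the calibration supplies the reverse bound; the
    gradient components other than \<open>A\<close> are therefore just dropped.\<close>
  have en: "energy1 W \<gamma> \<gamma>' \<le> energyP W u Du1 Du2"
  proof -
    have "energy1 W \<gamma> \<gamma>' = (\<integral>\<^sup>+x. ennreal ((1/2) * (norm (\<gamma>' (fst x)))\<^sup>2 + W (\<gamma> (fst x))) \<partial>cellm)"
      unfolding energy1_def by (rule nn_integral_cellm_fst[symmetric]) measurable
    also have "\<dots> \<le> (\<integral>\<^sup>+x. ennreal ((1/2) * ((norm (Du1 x))\<^sup>2 + (norm (Du2 x))\<^sup>2) + W (u x)) \<partial>cellm)"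
    proof (rule nn_integral_mono_AE)
      show "AE x in cellm. ennreal ((1/2) * (norm (\<gamma>' (fst x)))\<^sup>2 + W (\<gamma> (fst x))) \<le> ennreal ((1/2) * ((norm (Du1 x))\<^sup>2 + (norm (Du2 x))\<^sup>2) + W (u x))"
        using AE_cellm[OF Am] AE_cellm[OF u\<gamma>]
      proof eventually_elim
        case (elim x)
        have "(norm (\<gamma>' (fst x)))\<^sup>2 \<le> (norm (Du1 x))\<^sup>2 + (norm (Du2 x))\<^sup>2"
          using A2[of x] elim by (simp add: \<gamma>'_def nm add_increasing2)
        then show ?case using elim by (intro ennreal_leI) simp
      qed
    qed
    also have "\<dots> = energyP W u Du1 Du2" unfolding energyP_def by (rule nn_integral_cell[symmetric]) measurable
    finally show ?thesis .
  qed
  have wd: "weak_deriv1 \<gamma> \<gamma>'" unfolding weak_deriv1_def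
  proof (intro allI impI)
    fix \<phi> \<phi>' assume t: "test1 \<phi> \<phi>'"
    have T: "C1test \<phi> (\<lambda>x h. \<phi>' x * h)" by (rule test1_imp_C1test[OF t])
    \<comment> \<open>Testing with \<phi>(x1) \<psi>(x2) yields the one-dimensional identity
      multiplied by the integral of \<psi>. The lower bound 1 on [-1, 1] makes this integral
      positive, so it can be cancelled.\<close>
    obtain \<psi> \<psi>' where q: "C1test \<psi> \<psi>'" "\<And>x::real. 0 \<le> \<psi> x" "\<And>x. norm x \<le> 1 \<Longrightarrow> 1 \<le> \<psi> x" using C1test_ball[of 1] by metis
    obtain C R where C: "\<And>x. \<bar>\<phi> x\<bar> \<le> C" and R: "\<And>x. norm x > R \<Longrightarrow> \<phi> x = 0" and cR: "continuous_on UNIV \<phi>" and [measurable]: "\<phi> \<in> borel_measurable borel"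
      by (rule C1test_bounded[OF T], rule that)
    have \<phi>i: "integrable lborel \<phi>'" and \<phi>0: "(\<integral>t. \<phi>' t \<partial>lborel) = 0" using C1test_derivative_integral_0[OF T, of 1] by simp_all
    have c': "continuous_on UNIV \<phi>'" using t by (simp add: test1_def)
    then have [measurable]: "\<phi>' \<in> borel_measurable borel" by (rule borel_measurable_continuous_onI)
    have z: "\<phi>' x = 0" if x: "norm x > R" for x
    proof -
      have "(\<phi> has_real_derivative \<phi>' x) (at x)" using t by (simp add: test1_def)
      then have "((\<lambda>x. 0) has_real_derivative \<phi>' x) (at x)"
        by (rule has_field_derivative_transform_within_open[of _ _ _ "{x. norm x > R}"])
          (use x R in \<open>auto intro!: open_Collect_less continuous_intros\<close>)
      moreover have "((\<lambda>x. 0) has_real_derivative 0) (at x)" by simp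
      ultimately show ?thesis by (rule DERIV_unique)
    qed
    have "compact (\<phi>' ` cball 0 R)" by (intro compact_continuous_image continuous_on_subset[OF c']) auto
    then obtain C1 where "\<And>x. norm x \<le> R \<Longrightarrow> \<bar>\<phi>' x\<bar> \<le> C1" using compact_imp_bounded by (fastforce simp: bounded_iff)
    then have C1: "\<bar>\<phi>' x\<bar> \<le> max 0 C1" for x using z[of x] by (cases "norm x \<le> R") (auto simp: le_max_iff_disj)
    have iy: "integrable lborel (\<lambda>t. \<phi>' t * y t)" by (rule loc_int_bounded_mult[OF ly _ C1 z]) auto
    have im: "integrable lborel (\<lambda>t. \<phi> t * m t)" by (rule loc_int_bounded_mult[OF lm _ C R]) auto
    have i\<psi>: "integrable lborel \<psi>"
    proof -
      obtain C2 R2 where C2: "\<And>x. \<bar>\<psi> x\<bar> \<le> C2" and R2: "\<And>x. norm x > R2 \<Longrightarrow> \<psi> x = 0" and c2: "continuous_on UNIV \<psi>" and "\<psi> \<in> borel_measurable borel"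
        by (rule C1test_bounded[OF q(1)], rule that)
      show ?thesis by (rule integrable_continuous_compact_support[OF c2 R2])
    qed
    have [measurable]: "\<psi> \<in> borel_measurable borel" using i\<psi> by auto
    have pos: "(\<integral>t. \<psi> t \<partial>lborel) > 0"
    proof -
      have "(\<integral>t. indicat_real {-1..1::real} t \<partial>lborel) \<le> (\<integral>t. \<psi> t \<partial>lborel)"
      proof (rule integral_mono[OF _ i\<psi>])
        show "integrable lborel (indicat_real {-1..1::real})" by (simp add: emeasure_lborel_Icc_eq)
        show "indicat_real {-1..1} t \<le> \<psi> t" for t using q(2)[of t] q(3)[of t] by (auto simp: indicator_def)
      qed
      then show ?thesis by simp
    qed
    have "(\<integral>x. (\<phi> (fst x) * \<psi>' (snd x) (snd (1::real, 0::real)) + \<phi>' (fst x) * fst (1::real, 0::real) * \<psi> (snd x)) * u2 x \<partial>lborel) = - (\<integral>x. \<phi> (fst x) * \<psi> (snd x) * A x \<partial>lborel)"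
      using wA C1test_product[OF T q(1)] unfolding weak_dir_def by blast
    moreover have "\<psi>' x 0 = 0" for x
    proof -
      have "(\<psi> has_derivative \<psi>' x) (at x)" using q(1) by (simp add: C1test_def)
      then show ?thesis using has_derivative_linear linear_0 by blast
    qed
    ultimately have "(\<integral>x. \<phi>' (fst x) * \<psi> (snd x) * u2 x \<partial>lborel) = - (\<integral>x. \<phi> (fst x) * \<psi> (snd x) * A x \<partial>lborel)" by simp
    moreover have "(\<integral>x. \<phi>' (fst x) * \<psi> (snd x) * u2 x \<partial>lborel) = (\<integral>x. (\<phi>' (fst x) * y (fst x)) * \<psi> (snd x) \<partial>lborel)"
    proof (rule integral_cong_AE)
      show "AE x in lborel. \<phi>' (fst x) * \<psi> (snd x) * u2 x = (\<phi>' (fst x) * y (fst x)) * \<psi> (snd x)" using uy by eventually_elim simp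
    qed measurable
    moreover have "(\<integral>x. \<phi> (fst x) * \<psi> (snd x) * A x \<partial>lborel) = (\<integral>x. (\<phi> (fst x) * m (fst x)) * \<psi> (snd x) \<partial>lborel)"
    proof (rule integral_cong_AE)
      show "AE x in lborel. \<phi> (fst x) * \<psi> (snd x) * A x = (\<phi> (fst x) * m (fst x)) * \<psi> (snd x)" using Am by eventually_elim simp
    qed measurable
    ultimately have "(\<integral>t. \<phi>' t * y t \<partial>lborel) * (\<integral>t. \<psi> t \<partial>lborel) = - ((\<integral>t. \<phi> t * m t \<partial>lborel) * (\<integral>t. \<psi> t \<partial>lborel))"
      using integral_fst_snd_product(2)[OF iy i\<psi>] integral_fst_snd_product(2)[OF im i\<psi>] by simp
    then have "((\<integral>t. \<phi>' t * y t \<partial>lborel) + (\<integral>t. \<phi> t * m t \<partial>lborel)) * (\<integral>t. \<psi> t \<partial>lborel) = 0" by (simp add: distrib_right)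
    then have e: "(\<integral>t. \<phi>' t * y t \<partial>lborel) = - (\<integral>t. \<phi> t * m t \<partial>lborel)" using pos by simp
    have pair_int: "integrable lborel (\<lambda>t. (f t, k t))" if f: "integrable lborel f" and k: "integrable lborel k" for f k :: "real \<Rightarrow> real"
    proof (rule Bochner_Integration.integrable_bound[OF Bochner_Integration.integrable_add[OF integrable_norm[OF f] integrable_norm[OF k]]])
      have [measurable]: "f \<in> borel_measurable borel" "k \<in> borel_measurable borel" using f k by auto
      show "(\<lambda>t. (f t, k t)) \<in> borel_measurable lborel" unfolding borel_prod[symmetric] by measurable
      show "AE t in lborel. norm (f t, k t) \<le> norm (norm (f t) + norm (k t))" by (intro AE_I2) (simp add: order_trans[OF norm_Pair_le])
    qed
    have i1: "integrable lborel (\<lambda>t. \<phi>' t *\<^sub>R \<gamma> t)" using pair_int[OF integrable_mult_left[OF \<phi>i, of a] iy] by (simp add: \<gamma>_def)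
    have i2: "integrable lborel (\<lambda>t. \<phi> t *\<^sub>R \<gamma>' t)" using pair_int[OF integrable_zero im] by (simp add: \<gamma>'_def)
    have "(\<integral>t. \<phi>' t *\<^sub>R \<gamma> t \<partial>lborel) = - (\<integral>t. \<phi> t *\<^sub>R \<gamma>' t \<partial>lborel)"
      by (rule integral_pair_eqI[OF i1 i2]) (simp_all add: \<gamma>_def \<gamma>'_def e \<phi>0)
    then show "integrable lborel (\<lambda>t. \<phi>' t *\<^sub>R \<gamma> t) \<and> integrable lborel (\<lambda>t. \<phi> t *\<^sub>R \<gamma>' t) \<and> (\<integral>t. \<phi>' t *\<^sub>R \<gamma> t \<partial>lborel) = - (\<integral>t. \<phi> t *\<^sub>R \<gamma>' t \<partial>lborel)"
      using i1 i2 by blast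
  qed
  have uc: "AE t in lborel. snd (ubar u t) = y t"
    using ubar_components[OF um_ l1 l2[unfolded u2_def]] by eventually_elim (simp add: y_def u2_def)
  have close: "norm (\<gamma> t - z) \<le> norm (ubar u t - z)" if "snd (ubar u t) = y t" "fst z = a" for t z
  proof -
    have "norm (\<gamma> t - z) = \<bar>snd (ubar u t - z)\<bar>" using that by (cases z) (simp add: \<gamma>_def norm_Pair)
    also have "\<dots> \<le> norm (ubar u t - z)" by (metis norm_snd_le prod.collapse real_norm_def)
    finally show ?thesis .
  qed
  have "adm1 a um up \<gamma> \<gamma>'" unfolding adm1_def
  proof (intro conjI allI)
    show "\<gamma> \<in> borel_measurable lborel" "\<gamma>' \<in> borel_measurable lborel" by simp_all
    show "weak_deriv1 \<gamma> \<gamma>'" by (rule wd)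
    show "(\<integral>\<^sup>+t. ennreal ((norm (\<gamma>' t))\<^sup>2) \<partial>lborel) < \<infinity>" by (rule m2)
    show "AE t in lborel. fst (\<gamma> t) = a" by (simp add: \<gamma>_def)
    show "(\<integral>\<^sup>+r\<in>{s..t}. ennreal (norm (\<gamma> r)) \<partial>lborel) < \<infinity>" for s t
    proof -
      have 1: "set_integrable lborel {s..t} (\<lambda>r. \<bar>a\<bar>)" by (intro borel_integrable_atLeastAtMost' continuous_on_const)
      have 2: "set_integrable lborel {s..t} (\<lambda>r. \<bar>y r\<bar>)" using ly by (intro set_integrable_abs) (simp add: loc_int_def)
      have "set_integrable lborel {s..t} (\<lambda>r. \<bar>a\<bar> + \<bar>y r\<bar>)" by (rule set_integral_add(1)[OF 1 2])
      then have "(\<integral>\<^sup>+r. ennreal (norm (indicator {s..t} r *\<^sub>R (\<bar>a\<bar> + \<bar>y r\<bar>))) \<partial>lborel) < \<infinity>"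
        by (simp only: set_integrable_def integrable_iff_bounded)
      moreover have "(\<integral>\<^sup>+r\<in>{s..t}. ennreal (norm (\<gamma> r)) \<partial>lborel) \<le> (\<integral>\<^sup>+r. ennreal (norm (indicator {s..t} r *\<^sub>R (\<bar>a\<bar> + \<bar>y r\<bar>))) \<partial>lborel)"
      proof (rule nn_integral_mono)
        fix r
        have "norm (\<gamma> r) \<le> \<bar>a\<bar> + \<bar>y r\<bar>" using norm_Pair_le[of a "y r"] by (simp add: \<gamma>_def)
        then show "ennreal (norm (\<gamma> r)) * indicator {s..t} r \<le> ennreal (norm (indicator {s..t} r *\<^sub>R (\<bar>a\<bar> + \<bar>y r\<bar>)))"
          by (cases "r \<in> {s..t}") (auto intro!: ennreal_leI simp del: ennreal_plus)
      qed
      ultimately show ?thesis by (rule order_le_less_trans[rotated])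
    qed
    show "ess_lim_bot \<gamma> um" unfolding ess_lim_bot_def
    proof (intro allI impI)
      fix e :: real assume "e > 0"
      then obtain R where "AE t in lborel. t < R \<longrightarrow> norm (ubar u t - um) < e" using lb unfolding ess_lim_bot_def by meson
      then have "AE t in lborel. t < R \<longrightarrow> norm (\<gamma> t - um) < e" using uc
      proof eventually_elim
        case (elim t) then show ?case using close[of t um] um by force
      qed
      then show "\<exists>R. AE t in lborel. t < R \<longrightarrow> norm (\<gamma> t - um) < e" by blast
    qed
    show "ess_lim_top \<gamma> up" unfolding ess_lim_top_def
    proof (intro allI impI)
      fix e :: real assume "e > 0"
      then obtain R where "AE t in lborel. t > R \<longrightarrow> norm (ubar u t - up) < e" using lt unfolding ess_lim_top_def by meson
      then have "AE t in lborel. t > R \<longrightarrow> norm (\<gamma> t - up) < e" using uc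
      proof eventually_elim
        case (elim t) then show ?case using close[of t up] up by force
      qed
      then show "\<exists>R. AE t in lborel. t > R \<longrightarrow> norm (\<gamma> t - up) < e" by blast
    qed
  qed
  moreover have "fst (\<gamma> t) = a" for t by (simp add: \<gamma>_def)
  ultimately show thesis using that en u\<gamma> by blast
qed

text \<open>A decreasing connection becomes an increasing one under the reflection y to -y.\<close>

lemma autonomous_ode:
  fixes c :: "real \<Rightarrow> real"
  assumes mp: "m \<noteq> p" and cc: "continuous_on UNIV c"
    and sgn: "\<And>y. y \<in> open_segment m p \<Longrightarrow> (p - m) * c y > 0"
    and L: "\<And>y. y \<in> open_segment m p \<Longrightarrow> \<bar>c y\<bar> \<le> L * \<bar>y - m\<bar>" "\<And>y. y \<in> open_segment m p \<Longrightarrow> \<bar>c y\<bar> \<le> L * \<bar>y - p\<bar>"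
  obtains g G where "\<And>t. g t \<in> open_segment m p" "\<And>t. (g has_real_derivative c (g t)) (at t)"
    "(g \<longlongrightarrow> m) at_bot" "(g \<longlongrightarrow> p) at_top"
    "\<And>y. y \<in> open_segment m p \<Longrightarrow> (G has_real_derivative 1 / c y) (at y)" "\<And>t. G (g t) = t"
    "\<And>y. y \<in> open_segment m p \<Longrightarrow> g (G y) = y"
proof (cases "m < p")
  case True
  then have I: "open_segment m p = {m<..<p}" by (simp add: open_segment_eq_real_ivl)
  have pos: "c y > 0" if "y \<in> {m<..<p}" for y using sgn[of y] that True by (simp add: I zero_less_mult_iff)
  have cont: "isCont c y" for y using cc by (simp add: continuous_on_eq_continuous_at)
  have bd: "c y \<le> L * (y - m)" "c y \<le> L * (p - y)" if "y \<in> {m<..<p}" for y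
    using L[of y] that pos[OF that] by (simp_all add: I)
  show thesis by (rule autonomous_ode_increasing[OF True cont pos bd], assumption, assumption, assumption, rule that[unfolded I])
next
  case False
  then have pm: "p < m" using mp by simp
  then have I: "open_segment m p = {p<..<m}" by (simp add: open_segment_eq_real_ivl)
  have neg: "c y < 0" if "y \<in> {p<..<m}" for y using sgn[of y] that pm by (simp add: I zero_less_mult_iff)
  have "continuous_on UNIV (\<lambda>y. - c (- y))" by (intro continuous_intros continuous_on_compose2[OF cc]) auto
  then have cont: "isCont (\<lambda>y. - c (- y)) y" for y by (simp add: continuous_on_eq_continuous_at)
  have pos: "0 < - c (- y)" if "y \<in> {-m<..<-p}" for y using neg[of "- y"] that by simp
  have bd: "- c (- y) \<le> L * (y - - m)" "- c (- y) \<le> L * (- p - y)" if "y \<in> {-m<..<-p}" for y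
    using L[of "- y"] that pos[OF that] by (simp_all add: I algebra_simps)
  obtain g G where g: "\<And>t. g t \<in> {-m<..<-p}" "\<And>t. (g has_real_derivative - c (- g t)) (at t)"
    "(g \<longlongrightarrow> - m) at_bot" "(g \<longlongrightarrow> - p) at_top"
    "\<And>y. y \<in> {-m<..<-p} \<Longrightarrow> (G has_real_derivative 1 / (- c (- y))) (at y)" "\<And>t. G (g t) = t" "\<And>y. y \<in> {-m<..<-p} \<Longrightarrow> g (G y) = y"
    by (rule autonomous_ode_increasing[OF _ cont pos bd], use pm in simp, assumption, assumption, assumption, rule that)
  show thesis
  proof (rule that[of "\<lambda>t. - g t" "\<lambda>y. G (- y)"])
    show "- g t \<in> open_segment m p" for t using g(1)[of t] by (auto simp: I)
    show "((\<lambda>t. - g t) has_real_derivative c (- g t)) (at t)" for t using DERIV_minus[OF g(2)[of t]] by simp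
    show "((\<lambda>t. - g t) \<longlongrightarrow> m) at_bot" using tendsto_minus[OF g(3)] by simp
    show "((\<lambda>t. - g t) \<longlongrightarrow> p) at_top" using tendsto_minus[OF g(4)] by simp
    show "((\<lambda>y. G (- y)) has_real_derivative 1 / c y) (at y)" if "y \<in> open_segment m p" for y
    proof -
      have "- y \<in> {-m<..<-p}" using that by (auto simp: I)
      from DERIV_chain2[OF g(5)[OF this] DERIV_minus[OF DERIV_ident]] show ?thesis by simp
    qed
    show "G (- (- g t)) = t" for t by (simp add: g(6))
    show "- g (G (- y)) = y" if "y \<in> open_segment m p" for y
    proof -
      have "- y \<in> {-m<..<-p}" using that by (auto simp: I)
      from g(7)[OF this] show ?thesis by simp
    qed
  qed
qed

text \<open>Truncating both summands of \<open>w = f (z1 + z2) + h (z1 - z2)\<close> with the same odd 1-Lipschitz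
  function keeps the wave equation and the bound by \<open>w\<close>, and makes the calibration globally Lipschitz.\<close>
lemma truncated_calibration:
  fixes w :: "R2 \<Rightarrow> real"
  assumes C2: "C2_partials w w1 w2 w11 w12 w21 w22" and wave: "\<And>z. w11 z - w22 z = 0" and K: "compact K" "K \<noteq> {}"
  obtains f h M where "continuous_on UNIV f" "continuous_on UNIV h" "\<And>s. \<bar>f s\<bar> \<le> M" "\<And>s. \<bar>h s\<bar> \<le> M"
    "\<And>z. \<bar>f (fst z + snd z) + h (fst z - snd z)\<bar> \<le> \<bar>w z\<bar>"
    "\<And>z. z \<in> K \<Longrightarrow> f (fst z + snd z) + h (fst z - snd z) = w z"
proof -
  have wc: "continuous_on UNIV w"
    using C2 unfolding C2_partials_def by (meson continuous_at_imp_continuous_on has_derivative_continuous)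
  define f0 where "f0 = (\<lambda>s::real. w (s / 2, s / 2))"
  define h0 where "h0 = (\<lambda>t::real. w (t / 2, - (t / 2)) - w (0, 0))"
  have f0c: "continuous_on UNIV f0" unfolding f0_def by (intro continuous_on_compose2[OF wc] continuous_intros) auto
  have h0c: "continuous_on UNIV h0" unfolding h0_def by (intro continuous_intros continuous_on_compose2[OF wc]) auto
  have dec: "w z = f0 (fst z + snd z) + h0 (fst z - snd z)" for z
    using d_Alembert[OF C2 wave, of z] by (simp add: f0_def h0_def)
  have "compact ((\<lambda>z. \<bar>f0 (fst z + snd z)\<bar> + \<bar>h0 (fst z - snd z)\<bar>) ` K)"
    by (intro compact_continuous_image K continuous_intros continuous_on_compose2[OF f0c] continuous_on_compose2[OF h0c]) auto
  \<comment> \<open>\<open>M\<close> bounds the sum of both absolute values on \<open>K\<close>, so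
    clamping at this level changes neither summand there.\<close>
  then obtain M where M: "\<And>z. z \<in> K \<Longrightarrow> \<bar>f0 (fst z + snd z)\<bar> + \<bar>h0 (fst z - snd z)\<bar> \<le> M"
    using compact_imp_bounded by (fastforce simp: bounded_iff)
  obtain z0 where "z0 \<in> K" using K(2) by blast
  then have M0: "0 \<le> M" using M[of z0] by linarith
  define cl where "cl = (\<lambda>y::real. max (- M) (min M y))"
  show thesis
  proof (rule that[of "\<lambda>s. cl (f0 s)" "\<lambda>s. cl (h0 s)" M])
    show "continuous_on UNIV (\<lambda>s. cl (f0 s))" "continuous_on UNIV (\<lambda>s. cl (h0 s))"
      unfolding cl_def by (intro continuous_intros f0c h0c)+
    show "\<bar>cl (f0 s)\<bar> \<le> M" "\<bar>cl (h0 s)\<bar> \<le> M" for s using M0 by (auto simp: cl_def)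
    have "\<bar>cl x + cl y\<bar> \<le> \<bar>x + y\<bar>" for x y using M0 by (auto simp: cl_def max_def min_def)
    then show "\<bar>cl (f0 (fst z + snd z)) + cl (h0 (fst z - snd z))\<bar> \<le> \<bar>w z\<bar>" for z by (simp add: dec)
    show "cl (f0 (fst z + snd z)) + cl (h0 (fst z - snd z)) = w z" if "z \<in> K" for z
    proof -
      have "\<bar>f0 (fst z + snd z)\<bar> \<le> M" "\<bar>h0 (fst z - snd z)\<bar> \<le> M" using M[OF that] by linarith+
      then show ?thesis unfolding dec by (auto simp: cl_def)
    qed
  qed
qed

theorem theorem4p21:
  fixes W w w1 w2 w11 w12 w21 w22 :: "real \<times> real \<Rightarrow> real"
    and a :: real and um up :: "real \<times> real" and u :: "real \<times> real \<Rightarrow> real \<times> real"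
  assumes W_cont: "continuous_on UNIV W"
    and W_nonneg: "\<forall>z. W z \<ge> 0"
    and um_def: "fst um = a" and up_def: "fst up = a" and um_up: "um \<noteq> up"
    and W_zero: "W um = 0" "W up = 0"
    and w_C2: "C2_partials w w1 w2 w11 w12 w21 w22"
    and wave: "\<forall>z. w11 z - w22 z = 0"
    and W_ge: "\<forall>z. W z \<ge> (1/2) * (w z)\<^sup>2"
    and W_seg: "\<forall>z\<in>open_segment um up. W z = (1/2) * (w z)\<^sup>2 \<and> w z > 0"
    and u_min: "global_minP W um up u"
    and growth: "(\<exists>M. AE x in lborel. norm (u x) \<le> M) \<or>
                 (\<exists>C \<beta>. C > 0 \<and> \<beta> > 0 \<and> (\<forall>z. \<bar>w z\<bar> \<le> C * exp (\<beta> * (norm z)\<^sup>2)))"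
  shows "\<exists>g. (\<forall>t. fst (g t) = a) \<and> min1 W a um up g \<and>
             (\<forall>\<gamma>. min1 W a um up \<gamma> \<longrightarrow> (\<exists>\<tau>. AE t in lborel. \<gamma> t = g (t + \<tau>))) \<and>
             (AE x in lborel. u x = g (fst x))"
proof -
  define m where "m = snd um"
  define p where "p = snd up"
  have mp: "m \<noteq> p" using um_up um_def up_def by (auto simp: m_def p_def prod_eq_iff)
  have umm: "um = (a, m)" and upp: "up = (a, p)" using um_def up_def by (auto simp: m_def p_def prod_eq_iff)
  have W0: "W z \<ge> 0" for z using W_nonneg by blast
  \<comment> \<open>\<open>w\<close> is positive on the segment whichever end is higher, while the
    profile has to travel from \<open>m\<close> to \<open>p\<close>. The sign orients the
    calibration; its square is 1, so the bound by \<open>W\<close> is unaffected.\<close>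
  define eps :: real where "eps = sgn (p - m)"
  have eps: "\<bar>eps\<bar> = 1" "eps * eps = 1" "(p - m) * eps > 0" using mp by (auto simp: eps_def sgn_real_def)
  have seg: "(a, y) \<in> open_segment um up" if yi: "y \<in> open_segment m p" for y
  proof -
    obtain r where r: "0 < r" "r < 1" "y = (1 - r) *\<^sub>R m + r *\<^sub>R p" using in_segment(2)[THEN iffD1, OF yi] by blast
    have "(a, y) = (1 - r) *\<^sub>R um + r *\<^sub>R up" by (simp add: umm upp r(3) algebra_simps)
    then show ?thesis using r um_up by (auto simp: in_segment)
  qed
  \<comment> \<open>The bound of \<open>W\<close> from below forces \<open>w\<close> to vanish at
    the wells, which thereby become equilibria of the profile equation.\<close>
  have wz: "w um = 0" "w up = 0" using W_ge[rule_format, of um] W_ge[rule_format, of up] W_zero by (simp_all add: power2_less_eq_zero_iff)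
  define K where "K = {a} \<times> closed_segment m p"
  have Kc: "compact K" unfolding K_def by (intro compact_Times) auto
  have K0: "K \<noteq> {}" by (simp add: K_def)
  have wave': "w11 z - w22 z = 0" for z using wave by blast
  obtain f h M where fc: "continuous_on UNIV f" and hc: "continuous_on UNIV h" and fM: "\<And>s. \<bar>f s\<bar> \<le> M" and hM: "\<And>s. \<bar>h s\<bar> \<le> M"
    and le: "\<And>z. \<bar>f (fst z + snd z) + h (fst z - snd z)\<bar> \<le> \<bar>w z\<bar>"
    and eq: "\<And>z. z \<in> K \<Longrightarrow> f (fst z + snd z) + h (fst z - snd z) = w z"
    using truncated_calibration[OF w_C2 wave' Kc K0] by blast
  obtain F where F: "\<And>y. (F has_real_derivative eps * f y) (at y)"
    by (rule ex_antiderivative[of "\<lambda>y. eps * f y"]) (auto intro!: continuous_intros fc)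
  obtain H where H: "\<And>y. (H has_real_derivative eps * h y) (at y)"
    by (rule ex_antiderivative[of "\<lambda>y. eps * h y"]) (auto intro!: continuous_intros hc)
  \<comment> \<open>\<Psi> is the first component of the oriented calibration on the line z1 = a.
    Its derivative \<open>c\<close> is at once the one-dimensional calibration and the velocity of
    the optimal profile.\<close>
  define c where "c = (\<lambda>y. eps * f (a + y) + eps * h (a - y))"
  define \<Psi> where "\<Psi> = (\<lambda>y. F (a + y) - H (a - y))"
  have cc: "continuous_on UNIV c" unfolding c_def
    by (intro continuous_intros continuous_on_compose2[OF fc] continuous_on_compose2[OF hc]) auto
  have P: "(\<Psi> has_real_derivative c y) (at y)" for y
  proof -
    have "((\<lambda>y. F (a + y)) has_real_derivative eps * f (a + y) * 1) (at y)"
      by (rule DERIV_chain2[OF F]) (auto intro!: derivative_eq_intros)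
    moreover have "((\<lambda>y. H (a - y)) has_real_derivative eps * h (a - y) * (- 1)) (at y)"
      by (rule DERIV_chain2[OF H]) (auto intro!: derivative_eq_intros)
    ultimately show ?thesis unfolding \<Psi>_def c_def using DERIV_diff by fastforce
  qed
  have cal: "(eps * f (fst z + snd z) + eps * h (fst z - snd z))\<^sup>2 \<le> 2 * W z" for z
  proof -
    have "(eps * f (fst z + snd z) + eps * h (fst z - snd z))\<^sup>2 = (eps * eps) * (f (fst z + snd z) + h (fst z - snd z))\<^sup>2"
      by (simp add: power2_eq_square algebra_simps)
    also have "\<dots> \<le> (w z)\<^sup>2" using le[of z] eps(2) by (simp add: abs_le_square_iff)
    also have "\<dots> \<le> 2 * W z" using W_ge[rule_format, of z] by simp
    finally show ?thesis .
  qed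
  have cW: "(c y)\<^sup>2 \<le> 2 * W (a, y)" for y using cal[of "(a, y)"] by (simp add: c_def)
  have cw: "c y = eps * w (a, y)" if "y \<in> closed_segment m p" for y
    using eq[of "(a, y)"] that by (simp add: K_def c_def flip: distrib_left)
  have oc: "y \<in> closed_segment m p" if "y \<in> open_segment m p" for y using that by (simp add: open_segment_def)
  have Wc2: "W (a, y) = (1/2) * (c y)\<^sup>2" if "y \<in> open_segment m p" for y
    using W_seg seg[OF that] cw[OF oc[OF that]] eps(2) by (simp add: power_mult_distrib power2_eq_square)
  have sg: "(p - m) * c y > 0" if "y \<in> open_segment m p" for y
  proof -
    have "w (a, y) > 0" using W_seg seg[OF that] by blast
    then have "((p - m) * eps) * w (a, y) > 0" using eps(3) by (rule mult_pos_pos[rotated])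
    then show ?thesis using cw[OF oc[OF that]] by (simp add: mult.assoc)
  qed
  \<comment> \<open>\<open>w\<close> is Lipschitz on the segment and zero at its ends; this gives
    the linear bounds on the velocity that keep the profile away from the wells in finite
    time.\<close>
  obtain L where L: "\<And>y e. y \<in> closed_segment m p \<Longrightarrow> e \<in> closed_segment m p \<Longrightarrow> \<bar>w (a, y) - w (a, e)\<bar> \<le> L * \<bar>y - e\<bar>"
  proof -
    have d: "(w has_derivative (\<lambda>h. w1 z * fst h + w2 z * snd h)) (at z)" "(w2 has_derivative (\<lambda>h. w21 z * fst h + w22 z * snd h)) (at z)" for z
      using w_C2 unfolding C2_partials_def by blast+
    have w2c: "continuous_on UNIV w2" using d(2) by (meson continuous_at_imp_continuous_on has_derivative_continuous)
    have "compact ((\<lambda>y. w2 (a, y)) ` closed_segment m p)"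
      by (intro compact_continuous_image continuous_on_compose2[OF w2c] continuous_intros) auto
    then obtain L where L: "\<And>y. y \<in> closed_segment m p \<Longrightarrow> \<bar>w2 (a, y)\<bar> \<le> L"
      using compact_imp_bounded by (fastforce simp: bounded_iff)
    have dw: "((\<lambda>y. w (a, y)) has_real_derivative w2 (a, y)) (at y)" for y
    proof -
      have "((\<lambda>s. (a, s)) has_derivative (\<lambda>h. (0, h))) (at y)" by (auto intro!: derivative_eq_intros)
      from has_derivative_compose[OF this d(1)] show ?thesis by (simp add: has_field_derivative_def)
    qed
    have "\<bar>w (a, y) - w (a, e)\<bar> \<le> L * \<bar>y - e\<bar>" if "y \<in> closed_segment m p" "e \<in> closed_segment m p" for y e
      using field_differentiable_bound[of "closed_segment m p" "\<lambda>y. w (a, y)" "\<lambda>y. w2 (a, y)" L y e]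
        has_field_derivative_at_within[OF dw] L that by auto
    then show thesis by (rule that)
  qed
  have cL: "\<bar>c y\<bar> \<le> L * \<bar>y - m\<bar>" "\<bar>c y\<bar> \<le> L * \<bar>y - p\<bar>" if "y \<in> open_segment m p" for y
    using L[OF oc[OF that], of m] L[OF oc[OF that], of p] cw[OF oc[OF that]] wz eps(1) by (simp_all add: umm upp abs_mult)
  obtain g G where g: "\<And>t. g t \<in> open_segment m p" "\<And>t. (g has_real_derivative c (g t)) (at t)"
    and glb: "(g \<longlongrightarrow> m) at_bot" and glt: "(g \<longlongrightarrow> p) at_top"
    and G: "\<And>y. y \<in> open_segment m p \<Longrightarrow> (G has_real_derivative 1 / c y) (at y)" "\<And>t. G (g t) = t" "\<And>y. y \<in> open_segment m p \<Longrightarrow> g (G y) = y"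
    using autonomous_ode[OF mp cc sg cL] by blast
  define \<kappa> where "\<kappa> = \<Psi> p - \<Psi> m"
  have gb: "\<bar>g t\<bar> \<le> \<bar>m\<bar> + \<bar>p\<bar>" for t using g(1)[of t] by (auto simp: open_segment_eq_real_ivl split: if_splits)
  have glb': "(g \<longlongrightarrow> snd um) at_bot" and glt': "(g \<longlongrightarrow> snd up) at_top" using glb glt by (simp_all add: m_def p_def)
  note comp = competitor[OF um_def up_def W_cont g(2) cc gb glb' glt' P Wc2[OF g(1)]]
  \<comment> \<open>Nonnegativity prevents \<open>ennreal\<close> from altering \<kappa>. It holds
    because \<Psi> is nondecreasing along the profile, with derivative c(g)^2.\<close>
  have \<kappa>0: "\<kappa> \<ge> 0"
  proof -
    have mono: "\<Psi> (g s) \<le> \<Psi> (g t)" if "s \<le> t" for s t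
    proof (rule DERIV_nonneg_imp_nondecreasing[OF that])
      fix r show "\<exists>v. ((\<lambda>t. \<Psi> (g t)) has_real_derivative v) (at r) \<and> 0 \<le> v"
        using DERIV_chain2[OF P g(2), of r] by (intro exI[of _ "c (g r) * c (g r)"]) auto
    qed
    have \<Psi>c: "isCont \<Psi> z" for z using P DERIV_isCont by blast
    have "\<Psi> (g 0) \<le> \<Psi> p"
      by (rule tendsto_lowerbound[OF isCont_tendsto_compose[OF \<Psi>c glt]]) (use mono in \<open>auto intro: eventually_mono[OF eventually_ge_at_top[of 0]]\<close>)
    moreover have "\<Psi> m \<le> \<Psi> (g 0)"
      by (rule tendsto_upperbound[OF isCont_tendsto_compose[OF \<Psi>c glb]]) (use mono in \<open>auto intro: eventually_mono[OF eventually_le_at_bot[of 0]]\<close>)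
    ultimately show ?thesis by (simp add: \<kappa>_def)
  qed
  obtain Du1 Du2 where adm: "admP um up u Du1 Du2" and min: "\<And>v Dv1 Dv2. admP um up v Dv1 Dv2 \<Longrightarrow> energyP W u Du1 Du2 \<le> energyP W v Dv1 Dv2"
    using u_min unfolding global_minP_def by blast
  have Eu: "energyP W u Du1 Du2 \<le> ennreal \<kappa>"
    using min[OF comp(1)] comp(2) by (simp add: \<kappa>_def m_def p_def)
  have "AE x in lborel. fst (u x) = a" "AE x in lborel. snd (Du2 x) = 0"
  proof -
    have b: "\<bar>eps * f y\<bar> \<le> M" "\<bar>eps * h y\<bar> \<le> M" for y using fM[of y] hM[of y] eps(1) by (simp_all add: abs_mult)
    have E: "energyP W u Du1 Du2 \<le> ennreal ((F (a + snd up) - H (a - snd up)) - (F (a + snd um) - H (a - snd um)))"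
      using Eu by (simp add: \<kappa>_def \<Psi>_def m_def p_def)
    have ce: "continuous_on UNIV (\<lambda>y. eps * f y)" "continuous_on UNIV (\<lambda>y. eps * h y)" by (intro continuous_intros fc hc)+
    show "AE x in lborel. fst (u x) = a" "AE x in lborel. snd (Du2 x) = 0"
      using rigidity[OF adm um_def up_def W_cont W0 F ce(1) b(1) H ce(2) b(2) cal E] by blast+
  qed
  from one_dimensional_reduction[OF adm um_def up_def W_cont W0 this]
  obtain \<gamma> \<gamma>' where \<gamma>: "\<And>t. fst (\<gamma> t) = a" "adm1 a um up \<gamma> \<gamma>'" "energy1 W \<gamma> \<gamma>' \<le> energyP W u Du1 Du2" "AE x in lborel. u x = \<gamma> (fst x)"
    by blast
  have E\<gamma>: "energy1 W \<gamma> \<gamma>' \<le> ennreal \<kappa>" using \<gamma>(3) Eu by (rule order_trans)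
  have low: "ennreal \<kappa> \<le> energy1 W \<eta> \<eta>'" if ad: "adm1 a um up \<eta> \<eta>'" for \<eta> \<eta>'
  proof (cases "energy1 W \<eta> \<eta>' = \<infinity>")
    case False
    then have e: "energy1 W \<eta> \<eta>' = ennreal (enn2real (energy1 W \<eta> \<eta>'))" by (simp add: less_top)
    have "\<Psi> (snd up) - \<Psi> (snd um) \<le> enn2real (energy1 W \<eta> \<eta>')"
      by (rule energy1_calibration(1)[OF ad W_cont W0 cc P cW]) (use e in auto)
    then have "ennreal \<kappa> \<le> ennreal (enn2real (energy1 W \<eta> \<eta>'))" by (intro ennreal_leI) (simp add: \<kappa>_def m_def p_def)
    then show ?thesis using e by simp
  qed simp
  have uniq: "\<exists>\<tau>. AE t in lborel. \<eta> t = (a, g (t + \<tau>))" if ad: "adm1 a um up \<eta> \<eta>'" and E: "energy1 W \<eta> \<eta>' \<le> ennreal \<kappa>" for \<eta> \<eta>'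
  proof -
    have "\<exists>Y. (AE t in lborel. \<eta> t = (a, Y t)) \<and> (\<forall>t. (Y has_real_derivative c (Y t)) (at t)) \<and> (Y \<longlongrightarrow> snd um) at_bot \<and> (Y \<longlongrightarrow> snd up) at_top"
      by (rule energy1_calibration(2)[OF ad W_cont W0 cc P cW E \<kappa>0]) (simp add: \<kappa>_def m_def p_def)
    then obtain Y where Y: "AE t in lborel. \<eta> t = (a, Y t)" "\<And>t. (Y has_real_derivative c (Y t)) (at t)"
      "(Y \<longlongrightarrow> m) at_bot" "(Y \<longlongrightarrow> p) at_top" unfolding m_def p_def by blast
    \<comment> \<open>The limits of \<open>Y\<close> lie on either side of the midpoint, so
      \<open>Y\<close> attains it; one time inside the open segment is all that the translation
      argument requires.\<close>
    define d where "d = (m + p) / 2"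
    have di: "d \<in> open_segment m p" using mp by (auto simp: d_def open_segment_eq_real_ivl)
    have s: "\<exists>s. Y s < d"
    proof (cases "m < p")
      case True
      then have "m < d" by (simp add: d_def)
      from order_tendstoD(2)[OF Y(3) this] show ?thesis using eventually_happens by fastforce
    next
      case False
      then have "p < d" using mp by (simp add: d_def)
      from order_tendstoD(2)[OF Y(4) this] show ?thesis using eventually_happens by fastforce
    qed
    have t: "\<exists>s. d < Y s"
    proof (cases "m < p")
      case True
      then have "d < p" by (simp add: d_def)
      from order_tendstoD(1)[OF Y(4) this] show ?thesis using eventually_happens by fastforce
    next
      case False
      then have "d < m" using mp by (simp add: d_def)
      from order_tendstoD(1)[OF Y(3) this] show ?thesis using eventually_happens by fastforce
    qed
    have Yc: "continuous_on UNIV Y" using Y(2) by (meson DERIV_isCont continuous_at_imp_continuous_on)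
    have "connected (range Y)" by (rule connected_continuous_image[OF Yc connected_UNIV])
    then have "d \<in> range Y" using s t by (meson connectedD_interval less_imp_le rangeI)
    then obtain t0 where t0: "Y t0 \<in> open_segment m p" using di by blast
    have gc: "continuous_on UNIV g" using g(2) by (meson DERIV_isCont continuous_at_imp_continuous_on)
    have op: "open (open_segment m p)" by (simp add: open_segment_eq_real_ivl)
    have cn: "c y \<noteq> 0" if "y \<in> open_segment m p" for y using sg[OF that] by auto
    from ode_solution_translate[OF op g(1) gc G(1) cn G(2) G(3) Y(2) t0]
    obtain \<tau> where "\<And>t. Y t = g (t + \<tau>)" by blast
    then show ?thesis using Y(1) by auto
  qed
  \<comment> \<open>The witness is the curve \<gamma> read off from \<open>u\<close>, so that u =
    \<gamma>(x1) holds without any shift. It is \<open>g\<close> translated by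
    \<open>\<tau>0\<close>, and other minimisers are compared with it through the difference of
    their translations.\<close>
  obtain \<tau>0 where \<tau>0: "AE t in lborel. \<gamma> t = (a, g (t + \<tau>0))" using uniq[OF \<gamma>(2) E\<gamma>] by blast
  have "min1 W a um up \<gamma>" unfolding min1_def using \<gamma>(2) low E\<gamma> order_trans by blast
  moreover have "\<exists>\<tau>. AE t in lborel. \<eta> t = \<gamma> (t + \<tau>)" if mi: "min1 W a um up \<eta>" for \<eta>
  proof -
    obtain \<eta>' where \<eta>: "adm1 a um up \<eta> \<eta>'" "energy1 W \<eta> \<eta>' \<le> energy1 W \<gamma> \<gamma>'" using mi \<gamma>(2) unfolding min1_def by blast
    obtain \<tau> where \<tau>: "AE t in lborel. \<eta> t = (a, g (t + \<tau>))" using uniq[OF \<eta>(1) order_trans[OF \<eta>(2) E\<gamma>]] by blast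
    have "AE t in lborel. \<eta> t = \<gamma> (t + (\<tau> - \<tau>0))" using \<tau> AE_shift[OF \<tau>0, of "\<tau> - \<tau>0"] by eventually_elim simp
    then show ?thesis by blast
  qed
  ultimately show ?thesis using \<gamma>(1,4) by blast
qed

end
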